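(* Assume $\mu>0$, $q\in(2,\frac{12}5]$, $p\in(\frac{10}3,6)$. Let $a\in(0,\overline a_0)$ and $$a<\Big(\frac{3}{4C_p^p}\Big)^{\frac1{2p\gamma_p+p-6}}\Big(\frac{4}{4\gamma_p-1}\Big)^{\frac{p\gamma_p-1}{2p\gamma_p+p-6}}\Bigg(\frac{1-\gamma_p}{C_{12/5}^{12/5}}\Bigg)^{\frac{p\gamma_p-2}{2p\gamma_p+p-6}}.$$ Then there exists a second solution of mountain pass type $(\widehat\lambda,\widehat u)\in\mathbb R^+\times\mathcal H_r$, with $\widehat u>0$, of $$-\Delta u+\lambda u+(|x|^{-1}\ast|u|^2)u=|u|^{p-2}u+\mu|u|^{q-2}u\ \text{ in }\mathbb R^3,\qquad \int_{\mathbb R^3}|u|^2dx=a^2 .$$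
   Context: $\mathbb R^+=(0,\infty)$; $\mathcal H=H^1(\mathbb R^3,\mathbb C)$; $\mathcal H_r$ is its subspace of radial functions; $|\cdot|_t$ is the $L^t(\mathbb R^3)$ norm. $S_a=\{u\in\mathcal H:|u|_2=a\}$, $S_{a,r}=S_a\cap\mathcal H_r$, $$\mathcal J(u)=\frac12\int|\nabla u|^2+\frac14\iint\frac{|u(x)|^2|u(y)|^2}{|x-y|}dxdy-\frac1p\int|u|^p-\frac{\mu}{q}\int|u|^q .$$ Constants: $\gamma_t=\frac{3(t-2)}{2t}$; for $2<t<6$, $C_t$ is the sharp constant in $|u|_t\le C_t|u|_2^{1-\gamma_t}|\nabla u|_2^{\gamma_t}$ ($u\in\mathcal H$), i.e. $C_t^t=\frac{2t}{6-t}\big(\frac{6-t}{3(t-2)}\big)^{\frac{3(t-2)}4}|Q_t|_2^{-(t-2)}$ with $Q_t$ the unique positive radial solution of $-\Delta Q+Q=|Q|^{t-2}Q$ in $\mathbb R^3$. $$a_0=\Big(\frac1{2K}\Big)^{\frac{p\gamma_p-q\gamma_q}{\mathcal B}},\qquad \mathcal B=(q-q\gamma_q)(p\gamma_p-2)+(p-p\gamma_p)(2-q\gamma_q),$$ $$K=\Big(\frac{\mu C_q^q}{q}\Big)^{\frac{p\gamma_p-2}{p\gamma_p-q\gamma_q}}\Big[\frac{p(2-q\gamma_q)}{(p\gamma_p-2)C_p^p}\Big]^{\frac{q\gamma_q-2}{p\gamma_p-q\gamma_q}}+\Big(\frac p{C_p^p}\Big)^{\frac{q\gamma_q-2}{p\gamma_p-q\gamma_q}}\Big[\frac{\mu(2-q\gamma_q)C_q^q}{q(p\gamma_p-2)}\Big]^{\frac{p\gamma_p-2}{p\gamma_p-q\gamma_q}},$$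 $$\overline a_0=\min\Big\{a_0,\ \Big[\frac{p(2-q\gamma_q)}{2C_p^p(p\gamma_p-q\gamma_q)}\Big]^{\frac{2-q\gamma_q}{\mathcal B}}\Big[\frac{q(p\gamma_p-2)}{2\mu C_q^q(p\gamma_p-q\gamma_q)}\Big]^{\frac{p\gamma_p-2}{\mathcal B}}\Big\}.$$ For $b>0$, $\rho_b=\Big[\frac{\mu p(2-q\gamma_q)C_q^q}{q(p\gamma_p-2)C_p^p}b^{q(1-\gamma_q)-p(1-\gamma_p)}\Big]^{\frac1{p\gamma_p-q\gamma_q}}$, $\rho_0=\rho_{a_0}$, $D_{\rho_0}=\{u\in S_a:|\nabla u|_2\le\rho_0\}$. For $u\in S_a$, $s\in\mathbb R$: $(s\star u)(x)=e^{3s/2}u(e^sx)$, $\psi_u(s)=\mathcal J(s\star u)$, $P(u)=\psi_u'(0)=\int|\nabla u|^2+\frac14\iint\frac{|u(x)|^2|u(y)|^2}{|x-y|}dxdy-\gamma_p\int|u|^p-\mu\gamma_q\int|u|^q$, $\mathcal P=\{u\in S_a:P(u)=0\}$, $\mathcal P_{+}=\{u\in\mathcal P:\psi_u''(0)>0\}$, $\mathcal P_{+,r}=\mathcal P_+\cap\mathcal H_r$, $m(a,r)=\inf_{\mathcal P_{+,r}}\mathcal J$. "Mountain pass type" means $\mathcal J(\widehat u)=c_a$, where $c_a=\inf_{\zeta\in\Gamma}\max_{u\in\zeta([0,1])}\mathcal J(u)$ and $\Gamma=\{\zeta\in C([0,1],S_{a,r}):\zeta(0)\in\mathcal P_{+,r},\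 \mathcal J(\zeta(1))<2m(a,r)\}$. "Second" means that $\widehat u$ is different from the (first) positive ground state normalized solution, which is a minimizer of $\mathcal J$ on $D_{\rho_0}$ (a ground state normalized solution is a critical point of $\mathcal J|_{S_a}$ of least energy among all critical points of $\mathcal J|_{S_a}$). *)

theory Defs
  imports "HOL-Analysis.Analysis"
begin

section \<open>The space $H^1(\mathbb R^3,\mathbb C)$\<close>

text \<open>
  Elements of Lebesgue and Sobolev spaces are represented by Borel measurable functions; all notions
  below are invariant under changes on null sets, and equality of two elements is equality almost
  everywhere.
\<close>

primrec iterated_partial :: "3 list \<Rightarrow> (real^3 \<Rightarrow> real) \<Rightarrow> real^3 \<Rightarrow> real" where
  "iterated_partial [] f = f"
| "iterated_partial (i # is) f =
     (\<lambda>x. frechet_derivative (iterated_partial is f) (at x) (axis i 1))"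

definition test_function :: "(real^3 \<Rightarrow> real) \<Rightarrow> bool" where
  "test_function f \<longleftrightarrow>
     (\<forall>is x. iterated_partial is f differentiable (at x)) \<and> compact (closure {x. f x \<noteq> 0})"

definition is_weak_gradient :: "(real^3 \<Rightarrow> complex) \<Rightarrow> (real^3 \<Rightarrow> complex^3) \<Rightarrow> bool" where
  "is_weak_gradient u g \<longleftrightarrow>
     g \<in> borel_measurable lborel \<and>
     integrable lborel (\<lambda>x. (norm (g x))\<^sup>2) \<and>
     (\<forall>f i. test_function f \<longrightarrow>
        (\<integral>x. iterated_partial [i] f x *\<^sub>R u x \<partial>lborel) = - (\<integral>x. f x *\<^sub>R (g x $ i) \<partial>lborel))"

definition H1 :: "(real^3 \<Rightarrow> complex) set" where
  "H1 = {u. u \<in> borel_measurable lborel \<and> integrable lborel (\<lambda>x. (norm (u x))\<^sup>2) \<and>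
            (\<exists>g. is_weak_gradient u g)}"

text \<open>The weak gradient is unique up to null sets, so the choice below is immaterial.\<close>

definition weak_grad :: "(real^3 \<Rightarrow> complex) \<Rightarrow> real^3 \<Rightarrow> complex^3" where
  "weak_grad u = (SOME g. is_weak_gradient u g)"

definition radial :: "(real^3 \<Rightarrow> complex) \<Rightarrow> bool" where
  "radial u \<longleftrightarrow> (\<exists>f. AE x in lborel. u x = f (norm x))"

definition H1r :: "(real^3 \<Rightarrow> complex) set" where
  "H1r = {u \<in> H1. radial u}"

definition positive_fun :: "(real^3 \<Rightarrow> complex) \<Rightarrow> bool" where
  "positive_fun u \<longleftrightarrow> (AE x in lborel. u x \<in> \<real> \<and> 0 < Re (u x))"

definition Lnorm :: "real \<Rightarrow> (real^3 \<Rightarrow> complex) \<Rightarrow> real" where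
  "Lnorm t u = (\<integral>x. norm (u x) powr t \<partial>lborel) powr (1 / t)"

definition grad_norm :: "(real^3 \<Rightarrow> complex) \<Rightarrow> real" where
  "grad_norm u = sqrt (\<integral>x. (norm (weak_grad u x))\<^sup>2 \<partial>lborel)"

definition H1_norm :: "(real^3 \<Rightarrow> complex) \<Rightarrow> real" where
  "H1_norm u = sqrt ((grad_norm u)\<^sup>2 + (Lnorm 2 u)\<^sup>2)"

definition S :: "real \<Rightarrow> (real^3 \<Rightarrow> complex) set" where
  "S a = {u \<in> H1. Lnorm 2 u = a}"

definition Sr :: "real \<Rightarrow> (real^3 \<Rightarrow> complex) set" where
  "Sr a = S a \<inter> H1r"


section \<open>The energy functional and the equation\<close>

definition coulomb_potential :: "(real^3 \<Rightarrow> complex) \<Rightarrow> real^3 \<Rightarrow> real" where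
  "coulomb_potential u x = (\<integral>y. (norm (u y))\<^sup>2 / norm (x - y) \<partial>lborel)"

definition coulomb_energy :: "(real^3 \<Rightarrow> complex) \<Rightarrow> real" where
  "coulomb_energy u =
     (\<integral>x. (\<integral>y. (norm (u x))\<^sup>2 * (norm (u y))\<^sup>2 / norm (x - y) \<partial>lborel) \<partial>lborel)"

definition J :: "real \<Rightarrow> real \<Rightarrow> real \<Rightarrow> (real^3 \<Rightarrow> complex) \<Rightarrow> real" where
  "J p q \<mu> u =
     1/2 * (\<integral>x. (norm (weak_grad u x))\<^sup>2 \<partial>lborel) + 1/4 * coulomb_energy u
     - 1/p * (\<integral>x. norm (u x) powr p \<partial>lborel) - \<mu>/q * (\<integral>x. norm (u x) powr q \<partial>lborel)"

text \<open>
  Weak solutions in $H^1$ of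
  $-\Delta u + \lambda u + (|x|^{-1} * |u|^2) u = |u|^{p-2} u + \mu |u|^{q-2} u$.
\<close>

definition weak_solution ::
    "real \<Rightarrow> real \<Rightarrow> real \<Rightarrow> real \<Rightarrow> (real^3 \<Rightarrow> complex) \<Rightarrow> bool" where
  "weak_solution p q \<mu> lam u \<longleftrightarrow> u \<in> H1 \<and>
     (\<forall>v\<in>H1.
        (\<integral>x. (\<Sum>i\<in>UNIV. weak_grad u x $ i * cnj (weak_grad v x $ i)) \<partial>lborel)
        + of_real lam * (\<integral>x. u x * cnj (v x) \<partial>lborel)
        + (\<integral>x. of_real (coulomb_potential u x) * u x * cnj (v x) \<partial>lborel)
      = (\<integral>x. of_real (norm (u x) powr (p - 2)) * u x * cnj (v x) \<partial>lborel)
        + of_real \<mu> * (\<integral>x. of_real (norm (u x) powr (q - 2)) * u x * cnj (v x) \<partial>lborel))"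

text \<open>
  The tangent space of the sphere at $u$ consists of the $v$ orthogonal to $u$ with respect to the
  real inner product of $L^2(\mathbb R^3,\mathbb C)$.
\<close>

definition critical_on_S ::
    "real \<Rightarrow> real \<Rightarrow> real \<Rightarrow> real \<Rightarrow> (real^3 \<Rightarrow> complex) \<Rightarrow> bool" where
  "critical_on_S p q \<mu> a u \<longleftrightarrow> u \<in> S a \<and>
     (\<forall>v\<in>H1. (\<integral>x. Re (u x * cnj (v x)) \<partial>lborel) = 0 \<longrightarrow>
        ((\<lambda>t. J p q \<mu> (\<lambda>x. u x + t *\<^sub>R v x)) has_real_derivative 0) (at 0))"

definition ground_state ::
    "real \<Rightarrow> real \<Rightarrow> real \<Rightarrow> real \<Rightarrow> (real^3 \<Rightarrow> complex) \<Rightarrow> bool" where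
  "ground_state p q \<mu> a u \<longleftrightarrow> critical_on_S p q \<mu> a u \<and>
     (\<forall>v. critical_on_S p q \<mu> a v \<longrightarrow> J p q \<mu> u \<le> J p q \<mu> v)"


section \<open>Constants\<close>

definition gam :: "real \<Rightarrow> real" where
  "gam t = 3 * (t - 2) / (2 * t)"

text \<open>The sharp Gagliardo--Nirenberg constant, for $2 < t < 6$.\<close>

definition GN :: "real \<Rightarrow> real" where
  "GN t = Inf {C. 0 \<le> C \<and>
     (\<forall>u\<in>H1. Lnorm t u \<le> C * Lnorm 2 u powr (1 - gam t) * grad_norm u powr gam t)}"

definition \<B> :: "real \<Rightarrow> real \<Rightarrow> real" where
  "\<B> p q = (q - q * gam q) * (p * gam p - 2) + (p - p * gam p) * (2 - q * gam q)"

definition K :: "real \<Rightarrow> real \<Rightarrow> real \<Rightarrow> real" where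
  "K p q \<mu> =
     (\<mu> * GN q powr q / q) powr ((p * gam p - 2) / (p * gam p - q * gam q))
       * (p * (2 - q * gam q) / ((p * gam p - 2) * GN p powr p))
           powr ((q * gam q - 2) / (p * gam p - q * gam q))
     + (p / GN p powr p) powr ((q * gam q - 2) / (p * gam p - q * gam q))
       * (\<mu> * (2 - q * gam q) * GN q powr q / (q * (p * gam p - 2)))
           powr ((p * gam p - 2) / (p * gam p - q * gam q))"

definition a0 :: "real \<Rightarrow> real \<Rightarrow> real \<Rightarrow> real" where
  "a0 p q \<mu> = (1 / (2 * K p q \<mu>)) powr ((p * gam p - q * gam q) / \<B> p q)"

definition a0_bar :: "real \<Rightarrow> real \<Rightarrow> real \<Rightarrow> real" where
  "a0_bar p q \<mu> = min (a0 p q \<mu>)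
     ((p * (2 - q * gam q) / (2 * GN p powr p * (p * gam p - q * gam q)))
         powr ((2 - q * gam q) / \<B> p q)
      * (q * (p * gam p - 2) / (2 * \<mu> * GN q powr q * (p * gam p - q * gam q)))
         powr ((p * gam p - 2) / \<B> p q))"

definition rho :: "real \<Rightarrow> real \<Rightarrow> real \<Rightarrow> real \<Rightarrow> real" where
  "rho p q \<mu> b =
     (\<mu> * p * (2 - q * gam q) * GN q powr q / (q * (p * gam p - 2) * GN p powr p)
        * b powr (q * (1 - gam q) - p * (1 - gam p)))
       powr (1 / (p * gam p - q * gam q))"

definition D :: "real \<Rightarrow> real \<Rightarrow> real \<Rightarrow> real \<Rightarrow> (real^3 \<Rightarrow> complex) set" where
  "D p q \<mu> a = {u \<in> S a. grad_norm u \<le> rho p q \<mu> (a0 p q \<mu>)}"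


section \<open>The Pohozaev set and the mountain pass level\<close>

definition dilate :: "real \<Rightarrow> (real^3 \<Rightarrow> complex) \<Rightarrow> real^3 \<Rightarrow> complex" where
  "dilate s u = (\<lambda>x. exp (3 * s / 2) *\<^sub>R u (exp s *\<^sub>R x))"

definition \<psi> :: "real \<Rightarrow> real \<Rightarrow> real \<Rightarrow> (real^3 \<Rightarrow> complex) \<Rightarrow> real \<Rightarrow> real" where
  "\<psi> p q \<mu> u s = J p q \<mu> (dilate s u)"

definition P :: "real \<Rightarrow> real \<Rightarrow> real \<Rightarrow> (real^3 \<Rightarrow> complex) \<Rightarrow> real" where
  "P p q \<mu> u =
     (\<integral>x. (norm (weak_grad u x))\<^sup>2 \<partial>lborel) + 1/4 * coulomb_energy u
     - gam p * (\<integral>x. norm (u x) powr p \<partial>lborel)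
     - \<mu> * gam q * (\<integral>x. norm (u x) powr q \<partial>lborel)"

definition Pset :: "real \<Rightarrow> real \<Rightarrow> real \<Rightarrow> real \<Rightarrow> (real^3 \<Rightarrow> complex) set" where
  "Pset p q \<mu> a = {u \<in> S a. P p q \<mu> u = 0}"

definition Pset_plus :: "real \<Rightarrow> real \<Rightarrow> real \<Rightarrow> real \<Rightarrow> (real^3 \<Rightarrow> complex) set" where
  "Pset_plus p q \<mu> a = {u \<in> Pset p q \<mu> a. deriv (deriv (\<psi> p q \<mu> u)) 0 > 0}"

definition Pset_plus_r :: "real \<Rightarrow> real \<Rightarrow> real \<Rightarrow> real \<Rightarrow> (real^3 \<Rightarrow> complex) set" where
  "Pset_plus_r p q \<mu> a = Pset_plus p q \<mu> a \<inter> H1r"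

text \<open>
  Infima and maxima are taken in the extended reals, so that an infimum over the empty set or of a
  family unbounded below has its usual meaning.
\<close>

definition m_r :: "real \<Rightarrow> real \<Rightarrow> real \<Rightarrow> real \<Rightarrow> ereal" where
  "m_r p q \<mu> a = (INF u\<in>Pset_plus_r p q \<mu> a. ereal (J p q \<mu> u))"

definition H1_continuous_path :: "(real \<Rightarrow> real^3 \<Rightarrow> complex) \<Rightarrow> bool" where
  "H1_continuous_path \<zeta> \<longleftrightarrow>
     (\<forall>t\<in>{0..1}. \<forall>\<epsilon>>0. \<exists>\<delta>>0. \<forall>s\<in>{0..1}.
        \<bar>s - t\<bar> < \<delta> \<longrightarrow> H1_norm (\<lambda>x. \<zeta> s x - \<zeta> t x) < \<epsilon>)"

definition \<Gamma> :: "real \<Rightarrow> real \<Rightarrow> real \<Rightarrow> real \<Rightarrow> (real \<Rightarrow> real^3 \<Rightarrow> complex) set" where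
  "\<Gamma> p q \<mu> a = {\<zeta>. (\<forall>t\<in>{0..1}. \<zeta> t \<in> Sr a) \<and> H1_continuous_path \<zeta> \<and>
     \<zeta> 0 \<in> Pset_plus_r p q \<mu> a \<and> ereal (J p q \<mu> (\<zeta> 1)) < 2 * m_r p q \<mu> a}"

definition mp_level :: "real \<Rightarrow> real \<Rightarrow> real \<Rightarrow> real \<Rightarrow> ereal" where
  "mp_level p q \<mu> a = (INF \<zeta>\<in>\<Gamma> p q \<mu> a. SUP t\<in>{0..1}. ereal (J p q \<mu> (\<zeta> t)))"

text \<open>
  The first solution: a positive ground state that minimizes the energy on the set $D_{\rho_0}$.
\<close>

definition first_solution ::
    "real \<Rightarrow> real \<Rightarrow> real \<Rightarrow> real \<Rightarrow> (real^3 \<Rightarrow> complex) \<Rightarrow> bool" where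
  "first_solution p q \<mu> a w \<longleftrightarrow> ground_state p q \<mu> a w \<and> positive_fun w \<and>
     w \<in> D p q \<mu> a \<and> (\<forall>v\<in>D p q \<mu> a. J p q \<mu> w \<le> J p q \<mu> v)"

end

theory Submission
  imports Defs "HOL-Library.Diagonal_Subsequence"
begin

text \<open>The Gagliardo--Nirenberg inequality and the bound on \<open>a\<close> give a gap scale \<open>X\<close>
  for the gradient norm at which every fibre map \<open>s \<mapsto> J (dilate s u)\<close> with \<open>|u|\<^sub>2 \<le> a\<close> increases; it has a local minimum below
  this scale and a single maximum above. The solution minimises the maximal fibre value over the radial
  functions of mass at most \<open>a\<close>; a minimiser exists by radial compactness and may be replaced by its modulus.
  An envelope estimate compares the minimiser \<open>u\<close> with its perturbations up to a quadratic error. Adding a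
  spread out cloud of mass \<open>x\<close>, a quarter turn out of phase with \<open>u\<close>, costs \<open>O(x\<^sup>2)\<close> and gains a lower power
  of \<open>x\<close>; hence the mass of \<open>u\<close> is exactly \<open>a\<close> and the multiplier is positive. The first variation along
  radial directions and symmetric criticality give the equation; bounds for the second differences of
  \<open>r u(r)\<close> give positivity. Every path from a local fibre minimum to low energy meets the set of fibre
  maxima, and the path of dilations of \<open>u\<close> realises the level.\<close>

text \<open>Mass below \<open>a\<close> is allowed because bounded radial sequences have limits in
  the power norms strictly between 2 and 6 but may lose mass in L2, so that a constraint of exact
  mass would not survive the limit. The price is that the mass and the sign of the multiplier must
  be recovered from minimality. This works because the fibre maximum is nondegenerate: moving the
  dilation parameter has only a second order effect, so the maximal value reacts to a change of the
  four integrals of the energy by the direct change, up to a square. The quarter turn makes the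
  densities of two real functions add without a mixed term; hence masses add and the power terms are
  superadditive whatever the shape of \<open>u\<close>. A cloud of mass \<open>x\<close> dilated by
  the factor \<open>x\<close> has gradient and Coulomb energy of order \<open>x^3\<close>, while its
  \<open>q\<close> term has order \<open>x powr (2 * q - 3)\<close>, which beats \<open>x^2\<close>
  since \<open>q < 5/2\<close>. As the minimiser sits at the mountain pass level itself, no almost
  critical sequences enter.\<close>

abbreviation (input) "bmeas \<equiv> borel_measurable borel"
abbreviation (input) "CE \<equiv> coulomb_energy"
abbreviation (input) "cor \<equiv> complex_of_real"
abbreviation (input) "wgrad \<equiv> is_weak_gradient"
abbreviation (input) "orth \<equiv> orthogonal_transformation"
abbreviation (input) seqlim (infix "---->" 60) where "X ----> l \<equiv> (X \<longlongrightarrow> l) sequentially"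
abbreviation (input) nnint (binder "NN " 10) where "NN x. f x \<equiv> \<integral>\<^sup>+x. f x \<partial>lborel"
abbreviation (input) "pd i \<equiv> iterated_partial [i]"
notation (input) scaleR (infixr "*R" 75)

section \<open>Square integrable functions\<close>

lemma integrable_boundI:
  fixes f :: "'a => 'b::{banach, second_countable_topology}" and g :: "'a => real"
  assumes "integrable M g" "f \<in> borel_measurable M" "!!x. norm (f x) <= g x"
  shows "integrable M f"
proof (rule Bochner_Integration.integrable_bound[OF assms(1,2)], rule AE_I2)
  show "norm (f x) <= norm (g x)" for x using assms(3)[of x] by simp
qed

text \<open>Concrete measurable functions instead of classes, with arbitrary Euclidean domain and
  codomain: the same inner product calculus then serves \<open>u\<close>, its gradient field and
  real test functions.\<close>

definition L2 :: "('a::euclidean_space => 'b::euclidean_space) set" where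
  "L2 = {f. f \<in> bmeas \<and> integrable lborel (%x. (norm (f x))^2)}"

definition n2 :: "('a::euclidean_space => 'b::euclidean_space) => real" where
  "n2 f = sqrt (LBINT x. (norm (f x))^2)"

lemma L2_measurable: "f \<in> L2 ==> f \<in> bmeas"
  and L2_integrable: "f \<in> L2 ==> integrable lborel (%x. (norm (f x))^2)"
  by (auto simp: L2_def)

lemma n2_nonneg [simp]: "0 <= n2 f"
  by (simp add: n2_def)

lemma n2_sq: "(n2 f)^2 = (LBINT x. (norm (f x))^2)"
  by (simp add: n2_def)

lemma L2_bound:
  assumes f: "f \<in> L2" and g[measurable]: "g \<in> bmeas"
    and le: "AE x in lborel. norm (g x) <= c * norm (f x)"
  shows "g \<in> L2" "0 <= c ==> n2 g <= c * n2 f"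
proof -
  have *: "AE x in lborel. (norm (g x))^2 <= c^2 * (norm (f x))^2"
    using le by eventually_elim (metis norm_ge_zero power_mono power_mult_distrib)
  show 1: "g \<in> L2"
    unfolding L2_def
  proof (safe intro!: g)
    show "integrable lborel (%x. (norm (g x))^2)"
      by (rule Bochner_Integration.integrable_bound[of _ "%x. c^2 * (norm (f x))^2"])
        (use L2_integrable[OF f] * in \<open>auto\<close>)
  qed
  assume c: "0 <= c"
  have "(LBINT x. (norm (g x))^2) <= (LBINT x. c^2 * (norm (f x))^2)"
    by (rule integral_mono_AE) (use L2_integrable[OF f] L2_integrable[OF 1] * in auto)
  then have "n2 g <= sqrt (c^2 * (LBINT x. (norm (f x))^2))"
    by (simp add: n2_def)
  then show "n2 g <= c * n2 f"
    using c by (simp add: n2_def real_sqrt_mult)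
qed

lemma L2_bound1:
  assumes f: "f \<in> L2" and g[measurable]: "g \<in> bmeas"
    and le: "AE x in lborel. norm (g x) <= norm (f x)"
  shows "g \<in> L2" "n2 g <= n2 f"
  using L2_bound[of f g 1] assms by auto

lemma L2_cong_AE:
  assumes f: "f \<in> L2" and g: "g \<in> bmeas" and "AE x in lborel. g x = f x"
  shows "g \<in> L2" "n2 g = n2 f"
proof -
  show "g \<in> L2" by (rule L2_bound1(1)[OF f g]) (use assms(3) in \<open>eventually_elim, simp\<close>)
  show "n2 g = n2 f" unfolding n2_def
    using assms L2_measurable[OF f] by (auto intro!: integral_cong_AE arg_cong[of _ _ sqrt])
qed

lemma L2_scaleR: 
  assumes f: "f \<in> L2" shows "(%x. c *R f x) \<in> L2" "n2 (%x. c *R f x) = \<bar>c\<bar> * n2 f"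
proof -
  have [measurable]: "f \<in> bmeas" by (rule L2_measurable[OF f])
  show "(%x. c *R f x) \<in> L2" by (rule L2_bound(1)[OF f, of _ "\<bar>c\<bar>"]) auto
  show "n2 (%x. c *R f x) = \<bar>c\<bar> * n2 f"
    by (simp add: n2_def power_mult_distrib real_sqrt_mult)
qed

lemma L2_mult_complex:
  fixes f :: "'a::euclidean_space => complex"
  assumes f: "f \<in> L2" shows "(%x. c * f x) \<in> L2" "n2 (%x. c * f x) = norm c * n2 f"
proof -
  have [measurable]: "f \<in> bmeas" by (rule L2_measurable[OF f])
  show "(%x. c * f x) \<in> L2" by (rule L2_bound(1)[OF f, of _ "norm c"]) (auto simp: norm_mult)
  show "n2 (%x. c * f x) = norm c * n2 f"
    by (simp add: n2_def norm_mult power_mult_distrib real_sqrt_mult)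
qed

lemma L2_minus: 
  assumes f: "f \<in> L2" shows "(%x. - f x) \<in> L2" "n2 (%x. - f x) = n2 f"
  using L2_scaleR[OF f, of "-1"] by simp_all

lemma L2_zero [simp]: "(%x. 0) \<in> L2" "n2 (%x. 0) = 0"
  by (auto simp: L2_def n2_def)

lemma norm_add_sq_le: "(norm (x + y :: 'b::real_inner))^2 <= 2 * (norm x)^2 + 2 * (norm y)^2"
proof -
  have "(norm (x + y))^2 + (norm (x - y))^2 = 2 * (norm x)^2 + 2 * (norm y)^2"
    by (simp add: power2_norm_eq_inner inner_simps inner_commute)
  then show ?thesis by (smt (verit) zero_le_power2)
qed

lemma L2_add:
  assumes f: "f \<in> L2" and g: "g \<in> L2" shows "(%x. f x + g x) \<in> L2"
proof -
  have [measurable]: "f \<in> bmeas" "g \<in> bmeas"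
    using f g by (auto intro: L2_measurable)
  have "integrable lborel (%x. (norm (f x + g x))^2)"
    by (rule integrable_boundI[of _ "%x. 2 * (norm (f x))^2 + 2 * (norm (g x))^2"])
      (simp_all add: L2_integrable[OF f] L2_integrable[OF g] norm_add_sq_le)
  then show ?thesis by (simp add: L2_def)
qed

lemma L2_diff: "f \<in> L2 ==> g \<in> L2 ==> (%x. f x - g x) \<in> L2"
  using L2_add[of f "%x. - g x"] L2_minus(1)[of g] by simp

lemma L2_mult_integrable:
  assumes f: "f \<in> L2" and g: "g \<in> L2"
  shows "integrable lborel (%x. norm (f x) * norm (g x))"
proof -
  have [measurable]: "f \<in> bmeas" "g \<in> bmeas"
    using f g by (auto intro: L2_measurable)
  have "norm (f x) * norm (g x) <= (norm (f x))^2 + (norm (g x))^2" for x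
    using sum_squares_bound[of "norm (f x)" "norm (g x)"] mult_nonneg_nonneg[OF norm_ge_zero[of "f x"] norm_ge_zero[of "g x"]]
    by linarith
  then show ?thesis
    by (intro integrable_boundI[OF Bochner_Integration.integrable_add[OF L2_integrable[OF f] L2_integrable[OF g]]]) simp_all
qed

lemma Cauchy_Schwarz_n2:
  assumes f: "f \<in> L2" and g: "g \<in> L2"
  shows "(LBINT x. norm (f x) * norm (g x)) <= n2 f * n2 g"
proof -
  have [measurable]: "f \<in> bmeas" "g \<in> bmeas"
    using f g by (auto intro: L2_measurable)
  let ?I = "\<integral>x. norm (f x) * norm (g x) \<partial>lborel"
  have I: "(NN x. ennreal (norm (f x)) * ennreal (norm (g x))) = ennreal ?I"
    using nn_integral_eq_integral[OF L2_mult_integrable[OF f g]] by (simp add: ennreal_mult)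
  have F: "(NN x. (ennreal (norm (f x)))^2) = ennreal ((n2 f)^2)"
    using nn_integral_eq_integral[OF L2_integrable[OF f]] by (simp add: ennreal_power n2_sq)
  have G: "(NN x. (ennreal (norm (g x)))^2) = ennreal ((n2 g)^2)"
    using nn_integral_eq_integral[OF L2_integrable[OF g]] by (simp add: ennreal_power n2_sq)
  have I0: "0 <= ?I" by simp
  have "(ennreal ?I)^2 <= ennreal ((n2 f)^2) * ennreal ((n2 g)^2)"
    using Cauchy_Schwarz_nn_integral[of "%x. ennreal (norm (f x))" lborel "%x. ennreal (norm (g x))"]
    unfolding I F G by simp
  also have "\<dots> = ennreal ((n2 f * n2 g)^2)"
    by (simp add: ennreal_mult power_mult_distrib)
  finally have "?I^2 <= (n2 f * n2 g)^2"
    using I0 by (simp add: ennreal_power del: Bochner_Integration.integral_nonneg_AE)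
  then show ?thesis by (rule power2_le_imp_le) simp
qed

definition ip :: "('a::euclidean_space => 'b::euclidean_space) => ('a => 'b) => real" where
  "ip f g = (LBINT x. f x \<bullet> g x)"

lemma ip_integrable:
  assumes f: "f \<in> L2" and g: "g \<in> L2"
  shows "integrable lborel (%x. f x \<bullet> g x)"
proof -
  have [measurable]: "f \<in> bmeas" "g \<in> bmeas"
    using f g by (auto intro: L2_measurable)
  show ?thesis
    by (rule integrable_boundI[OF L2_mult_integrable[OF f g]]) (simp_all add: Cauchy_Schwarz_ineq2)
qed

lemma ip_bound:
  assumes f: "f \<in> L2" and g: "g \<in> L2"
  shows "\<bar>ip f g\<bar> <= n2 f * n2 g"
proof -
  have "\<bar>ip f g\<bar> <= (LBINT x. norm (f x) * norm (g x))"
    unfolding ip_def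
    by (rule order_trans[OF integral_abs_bound])
      (intro integral_mono integrable_abs ip_integrable L2_mult_integrable f g Cauchy_Schwarz_ineq2)
  also have "\<dots> <= n2 f * n2 g" by (rule Cauchy_Schwarz_n2[OF f g])
  finally show ?thesis .
qed

lemma ip_self: "ip f f = (n2 f)^2"
  by (simp add: ip_def n2_sq power2_norm_eq_inner)

lemma ip_commute: "ip f g = ip g f"
  by (simp add: ip_def inner_commute)

lemma ip_add_left:
  assumes "f \<in> L2" "g \<in> L2" "h \<in> L2" shows "ip (%x. f x + g x) h = ip f h + ip g h"
  using assms by (simp add: ip_def inner_add_left ip_integrable)

lemma ip_diff_left:
  assumes "f \<in> L2" "g \<in> L2" "h \<in> L2" shows "ip (%x. f x - g x) h = ip f h - ip g h"
  using assms by (simp add: ip_def inner_diff_left ip_integrable)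

lemma ip_scaleR_left: "ip (%x. c *R f x) h = c * ip f h"
  by (simp add: ip_def)

lemma n2_add_sq:
  assumes "f \<in> L2" "g \<in> L2"
  shows "(n2 (%x. f x + g x))^2 = (n2 f)^2 + 2 * ip f g + (n2 g)^2"
proof -
  have "ip (%x. f x + g x) (%x. f x + g x) = ip f (%x. f x + g x) + ip g (%x. f x + g x)"
    by (intro ip_add_left L2_add assms)
  also have "ip f (%x. f x + g x) = ip f f + ip g f"
    unfolding ip_commute[of f "%x. f x + g x"] by (intro ip_add_left L2_add assms)
  also have "ip g (%x. f x + g x) = ip f g + ip g g"
    unfolding ip_commute[of g "%x. f x + g x"] by (subst ip_add_left) (simp_all add: assms)
  finally show ?thesis by (simp add: ip_self ip_commute[of g f])
qed

lemma n2_triangle: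
  assumes "f \<in> L2" "g \<in> L2"
  shows "n2 (%x. f x + g x) <= n2 f + n2 g"
proof (rule power2_le_imp_le)
  show "(n2 (%x. f x + g x))^2 <= (n2 f + n2 g)^2"
    using ip_bound[OF assms] by (simp add: n2_add_sq[OF assms] power2_sum)
qed simp

lemma n2_triangle_diff:
  assumes "f \<in> L2" "g \<in> L2"
  shows "n2 (%x. f x - g x) <= n2 f + n2 g"
  using n2_triangle[OF assms(1) L2_minus(1)[OF assms(2)]] by (simp add: L2_minus(2) assms)

lemma n2_triangle3:
  assumes "f \<in> L2" "g \<in> L2" "h \<in> L2"
  shows "n2 (%x. f x - h x) <= n2 (%x. f x - g x) + n2 (%x. g x - h x)"
  using n2_triangle[OF L2_diff[OF assms(1,2)] L2_diff[OF assms(2,3)]] by simp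

lemma n2_diff_commute: "n2 (%x. f x - g x) = n2 (%x. g x - f x)"
  by (simp add: n2_def norm_minus_commute)

lemma n2_diff_abs:
  assumes "f \<in> L2" "g \<in> L2"
  shows "\<bar>n2 f - n2 g\<bar> <= n2 (%x. f x - g x)"
  using n2_triangle[OF L2_diff[OF assms] assms(2)] n2_triangle[OF L2_diff[OF assms(2,1)] assms(1)]
  by (simp add: n2_diff_commute[of f g])

lemma n2_eq_0_iff:
  assumes f: "f \<in> L2" shows "n2 f = 0 \<longleftrightarrow> (AE x in lborel. f x = 0)"
proof -
  have "n2 f = 0 \<longleftrightarrow> (LBINT x. (norm (f x))^2) = 0"
    by (simp add: n2_def)
  also have "\<dots> \<longleftrightarrow> (AE x in lborel. (norm (f x))^2 = 0)"
    by (rule integral_nonneg_eq_0_iff_AE) (use L2_integrable[OF f] in auto)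
  finally show ?thesis by simp
qed

text \<open>Fatou's lemma for the squares. A norm bound and almost everywhere convergence yield both
  membership and lower semicontinuity of the mass, also for limits that are not norm limits.\<close>

lemma L2_Fatou:
  fixes F :: "nat => 'a::euclidean_space => 'b::euclidean_space"
  assumes F: "!!n. F n \<in> L2" and b: "!!n. n2 (F n) <= c"
    and lim: "AE x in lborel. (%n. F n x) ----> f x" and f[measurable]: "f \<in> bmeas"
  shows "f \<in> L2" "n2 f <= c"
proof -
  have [measurable]: "!!n. F n \<in> bmeas" using F by (auto intro: L2_measurable)
  have c: "0 <= c" using b[of 0] n2_nonneg order_trans by blast
  have "(NN x. ennreal ((norm (f x))^2))
      <= (NN x. liminf (%n. ennreal ((norm (F n x))^2)))"
  proof (rule nn_integral_mono_AE)
    show "AE x in lborel. ennreal ((norm (f x))^2) <= liminf (%n. ennreal ((norm (F n x))^2))"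
      using lim
    proof eventually_elim
      case (elim x)
      have "(%n. ennreal ((norm (F n x))^2)) ----> ennreal ((norm (f x))^2)"
        by (intro tendsto_intros tendsto_ennrealI elim)
      then show ?case using lim_imp_Liminf[OF sequentially_bot] by fastforce
    qed
  qed
  also have "\<dots> <= liminf (%n. \<integral>\<^sup>+x. ennreal ((norm (F n x))^2) \<partial>lborel)"
    by (rule nn_integral_liminf) auto
  also have "\<dots> = liminf (%n. ennreal ((n2 (F n))^2))"
    using nn_integral_eq_integral[OF L2_integrable[OF F]] by (simp add: n2_sq)
  also have "\<dots> <= ennreal (c^2)"
    by (rule order_trans[OF Liminf_mono[of _ "%_. ennreal (c^2)"]], rule always_eventually)
       (auto intro!: ennreal_leI power_mono b simp: Liminf_const)
  finally have le: "(NN x. ennreal ((norm (f x))^2)) <= ennreal (c^2)" .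
  then have "(NN x. ennreal ((norm (f x))^2)) < \<infinity>"
    by (simp add: le_less_trans)
  then have i: "integrable lborel (%x. (norm (f x))^2)"
    by (intro integrableI_bounded) auto
  then show "f \<in> L2" by (simp add: L2_def)
  have "(n2 f)^2 <= c^2"
    using le nn_integral_eq_integral[OF i] by (simp add: n2_sq)
  then show "n2 f <= c" using c by (rule power2_le_imp_le)
qed

lemma L2_dominated:
  fixes F :: "nat => 'a::euclidean_space => 'b::euclidean_space"
    and h :: "'a::euclidean_space => 'c::euclidean_space"
  assumes F[measurable]: "!!n. F n \<in> bmeas" and h: "h \<in> L2"
    and b: "!!n. AE x in lborel. norm (F n x) <= norm (h x)"
    and lim: "AE x in lborel. (%n. F n x) ----> f x" and f[measurable]: "f \<in> bmeas"
  shows "f \<in> L2" "!!n. F n \<in> L2" "(%n. n2 (%x. F n x - f x)) ----> 0"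
proof -
  have [measurable]: "h \<in> bmeas" using h by (rule L2_measurable)
  have "AE x in lborel. \<forall>n. norm (F n x) <= norm (h x)"
    using b by (simp add: AE_all_countable)
  with lim have fb: "AE x in lborel. norm (f x) <= norm (h x)"
  proof eventually_elim
    case (elim x)
    show ?case
      by (rule LIMSEQ_le_const2[OF tendsto_norm[OF elim(1)]]) (use elim(2) in auto)
  qed
  show fL: "f \<in> L2" by (rule L2_bound1(1)[OF h f fb])
  show FL: "F n \<in> L2" for n by (rule L2_bound1(1)[OF h F b])
  have "(%n. \<integral>x. (norm (F n x - f x))^2 \<partial>lborel) ----> (\<integral>x. 0 \<partial>(lborel::'a measure))"
  proof (rule integral_dominated_convergence[where w = "%x. 4 * (norm (h x))^2"])
    show "AE x in lborel. (%n. (norm (F n x - f x))^2) ----> 0"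
      using lim
    proof eventually_elim
      case (elim x)
      have "(%n. (norm (F n x - f x))^2) ----> (norm (f x - f x))\<^sup>2"
        by (intro tendsto_intros elim)
      then show ?case by simp
    qed
    show "AE x in lborel. norm ((norm (F n x - f x))^2) <= 4 * (norm (h x))^2" for n
      using b[of n] fb
    proof eventually_elim
      case (elim x)
      have "norm (F n x - f x) <= 2 * norm (h x)"
        using norm_triangle_ineq4[of "F n x" "f x"] elim by linarith
      then have "(norm (F n x - f x))^2 <= (2 * norm (h x))^2" by (intro power_mono) auto
      then show ?case by (simp add: power_mult_distrib)
    qed
  qed (use L2_integrable[OF h] in auto)
  then have "(%n. (n2 (%x. F n x - f x))^2) ----> 0" by (simp add: n2_sq)
  from tendsto_real_sqrt[OF this] show "(%n. n2 (%x. F n x - f x)) ----> 0" by simp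
qed

text \<open>Subtracting a small multiple of \<open>|W|\<^sup>2\<close> leaves a dominated integrand, by the arithmetic-geometric mean
  inequality.\<close>

lemma weak_null:
  fixes W :: "nat => 'a::euclidean_space => 'b::euclidean_space"
    and phi :: "'a::euclidean_space => 'c::euclidean_space"
  assumes W: "!!n. W n \<in> L2" and b: "!!n. n2 (W n) <= c"
    and lim: "AE x in lborel. (%n. W n x) ----> 0" and p: "phi \<in> L2"
  shows "(%n. \<integral>x. norm (phi x) * norm (W n x) \<partial>lborel) ----> 0"
proof (rule LIMSEQ_I)
  fix e :: real assume e: "0 < e"
  have [measurable]: "!!n. W n \<in> bmeas" "phi \<in> bmeas"
    using W p by (auto intro: L2_measurable)
  have c: "0 <= c" using b[of 0] n2_nonneg order_trans by blast
  \<comment> \<open>Small enough that the subtracted part \<open>d * c^2\<close> is at most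
    \<open>e / 2\<close>; the summand 1 covers \<open>c = 0\<close>.\<close>
  define d where "d = e / (2 * (c^2 + 1))"
  have d: "0 < d" using e by (simp add: d_def add_nonneg_pos)
  define Z where "Z n x = max 0 (norm (phi x) * norm (W n x) - d * (norm (W n x))^2)" for n x
  have [measurable]: "!!n. Z n \<in> bmeas" unfolding Z_def by measurable
  have Zb: "norm (Z n x) <= 1 / (4 * d) * (norm (phi x))^2" for n x
  proof -
    have "0 <= (norm (phi x) / (2 * sqrt d) - sqrt d * norm (W n x))^2" by simp
    also have "\<dots> = 1 / (4 * d) * (norm (phi x))^2 - norm (phi x) * norm (W n x) + d * (norm (W n x))^2"
      using d by (simp add: power2_diff power_mult_distrib power_divide)
    finally show ?thesis using d by (simp add: Z_def)
  qed
  have "(%n. \<integral>x. Z n x \<partial>lborel) ----> (\<integral>x. 0 \<partial>(lborel::'a measure))"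
  proof (rule integral_dominated_convergence[where w = "%x. 1 / (4 * d) * (norm (phi x))^2"])
    show "AE x in lborel. (%n. Z n x) ----> 0"
      using lim
    proof eventually_elim
      case (elim x)
      have "(%n. Z n x) ----> max 0 (norm (phi x) * norm (0::'b) - d * (norm (0::'b))^2)"
        unfolding Z_def by (intro tendsto_intros elim)
      then show ?case by simp
    qed
  qed (use Zb L2_integrable[OF p] in auto)
  then have "eventually (%n. \<bar>\<integral>x. Z n x \<partial>lborel\<bar> < e / 2) sequentially"
    using e by (auto simp: tendsto_iff dist_real_def dest!: spec[of _ "e/2"])
  then obtain N where N: "!!n. n \<ge> N ==> \<bar>\<integral>x. Z n x \<partial>lborel\<bar> < e / 2"
    by (auto simp: eventually_sequentially)
  have "norm ((LBINT x. norm (phi x) * norm (W n x)) - 0) < e" if "n \<ge> N" for n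
  proof -
    have Zi: "integrable lborel (Z n)"
      by (rule integrable_boundI[OF integrable_mult_right[OF L2_integrable[OF p]] _ Zb]) simp
    have "(LBINT x. norm (phi x) * norm (W n x)) <= (LBINT x. Z n x + d * (norm (W n x))^2)"
      by (rule integral_mono) (use Zi L2_mult_integrable[OF p W] L2_integrable[OF W] in \<open>auto simp: Z_def\<close>)
    also have "\<dots> = (LBINT x. Z n x) + d * (n2 (W n))^2"
      using Zi L2_integrable[OF W] by (simp add: n2_sq)
    also have "d * (n2 (W n))^2 <= d * c^2" using b[of n] d by (intro mult_left_mono power_mono) auto
    also have "\<dots> <= e / 2"
    proof -
      have "c^2 / (c^2 + 1) <= 1" by (simp add: add_nonneg_pos)
      then have "e / 2 * (c^2 / (c^2 + 1)) <= e / 2 * 1" using e by (intro mult_left_mono) auto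
      then show ?thesis by (simp add: d_def)
    qed
    finally show ?thesis using N[OF that] by (simp add: abs_less_iff)
  qed
  then show "\<exists>N. \<forall>n\<ge>N. norm ((LBINT x. norm (phi x) * norm (W n x)) - 0) < e" by blast
qed

lemma ip_tendsto:
  assumes "!!n. F n \<in> L2" "f \<in> L2" "(%n. n2 (%x. F n x - f x)) ----> 0" "g \<in> L2"
  shows "(%n. ip (F n) g) ----> ip f g"
proof (rule LIM_zero_cancel)
  have "\<bar>ip (F n) g - ip f g\<bar> <= n2 (%x. F n x - f x) * n2 g" for n
    using ip_bound[OF L2_diff[OF assms(1)[of n] assms(2)] assms(4)] by (simp add: ip_diff_left assms)
  then show "(%n. ip (F n) g - ip f g) ----> 0"
    by (intro tendsto_0_le[OF tendsto_mult_left_zero[OF assms(3), of "n2 g"], where K=1] always_eventually) simp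
qed

lemma n2_tendsto:
  assumes "!!n. F n \<in> L2" "f \<in> L2" "(%n. n2 (%x. F n x - f x)) ----> 0"
  shows "(%n. n2 (F n)) ----> n2 f"
  by (rule LIM_zero_cancel, rule tendsto_0_le[OF assms(3), where K=1])
    (rule always_eventually, simp add: n2_diff_abs assms)

lemma L2_AE_subseq:
  fixes F :: "nat => 'a::euclidean_space => 'b::euclidean_space"
  assumes F: "!!n. F n \<in> L2" and f: "f \<in> L2" and lim: "(%n. n2 (%x. F n x - f x)) ----> 0"
  obtains r where "strict_mono r" "AE x in lborel. (%n. F (r n) x) ----> f x"
proof -
  have "(%n. \<integral>x. norm ((norm (F n x - f x))^2) \<partial>lborel) ----> 0"
    using tendsto_power[OF lim, of 2] by (simp add: n2_sq)
  from tendsto_L1_AE_subseq[OF L2_integrable[OF L2_diff[OF F f]] this]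
  obtain r where r: "strict_mono r" and ae: "AE x in lborel. (%n. (norm (F (r n) x - f x))^2) ----> 0"
    by blast
  from ae have "AE x in lborel. (%n. F (r n) x) ----> f x"
  proof eventually_elim
    case (elim x)
    from tendsto_real_sqrt[OF elim] have "(%n. norm (F (r n) x - f x)) ----> 0" by simp
    then show ?case by (rule LIM_zero_cancel[OF tendsto_norm_zero_cancel])
  qed
  with r that show thesis by blast
qed

text \<open>Riesz-Fischer. Along a subsequence with increments below \<open>(1/2)^k\<close> the sums
  \<open>A m\<close> of the moduli have norm at most 2, so by monotone convergence they stay bounded
  almost everywhere and the subsequence converges pointwise. Fatou's lemma turns this into norm
  convergence of the whole sequence.\<close>

theorem L2_complete:
  fixes F :: "nat => 'a::euclidean_space => 'b::euclidean_space"
  assumes F: "!!n. F n \<in> L2"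
    and C: "!!e. 0 < e ==> \<exists>N. \<forall>m\<ge>N. \<forall>n\<ge>N. n2 (%x. F m x - F n x) < e"
  obtains f where "f \<in> L2" "(%n. n2 (%x. F n x - f x)) ----> 0"
proof -
  have [measurable]: "!!n. F n \<in> bmeas" using F by (auto intro: L2_measurable)
  obtain N where N: "!!k m n. m \<ge> N k ==> n \<ge> N k ==> n2 (%x. F m x - F n x) < (1/2)^k"
    using C[of "(1/2)^k" for k] by (metis half_gt_zero zero_less_one zero_less_power)
  \<comment> \<open>The sum makes \<open>r k\<close> at least \<open>N k\<close>; the summand
    \<open>k\<close> makes \<open>r\<close> strictly increasing even where \<open>N\<close>
    vanishes.\<close>
  define r where "r k = (\<Sum>i\<le>k. N i) + k" for k
  have r: "strict_mono r" by (auto simp: r_def strict_mono_Suc_iff)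
  have rN: "N k <= r k" for k
    unfolding r_def by (rule trans_le_add1, rule member_le_sum) auto
  have step: "n2 (%x. F (r (Suc k)) x - F (r k) x) < (1/2)^k" for k
    by (rule N) (use rN[of k] strict_monoD[OF r, of k "Suc k"] in auto)
  define A where "A m x = (\<Sum>k<m. norm (F (r (Suc k)) x - F (r k) x))" for m x
  have [measurable]: "!!m. A m \<in> bmeas" unfolding A_def by measurable
  have AL: "A m \<in> L2 \<and> n2 (A m) <= 2" for m
  proof -
    have "A m \<in> L2 \<and> n2 (A m) <= (\<Sum>k<m. (1/2)^k)"
    proof (induction m)
      case 0 then show ?case by (simp add: A_def)
    next
      case (Suc m)
      have eq: "A (Suc m) = (%x. A m x + norm (F (r (Suc m)) x - F (r m) x))"
        by (simp add: A_def fun_eq_iff)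
      have d: "(%x. norm (F (r (Suc m)) x - F (r m) x)) \<in> L2"
        "n2 (%x. norm (F (r (Suc m)) x - F (r m) x)) <= n2 (%x. F (r (Suc m)) x - F (r m) x)"
        by (rule L2_bound1[OF L2_diff[OF F[of "r (Suc m)"] F[of "r m"]]]; simp)+
      have "n2 (A (Suc m)) <= n2 (A m) + n2 (%x. norm (F (r (Suc m)) x - F (r m) x))"
        unfolding eq by (rule n2_triangle) (use Suc d in auto)
      also have "\<dots> <= (\<Sum>k<Suc m. (1/2)^k)" using Suc d step[of m] by simp
      finally show ?case unfolding eq using L2_add[OF _ d(1)] Suc by blast
    qed
    moreover have "(\<Sum>k<m. (1/2::real)^k) <= 2"
      by (simp add: sum_gp_strict)
    ultimately show ?thesis by linarith
  qed
  have "(NN x. (SUP m. ennreal ((A m x)^2))) = (SUP m. \<integral>\<^sup>+x. ennreal ((A m x)^2) \<partial>lborel)"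
  proof (rule nn_integral_monotone_convergence_SUP)
    have "0 <= A m x" "A m x <= A (Suc m) x" for m x by (auto simp: A_def intro!: sum_nonneg)
    then show "incseq (%m x. ennreal ((A m x)^2))"
      by (auto simp: incseq_Suc_iff le_fun_def intro!: ennreal_leI power_mono)
  qed auto
  also have "\<dots> <= ennreal 4"
  proof (rule SUP_least)
    fix m
    have "(NN x. ennreal ((A m x)^2)) = ennreal ((n2 (A m))^2)"
      using nn_integral_eq_integral[OF L2_integrable[of "A m"]] AL by (simp add: n2_sq)
    also have "\<dots> <= ennreal (2\<^sup>2)" using AL[of m] by (intro ennreal_leI power_mono) auto
    finally show "(NN x. ennreal ((A m x)^2)) <= ennreal 4" by simp
  qed
  finally have "(NN x. (SUP m. ennreal ((A m x)^2))) \<noteq> \<infinity>"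
    using ennreal_less_top[of 4] by (metis infinity_ennreal_def leD)
  then have "AE x in lborel. (SUP m. ennreal ((A m x)^2)) \<noteq> \<infinity>"
    by (rule nn_integral_noteq_infinite[rotated]) auto
  then have conv: "AE x in lborel. convergent (%k. F (r k) x)"
  proof eventually_elim
    case (elim x)
    then obtain B where B: "(SUP m. ennreal ((A m x)^2)) = ennreal B" "0 <= B"
      by (metis ennreal_cases infinity_ennreal_def)
    have "(A m x)^2 <= B" for m
      using B SUP_upper[of m UNIV "%m. ennreal ((A m x)^2)"] by simp
    then have "A m x <= sqrt B" for m by (simp add: real_le_rsqrt)
    then have "summable (%k. norm (F (r (Suc k)) x - F (r k) x))"
      by (intro summableI_nonneg_bounded[of _ "sqrt B"]) (auto simp: A_def)
    then have "summable (%k. F (r (Suc k)) x - F (r k) x)" by (rule summable_norm_cancel)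
    then show ?case
      unfolding summable_iff_convergent sum_lessThan_telescope[of "%k. F (r k) x"] convergent_diff_const_right_iff .
  qed
  define f where "f x = lim (%k. F (r k) x)" for x
  have [measurable]: "f \<in> bmeas" unfolding f_def by measurable
  have lim: "AE x in lborel. (%k. F (r k) x) ----> f x"
    using conv by eventually_elim (simp add: f_def convergent_LIMSEQ_iff)
  \<comment> \<open>Fatou is applied to \<open>F n - F (r j)\<close> in \<open>j\<close>, shifted by
    \<open>k\<close> so that the Cauchy bound for \<open>k\<close> holds for every term.\<close>
  have close: "(%x. F n x - f x) \<in> L2 \<and> n2 (%x. F n x - f x) <= (1/2)^k" if "n \<ge> N k" for n k
  proof -
    have a: "!!j. (%x. F n x - F (r (j + k)) x) \<in> L2" by (intro L2_diff F)
    have b: "n2 (%x. F n x - F (r (j + k)) x) <= (1/2)^k" for j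
    proof -
      have "N k <= r (j + k)" using rN[of k] strict_mono_leD[OF r, of k "j + k"] by simp
      then show ?thesis using N[OF that] less_imp_le by blast
    qed
    have c: "AE x in lborel. (%j. F n x - F (r (j + k)) x) ----> F n x - f x"
      using lim by eventually_elim (intro tendsto_intros LIMSEQ_ignore_initial_segment)
    show ?thesis using L2_Fatou[OF a b c] by simp
  qed
  have fL: "f \<in> L2"
    using L2_diff[OF F[of "N 0"] close[of 0 "N 0", THEN conjunct1]] by simp
  have "(%n. n2 (%x. F n x - f x)) ----> 0"
  proof (rule LIMSEQ_I)
    fix e :: real assume "0 < e"
    then obtain k where k: "(1/2)^k < e" using real_arch_pow_inv[of e "1/2"] by auto
    show "\<exists>M. \<forall>n\<ge>M. norm (n2 (%x. F n x - f x) - 0) < e"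
      using close[of k] k by (intro exI[of _ "N k"]) fastforce
  qed
  with fL that show thesis by blast
qed

text \<open>Truncation in value and in space reduces to the bounded functions \<open>F k\<close>
  with bounded support. Those are almost everywhere limits of continuous functions; clipping the
  values with \<open>tau\<close> and the support with \<open>cut\<close> provides a common majorant,
  so the limit also holds in norm.\<close>

lemma L2_dense_continuous:
  fixes f :: "'a::euclidean_space => 'b::euclidean_space"
  assumes f: "f \<in> L2" and e: "0 < e"
  obtains h R where "continuous_on UNIV h" "!!x. R <= norm x ==> h x = 0" "h \<in> L2"
    "n2 (%x. f x - h x) < e"
proof -
  have [measurable]: "f \<in> bmeas" using f by (rule L2_measurable)
  define F where "F k x = (if norm (f x) <= real k \<and> norm x <= real k then f x else 0)" for k x
  have [measurable]: "!!k. F k \<in> bmeas" unfolding F_def by measurable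
  have Fl: "(%k. F k x) ----> f x" for x
  proof (rule tendsto_eventually)
    obtain k0 where "max (norm (f x)) (norm x) <= real k0" using real_arch_simple by blast
    then show "\<forall>\<^sub>F k in sequentially. F k x = f x"
      by (intro eventually_sequentiallyI[of k0]) (auto simp: F_def)
  qed
  have FL: "!!k. F k \<in> L2" "(%k. n2 (%x. F k x - f x)) ----> 0"
    using L2_dominated[of F f f] f Fl by (auto simp: F_def)
  then obtain k where k: "n2 (%x. F k x - f x) < e / 2"
    using e order_tendstoD(2)[OF FL(2), of "e/2"] by (auto simp: eventually_sequentially)
  have "F k \<in> borel_measurable lebesgue" by (simp add: measurable_completion)
  from lebesgue_measurable_imp_measurable_on[OF this, of UNIV]
  obtain Z g where Z: "negligible Z" and g: "!!n. continuous_on UNIV (g n)"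
    and lim: "!!x. x \<notin> Z ==> (%n. g n x) ----> F k x"
    by (auto simp: measurable_on_def)
  define tau where "tau y = (1 / max 1 (norm y / (real k + 1))) *R y" for y :: 'b
  define cut where "cut x = max 0 (min 1 (real k + 1 - norm x))" for x :: 'a
  have tau: "continuous_on UNIV tau" unfolding tau_def by (intro continuous_intros) auto
  have taub: "norm (tau y) <= real k + 1" for y
  proof (cases "norm y <= real k + 1")
    case False
    then have "norm y / (real k + 1) \<ge> 1" by simp
    then have "norm (tau y) = norm y / (norm y / (real k + 1))" by (simp add: tau_def max_def)
    also have "\<dots> = real k + 1"
    proof -
      have "norm y \<noteq> 0" using False by linarith
      then show ?thesis by simp
    qed
    finally show ?thesis by simp
  next
    case True
    then have "tau y = y" by (auto simp: tau_def max_def field_simps)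
    with True show ?thesis by simp
  qed
  define h where "h n x = cut x *R tau (g n x)" for n x
  have hc: "continuous_on UNIV (h n)" for n
    unfolding h_def cut_def
    by (intro continuous_intros continuous_on_compose2[OF tau g]) auto
  have hm[measurable]: "h n \<in> bmeas" for n
    using borel_measurable_continuous_onI[OF hc] by simp
  define w where "w x = (real k + 1) * indicator (cball (0::'a) (real k + 1)) x" for x
  have w: "w \<in> L2"
  proof -
    have "integrable lborel (%x. (real k + 1)^2 * indicator (cball (0::'a) (real k + 1)) x)"
      by (intro integrable_mult_right integrable_real_indicator)
        (simp_all add: emeasure_lborel_cball_finite[unfolded infinity_ennreal_def])
    moreover have "(norm (w x))^2 = (real k + 1)^2 * indicator (cball (0::'a) (real k + 1)) x" for x
      by (auto simp: w_def power_mult_distrib indicator_def)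
    ultimately show ?thesis unfolding L2_def by (auto simp: w_def[abs_def])
  qed
  have hb: "norm (h n x) <= norm (w x)" for n x
  proof (cases "norm x <= real k + 1")
    case True
    then have "norm (h n x) <= 1 * (real k + 1)"
      unfolding h_def norm_scaleR by (intro mult_mono taub) (auto simp: cut_def)
    with True show ?thesis by (simp add: w_def)
  qed (auto simp: h_def cut_def w_def)
  have ae: "AE x in lborel. x \<notin> Z"
    using Z AE_not_in[of Z "lebesgue :: 'a measure"]
    by (simp add: negligible_iff_null_sets AE_completion_iff)
  have hl: "AE x in lborel. (%n. h n x) ----> F k x"
    using ae
  proof eventually_elim
    case (elim x)
    have "(%n. h n x) ----> cut x *R tau (F k x)"
      unfolding h_def using continuous_on_tendsto_compose[OF tau lim[OF elim]]
      by (intro tendsto_intros) auto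
    moreover have "cut x *R tau (F k x) = F k x"
      by (auto simp: F_def cut_def tau_def max_def min_def field_simps)
    ultimately show ?case by simp
  qed
  have hL: "!!n. h n \<in> L2" "(%n. n2 (%x. h n x - F k x)) ----> 0"
    using L2_dominated[OF hm w _ hl] hb by auto
  then obtain n where n: "n2 (%x. h n x - F k x) < e / 2"
    using e order_tendstoD(2)[OF hL(2), of "e/2"] by (auto simp: eventually_sequentially)
  show thesis
  proof (rule that[of "h n" "real k + 1"])
    show "h n x = 0" if "real k + 1 <= norm x" for x
      using that by (auto simp: h_def cut_def)
    have "n2 (%x. f x - h n x) <= n2 (%x. f x - F k x) + n2 (%x. F k x - h n x)"
      by (rule n2_triangle3) (use f FL hL in auto)
    also have "\<dots> < e"
      using k n unfolding n2_diff_commute[of f "F k"] n2_diff_commute[of "F k" "h n"] by linarith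
    finally show "n2 (%x. f x - h n x) < e" .
  qed (use hc hL in auto)
qed

lemma L2_cont_compact:
  fixes h :: "'a::euclidean_space => 'b::euclidean_space"
  assumes c: "continuous_on UNIV h" and z: "!!x. R <= norm x ==> h x = 0"
  shows "h \<in> L2" "\<exists>B. \<forall>x. norm (h x) <= B" "integrable lborel h"
proof -
  have [measurable]: "h \<in> bmeas" using borel_measurable_continuous_onI[OF c] .
  have "compact (h ` cball 0 R)"
    by (intro compact_continuous_image continuous_on_subset[OF c]) auto
  then obtain B where B: "!!x. x \<in> cball 0 R ==> norm (h x) <= B"
    by (meson compact_imp_bounded bounded_iff imageI)
  have B': "norm (h x) <= \<bar>B\<bar>" for x
  proof (cases "x \<in> cball 0 R")
    case True then show ?thesis using B[of x] by linarith
  qed (use z[of x] in auto)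
  then show "\<exists>B. \<forall>x. norm (h x) <= B" by blast
  have i: "integrable lborel (%x. c * indicator (cball (0::'a) R) x :: real)" for c
    by (intro integrable_mult_right integrable_real_indicator)
        (simp_all add: emeasure_lborel_cball_finite[unfolded infinity_ennreal_def])
  have "norm (h x) <= \<bar>B\<bar> * indicator (cball (0::'a) R) x" for x
    using B'[of x] z[of x] by (auto simp: indicator_def)
  then show "integrable lborel h"
    by (intro integrable_boundI[OF i[of "\<bar>B\<bar>"]]) simp_all
  have "(norm (h x))^2 <= B^2 * indicator (cball (0::'a) R) x" for x
    using power_mono[OF B'[of x], of 2] z[of x] by (auto simp: indicator_def)
  then have "integrable lborel (%x. (norm (h x))^2)"
    by (intro integrable_boundI[OF i[of "B^2"]]) simp_all
  then show "h \<in> L2" by (simp add: L2_def)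
qed

text \<open>Translations and dilations at once. Isometry reduces the claim to continuous functions
  of bounded support, where dominated convergence applies; \<open>grow\<close> keeps the supports of
  all transformed functions in one ball.\<close>

lemma L2_transform_continuous:
  fixes phi :: "nat => 'a::euclidean_space => 'a" and f :: "'a => 'b::euclidean_space"
  assumes T: "!!n h. h \<in> L2 ==> (%x. m n *R h (phi n x)) \<in> (L2 :: ('a => 'b) set)"
    and iso: "!!n h. h \<in> (L2 :: ('a => 'b) set) ==> n2 (%x. m n *R h (phi n x)) = n2 h"
    and phi: "!!x. (%n. phi n x) ----> x" and m: "m ----> 1"
    and grow: "!!n x. norm x <= c * norm (phi n x) + c"
    and f: "f \<in> L2"
  shows "(%n. n2 (%x. m n *R f (phi n x) - f x)) ----> 0"
proof (rule LIMSEQ_I)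
  fix e :: real assume e: "0 < e"
  obtain h R where h: "continuous_on UNIV h" "!!x. R <= norm x ==> h x = 0" "h \<in> L2"
    "n2 (%x. f x - h x) < e / 3"
    using L2_dense_continuous[OF f, of "e/3"] e by auto
  obtain B where B: "!!x. norm (h x) <= B" using L2_cont_compact(2)[OF h(1,2)] by blast
  obtain m0 where m0: "!!n. \<bar>m n\<bar> <= m0"
    using convergent_imp_Bseq[OF convergentI[OF m]] by (auto simp: Bseq_def)
  \<comment> \<open>By \<open>grow\<close>, a point whose image lies in the ball of radius
    \<open>R\<close> has norm at most \<open>c * R + c\<close>; \<open>max c 0\<close> guards
    against a negative \<open>c\<close>.\<close>
  define R' where "R' = max R (max c 0 * R + max c 0)"
  define w where "w x = (m0 * B) * indicator (cball (0::'a) R') x" for x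
  have w: "w \<in> L2"
  proof -
    have "integrable lborel (%x. (m0 * B)^2 * indicator (cball (0::'a) R') x)"
      by (intro integrable_mult_right integrable_real_indicator)
        (simp_all add: emeasure_lborel_cball_finite[unfolded infinity_ennreal_def])
    moreover have "(norm (w x))^2 = (m0 * B)^2 * indicator (cball (0::'a) R') x" for x
      by (auto simp: w_def power_mult_distrib indicator_def)
    ultimately show ?thesis unfolding L2_def by (auto simp: w_def[abs_def])
  qed
  have TL: "(%x. m n *R h (phi n x)) \<in> L2" for n by (rule T[OF h(3)])
  have m00: "0 <= m0" using m0[of 0] by linarith
  have B0: "0 <= B" using B[of 0] norm_ge_zero order_trans by blast
  have b: "norm (m n *R h (phi n x)) <= norm (w x)" for n x
  proof (cases "R <= norm (phi n x)")
    case True then show ?thesis using h(2) by simp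
  next
    case False
    have "norm x <= max c 0 * norm (phi n x) + max c 0"
      using grow[of x n] by (smt (verit) mult_right_mono norm_ge_zero)
    also have "\<dots> <= max c 0 * R + max c 0" using False by (intro add_right_mono mult_left_mono) auto
    finally have "x \<in> cball 0 R'" by (simp add: R'_def)
    moreover have "norm (m n *R h (phi n x)) <= m0 * B"
      using m0[of n] B[of "phi n x"] m00 by (auto intro!: mult_mono)
    ultimately show ?thesis using m00 B0 by (simp add: w_def)
  qed
  have l: "(%n. m n *R h (phi n x)) ----> h x" for x
    using tendsto_scaleR[OF m continuous_on_tendsto_compose[OF h(1) phi]] by simp
  have "(%n. n2 (%x. m n *R h (phi n x) - h x)) ----> 0"
    by (rule L2_dominated(3)[OF L2_measurable[OF TL] w _ _ L2_measurable[OF h(3)]])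
       (use b l in auto)
  from order_tendstoD(2)[OF this, of "e/3"] e obtain N
    where N: "!!n. n \<ge> N ==> n2 (%x. m n *R h (phi n x) - h x) < e / 3"
    by (auto simp: eventually_sequentially)
  have "norm (n2 (%x. m n *R f (phi n x) - f x) - 0) < e" if "n \<ge> N" for n
  proof -
    have a: "n2 (%x. m n *R f (phi n x) - m n *R h (phi n x)) = n2 (%x. f x - h x)"
      using iso[OF L2_diff[OF f h(3)], of n] by (simp add: scaleR_diff_right)
    have "n2 (%x. m n *R f (phi n x) - f x)
        <= n2 (%x. m n *R f (phi n x) - m n *R h (phi n x)) + n2 (%x. m n *R h (phi n x) - f x)"
      by (rule n2_triangle3) (use T f h in auto)
    also have "n2 (%x. m n *R h (phi n x) - f x)
        <= n2 (%x. m n *R h (phi n x) - h x) + n2 (%x. h x - f x)"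
      by (rule n2_triangle3) (use T f h in auto)
    finally show ?thesis using a h(4) N[OF that] by (simp add: n2_diff_commute[of h f])
  qed
  then show "\<exists>N. \<forall>n\<ge>N. norm (n2 (%x. m n *R f (phi n x) - f x) - 0) < e" by blast
qed

section \<open>Affine changes of variables\<close>

lemma lborel_nn_integral_affine:
  fixes f :: "'a::euclidean_space => ennreal"
  assumes [measurable]: "f \<in> bmeas" and c: "c \<noteq> 0"
  shows "(NN x. f x) = ennreal (\<bar>c\<bar> ^ DIM('a)) * (NN x. f (t + c *R x))"
  by (subst lborel_affine[OF c, of t])
    (simp add: nn_integral_density nn_integral_distr nn_integral_cmult)

lemma lborel_integrable_affine:
  fixes f :: "'a::euclidean_space => 'b::euclidean_space"
  assumes f: "integrable lborel f" and c: "c \<noteq> 0"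
  shows "integrable lborel (%x. f (t + c *R x))"
proof -
  have [measurable]: "f \<in> bmeas" using f by auto
  from f have "integrable lborel (%x. \<bar>c\<bar> ^ DIM('a) *R f (t + c *R x))"
    by (subst (asm) lborel_affine[OF c, of t]) (auto simp: integrable_density integrable_distr_eq)
  from integrable_scaleR_right[OF this, of "1 / \<bar>c\<bar> ^ DIM('a)"] c show ?thesis by simp
qed

lemma lborel_integral_affine:
  fixes f :: "'a::euclidean_space => 'b::euclidean_space"
  assumes [measurable]: "f \<in> bmeas" and c: "c \<noteq> 0"
  shows "(LBINT x. f x) = \<bar>c\<bar> ^ DIM('a) *R (LBINT x. f (t + c *R x))"
  by (subst lborel_affine[OF c, of t]) (simp add: integral_density integral_distr)

lemma lborel_AE_affine:
  fixes t :: "'a::euclidean_space"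
  assumes c: "c \<noteq> 0" and ae: "AE x in lborel. Q x"
  shows "AE x in lborel. Q (t + c *R x)"
proof -
  from ae obtain N where N: "{x. \<not> Q x} \<subseteq> N" "N \<in> sets lborel" "emeasure lborel N = 0"
    by (auto elim!: AE_E)
  have [measurable]: "N \<in> sets borel" using N by simp
  have "0 = ennreal (\<bar>c\<bar> ^ DIM('a)) * (NN x. indicator N (t + c *R x))"
    using lborel_nn_integral_affine[of "indicator N" c t] c N by simp
  then have "(NN x. indicator N (t + c *R x)) = 0"
    using c by (auto simp: zero_less_power)
  then have "AE x in lborel. (indicator N (t + c *R x) :: ennreal) = 0"
    by (subst (asm) nn_integral_0_iff_AE) auto
  then show ?thesis using N(1) by (auto elim!: eventually_mono split: split_indicator_asm)
qed

lemma L2_affine: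
  fixes f :: "'a::euclidean_space => 'b::euclidean_space"
  assumes f: "f \<in> L2" and c: "c \<noteq> 0"
  shows "(%x. f (t + c *R x)) \<in> L2"
    and "(n2 f)^2 = \<bar>c\<bar> ^ DIM('a) * (n2 (%x. f (t + c *R x)))^2"
proof -
  have [measurable]: "f \<in> bmeas" by (rule L2_measurable[OF f])
  show "(%x. f (t + c *R x)) \<in> L2"
    using lborel_integrable_affine[OF L2_integrable[OF f] c, of t] by (simp add: L2_def)
  show "(n2 f)^2 = \<bar>c\<bar> ^ DIM('a) * (n2 (%x. f (t + c *R x)))^2"
    using lborel_integral_affine[of "%x. (norm (f x))^2", OF _ c, of t] by (simp add: n2_sq)
qed

lemma L2_translate:
  fixes f :: "'a::euclidean_space => 'b::euclidean_space"
  assumes f: "f \<in> L2"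
  shows "(%x. f (x + t)) \<in> L2" "n2 (%x. f (x + t)) = n2 f"
    "(%x. f (x - t)) \<in> L2" "n2 (%x. f (x - t)) = n2 f"
    "(%x. f (t - x)) \<in> L2" "n2 (%x. f (t - x)) = n2 f"
proof -
  have *: "n2 f = n2 g" if "(n2 f)^2 = (n2 g)^2" for g :: "'a => 'b"
    using that by simp
  show "(%x. f (x + t)) \<in> L2" "n2 (%x. f (x + t)) = n2 f"
    using L2_affine[OF f, of 1 t] by (simp_all add: add.commute)
  show "(%x. f (x - t)) \<in> L2" "n2 (%x. f (x - t)) = n2 f"
    using L2_affine[OF f, of 1 "-t"] by (simp_all add: add.commute)
  show "(%x. f (t - x)) \<in> L2" "n2 (%x. f (t - x)) = n2 f"
    using L2_affine[OF f, of "-1" t] by (simp_all add: add.commute)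
qed

lemma L2_translate_continuous:
  fixes f :: "'a::euclidean_space => 'b::euclidean_space"
  assumes f: "f \<in> L2" and y: "y ----> 0"
  shows "(%n. n2 (%x. f (x - y n) - f x)) ----> 0"
proof -
  obtain B where B: "!!n. norm (y n) <= B"
    using convergent_imp_Bseq[OF convergentI[OF y]] by (auto simp: Bseq_def)
  have "(%n. n2 (%x. (1::real) *R f (x - y n) - f x)) ----> 0"
  proof (rule L2_transform_continuous[where m="%_. 1" and phi="%n x. x - y n" and c="max 1 B"])
    show "(%n. x - y n) ----> x" for x using tendsto_diff[OF tendsto_const y] by simp
    show "norm x <= max 1 B * norm (x - y n) + max 1 B" for n x
    proof -
      have "norm x <= norm (x - y n) + norm (y n)" by (metis diff_add_cancel norm_triangle_ineq)
      also have "\<dots> <= max 1 B * norm (x - y n) + max 1 B"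
        using B[of n] mult_right_mono[of 1 "max 1 B" "norm (x - y n)"] by auto
      finally show ?thesis .
    qed
  qed (use f in \<open>auto simp: L2_translate\<close>)
  then show ?thesis by simp
qed

lemma L2_translate_uniform:
  fixes f :: "'a::euclidean_space => 'b::euclidean_space"
  assumes f: "f \<in> L2" and e: "0 < e"
  obtains d where "0 < d" "!!y. norm y < d ==> n2 (%x. f (x - y) - f x) < e"
proof (rule ccontr)
  assume "\<not> thesis"
  with that have "\<forall>d>0. \<exists>y. norm y < d \<and> \<not> n2 (%x. f (x - y) - f x) < e" by blast
  then have "\<exists>y. norm y < inverse (real (Suc n)) \<and> \<not> n2 (%x. f (x - y) - f x) < e" for n
    by simp
  then obtain y where y: "!!n. norm (y n) < inverse (real (Suc n))"
    "!!n. \<not> n2 (%x. f (x - y n) - f x) < e" by metis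
  have "y ----> 0"
    by (rule Lim_null_comparison[OF _ LIMSEQ_inverse_real_of_nat])
      (rule always_eventually, use y(1) less_imp_le in blast)
  from order_tendstoD(2)[OF L2_translate_continuous[OF f this] e]
  show False using y(2) by (auto simp: eventually_sequentially)
qed

section \<open>Functions with a gradient\<close>

text \<open>A Frechet derivative encoded by the family of its partial derivatives, with values in
  any normed space, so that real kernels and complex functions share one calculus.\<close>

definition gderiv :: "(real^3 => 'b::real_normed_vector) => (3 => 'b) => real^3 => bool" where
  "gderiv f H x \<longleftrightarrow> (f has_derivative (%v. \<Sum>i\<in>UNIV. v $ i *R H i)) (at x)"

lemma gderiv_sum_axis: "(\<Sum>i\<in>UNIV. axis j (1::real) $ i *R H i) = (H (j::3) :: 'b::real_vector)"
  by (simp add: axis_def if_distrib[of "%c. c *R _"] cong: if_cong)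

lemma gderiv_unique:
  assumes "gderiv f H x" "gderiv f H' x" shows "H = H'"
proof
  fix j
  have "(%v::real^3. \<Sum>i\<in>UNIV. v $ i *R H i) = (%v. \<Sum>i\<in>UNIV. v $ i *R H' i)"
    using has_derivative_unique assms unfolding gderiv_def by blast
  from fun_cong[OF this, of "axis j 1"] show "H j = H' j" by (simp add: gderiv_sum_axis)
qed

lemma gderiv_continuous: "(!!x. gderiv f (H x) x) ==> continuous_on UNIV f"
  unfolding gderiv_def
  by (meson continuous_at_imp_continuous_on has_derivative_continuous)

lemma gderiv_bound: "norm (\<Sum>i\<in>UNIV. v $ i *R H i) <= norm (v::real^3) * (\<Sum>i\<in>UNIV. norm (H i))"
proof -
  have "norm (\<Sum>i\<in>UNIV. v $ i *R H i) <= (\<Sum>i\<in>UNIV. norm v * norm (H i))"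
    by (rule sum_norm_le) (auto intro!: mult_right_mono component_le_norm_cart)
  then show ?thesis by (simp add: sum_distrib_left)
qed

lemma gderiv_scaleR: "gderiv f H x ==> gderiv (%x. c *R f x) (%i. c *R H i) x"
  unfolding gderiv_def
  by (drule has_derivative_scaleR_right[where r=c]) (simp add: scaleR_sum_right mult.commute)

lemma gderiv_add: "gderiv f H x ==> gderiv g H' x ==> gderiv (%x. f x + g x) (%i. H i + H' i) x"
  unfolding gderiv_def
  by (drule (1) has_derivative_add) (simp add: scaleR_add_right sum.distrib)

lemma gderiv_bounded_linear:
  assumes "bounded_linear L" "gderiv f H x" shows "gderiv (%x. L (f x)) (%i. L (H i)) x"
proof -
  interpret bounded_linear L by fact
  show ?thesis using has_derivative[OF assms(2)[unfolded gderiv_def]]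
    by (simp add: gderiv_def sum scaleR)
qed

lemma gderiv_mult_real:
  fixes f :: "real^3 => real"
  assumes "gderiv f H x" "gderiv g H' x"
  shows "gderiv (%x. f x *R g x) (%i. H i *R g x + f x *R H' i) x"
  using has_derivative_scaleR[OF assms[unfolded gderiv_def]]
  by (simp add: gderiv_def scaleR_add_right sum.distrib scaleR_sum_left scaleR_sum_right mult_ac add.commute)

lemma gderiv_affine:
  assumes "gderiv f H (t + c *R x)"
  shows "gderiv (%x. f (t + c *R x)) (%i. c *R H i) x"
proof -
  have "((%x. t + c *R x) has_derivative (%v. c *R v)) (at x)"
    by (auto intro!: derivative_eq_intros)
  from diff_chain_at[OF this assms[unfolded gderiv_def]]
  show ?thesis by (simp add: gderiv_def o_def mult.commute)
qed

lemma gderiv_compose_real: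
  fixes Phi :: "real => real"
  assumes "gderiv f H x" "(Phi has_field_derivative d) (at (f x))"
  shows "gderiv (%x. Phi (f x)) (%i. d * H i) x"
proof -
  have "((%x. Phi (f x)) has_derivative (%v. d * (\<Sum>i\<in>UNIV. v $ i *R H i))) (at x)"
    using diff_chain_at[OF assms(1)[unfolded gderiv_def] assms(2)[unfolded has_field_derivative_def]]
    by (simp add: o_def mult.commute)
  then show ?thesis by (simp add: gderiv_def sum_distrib_left mult_ac)
qed

lemma gderiv_lipschitz:
  assumes g: "!!x. gderiv f (H x) x" and b: "!!x i. norm (H x i) <= B"
  shows "norm (f y - f x) <= 3 * B * norm (y - x)"
proof (rule differentiable_bound[of UNIV f "%x v. \<Sum>i\<in>UNIV. v $ i *R H x i"])
  show "onorm (%v. \<Sum>i\<in>UNIV. v $ i *R H x i) <= 3 * B" for x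
  proof (rule onorm_le)
    fix v :: "real^3"
    have "(\<Sum>i\<in>UNIV. norm (H x i)) <= (\<Sum>i\<in>(UNIV::3 set). B)" by (rule sum_mono) (rule b)
    then have "norm v * (\<Sum>i\<in>UNIV. norm (H x i)) <= norm v * (3 * B)"
      by (intro mult_left_mono) auto
    with gderiv_bound[of v "H x"]
    show "norm (\<Sum>i\<in>UNIV. v $ i *R H x i) <= 3 * B * norm v" by (simp add: mult.commute)
  qed
qed (use g in \<open>auto simp: gderiv_def\<close>)

lemma test_function_gderiv:
  assumes "test_function f"
  shows "gderiv f (%i. pd i f x) x"
proof -
  have d: "f differentiable (at x)" using assms by (metis test_function_def iterated_partial.simps(1))
  then have 1: "(f has_derivative frechet_derivative f (at x)) (at x)" by (simp add: frechet_derivative_works)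
  have eq: "frechet_derivative f (at x) = (%v. \<Sum>i\<in>UNIV. v $ i *R pd i f x)"
  proof
    fix v :: "real^3"
    interpret bounded_linear "frechet_derivative f (at x)" using 1 by (rule has_derivative_bounded_linear)
    have "v = (\<Sum>i\<in>UNIV. v $ i *R axis i 1)"
      using basis_expansion[of v] by (simp add: scalar_mult_eq_scaleR)
    then have "frechet_derivative f (at x) v = (\<Sum>i\<in>UNIV. v $ i *R frechet_derivative f (at x) (axis i 1))"
      by (metis (no_types, lifting) scaleR sum sum.cong)
    then show "frechet_derivative f (at x) v = (\<Sum>i\<in>UNIV. v $ i *R pd i f x)" by simp
  qed
  show ?thesis using 1 unfolding gderiv_def eq .
qed

lemma gderiv_iterated_partial:
  assumes "!!x. gderiv f (H x) x" shows "pd i f = (%x. H x i)"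
proof
  fix x
  have "frechet_derivative f (at x) = (%v. \<Sum>i\<in>UNIV. v $ i *R H x i)"
    using frechet_derivative_at[OF assms[unfolded gderiv_def], of x] by (rule sym)
  then show "pd i f x = H x i" by (simp add: gderiv_sum_axis del: real_scaleR_def)
qed

lemma iterated_partial_append: "iterated_partial (is @ js) f = iterated_partial is (iterated_partial js f)"
  by (induction "is") auto

lemma test_function_partial:
  assumes f: "test_function f" shows "test_function (pd i f)"
  unfolding test_function_def
proof safe
  show "iterated_partial is (pd i f) differentiable at x" for "is" x
    using f unfolding test_function_def by (metis iterated_partial_append)
  have "{x. pd i f x \<noteq> 0} \<subseteq> closure {x. f x \<noteq> 0}"
  proof (safe, rule ccontr)
    fix x assume x: "pd i f x \<noteq> 0" "x \<notin> closure {x. f x \<noteq> 0}"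
    have "gderiv (%x. 0) (%i. 0) x" unfolding gderiv_def by simp
    then have "gderiv f (%i. 0) x" unfolding gderiv_def
    proof (rule has_derivative_transform_within_open[where s="- closure {x. f x \<noteq> 0}"])
      show "0 = f y" if "y \<in> - closure {x. f x \<noteq> 0}" for y
        using that closure_subset[of "{x. f x \<noteq> 0}"] by auto
    qed (use x in auto)
    from gderiv_unique[OF test_function_gderiv[OF f] this] have "pd i f x = 0" by metis
    with x show False by simp
  qed
  then have "closure {x. pd i f x \<noteq> 0} \<subseteq> closure {x. f x \<noteq> 0}"
    by (simp add: closure_minimal)
  then show "compact (closure {x. pd i f x \<noteq> 0})"
    using f unfolding test_function_def by (meson closed_closure compact_closure bounded_subset compact_imp_bounded bounded_closure closure_subset)
qed

lemma test_function_vanish: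
  assumes "test_function f" obtains R where "!!x. R <= norm x ==> f x = 0" "0 < R"
proof -
  have "bounded {x. f x \<noteq> 0}"
    using assms bounded_subset[OF compact_imp_bounded closure_subset] unfolding test_function_def by blast
  then obtain R where R: "!!x. f x \<noteq> 0 ==> norm x < R" "0 < R"
    by (auto simp: bounded_pos_less)
  show thesis by (rule that[of R]) (use R in fastforce)+
qed

lemma test_function_continuous: "test_function f ==> continuous_on UNIV f"
  using gderiv_continuous[OF test_function_gderiv] by blast

lemma test_function_L2: assumes "test_function f" shows "f \<in> L2" "integrable lborel f" "f \<in> bmeas"
  using test_function_vanish[OF assms] L2_cont_compact[OF test_function_continuous[OF assms]] L2_measurable by metis+

lemma test_function_bounded: assumes "test_function f" obtains B where "!!x. norm (f x) <= B"
  using test_function_vanish[OF assms] L2_cont_compact(2)[OF test_function_continuous[OF assms]] by metis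

lemma test_function_affine:
  assumes f: "test_function f" and c: "c \<noteq> 0"
  shows "test_function (%x. f (t + c *R x))"
proof -
  have eq: "iterated_partial is (%x. f (t + c *R x)) = (%x. c ^ length is *R iterated_partial is f (t + c *R x))" for "is"
  proof (induction "is")
    case (Cons i "is")
    have "test_function (iterated_partial is f)"
      using f by (induction "is") (auto dest: test_function_partial)
    then have g: "gderiv (%x. c ^ length is *R iterated_partial is f (t + c *R x))
         (%i. c ^ length is *R c *R pd i (iterated_partial is f) (t + c *R x)) x" for x
      by (intro gderiv_scaleR gderiv_affine test_function_gderiv)
    have "iterated_partial (i # is) (%x. f (t + c *R x)) = pd i (iterated_partial is (%x. f (t + c *R x)))"
      by simp
    also have "\<dots> = (%x. c ^ length is *R c *R pd i (iterated_partial is f) (t + c *R x))"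
      unfolding Cons by (rule gderiv_iterated_partial[OF g])
    finally show ?case by (simp add: mult_ac)
  qed simp
  obtain R where R: "!!x. R <= norm x ==> f x = 0" "0 < R" using test_function_vanish[OF f] by blast
  have "{x. f (t + c *R x) \<noteq> 0} \<subseteq> cball 0 ((R + norm t) / \<bar>c\<bar>)"
  proof safe
    fix x assume "f (t + c *R x) \<noteq> 0"
    then have "norm (t + c *R x) < R" using R(1) by (metis not_le)
    then have "\<bar>c\<bar> * norm x <= R + norm t"
      using norm_triangle_ineq4[of "t + c *R x" t] by simp
    then show "x \<in> cball 0 ((R + norm t) / \<bar>c\<bar>)" using c by (simp add: field_simps)
  qed
  then have b: "bounded {x. f (t + c *R x) \<noteq> 0}" using bounded_cball bounded_subset by blast
  show ?thesis unfolding test_function_def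
  proof safe
    fix "is" x
    have "test_function (iterated_partial is f)"
      using f by (induction "is") (auto dest: test_function_partial)
    then have "gderiv (%x. c ^ length is *R iterated_partial is f (t + c *R x))
         (%i. c ^ length is *R c *R pd i (iterated_partial is f) (t + c *R x)) x"
      by (intro gderiv_scaleR gderiv_affine test_function_gderiv)
    then show "iterated_partial is (%x. f (t + c *R x)) differentiable at x"
      unfolding eq gderiv_def differentiable_def by blast
  qed (use b compact_closure in blast)
qed

lemma test_function_scale:
  assumes f: "test_function f" shows "test_function (%x. c * f x)"
proof (cases "c = 0")
  case False
  have eq: "iterated_partial is (%x. c * f x) = (%x. c * iterated_partial is f x)" for "is"
  proof (induction "is")
    case (Cons i "is")
    have "test_function (iterated_partial is f)"
      using f by (induction "is") (auto dest: test_function_partial)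
    from gderiv_iterated_partial[OF gderiv_scaleR[OF test_function_gderiv[OF this]]]
    show ?case using Cons by simp
  qed simp
  show ?thesis unfolding test_function_def eq
    using f False by (auto simp: test_function_def)
next
  case True
  have "iterated_partial is (%x. 0) = (%x. 0)" for "is"
  proof (induction "is")
    case (Cons i "is")
    have "gderiv (%x. 0::real) (%i. 0) x" for x unfolding gderiv_def by simp
    from gderiv_iterated_partial[OF this] Cons show ?case by simp
  qed simp
  with True show ?thesis by (simp add: test_function_def)
qed

subsection \<open>A bump function\<close>

text \<open>The flat functions \<open>exp (- 1 / t) / t ^ k\<close>, continued by 0. The parameter
  \<open>k\<close> makes the family closed under differentiation up to linear combinations, so that
  smoothness at 0 rests on a single limit.\<close>

definition hexp :: "nat => real => real" where
  "hexp k t = (if t <= 0 then 0 else exp (- 1 / t) / t ^ k)"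

lemma hexp_tendsto_0: "((%t. hexp k t) \<longlongrightarrow> 0) (at 0)"
proof -
  have "((%t. (inverse t) ^ k / exp (inverse t)) \<longlongrightarrow> 0) (at_right (0::real))"
    by (rule filterlim_compose[OF tendsto_power_div_exp_0 filterlim_inverse_at_top_right])
  then have r: "((%t. hexp k t) \<longlongrightarrow> 0) (at_right 0)"
  proof (rule Lim_transform_eventually)
    show "\<forall>\<^sub>F t in at_right 0. inverse t ^ k / exp (inverse t) = hexp k t"
      unfolding eventually_at_right_field
      by (intro exI[of _ 1]) (auto simp: hexp_def field_simps exp_minus power_inverse)
  qed
  have l: "((%t. hexp k t) \<longlongrightarrow> 0) (at_left 0)"
    by (rule tendsto_eventually, unfold eventually_at_left_field) (auto simp: hexp_def intro!: exI[of _ "-1"])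
  from filterlim_split_at[OF l r] show ?thesis .
qed

lemma hexp_deriv: "(hexp k has_real_derivative (hexp (k + 2) t - k * hexp (k + 1) t)) (at t)"
proof -
  consider "t < 0" | "t > 0" | "t = 0" by linarith
  then show ?thesis
  proof cases
    case 1
    have "((%t. 0) has_real_derivative 0) (at t)" by simp
    then have "(hexp k has_real_derivative 0) (at t)"
      by (rule has_field_derivative_transform_within_open[where S="{..<0}"]) (use 1 in \<open>auto simp: hexp_def\<close>)
    with 1 show ?thesis by (simp add: hexp_def)
  next
    case 2
    have "((%t. exp (- 1 / t) / t ^ k) has_real_derivative (hexp (k + 2) t - k * hexp (k + 1) t)) (at t)"
      using 2 by (auto intro!: derivative_eq_intros simp: hexp_def power2_eq_square)
        (cases k; simp add: field_simps power2_eq_square)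
    then show ?thesis
      by (rule has_field_derivative_transform_within_open[where S="{0<..}"]) (use 2 in \<open>auto simp: hexp_def\<close>)
  next
    case 3
    \<comment> \<open>At 0 the difference quotient of \<open>hexp k\<close> is
      \<open>hexp (Suc k)\<close>, also for negative increments, where both vanish.\<close>
    have "((%h. (hexp k (0 + h) - hexp k 0) / h) \<longlongrightarrow> 0) (at 0)"
    proof (rule Lim_transform_eventually[OF hexp_tendsto_0[of "Suc k"]])
      show "\<forall>\<^sub>F h in at 0. hexp (Suc k) h = (hexp k (0 + h) - hexp k 0) / h"
        by (rule always_eventually) (auto simp: hexp_def)
    qed
    with 3 show ?thesis by (simp add: DERIV_def hexp_def)
  qed
qed

text \<open>A class that contains the bump and is closed under partial derivatives, which gives all
  orders by induction. Products with coordinates are enough, because the chain rule for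
  \<open>1 - |x|^2\<close> produces only these.\<close>

inductive bumpy :: "(real^3 => real) => bool" where
  base: "bumpy (%x. hexp k (1 - x \<bullet> x))"
| coord: "bumpy f ==> bumpy (%x. x $ i * f x)"
| cmult: "bumpy f ==> bumpy (%x. c * f x)"
| plus: "bumpy f ==> bumpy g ==> bumpy (%x. f x + g x)"

lemma bumpy_gderiv: "bumpy f ==> \<exists>H. (\<forall>x. gderiv f (%i. H i x) x) \<and> (\<forall>i. bumpy (H i))"
proof (induction rule: bumpy.induct)
  case (base k)
  let ?H = "%i x. (hexp (k + 2) (1 - x \<bullet> x) + (- real k) * hexp (k + 1) (1 - x \<bullet> x))"
  have 1: "gderiv (%x. 1 - x \<bullet> x) (%i. -2 * x $ i) x" for x :: "real^3"
  proof -
    have "((%x. 1 - x \<bullet> x) has_derivative (%v. - 2 * (x \<bullet> v))) (at x)"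
      by (auto intro!: derivative_eq_intros simp: inner_commute)
    moreover have "- 2 * (x \<bullet> v) = (\<Sum>i\<in>UNIV. v $ i *R (-2 * x $ i))" for v
      by (simp add: inner_vec_def sum_distrib_left mult_ac sum_negf)
    ultimately show ?thesis by (simp add: gderiv_def)
  qed
  have 2: "gderiv (%x. hexp k (1 - x \<bullet> x)) (%i. (hexp (k + 2) (1 - x \<bullet> x) - k * hexp (k + 1) (1 - x \<bullet> x)) * (-2 * x $ i)) x" for x :: "real^3"
    by (rule gderiv_compose_real[OF 1 hexp_deriv])
  have 3: "bumpy (%x. -2 * (x $ i * (?H i x)))" for i
    by (intro bumpy.intros)
  have 4: "(hexp (k + 2) (1 - x \<bullet> x) - k * hexp (k + 1) (1 - x \<bullet> x)) * (-2 * x $ i) = -2 * (x $ i * (?H i x))" for x :: "real^3" and i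
    by simp
  show ?case using 2 3 unfolding 4
    by (intro exI[of _ "%i x. -2 * (x $ i * (?H i x))"]) blast
next
  case (coord f i)
  then obtain H where H: "!!x. gderiv f (%i. H i x) x" "!!i. bumpy (H i)" by blast
  have 1: "gderiv (%x. x $ i) (%j. if j = i then 1 else 0) x" for x
    by (auto simp: gderiv_def if_distrib[of "%c. _ * c"] cong: if_cong intro!: derivative_eq_intros bounded_linear_vec_nth bounded_linear_imp_has_derivative)
  have 2: "gderiv (%x. x $ i * f x) (%j. (if j = i then 1 else 0) * f x + x $ i * H j x) x" for x
    using gderiv_mult_real[OF 1 H(1)] by simp
  have 3: "bumpy (%x. (if j = i then 1 else 0) * f x + x $ i * H j x)" for j
    by (intro bumpy.intros coord H)
  from 2 3 show ?case by (intro exI[of _ "%j x. (if j = i then 1 else 0) * f x + x $ i * H j x"]) blast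
next
  case (cmult f c)
  then obtain H where H: "!!x. gderiv f (%i. H i x) x" "!!i. bumpy (H i)" by blast
  have "gderiv (%x. c * f x) (%j. c * H j x) x" for x
    using gderiv_scaleR[OF H(1)] by simp
  with bumpy.cmult[OF H(2)] show ?case by (intro exI[of _ "%j x. c * H j x"]) blast
next
  case (plus f g)
  then obtain H H' where H: "!!x. gderiv f (%i. H i x) x" "!!i. bumpy (H i)"
    "!!x. gderiv g (%i. H' i x) x" "!!i. bumpy (H' i)" by blast
  show ?case using gderiv_add[OF H(1,3)] bumpy.plus[OF H(2,4)]
    by (intro exI[of _ "%j x. H j x + H' j x"]) blast
qed

lemma bumpy_iterated: "bumpy f ==> bumpy (iterated_partial is f)"
proof (induction "is")
  case (Cons i "is")
  then obtain H where H: "!!x. gderiv (iterated_partial is f) (%i. H i x) x" "!!i. bumpy (H i)"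
    using bumpy_gderiv by blast
  have "iterated_partial (i # is) f = pd i (iterated_partial is f)" by simp
  also have "\<dots> = H i" using gderiv_iterated_partial[OF H(1)] by blast
  finally show ?case using H(2) by simp
qed simp

lemma bumpy_vanish: "bumpy f ==> 1 <= norm x ==> f x = 0"
proof (induction rule: bumpy.induct)
  case (base k)
  then have "1 <= x \<bullet> x" by (metis one_le_power power2_norm_eq_inner)
  then show ?case by (simp add: hexp_def)
qed auto

lemma bumpy_test: assumes "bumpy f" shows "test_function f"
  unfolding test_function_def
proof safe
  show "iterated_partial is f differentiable at x" for "is" x
    using bumpy_gderiv[OF bumpy_iterated[OF assms]] unfolding gderiv_def differentiable_def by blast
  have "{x. f x \<noteq> 0} \<subseteq> cball 0 1" using bumpy_vanish[OF assms] by force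
  then show "compact (closure {x. f x \<noteq> 0})"
    using bounded_subset[OF bounded_cball] compact_closure by blast
qed

definition bump :: "real^3 => real" where "bump x = hexp 0 (1 - x \<bullet> x)"

lemma bump_test: "test_function bump"
  using bumpy_test[OF bumpy.base[of 0]] by (simp add: bump_def[abs_def])

lemma bump_nonneg: "0 <= bump x" by (simp add: bump_def hexp_def)

lemma bump_pos: "norm x < 1 ==> 0 < bump x"
proof -
  assume "norm x < 1"
  then have "x \<bullet> x < 1" by (metis norm_ge_zero power2_norm_eq_inner power_less_one_iff zero_less_numeral)
  then show ?thesis by (simp add: bump_def hexp_def)
qed

lemma bump_vanish: "1 <= norm x ==> bump x = 0"
  using bumpy_vanish[OF bumpy.base[of 0]] by (simp add: bump_def)

lemma bump_integral_pos: "0 < (LBINT x. bump x)"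
proof -
  have "(LBINT x. bump x) \<noteq> 0"
  proof
    assume "(LBINT x. bump x) = 0"
    then have "AE x in lborel. bump x = 0"
      using integral_nonneg_eq_0_iff_AE[OF test_function_L2(2)[OF bump_test]] bump_nonneg by auto
    then have "AE x in lborel. x \<notin> ball (0::real^3) 1"
      by eventually_elim (use bump_pos in fastforce)
    then have "emeasure lborel (ball (0::real^3) 1) = 0"
      by (subst (asm) AE_iff_measurable[OF _ refl]) (auto simp: ball_def)
    then show False using emeasure_lborel_ball_finite[of 0 1] content_ball_pos[of 1 "0::real^3"]
      by (simp add: measure_def)
  qed
  moreover have "0 <= (LBINT x. bump x)" by (simp add: bump_nonneg)
  ultimately show ?thesis by linarith
qed

definition mol :: "nat => real^3 => real" where
  "mol n x = (real (Suc n) ^ 3 / (LBINT x. bump x)) * bump (real (Suc n) *R x)"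

lemma mol_test: "test_function (mol n)"
  using test_function_scale[OF test_function_affine[OF bump_test, of "real (Suc n)" 0],
      of "real (Suc n) ^ 3 / (LBINT x. bump x)"]
  by (simp add: mol_def[abs_def] del: of_nat_Suc)

lemma mol_nonneg: "0 <= mol n x"
  using bump_integral_pos bump_nonneg by (simp add: mol_def)

lemma mol_vanish: "1 / real (Suc n) <= norm x ==> mol n x = 0"
  by (auto simp: mol_def intro!: bump_vanish) (simp add: field_simps)

lemma mol_integral: "(LBINT x. mol n x) = 1"
proof -
  have "(LBINT x. bump x) = real (Suc n) ^ 3 * (LBINT x. bump (real (Suc n) *R x))"
    using lborel_integral_affine[OF test_function_L2(3)[OF bump_test], of "real (Suc n)" 0] by simp
  moreover from this have "(LBINT x. bump (real (Suc n) *R x)) \<noteq> 0" using bump_integral_pos by auto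
  ultimately show ?thesis by (simp add: mol_def[abs_def] del: of_nat_Suc)
qed

lemma mol_radial: "norm x = norm y ==> mol n x = mol n y"
  by (simp add: mol_def bump_def norm_eq)

section \<open>Mollification\<close>

definition conv :: "(real^3 => real) => (real^3 => 'b::euclidean_space) => real^3 => 'b" where
  "conv k u x = (LBINT y. k (x - y) *R u y)"

lemma L2_scaleR_integrable:
  assumes "k \<in> L2" "u \<in> L2" shows "integrable lborel (%y. k y *R u y)"
proof -
  have [measurable]: "k \<in> bmeas" "u \<in> bmeas"
    using assms by (auto intro: L2_measurable)
  show ?thesis by (rule integrable_boundI[OF L2_mult_integrable[OF assms]]) simp_all
qed

lemma conv_integrable:
  assumes "k \<in> L2" "u \<in> L2" shows "integrable lborel (%y. k (x - y) *R u y)"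
  by (rule L2_scaleR_integrable) (use assms L2_translate in auto)

text \<open>The second partial derivatives are bounded by some \<open>B0\<close>, so each first
  partial is Lipschitz with constant \<open>3 * B0\<close>; summing over three coordinates gives
  \<open>9 * B0\<close>. The bound is uniform in the base point, as differentiation under the
  integral requires.\<close>

lemma test_function_taylor:
  assumes k: "test_function k"
  obtains C where "0 <= C" "!!z v. \<bar>k (z + v) - k z - (\<Sum>i\<in>UNIV. v $ i * pd i k z)\<bar> <= C * (norm v)^2"
proof -
  have t: "test_function (pd j (pd i k))" for i j
    using k by (intro test_function_partial)
  define B where "B i j = (SOME B. \<forall>x. norm (pd j (pd i k) x) <= B)" for i j
  have B: "norm (pd j (pd i k) x) <= B i j" for i j x
  proof -
    have "\<exists>B. \<forall>x. norm (pd j (pd i k) x) <= B"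
      using test_function_bounded[OF t] by metis
    from someI_ex[OF this] show ?thesis unfolding B_def by blast
  qed
  define B0 where "B0 = (\<Sum>i\<in>UNIV. \<Sum>j\<in>UNIV. B i j)"
  have Bn: "0 <= B i j" for i j using B[of j i 0] norm_ge_zero order_trans by blast
  have "B i j <= (\<Sum>j\<in>UNIV. B i j)" for i j by (rule member_le_sum) (auto simp: Bn)
  moreover have "(\<Sum>j\<in>UNIV. B i j) <= B0" for i
    unfolding B0_def by (rule member_le_sum[where f="%i. \<Sum>j\<in>UNIV. B i j"]) (auto simp: Bn sum_nonneg)
  ultimately have BB: "B i j <= B0" for i j by (rule order_trans)
  have Bb: "norm (pd j (pd i k) x) <= B0" for i j x
    using B BB order_trans by blast
  have B0: "0 <= B0" by (auto simp: B0_def Bn intro!: sum_nonneg)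
  have lip: "norm (pd i k y - pd i k x) <= 3 * B0 * norm (y - x)" for i x y
    by (rule gderiv_lipschitz[OF test_function_gderiv[OF test_function_partial[OF k]]]) (rule Bb)
  show thesis
  proof (rule that[of "9 * B0"])
    fix z v :: "real^3"
    have "norm (k (z + v) - k z - (\<Sum>i\<in>UNIV. (z + v - z) $ i *R pd i k z))
        <= norm (z + v - z) * (9 * B0 * norm v)"
    proof (rule differentiable_bound_linearization[where S="cball z (norm v)"])
      show "z + t *R (z + v - z) \<in> cball z (norm v)" if "t \<in> {0..1}" for t
        using that mult_left_le_one_le[of "norm v" t] by (simp add: dist_norm)
      show "(k has_derivative (%w. \<Sum>i\<in>UNIV. w $ i *R pd i k x)) (at x within cball z (norm v))" for x
        using test_function_gderiv[OF k, of x] unfolding gderiv_def by (rule has_derivative_at_withinI)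
      show "onorm ((%w. \<Sum>i\<in>UNIV. w $ i *R pd i k x) - (%w. \<Sum>i\<in>UNIV. w $ i *R pd i k z)) <= 9 * B0 * norm v"
        if x: "x \<in> cball z (norm v)" for x
      proof (rule onorm_le)
        fix w :: "real^3"
        have "norm (((%w. \<Sum>i\<in>UNIV. w $ i *R pd i k x) - (%w. \<Sum>i\<in>UNIV. w $ i *R pd i k z)) w)
          = norm (\<Sum>i\<in>UNIV. w $ i *R (pd i k x - pd i k z))"
          by (simp add: sum_subtractf right_diff_distrib del: iterated_partial.simps)
        also have "\<dots> <= norm w * (\<Sum>i\<in>UNIV. norm (pd i k x - pd i k z))"
          by (rule gderiv_bound)
        also have "\<dots> <= norm w * (\<Sum>i\<in>(UNIV::3 set). 3 * B0 * norm v)"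
        proof (intro mult_left_mono sum_mono)
          fix i
          have "3 * B0 * norm (x - z) <= 3 * B0 * norm v"
            using x B0 by (intro mult_left_mono) (auto simp: dist_norm norm_minus_commute)
          then show "norm (pd i k x - pd i k z) <= 3 * B0 * norm v"
            using lip[of i x z] by linarith
        qed simp
        finally show "norm (((%w. \<Sum>i\<in>UNIV. w $ i *R pd i k x) - (%w. \<Sum>i\<in>UNIV. w $ i *R pd i k z)) w) <= 9 * B0 * norm v * norm w"
          by (simp add: mult_ac)
      qed
    qed simp
    then show "\<bar>k (z + v) - k z - (\<Sum>i\<in>UNIV. v $ i * pd i k z)\<bar> <= 9 * B0 * (norm v)^2"
      by (simp add: power2_eq_square mult_ac del: iterated_partial.simps)
  qed (use B0 in simp)
qed

text \<open>The uniform Taylor bound makes the error of the linearisation at most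
  \<open>C * |y - x|^2\<close> times the integral of \<open>|u|\<close> over a fixed ball, which is
  finite by Cauchy-Schwarz.\<close>

lemma conv_gderiv:
  assumes k: "test_function k" and u: "u \<in> L2"
  shows "gderiv (conv k u) (%i. conv (pd i k) u x) x"
proof -
  note [simp del] = iterated_partial.simps
  have [measurable]: "u \<in> bmeas" using u by (rule L2_measurable)
  let ?g = "%i. pd i k"
  have tg: "test_function (?g i)" for i using k by (rule test_function_partial)
  have kL: "k \<in> L2" "?g i \<in> L2" for i using test_function_L2 k tg by blast+
  obtain C where C: "0 <= C" "!!z v. \<bar>k (z + v) - k z - (\<Sum>i\<in>UNIV. v $ i * ?g i z)\<bar> <= C * (norm v)^2"
    using test_function_taylor[OF k] by blast
  obtain R0 where R0: "!!x. R0 <= norm x ==> k x = 0" using test_function_vanish[OF k] by blast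
  have "\<exists>R. \<forall>x. R <= norm x \<longrightarrow> ?g i x = 0" for i using test_function_vanish[OF tg] by metis
  then obtain Ri where Ri: "!!i x. Ri i <= norm x ==> ?g i x = 0" by metis
  define R where "R = \<bar>R0\<bar> + (\<Sum>i\<in>UNIV. \<bar>Ri i\<bar>)"
  have "\<bar>Ri i\<bar> <= (\<Sum>i\<in>UNIV. \<bar>Ri i\<bar>)" for i by (rule member_le_sum) auto
  then have R: "R <= norm x ==> k x = 0" "R <= norm x ==> ?g i x = 0" for x i
    unfolding R_def by (smt (verit) R0 sum_nonneg abs_ge_zero, smt (verit) Ri)
  \<comment> \<open>For \<open>|y - x| < 1\<close> the remainder vanishes unless \<open>xi\<close>
    lies within \<open>R + 1\<close> of \<open>x\<close>.\<close>
  define w where "w y = indicat_real (cball x (R + 1)) y" for y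
  have [measurable]: "w \<in> bmeas" unfolding w_def by (intro borel_measurable_indicator) simp
  have wL: "w \<in> L2"
  proof -
    have "integrable lborel (indicat_real (cball x (R + 1)))"
      by (intro integrable_real_indicator) (simp_all add: emeasure_lborel_cball_finite[unfolded infinity_ennreal_def])
    moreover have "(norm (w y))^2 = indicat_real (cball x (R + 1)) y" for y by (simp add: w_def indicator_def)
    ultimately show ?thesis unfolding L2_def by simp
  qed
  have wu: "integrable lborel (%y. w y * norm (u y))"
    using L2_mult_integrable[OF wL u] by (simp add: w_def)
  define c where "c = (LBINT y. w y * norm (u y))"
  have c: "0 <= c" unfolding c_def by (simp add: w_def)
  have key: "norm (conv k u y - conv k u x - (\<Sum>i\<in>UNIV. (y - x) $ i *R conv (?g i) u x)) <= C * c * (norm (y - x))^2"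
    if y: "norm (y - x) < 1" for y
  proof -
    let ?r = "%xi. k (y - xi) - k (x - xi) - (\<Sum>i\<in>UNIV. (y - x) $ i * ?g i (x - xi))"
    have "conv k u y - conv k u x - (\<Sum>i\<in>UNIV. (y - x) $ i *R conv (?g i) u x)
       = (LBINT xi. k (y - xi) *R u xi - k (x - xi) *R u xi - (\<Sum>i\<in>UNIV. (y - x) $ i *R (?g i (x - xi) *R u xi)))"
    proof -
      note i1 = conv_integrable[OF kL(1) u, of y] and i2 = conv_integrable[OF kL(1) u, of x]
      have i3: "integrable lborel (%xi. (y - x) $ i *R (?g i (x - xi) *R u xi))" for i
        by (intro integrable_scaleR_right conv_integrable[OF kL(2) u])
      show ?thesis unfolding conv_def
        by (subst Bochner_Integration.integral_diff[OF Bochner_Integration.integrable_diff[OF i1 i2] Bochner_Integration.integrable_sum[OF i3]],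
          subst Bochner_Integration.integral_diff[OF i1 i2], subst Bochner_Integration.integral_sum[OF i3])
          (simp only: integral_scaleR_right)
    qed
    also have "\<dots> = (LBINT xi. ?r xi *R u xi)"
      by (simp add: scaleR_diff_left scaleR_sum_left)
    finally have eq: "conv k u y - conv k u x - (\<Sum>i\<in>UNIV. (y - x) $ i *R conv (?g i) u x) = (LBINT xi. ?r xi *R u xi)" .
    have b: "norm (?r xi *R u xi) <= C * (norm (y - x))^2 * (w xi * norm (u xi))" for xi
    proof (cases "xi \<in> cball x (R + 1)")
      case True
      have "\<bar>?r xi\<bar> <= C * (norm (y - x))^2" using C(2)[of "x - xi" "y - x"] by simp
      then show ?thesis using True by (auto simp: w_def intro: mult_right_mono)
    next
      case False
      then have 1: "R + 1 < norm (x - xi)" by (simp add: dist_norm)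
      then have "R <= norm (x - xi)" by simp
      moreover have "R <= norm (y - xi)"
        using 1 y norm_triangle_ineq[of "y - xi" "x - y"] by (simp add: norm_minus_commute)
      ultimately show ?thesis using R C(1) by (simp add: w_def mult_nonneg_nonneg)
    qed
    have "norm (LBINT xi. ?r xi *R u xi) <= (LBINT xi. norm (?r xi *R u xi))"
      by (rule integral_norm_bound)
    also have "\<dots> <= (LBINT xi. C * (norm (y - x))^2 * (w xi * norm (u xi)))"
    proof (rule integral_mono_AE')
      show "integrable lborel (%xi. C * (norm (y - x))^2 * (w xi * norm (u xi)))" using wu by simp
      show "AE xi in lborel. 0 <= C * (norm (y - x))^2 * (w xi * norm (u xi))"
        using C(1) by (auto simp: w_def)
    qed (use b in auto)
    also have "\<dots> = C * c * (norm (y - x))^2" by (simp add: c_def)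
    finally show ?thesis unfolding eq .
  qed
  show ?thesis unfolding gderiv_def has_derivative_at_alt
  proof (intro conjI allI impI)
    show "bounded_linear (%v. \<Sum>i\<in>UNIV. v $ i *R conv (?g i) u x)"
      by (intro bounded_linear_sum bounded_linear_compose[OF bounded_linear_scaleR_left bounded_linear_vec_nth])
    fix e :: real assume e: "0 < e"
    have Cc: "0 <= C * c" using C c by simp
    show "\<exists>d>0. \<forall>y. norm (y - x) < d \<longrightarrow>
        norm (conv k u y - conv k u x - (\<Sum>i\<in>UNIV. (y - x) $ i *R conv (?g i) u x)) <= e * norm (y - x)"
    proof (intro exI[of _ "min 1 (e / (C * c + 1))"] conjI allI impI)
      fix y assume y: "norm (y - x) < min 1 (e / (C * c + 1))"
      then have "norm (y - x) * (C * c + 1) <= e" using Cc by (simp add: field_simps)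
      then have "C * c * norm (y - x) <= e"
        by (smt (verit, best) norm_ge_zero distrib_left mult.commute mult_cancel_left2)
      then have "C * c * norm (y - x) * norm (y - x) <= e * norm (y - x)" by (intro mult_right_mono) auto
      then show "norm (conv k u y - conv k u x - (\<Sum>i\<in>UNIV. (y - x) $ i *R conv (?g i) u x)) <= e * norm (y - x)"
        using key[of y] y by (simp add: power2_eq_square mult_ac)
    qed (use e Cc in auto)
  qed
qed

lemma conv_continuous: "test_function k ==> u \<in> L2 ==> continuous_on UNIV (conv k u)"
  using gderiv_continuous[OF conv_gderiv] by blast

lemma conv_measurable: "test_function k ==> u \<in> L2 ==> conv k u \<in> bmeas"
  using borel_measurable_continuous_onI[OF conv_continuous] by blast

lemma conv_commute:
  assumes "k \<in> bmeas" "u \<in> bmeas"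
  shows "conv k u x = (LBINT y. k y *R u (x - y))"
  unfolding conv_def
  using lborel_integral_affine[of "%y. k (x - y) *R u y" "-1" x] assms by simp

text \<open>Cauchy-Schwarz for the probability density \<open>mol n\<close>, followed by Fubini,
  bounds the squared distance by the \<open>mol n\<close> average of the squared translation errors,
  in which only translations shorter than \<open>1 / Suc n\<close> count.\<close>

lemma conv_mol_close:
  fixes u :: "real^3 => 'b::euclidean_space"
  assumes u: "u \<in> L2" and e: "0 <= e"
    and b: "!!y. norm y < 1 / real (Suc n) ==> n2 (%x. u (x - y) - u x) <= e"
  shows "(%x. conv (mol n) u x - u x) \<in> L2" "n2 (%x. conv (mol n) u x - u x) <= e"
proof -
  note t = test_function_L2[OF mol_test[of n]]
  have [measurable]: "u \<in> bmeas" "mol n \<in> bmeas"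
    "conv (mol n) u \<in> bmeas"
    using t L2_measurable[OF u] conv_measurable[OF mol_test u] by auto
  have m0: "0 <= mol n y" for y by (rule mol_nonneg)
  have i1: "(NN y. ennreal (mol n y)) = 1"
    using nn_integral_eq_integral[OF t(2)] m0 mol_integral[of n] by simp
  have pt: "ennreal ((norm (conv (mol n) u x - u x))^2)
      <= (NN y. ennreal (mol n y * (norm (u (x - y) - u x))^2))" for x
  proof -
    have i: "integrable lborel (%y. mol n y *R u (x - y))"
      by (rule L2_scaleR_integrable[OF t(1)]) (rule L2_translate[OF u])
    have "conv (mol n) u x - u x = (LBINT y. mol n y *R u (x - y)) - (LBINT y. mol n y *R u x)"
      using mol_integral[of n] t(2) by (simp add: conv_commute)
    also have "\<dots> = (LBINT y. mol n y *R (u (x - y) - u x))"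
      using i t(2) by (simp add: scaleR_diff_right)
    finally have eq: "conv (mol n) u x - u x = (LBINT y. mol n y *R (u (x - y) - u x))" .
    have "integrable lborel (%y. mol n y *R (u (x - y) - u x))"
      using i t(2) by (simp add: scaleR_diff_right)
    from integral_norm_bound_ennreal[OF this]
    have "ennreal (norm (conv (mol n) u x - u x)) <= (NN y. ennreal (norm (mol n y *R (u (x - y) - u x))))"
      unfolding eq .
    also have "\<dots> = (NN y. ennreal (sqrt (mol n y)) * ennreal (sqrt (mol n y) * norm (u (x - y) - u x)))"
      by (rule nn_integral_cong) (simp add: m0 ennreal_mult[symmetric] mult.assoc[symmetric])
    finally have "(ennreal (norm (conv (mol n) u x - u x)))^2 <= (\<dots>)^2" by (intro power_mono) auto
    also have "\<dots> <= (NN y. (ennreal (sqrt (mol n y)))^2) * (NN y. (ennreal (sqrt (mol n y) * norm (u (x - y) - u x)))^2)"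
      by (rule Cauchy_Schwarz_nn_integral) auto
    also have "\<dots> = 1 * (NN y. ennreal (mol n y * (norm (u (x - y) - u x))^2))"
      using i1 by (simp add: ennreal_power m0 power_mult_distrib)
    finally show ?thesis by (simp add: ennreal_power)
  qed
  have "(NN x. ennreal ((norm (conv (mol n) u x - u x))^2))
     <= (\<integral>\<^sup>+x. (NN y. ennreal (mol n y * (norm (u (x - y) - u x))^2)) \<partial>lborel)"
    by (rule nn_integral_mono) (rule pt)
  also have "\<dots> = (\<integral>\<^sup>+y. (NN x. ennreal (mol n y * (norm (u (x - y) - u x))^2)) \<partial>lborel)"
    by (rule lborel_pair.Fubini') measurable
  also have "\<dots> = (NN y. ennreal (mol n y) * ennreal ((n2 (%x. u (x - y) - u x))^2))"
  proof (rule nn_integral_cong)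
    fix y
    have "(NN x. ennreal ((norm (u (x - y) - u x))^2)) = ennreal ((n2 (%x. u (x - y) - u x))^2)"
      using nn_integral_eq_integral[OF L2_integrable[OF L2_diff[OF L2_translate(3)[OF u] u]]] by (simp add: n2_sq)
    then show "(NN x. ennreal (mol n y * (norm (u (x - y) - u x))^2)) = ennreal (mol n y) * ennreal ((n2 (%x. u (x - y) - u x))^2)"
      by (simp add: ennreal_mult m0 nn_integral_cmult)
  qed
  also have "\<dots> <= (NN y. ennreal (mol n y) * ennreal (e^2))"
  proof (rule nn_integral_mono)
    fix y
    show "ennreal (mol n y) * ennreal ((n2 (%x. u (x - y) - u x))^2) <= ennreal (mol n y) * ennreal (e^2)"
    proof (cases "norm y < 1 / real (Suc n)")
      case True
      then show ?thesis by (intro mult_left_mono ennreal_leI power_mono b) auto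
    qed (simp add: mol_vanish)
  qed
  also have "\<dots> = ennreal (e^2)" by (simp add: nn_integral_multc i1)
  finally have le: "(NN x. ennreal ((norm (conv (mol n) u x - u x))^2)) <= ennreal (e^2)" .
  then have "(NN x. ennreal ((norm (conv (mol n) u x - u x))^2)) < \<infinity>"
    by (simp add: le_less_trans)
  then have i: "integrable lborel (%x. (norm (conv (mol n) u x - u x))^2)"
    by (intro integrableI_bounded) auto
  then show "(%x. conv (mol n) u x - u x) \<in> L2" by (simp add: L2_def)
  have "(n2 (%x. conv (mol n) u x - u x))^2 <= e^2"
    using le nn_integral_eq_integral[OF i] by (simp add: n2_sq)
  then show "n2 (%x. conv (mol n) u x - u x) <= e" using e by (rule power2_le_imp_le)
qed

lemma conv_mol_L2:
  assumes u: "u \<in> L2" shows "conv (mol n) u \<in> L2"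
proof -
  have "n2 (%x. u (x - y) - u x) <= 2 * n2 u" for y
    using n2_triangle_diff[OF L2_translate(3)[OF u, of y] u] L2_translate(4)[OF u, of y] by simp
  from L2_add[OF conv_mol_close(1)[OF u _ this] u] show ?thesis by simp
qed

lemma conv_mol_tendsto:
  assumes u: "u \<in> L2" shows "(%n. n2 (%x. conv (mol n) u x - u x)) ----> 0"
proof (rule LIMSEQ_I)
  fix e :: real assume e: "0 < e"
  obtain d where d: "0 < d" "!!y. norm y < d ==> n2 (%x. u (x - y) - u x) < e / 2"
    using L2_translate_uniform[OF u, of "e/2"] e by auto
  obtain N where N: "1 / real (Suc N) < d" using d(1) nat_approx_posE by blast
  have "norm (n2 (%x. conv (mol n) u x - u x) - 0) < e" if "N <= n" for n
  proof -
    have "1 / real (Suc n) <= 1 / real (Suc N)" using that by (simp add: frac_le)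
    then have "n2 (%x. u (x - y) - u x) <= e / 2" if "norm y < 1 / real (Suc n)" for y
      using that N d(2)[of y] by linarith
    from conv_mol_close(2)[OF u _ this, of n] have "n2 (%x. conv (mol n) u x - u x) <= e / 2" using e by simp
    then show ?thesis using e by simp
  qed
  then show "\<exists>N. \<forall>n\<ge>N. norm (n2 (%x. conv (mol n) u x - u x) - 0) < e" by blast
qed

section \<open>Weak gradients\<close>

text \<open>Difference quotients of \<open>F\<close> integrate to 0 by translation invariance. They
  are bounded by the Lipschitz constant on the ball of radius \<open>|R| + 1\<close>, so dominated
  convergence carries this over to the derivative.\<close>

lemma integral_gderiv_zero:
  fixes F :: "real^3 => 'b::euclidean_space"
  assumes d: "!!x. gderiv F (%i. H i x) x" and c: "!!i. continuous_on UNIV (H i)"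
    and z: "!!x. R <= norm x ==> F x = 0" "!!i x. R <= norm x ==> H i x = 0"
  shows "(LBINT x. H i x) = 0"
proof -
  have "\<exists>B. \<forall>x. norm (H i x) <= B" for i using L2_cont_compact(2)[OF c z(2)] .
  then obtain B where B: "!!i x. norm (H i x) <= B i" by metis
  have Bn: "0 <= B i" for i using B[of i 0] norm_ge_zero order_trans by blast
  have BB: "norm (H i x) <= (\<Sum>i\<in>UNIV. B i)" for i x
    by (rule order_trans[OF B]) (rule member_le_sum, auto simp: Bn)
  define C where "C = 3 * (\<Sum>i\<in>UNIV. B i)"
  have C: "norm (F y - F x) <= C * norm (y - x)" for x y
    using gderiv_lipschitz[OF d BB] by (simp add: C_def)
  have C0: "0 <= C" by (simp add: C_def Bn sum_nonneg)
  have Fc: "continuous_on UNIV F" by (rule gderiv_continuous[OF d])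
  have Fi: "integrable lborel F" by (rule L2_cont_compact(3)[OF Fc z(1)])
  have [measurable]: "F \<in> bmeas" "H i \<in> bmeas"
    using borel_measurable_continuous_onI Fc c by blast+
  let ?t = "%n. inverse (real (Suc n))"
  let ?q = "%n x. (1 / ?t n) *R (F (x + ?t n *R axis i 1) - F x)"
  have "(%n. \<integral>x. ?q n x \<partial>lborel) ----> (LBINT x. H i x)"
  proof (rule integral_dominated_convergence[where w="%x. C * indicat_real (cball 0 (\<bar>R\<bar> + 1)) x"])
    show "integrable lborel (%x. C * indicat_real (cball (0::real^3) (\<bar>R\<bar> + 1)) x)"
      by (intro integrable_mult_right integrable_real_indicator) (simp_all add: emeasure_lborel_cball_finite[unfolded infinity_ennreal_def])
    show "AE x in lborel. (%n. ?q n x) ----> H i x"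
    proof (rule AE_I2)
      fix x :: "real^3"
      have "((%t. x + t *R axis i 1) has_derivative (%h. h *R axis i 1)) (at 0)"
        by (auto intro!: derivative_eq_intros)
      from diff_chain_at[OF this, of F "%v. \<Sum>j\<in>UNIV. v $ j *R H j x"] d[of x]
      have "((%t. F (x + t *R axis i 1)) has_derivative (%h. \<Sum>j\<in>UNIV. (h *R axis i 1) $ j *R H j x)) (at 0)"
        by (simp add: gderiv_def o_def)
      moreover have "(%h::real. \<Sum>j\<in>UNIV. (h *R axis i 1) $ j *R H j x) = (%h. h *R H i x)"
        by (simp add: scaleR_scaleR[symmetric] scaleR_sum_right[symmetric] gderiv_sum_axis del: scaleR_scaleR)
      ultimately have "((%t. F (x + t *R axis i 1)) has_vector_derivative H i x) (at 0)"
        by (simp add: has_vector_derivative_def)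
      then have "((%t. (1 / t) *R (F (x + t *R axis i 1) - F x)) \<longlongrightarrow> H i x) (at 0)"
      proof -
        assume "((%t. F (x + t *R axis i 1)) has_vector_derivative H i x) (at 0)"
        then have "((%t. norm (F (x + t *R axis i 1) - F x - t *R H i x) / norm t) \<longlongrightarrow> 0) (at 0)"
          unfolding has_vector_derivative_def has_derivative_at by simp
        then have "((%t. norm ((1 / t) *R (F (x + t *R axis i 1) - F x) - H i x)) \<longlongrightarrow> 0) (at 0)"
        proof (rule Lim_transform_eventually)
          have "norm (F (x + t *R axis i 1) - F x - t *R H i x) / norm t
            = norm ((1 / t) *R (F (x + t *R axis i 1) - F x) - H i x)" if "t \<noteq> 0" for t
          proof -
            have "(1 / t) *R (F (x + t *R axis i 1) - F x) - H i x = (1 / t) *R (F (x + t *R axis i 1) - F x - t *R H i x)"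
              using that by (simp add: scaleR_diff_right)
            then show ?thesis by (simp add: norm_scaleR)
          qed
          then show "\<forall>\<^sub>F t in at 0. norm (F (x + t *R axis i 1) - F x - t *R H i x) / norm t
            = norm ((1 / t) *R (F (x + t *R axis i 1) - F x) - H i x)"
            by (auto simp: eventually_at_filter)
        qed
        then show ?thesis by (rule LIM_zero_cancel[OF tendsto_norm_zero_cancel])
      qed
      then show "(%n. ?q n x) ----> H i x"
        by (rule tendsto_at_iff_sequentially[THEN iffD1, rule_format, unfolded o_def])
          (use LIMSEQ_inverse_real_of_nat in auto)
    qed
    show "AE x in lborel. norm (?q n x) <= C * indicat_real (cball 0 (\<bar>R\<bar> + 1)) x" for n
    proof (rule AE_I2)
      fix x :: "real^3"
      have t: "0 < ?t n" "?t n <= 1" by (auto simp: field_simps)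
      show "norm (?q n x) <= C * indicat_real (cball 0 (\<bar>R\<bar> + 1)) x"
      proof (cases "x \<in> cball 0 (\<bar>R\<bar> + 1)")
        case True
        have "norm (F (x + ?t n *R axis i 1) - F x) <= C * ?t n"
          using C[of "x + ?t n *R axis i 1" x] t by simp
        then have "norm (?q n x) <= 1 / ?t n * (C * ?t n)"
          unfolding norm_scaleR using t by (intro mult_mono) auto
        with True t show ?thesis by (simp del: of_nat_Suc)
      next
        case False
        then have 1: "\<bar>R\<bar> + 1 < norm x" by simp
        have "norm x <= norm (x + ?t n *R axis i 1) + ?t n"
          using norm_triangle_ineq4[of "x + ?t n *R axis i 1" "?t n *R axis i 1"] t by simp
        then have "R <= norm (x + ?t n *R axis i 1)" "R <= norm x" using 1 t by linarith+
        then show ?thesis using z(1) C0 by simp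
      qed
    qed
  qed auto
  moreover have "(LBINT x. ?q n x) = 0" for n
  proof -
    have i2: "integrable lborel (%x. F (x + ?t n *R axis i 1))"
      using lborel_integrable_affine[OF Fi, of 1 "?t n *R axis i 1"] by (simp add: add.commute)
    have "(LBINT x. F x) = (LBINT x. F (x + ?t n *R axis i 1))"
      using lborel_integral_affine[of F 1 "?t n *R axis i 1"] by (simp add: add.commute)
    with Fi i2 show ?thesis by (simp del: of_nat_Suc)
  qed
  ultimately show ?thesis by (simp add: LIMSEQ_const_iff)
qed

text \<open>The C^1 functions in H1, on which pointwise calculus works; mollification makes them
  approximate every element of H1 together with its gradient.\<close>

definition nice :: "(real^3 => complex) => (real^3 => complex^3) => bool" where
  "nice f G \<longleftrightarrow> (\<forall>x. gderiv f (%i. G x $ i) x) \<and> continuous_on UNIV G \<and> f \<in> L2 \<and> G \<in> L2"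

lemma wgD:
  assumes "wgrad u g"
  shows "g \<in> L2" "test_function f ==> (LBINT x. pd i f x *R u x) = - (LBINT x. f x *R (g x $ i))"
  using assms by (auto simp: is_weak_gradient_def L2_def)

lemma wgI:
  assumes "g \<in> L2" "!!f i. test_function f ==> (LBINT x. pd i f x *R u x) = - (LBINT x. f x *R (g x $ i))"
  shows "wgrad u g"
  using assms by (auto simp: is_weak_gradient_def L2_def)

lemma L2_component:
  fixes g :: "real^3 => complex^3"
  assumes g: "g \<in> L2" shows "(%x. g x $ i) \<in> L2" "n2 (%x. g x $ i) <= n2 g"
proof -
  have [measurable]: "g \<in> bmeas" using g by (rule L2_measurable)
  have "(%x. g x $ i) \<in> bmeas"
    by (rule borel_measurable_continuous_on[OF _ L2_measurable[OF g], of "%y. y $ i"]) (intro continuous_intros)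
  then show "(%x. g x $ i) \<in> L2" "n2 (%x. g x $ i) <= n2 g"
    by (rule L2_bound1[OF g]; simp add: Finite_Cartesian_Product.norm_nth_le)+
qed

text \<open>By the product rule the sum of both integrands is a partial derivative of a function
  with bounded support, whose integral vanishes.\<close>

lemma nice_weak_gradient:
  assumes n: "nice f G" shows "wgrad f G"
proof (rule wgI)
  note [simp del] = iterated_partial.simps
  show GL: "G \<in> L2" using n by (simp add: nice_def)
  have fL: "f \<in> L2" and gd: "!!x. gderiv f (%i. G x $ i) x" and Gc: "continuous_on UNIV G"
    using n by (auto simp: nice_def)
  fix phi i assume t: "test_function phi"
  obtain R where R: "!!x. R <= norm x ==> phi x = 0" using test_function_vanish[OF t] by blast
  note tp = test_function_partial[OF t]
  have "\<exists>R. \<forall>x. R <= norm x \<longrightarrow> pd j phi x = 0" for j using test_function_vanish[OF tp] by metis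
  then obtain Ri where Ri: "!!j x. Ri j <= norm x ==> pd j phi x = 0" by metis
  define R' where "R' = \<bar>R\<bar> + (\<Sum>i\<in>UNIV. \<bar>Ri i\<bar>)"
  have le: "\<bar>Ri i\<bar> <= (\<Sum>i\<in>UNIV. \<bar>Ri i\<bar>)" for i by (rule member_le_sum) auto
  have le0: "0 <= (\<Sum>i\<in>UNIV. \<bar>Ri i\<bar>)" by (rule sum_nonneg) auto
  have R': "phi x = 0" "pd j phi x = 0" if "R' <= norm x" for x j
    using that le[of j] le0 R[of x] Ri[of j x] unfolding R'_def by linarith+
  have "(LBINT x. pd i phi x *R f x + phi x *R (G x $ i)) = 0"
  proof (rule integral_gderiv_zero[where H="%i x. pd i phi x *R f x + phi x *R (G x $ i)" and R=R'])
    show "gderiv (%x. phi x *R f x) (%i. pd i phi x *R f x + phi x *R G x $ i) x" for x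
      by (rule gderiv_mult_real[OF test_function_gderiv[OF t] gd])
    show "continuous_on UNIV (%x. pd i phi x *R f x + phi x *R G x $ i)" for i
      by (intro continuous_intros test_function_continuous t tp gderiv_continuous[OF gd] Gc)
  qed (use R' in auto)
  moreover have "integrable lborel (%x. pd i phi x *R f x)"
    by (rule L2_scaleR_integrable[OF test_function_L2(1)[OF tp] fL])
  moreover have "integrable lborel (%x. phi x *R (G x $ i))"
    by (rule L2_scaleR_integrable[OF test_function_L2(1)[OF t] L2_component(1)[OF GL]])
  ultimately show "(LBINT x. pd i phi x *R f x) = - (LBINT x. phi x *R (G x $ i))"
    by (simp add: eq_neg_iff_add_eq_0)
qed

text \<open>The derivative of the convolution falls on the kernel, and \<open>mol n (x - y)\<close>
  as a function of \<open>y\<close> is itself a test function, so the weak gradient identity moves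
  the derivative onto \<open>g\<close>.\<close>

lemma wg_mollify:
  assumes u: "u \<in> L2" and w: "wgrad u g"
  shows "nice (conv (mol n) u) (conv (mol n) g)"
  unfolding nice_def
proof safe
  note [simp del] = iterated_partial.simps
  note gL = wgD(1)[OF w]
  show "continuous_on UNIV (conv (mol n) g)" by (rule conv_continuous[OF mol_test gL])
  show "conv (mol n) u \<in> L2" "conv (mol n) g \<in> L2" by (rule conv_mol_L2[OF u], rule conv_mol_L2[OF gL])
  fix x
  have "conv (pd i (mol n)) u x = conv (mol n) g x $ i" for i
  proof -
    have t: "test_function (%y. mol n (x - y))"
      using test_function_affine[OF mol_test, of "-1" n x] by simp
    have gd: "gderiv (%y. mol n (x - y)) (%i. - pd i (mol n) (x - y)) y" for y
      using gderiv_affine[of "mol n" "%i. pd i (mol n) (x - y)" x "-1" y]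
        test_function_gderiv[OF mol_test, of n "x - y"] by simp
    have "(LBINT y. - pd i (mol n) (x - y) *R u y) = - (LBINT y. mol n (x - y) *R (g y $ i))"
      using wgD(2)[OF w t, of i] unfolding gderiv_iterated_partial[OF gd] .
    moreover have "(LBINT y. mol n (x - y) *R (g y $ i)) = (LBINT y. mol n (x - y) *R g y) $ i"
      using integral_bounded_linear[OF bounded_linear_vec_nth[of i] conv_integrable[OF test_function_L2(1)[OF mol_test[of n]] gL, of x]] by simp
    ultimately show ?thesis by (simp add: conv_def)
  qed
  then show "gderiv (conv (mol n) u) (%i. conv (mol n) g x $ i) x"
    using conv_gderiv[OF mol_test u, of n x] by simp
qed

text \<open>After mollification both fields are the classical gradient of the same function and
  hence equal; in the limit of the mollification the fields themselves agree.\<close>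

lemma wg_unique:
  assumes u: "u \<in> L2" and w: "wgrad u g" "wgrad u h"
  shows "AE x in lborel. g x = h x"
proof -
  note gL = wgD(1)[OF w(1)] and hL = wgD(1)[OF w(2)]
  have "conv (mol n) g x = conv (mol n) h x" for n x
  proof -
    have "(%i. conv (mol n) g x $ i) = (%i. conv (mol n) h x $ i)"
      using wg_mollify[OF u w(1), of n] wg_mollify[OF u w(2), of n] gderiv_unique unfolding nice_def by blast
    then show ?thesis by (simp add: vec_eq_iff fun_eq_iff)
  qed
  then have eq: "conv (mol n) g = conv (mol n) h" for n by blast
  have "n2 (%x. g x - h x) <= n2 (%x. conv (mol n) g x - g x) + n2 (%x. conv (mol n) h x - h x)" for n
    using n2_triangle3[OF gL conv_mol_L2[OF gL] hL, of n] unfolding eq[of n]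
    by (simp add: n2_diff_commute[of g "conv (mol n) h"])
  moreover have "(%n. n2 (%x. conv (mol n) g x - g x) + n2 (%x. conv (mol n) h x - h x)) ----> 0 + 0"
    by (intro tendsto_add conv_mol_tendsto gL hL)
  ultimately have "n2 (%x. g x - h x) <= 0 + 0" by (intro LIMSEQ_le_const) auto
  then have "n2 (%x. g x - h x) = 0" using n2_nonneg[of "%x. g x - h x"] by linarith
  then show ?thesis by (subst (asm) n2_eq_0_iff[OF L2_diff[OF gL hL]]) simp
qed

text \<open>The defining identity involves \<open>u\<close> and its gradient only through integrals
  against test functions and survives their convergence. This covers norm limits as well as the weak
  limit of a minimising sequence.\<close>

lemma wg_weak_limit:
  fixes U :: "nat => real^3 => complex"
  assumes w: "!!n. wgrad (U n) (g n)" and h: "h \<in> L2"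
    and l: "!!f. test_function f ==> (%n. \<integral>x. f x *R U n x \<partial>lborel) ----> (LBINT x. f x *R u x)"
    and k: "!!f i. test_function f ==> (%n. \<integral>x. f x *R (g n x $ i) \<partial>lborel) ----> (LBINT x. f x *R (h x $ i))"
  shows "wgrad u h"
proof (rule wgI[OF h])
  fix f i assume t: "test_function f"
  have "(%n. - (LBINT x. f x *R (g n x $ i))) ----> (LBINT x. pd i f x *R u x)"
    using l[OF test_function_partial[OF t], of i] unfolding wgD(2)[OF w t] .
  moreover have "(%n. - (LBINT x. f x *R (g n x $ i))) ----> - (LBINT x. f x *R (h x $ i))"
    by (intro tendsto_minus k t)
  ultimately show "(LBINT x. pd i f x *R u x) = - (LBINT x. f x *R (h x $ i))"
    by (rule LIMSEQ_unique)
qed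

lemma scaleR_integral_tendsto:
  assumes F: "!!n. F n \<in> L2" and f: "f \<in> L2" and lim: "(%n. n2 (%x. F n x - f x)) ----> 0"
    and k: "k \<in> L2"
  shows "(%n. \<integral>x. k x *R F n x \<partial>lborel) ----> (LBINT x. k x *R f x)"
proof (rule LIM_zero_cancel)
  have "norm ((LBINT x. k x *R F n x) - (LBINT x. k x *R f x)) <= n2 (%x. F n x - f x) * n2 k" for n
  proof -
    have "(LBINT x. k x *R F n x) - (LBINT x. k x *R f x) = (LBINT x. k x *R (F n x - f x))"
      using L2_scaleR_integrable[OF k F] L2_scaleR_integrable[OF k f] by (simp add: scaleR_diff_right)
    also have "norm \<dots> <= (LBINT x. norm (k x) * norm (F n x - f x))"
      using integral_norm_bound[of lborel "%x. k x *R (F n x - f x)"] by simp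
    also have "\<dots> <= n2 k * n2 (%x. F n x - f x)" by (rule Cauchy_Schwarz_n2[OF k L2_diff[OF F f]])
    finally show ?thesis by (simp add: mult.commute)
  qed
  then show "(%n. (LBINT x. k x *R F n x) - (LBINT x. k x *R f x)) ----> 0"
    by (intro tendsto_0_le[OF tendsto_mult_left_zero[OF lim, of "n2 k"], where K=1] always_eventually) simp
qed

lemma wg_closed:
  assumes w: "!!n. wgrad (U n) (g n)" and U: "!!n. U n \<in> L2" and u: "u \<in> L2" and h: "h \<in> L2"
    and l: "(%n. n2 (%x. U n x - u x)) ----> 0" "(%n. n2 (%x. g n x - h x)) ----> 0"
  shows "wgrad u h"
proof (rule wg_weak_limit[OF w h])
  show "(%n. \<integral>x. f x *R U n x \<partial>lborel) ----> (LBINT x. f x *R u x)" if "test_function f" for f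
    by (rule scaleR_integral_tendsto[OF U u l(1) test_function_L2(1)[OF that]])
  show "(%n. \<integral>x. f x *R (g n x $ i) \<partial>lborel) ----> (LBINT x. f x *R (h x $ i))" if "test_function f" for f i
  proof (rule scaleR_integral_tendsto[OF _ _ _ test_function_L2(1)[OF that]])
    have "n2 (%x. g n x $ i - h x $ i) <= n2 (%x. g n x - h x)" for n
      using L2_component(2)[OF L2_diff[OF wgD(1)[OF w[of n]] h], of i] by simp
    then show "(%n. n2 (%x. g n x $ i - h x $ i)) ----> 0"
      by (intro tendsto_0_le[OF l(2), where K=1] always_eventually) simp
  qed (use L2_component(1)[OF wgD(1)[OF w]] L2_component(1)[OF h] in auto)
qed

lemma wg_cong:
  assumes w: "wgrad u g" and u: "u \<in> bmeas" "v \<in> bmeas"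
    and ae: "AE x in lborel. v x = u x"
  shows "wgrad v g"
proof (rule wgI[OF wgD(1)[OF w]])
  note [simp del] = iterated_partial.simps
  fix f i assume t: "test_function f"
  have [measurable]: "pd i f \<in> bmeas"
    by (rule test_function_L2(3)[OF test_function_partial[OF t]])
  have "(LBINT x. pd i f x *R v x) = (LBINT x. pd i f x *R u x)"
    by (rule integral_cong_AE) (use u ae in \<open>auto elim: eventually_mono\<close>)
  then show "(LBINT x. pd i f x *R v x) = - (LBINT x. f x *R (g x $ i))"
    using wgD(2)[OF w t] by simp
qed

lemma wg_add:
  assumes u: "u \<in> L2" "v \<in> L2" and w: "wgrad u g" "wgrad v h"
  shows "wgrad (%x. u x + v x) (%x. g x + h x)"
proof (rule wgI)
  show "(%x. g x + h x) \<in> L2" by (intro L2_add wgD(1)[OF w(1)] wgD(1)[OF w(2)])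
  fix f i assume t: "test_function f"
  note kL = test_function_L2(1)[OF t] and pL = test_function_L2(1)[OF test_function_partial[OF t, of i]]
  note i = L2_scaleR_integrable[OF pL u(1)] L2_scaleR_integrable[OF pL u(2)]
    L2_scaleR_integrable[OF kL L2_component(1)[OF wgD(1)[OF w(1)], of i]]
    L2_scaleR_integrable[OF kL L2_component(1)[OF wgD(1)[OF w(2)], of i]]
  show "(LBINT x. pd i f x *R (u x + v x)) = - (LBINT x. f x *R ((g x + h x) $ i))"
    using i wgD(2)[OF w(1) t, of i] wgD(2)[OF w(2) t, of i] by (simp add: scaleR_add_right)
qed

lemma wg_cmult:
  assumes u: "u \<in> L2" and w: "wgrad u g"
  shows "wgrad (%x. c * u x) (%x. c *s g x)"
proof (rule wgI)
  have [measurable]: "g \<in> bmeas" by (rule L2_measurable[OF wgD(1)[OF w]])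
  have 1: "c *s y = (\<Sum>i\<in>UNIV. axis i (c * y $ i))" for y :: "complex^3"
    by (simp add: vec_eq_iff axis_def if_distrib cong: if_cong)
  have 2: "norm (c *s y) = norm c * norm y" for y :: "complex^3"
    by (simp add: norm_vec_def norm_mult L2_set_right_distrib)
  have "(%y. c *s y) \<in> borel_measurable (borel :: (complex^3) measure)"
    by (rule borel_measurable_continuous_onI) (simp add: vector_scalar_mult_def continuous_intros)
  then have "(%x. c *s g x) \<in> bmeas" by (rule measurable_compose_rev) simp
  then show "(%x. c *s g x) \<in> L2"
    by (rule L2_bound(1)[OF wgD(1)[OF w], of _ "norm c"]) (simp add: 2)
  fix f i assume t: "test_function f"
  have "(LBINT x. pd i f x *R (c * u x)) = c * (LBINT x. pd i f x *R u x)"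
    by (subst integral_mult_right_zero[symmetric]) (simp add: scaleR_conv_of_real mult_ac)
  also have "\<dots> = - (c * (LBINT x. f x *R (g x $ i)))" using wgD(2)[OF w t, of i] by simp
  also have "c * (LBINT x. f x *R (g x $ i)) = (LBINT x. f x *R ((c *s g x) $ i))"
    by (subst integral_mult_right_zero[symmetric]) (simp add: scaleR_conv_of_real mult_ac)
  finally show "(LBINT x. pd i f x *R (c * u x)) = - (LBINT x. f x *R ((c *s g x) $ i))" .
qed

lemma norm_smult_vec: "norm (c *s y) = norm c * norm (y :: complex^3)"
  by (simp add: norm_vec_def norm_mult L2_set_right_distrib)

lemma H1_iff: "u \<in> H1 \<longleftrightarrow> u \<in> L2 \<and> (\<exists>g. wgrad u g)"
  by (auto simp: H1_def L2_def)

lemma H1I: "u \<in> L2 ==> wgrad u g ==> u \<in> H1" by (auto simp: H1_iff)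

lemma H1_L2: "u \<in> H1 ==> u \<in> L2" by (simp add: H1_iff)

lemma H1_wg: "u \<in> H1 ==> wgrad u (weak_grad u)"
  using someI_ex[of "wgrad u"] by (auto simp: H1_iff weak_grad_def)

lemma weak_grad_L2: "u \<in> H1 ==> weak_grad u \<in> L2"
  by (rule wgD(1)[OF H1_wg])

lemma weak_grad_AE: "u \<in> L2 ==> wgrad u g ==> AE x in lborel. weak_grad u x = g x"
  by (rule wg_unique[OF _ H1_wg]) (auto intro: H1I)

lemma grad_norm_eq: "grad_norm u = n2 (weak_grad u)"
  by (simp add: grad_norm_def n2_def)

lemma grad_norm_wg:
  assumes "u \<in> L2" "wgrad u g" shows "grad_norm u = n2 g"
  unfolding grad_norm_eq
  using weak_grad_AE[OF assms] weak_grad_L2[OF H1I[OF assms]] 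
  by (intro L2_cong_AE(2)[OF wgD(1)[OF assms(2)]]) (auto intro: L2_measurable)

lemma Lnorm_2: "Lnorm 2 u = n2 u"
proof -
  have "norm (u x) powr 2 = (norm (u x))^2" for x by simp
  then show ?thesis by (simp add: Lnorm_def n2_def powr_half_sqrt)
qed

lemma H1_norm_eq: "H1_norm u = sqrt ((grad_norm u)^2 + (n2 u)^2)"
  by (simp add: H1_norm_def Lnorm_2)

lemma H1_add: "u \<in> H1 ==> v \<in> H1 ==> (%x. u x + v x) \<in> H1"
  using H1I[OF L2_add wg_add] H1_L2 H1_wg by blast

lemma H1_cmult: "u \<in> H1 ==> (%x. c * u x) \<in> H1"
  using H1I[OF L2_mult_complex(1) wg_cmult] H1_L2 H1_wg by blast

lemma H1_diff: "u \<in> H1 ==> v \<in> H1 ==> (%x. u x - v x) \<in> H1"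
  using H1_add[of u "%x. -1 * v x"] H1_cmult[of v "-1"] by simp

lemma H1_scaleR: "u \<in> H1 ==> (%x. c *R u x) \<in> H1"
  using H1_cmult[of u "of_real c"] by (simp add: scaleR_conv_of_real)

section \<open>The Gagliardo--Nirenberg inequality\<close>

lemma ball_borel [measurable]:
  "ball (c::'a::euclidean_space) r \<in> sets borel" "cball c r \<in> sets borel"
  by simp_all

lemma gderiv_norm_vec:
  fixes G :: "complex^3"
  shows "norm (\<Sum>i\<in>UNIV. v $ i *R G $ i) <= norm (v::real^3) * norm G"
proof -
  have "norm (\<Sum>i\<in>UNIV. v $ i *R G $ i) <= (\<Sum>i\<in>UNIV. \<bar>v $ i\<bar> * \<bar>norm (G $ i)\<bar>)"
    by (rule sum_norm_le) simp
  also have "\<dots> <= L2_set (%i. v $ i) UNIV * L2_set (%i. norm (G $ i)) UNIV"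
    by (rule L2_set_mult_ineq)
  also have "\<dots> = norm v * norm G" by (simp add: norm_vec_def L2_set_def)
  finally show ?thesis .
qed

text \<open>Fundamental theorem of calculus along the segment from \<open>x\<close> to
  \<open>x + z\<close> in the parametrisation \<open>sigma ^ m\<close>. Its speed
  \<open>m * sigma ^ (m - 1)\<close> is small near \<open>x\<close> and will absorb the growth of
  averages of the gradient over small balls.\<close>

lemma nice_segment:
  assumes n: "nice f G" and z: "norm z < 1" and m: "1 <= m"
  shows "ennreal (norm (f x)) <= ennreal (norm (f (x + z)))
    + (NN sigma. indicator {0..1} sigma * ennreal (m * sigma ^ (m - 1) * norm (G (x + sigma ^ m *R z))))"
proof -
  have gd: "!!x. gderiv f (%i. G x $ i) x" and Gc: "continuous_on UNIV G"
    using n by (auto simp: nice_def)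
  let ?h = "%sigma::real. f (x + sigma ^ m *R z)"
  let ?h' = "%sigma::real. \<Sum>i\<in>UNIV. ((m * sigma ^ (m - 1)) *R z) $ i *R (G (x + sigma ^ m *R z) $ i)"
  have d: "(?h has_vector_derivative ?h' sigma) (at sigma within {0..1})" for sigma :: real
  proof -
    have "((%sigma. x + sigma ^ m *R z) has_derivative (%h. h *R ((m * sigma ^ (m - 1)) *R z))) (at sigma)"
      by (auto intro!: derivative_eq_intros simp: mult_ac)
    from diff_chain_at[OF this, of f "%v. \<Sum>i\<in>UNIV. v $ i *R (G (x + sigma ^ m *R z) $ i)"] gd[of "x + sigma ^ m *R z"]
    have "(?h has_derivative (%h. \<Sum>i\<in>UNIV. (h *R ((m * sigma ^ (m - 1)) *R z)) $ i *R (G (x + sigma ^ m *R z) $ i))) (at sigma)"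
      by (simp add: gderiv_def o_def)
    moreover have "(%h. \<Sum>i\<in>UNIV. (h *R ((m * sigma ^ (m - 1)) *R z)) $ i *R (G (x + sigma ^ m *R z) $ i)) = (%h. h *R ?h' sigma)"
      by (simp add: scaleR_sum_right mult_ac)
    ultimately show ?thesis
      by (simp add: has_vector_derivative_def has_derivative_at_withinI)
  qed
  have c: "continuous_on {0..1} ?h'"
    by (intro continuous_intros continuous_on_compose2[OF Gc]) auto
  have bi: "has_bochner_integral lborel (%sigma. indicator {0..1} sigma *R ?h' sigma) (f (x + z) - f (x + 0 ^ m *R z))"
    using has_bochner_integral_FTC_Icc[of 0 1 ?h ?h', OF _ d c] by simp
  have eq: "f (x + z) - f x = (LBINT sigma. indicator {0..1} sigma *R ?h' sigma)"
    using has_bochner_integral_integral_eq[OF bi] m by (simp add: power_0_left)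
  have "ennreal (norm (f (x + z) - f x)) <= (NN sigma. ennreal (norm (indicator {0..1} sigma *R ?h' sigma)))"
    unfolding eq by (rule integral_norm_bound_ennreal) (use bi in \<open>simp add: has_bochner_integral_iff\<close>)
  also have "\<dots> <= (NN sigma. indicator {0..1} sigma * ennreal (m * sigma ^ (m - 1) * norm (G (x + sigma ^ m *R z))))"
  proof (rule nn_integral_mono)
    fix sigma :: real
    show "ennreal (norm (indicator {0..1} sigma *R ?h' sigma)) <= indicator {0..1} sigma * ennreal (m * sigma ^ (m - 1) * norm (G (x + sigma ^ m *R z)))"
    proof (cases "sigma \<in> {0..1}")
      case True
      have "norm (?h' sigma) <= norm ((m * sigma ^ (m - 1)) *R z) * norm (G (x + sigma ^ m *R z))"
        by (rule gderiv_norm_vec)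
      also have "\<dots> <= (m * sigma ^ (m - 1)) * norm (G (x + sigma ^ m *R z))"
        using True z by (intro mult_right_mono) (auto simp: mult_left_le)
      finally show ?thesis using True by (simp add: ennreal_leI)
    qed simp
  qed
  finally have "ennreal (norm (f (x + z) - f x)) <= (NN sigma. indicator {0..1} sigma * ennreal (m * sigma ^ (m - 1) * norm (G (x + sigma ^ m *R z))))" .
  moreover have "ennreal (norm (f x)) <= ennreal (norm (f (x + z))) + ennreal (norm (f (x + z) - f x))"
  proof -
    have "norm (f x) <= norm (f (x + z)) + norm (f (x + z) - f x)"
      using norm_triangle_ineq4[of "f (x + z)" "f (x + z) - f x"] by simp
    then show ?thesis by (simp add: ennreal_leI flip: ennreal_plus)
  qed
  ultimately show ?thesis by (meson add_left_mono order_trans)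
qed

text \<open>Convexity: the graph of \<open>x powr t\<close> lies above its tangent at
  \<open>c\<close>. Obtained from Young's inequality, it is the source of the later Jensen,
  Bernoulli and difference bounds.\<close>

lemma powr_tangent:
  fixes t x c :: real
  assumes "1 < t" "0 <= x" "0 < c" shows "t * c powr (t - 1) * x <= x powr t + (t - 1) * c powr t"
proof (cases "x = 0")
  case False
  have "(x powr t) powr (1/t) * (c powr t) powr ((t-1)/t) <= 1/t * x powr t + (t-1)/t * c powr t"
    by (rule Youngs_inequality_0) (use assms False in \<open>auto simp: field_simps\<close>)
  then have "x * c powr (t - 1) <= 1/t * x powr t + (t-1)/t * c powr t"
    using assms by (simp add: powr_powr)
  then have "t * (x * c powr (t - 1)) <= t * (1/t * x powr t + (t-1)/t * c powr t)"
    using assms by (intro mult_left_mono) auto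
  also have "\<dots> = x powr t + (t - 1) * c powr t" using assms by (simp add: distrib_left)
  finally show ?thesis by (simp add: mult_ac)
qed (use assms in auto)

lemma unit_interval_Jensen:
  fixes phi :: "real => real"
  assumes [measurable]: "phi \<in> bmeas" and t: "1 < t"
    and p: "!!s. 0 <= phi s" and x: "0 <= x" "ennreal x <= (NN s. indicator {0..1} s * ennreal (phi s))"
  shows "ennreal (x powr t) <= (NN s. indicator {0..1} s * ennreal (phi s powr t))"
proof (cases "x = 0")
  case False
  with x have x0: "0 < x" by simp
  let ?c = "t * x powr (t - 1)"
  have c: "0 <= ?c" using t by simp
  have "ennreal (t * x powr t) = ennreal ?c * ennreal x"
    using x0 t by (simp add: powr_diff ennreal_mult[symmetric])
  also have "\<dots> <= ennreal ?c * (NN s. indicator {0..1} s * ennreal (phi s))"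
    by (intro mult_left_mono x) simp
  also have "\<dots> = (NN s. indicator {0..1} s * ennreal (?c * phi s))"
    by (subst nn_integral_cmult[symmetric]) (use c p in \<open>auto intro!: nn_integral_cong simp: ennreal_mult split: split_indicator\<close>)
  also have "\<dots> <= (NN s. indicator {0..1} s * ennreal (phi s powr t) + ennreal ((t - 1) * x powr t) * indicator {0..1} s)"
  proof (rule nn_integral_mono)
    fix s :: real
    have "ennreal (?c * phi s) <= ennreal (phi s powr t) + ennreal ((t - 1) * x powr t)"
      using powr_tangent[OF t p x0, of s] t by (simp add: ennreal_leI flip: ennreal_plus)
    then show "indicator {0..1} s * ennreal (?c * phi s) <= indicator {0..1} s * ennreal (phi s powr t) + ennreal ((t - 1) * x powr t) * indicator {0..1} s"
      by (auto split: split_indicator)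
  qed
  also have "\<dots> = (NN s. indicator {0..1} s * ennreal (phi s powr t)) + ennreal ((t - 1) * x powr t)"
    by (subst nn_integral_add) (auto simp: nn_integral_cmult)
  also have "ennreal (t * x powr t) = ennreal ((t - 1) * x powr t) + ennreal (x powr t)"
    using t mult_right_mono[of 1 t "x powr t"] by (subst ennreal_plus[symmetric]) (auto simp: algebra_simps)
  finally have "ennreal ((t - 1) * x powr t) + ennreal (x powr t) <= ennreal ((t - 1) * x powr t) + (NN s. indicator {0..1} s * ennreal (phi s powr t))"
    by (simp add: add.commute)
  then show ?thesis by (simp add: ennreal_add_left_cancel_le)
qed simp

definition vol1 :: real where "vol1 = measure lborel (ball (0::real^3) 1)"

lemma vol1_pos: "0 < vol1"
  by (simp add: vol1_def content_ball_pos)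

lemma emeasure_ball1: "emeasure lborel (ball (0::real^3) 1) = ennreal vol1"
  unfolding vol1_def using emeasure_lborel_ball_finite[of "0::real^3" 1] by (simp add: emeasure_eq_ennreal_measure less_top)

lemma emeasure_cball_finite': "emeasure lborel (cball (0::'a::euclidean_space) r) < top"
  using emeasure_lborel_cball_finite[of "0::'a" r] by simp

lemma ennreal_power2_le_imp_le:
  assumes "(x::ennreal)^2 <= (ennreal b)^2" "0 <= b" shows "x <= ennreal b"
proof (cases x)
  case (real r)
  then have "r^2 <= b^2" using assms by (simp add: ennreal_power)
  then have "r <= b" using assms(2) by (rule power2_le_imp_le)
  then show ?thesis using real by (simp add: ennreal_leI)
next
  case top
  then show ?thesis using assms by (simp add: power2_eq_square ennreal_mult[symmetric] top_unique)
qed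

lemma ball1_const: "(NN z. indicator (ball (0::real^3) 1) z * c) = ennreal vol1 * c"
  by (subst nn_integral_multc) (auto simp: emeasure_ball1)

lemma ball1_average:
  fixes h :: "real^3 => 'b::euclidean_space"
  assumes h: "h \<in> L2"
  shows "(NN z. indicator (ball 0 1) z * ennreal (norm (h z)))
    <= ennreal (sqrt (vol1 * (LBINT z. indicator (ball 0 1) z * (norm (h z))^2)))"
proof -
  have [measurable]: "h \<in> bmeas" using h by (rule L2_measurable)
  have i: "integrable lborel (%z. indicator (ball 0 1) z * (norm (h z))^2)"
    using integrable_mult_indicator[of "ball 0 1", OF _ L2_integrable[OF h]] by simp
  have "(NN z. indicator (ball 0 1) z * ennreal (norm (h z)))^2
     = (NN z. indicator (ball 0 1) z * (indicator (ball 0 1) z * ennreal (norm (h z))))^2"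
    by (intro arg_cong[of _ _ "%x. x^2"] nn_integral_cong) (auto split: split_indicator)
  also have "\<dots> <= (NN z. (indicator (ball (0::real^3) 1) z)^2) * (NN z. (indicator (ball 0 1) z * ennreal (norm (h z)))^2)"
    using Cauchy_Schwarz_nn_integral[of "indicator (ball (0::real^3) 1)" lborel "%z. indicator (ball 0 1) z * ennreal (norm (h z))"]
    by (simp add: borel_measurable_indicator)
  also have "(NN z. (indicator (ball (0::real^3) 1) z)^2) = (NN z. indicator (ball (0::real^3) 1) z)"
    by (rule nn_integral_cong) (auto split: split_indicator)
  also have "\<dots> = ennreal vol1" by (simp add: emeasure_ball1)
  also have "(NN z. (indicator (ball 0 1) z * ennreal (norm (h z)))^2) = (NN z. ennreal (indicator (ball 0 1) z * (norm (h z))^2))"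
    by (rule nn_integral_cong) (auto split: split_indicator simp: ennreal_power)
  also have "\<dots> = ennreal (LBINT z. indicator (ball 0 1) z * (norm (h z))^2)"
    by (rule nn_integral_eq_integral[OF i]) auto
  also have "ennreal vol1 * \<dots> = (ennreal (sqrt (vol1 * (LBINT z. indicator (ball 0 1) z * (norm (h z))^2))))^2"
    using vol1_pos by (simp add: ennreal_power ennreal_mult[symmetric])
  finally show ?thesis by (rule ennreal_power2_le_imp_le) (simp add: vol1_pos less_imp_le)
qed


text \<open>By Fubini and translation invariance the local energies, whatever the inner scale
  \<open>s\<close>, integrate to the global one times the volume of the unit ball.\<close>

lemma ball1_L2_integral:
  fixes F :: "real^3 => 'b::euclidean_space"
  assumes F: "F \<in> L2" and s: "0 < s"
  shows "(NN x. ennreal (LBINT z. indicator (ball 0 1) z * (norm (F (x + s *R z)))^2)) = ennreal (vol1 * (n2 F)^2)"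
proof -
  have [measurable]: "F \<in> bmeas" by (rule L2_measurable[OF F])
  define B where "B = ball (0::real^3) 1"
  have [measurable]: "B \<in> sets borel" by (simp add: B_def)
  let ?g = "%x z. indicator B z * ennreal ((norm (F (x + s *R z)))^2)"
  have "ennreal (LBINT z. indicator B z * (norm (F (x + s *R z)))^2) = (NN z. ?g x z)" for x
  proof -
    have "(%z. F (x + s *R z)) \<in> L2" by (rule L2_affine(1)[OF F]) (use s in simp)
    from integrable_mult_indicator[of B, OF _ L2_integrable[OF this]]
    have "integrable lborel (%z. indicator B z * (norm (F (x + s *R z)))^2)" by simp
    from nn_integral_eq_integral[OF this] show ?thesis by (simp add: ennreal_mult ennreal_indicator)
  qed
  then have "(NN x. ennreal (LBINT z. indicator B z * (norm (F (x + s *R z)))^2)) = (NN x. (NN z. ?g x z))" by simp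
  also have "\<dots> = (NN z. (NN x. ?g x z))" by (rule lborel_pair.Fubini') measurable
  also have "\<dots> = (NN z. indicator B z * ennreal ((n2 F)^2))"
  proof (rule nn_integral_cong)
    fix z
    have "(NN x. ennreal ((norm (F (x + s *R z)))^2)) = ennreal ((n2 F)^2)"
      using nn_integral_eq_integral[OF L2_integrable[OF L2_translate(1)[OF F]]] L2_translate(2)[OF F, of "s *R z"] by (simp add: n2_sq[symmetric])
    then show "(NN x. ?g x z) = indicator B z * ennreal ((n2 F)^2)" by (simp add: nn_integral_cmult)
  qed
  also have "\<dots> = ennreal (vol1 * (n2 F)^2)"
    using vol1_pos by (simp only: B_def ball1_const) (simp add: ennreal_mult)
  finally show ?thesis by (simp add: B_def)
qed

text \<open>A subcritical Sobolev inequality by averaging \<open>nice_segment\<close> over the unit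
  ball: \<open>|f x|\<close> is at most a local mean of \<open>|f|\<close> plus an integral over
  \<open>sigma\<close> of means of \<open>|G|\<close> over balls of radius \<open>sigma ^ m\<close>.
  In the power \<open>t\<close> of a mean, the exponent \<open>t - 2\<close> is spent on the global
  norm, and the remaining square integrates over \<open>x\<close> to a norm again.\<close>

lemma GN_nice:
  assumes t: "2 < t" "t < 6"
  obtains C where "0 < C" "!!f G. nice f G ==>
    (NN x. ennreal (norm (f x) powr t)) <= ennreal (C * (n2 f powr t + n2 G powr t))"
proof -
  \<comment> \<open>Here \<open>t < 6\<close> enters: this size of \<open>m\<close> makes the final
    exponent of \<open>sigma\<close>, which is
    \<open>(m - 1) * t - 3 * m / 2 * (t - 2) = m * (3 - t / 2) - t\<close>, nonnegative.\<close>
  obtain m0 :: nat where m0: "t / (3 - t / 2) <= real m0" using real_arch_simple by blast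
  define m where "m = max 1 m0"
  have m1: "1 <= m" by (simp add: m_def)
  have "t / (3 - t / 2) <= real m" using m0 by (simp add: m_def)
  then have mt: "t <= real m * (3 - t / 2)" using t by (simp add: field_simps)
  define C1 where "C1 = (2 powr t * real m powr t) * vol1 powr (1 - t / 2)"
  have C1: "0 < C1" using vol1_pos m1 by (simp add: C1_def)
  show thesis
  proof (rule that[OF C1])
    fix f G assume n: "nice f G"
    have fL: "f \<in> L2" and GL: "G \<in> L2" and Gc: "continuous_on UNIV G" and fc: "continuous_on UNIV f"
      using n gderiv_continuous[of f "%x i. G x $ i"] by (auto simp: nice_def)
    have [measurable]: "f \<in> bmeas" "G \<in> bmeas"
      using fL GL by (auto intro: L2_measurable)
    define B where "B = ball (0::real^3) 1"
    have [measurable]: "B \<in> sets borel" by (simp add: B_def)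
    define e where "e sigma x = (LBINT z. indicator B z * (norm (G (x + sigma ^ m *R z)))^2)" for sigma x
    define e0 where "e0 x = (LBINT z. indicator B z * (norm (f (x + z)))^2)" for x
    have [measurable]: "(%(sigma, x). e sigma x) \<in> borel_measurable (borel \<Otimes>\<^sub>M borel)" unfolding e_def
      by measurable
    have [measurable]: "e0 \<in> bmeas" unfolding e0_def by measurable
    have e_nonneg: "0 <= e sigma x" "0 <= e0 x" for sigma x by (auto simp: e_def e0_def)
    have GsL: "(%z. G (x + sigma ^ m *R z)) \<in> L2" "(n2 G)^2 = (sigma ^ m) ^ 3 * (n2 (%z. G (x + sigma ^ m *R z)))^2" if "0 < sigma" for sigma x
      using L2_affine[OF GL, of "sigma ^ m" x] that by auto
    have fsL: "(%z. f (x + z)) \<in> L2" "n2 (%z. f (x + z)) = n2 f" for x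
      using L2_translate(1,2)[OF fL, of x] by (simp_all add: add.commute)
    have indle: "(LBINT z. indicator B z * (norm (h z))^2) <= (n2 h)^2" if "h \<in> L2" for h :: "real^3 => 'c::euclidean_space"
      unfolding n2_sq
      by (rule integral_mono_AE') (auto simp: L2_integrable[OF that] split: split_indicator)
    have e_le: "e sigma x * sigma ^ (3 * m) <= (n2 G)^2" if "0 < sigma" for sigma x
    proof -
      have "e sigma x * sigma ^ (3 * m) <= (n2 (%z. G (x + sigma ^ m *R z)))^2 * sigma ^ (3 * m)"
        unfolding e_def using that by (intro mult_right_mono indle GsL) auto
      also have "\<dots> = (n2 G)^2" using GsL(2)[OF that, of x] by (simp add: power_mult[symmetric] mult.commute)
      finally show ?thesis .
    qed
    have e0_le: "e0 x <= (n2 f)^2" for x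
      unfolding e0_def using indle[OF fsL(1)[of x]] fsL(2)[of x] by simp
    define phi where "phi x sigma = (if sigma <= 0 then 0 else real m * sigma ^ (m - 1) * sqrt (e sigma x / vol1))" for x sigma
    have [measurable]: "(%(x, sigma). phi x sigma) \<in> borel_measurable (borel \<Otimes>\<^sub>M borel)" unfolding phi_def by measurable
    have phi0: "0 <= phi x sigma" for x sigma using e_nonneg vol1_pos by (auto simp: phi_def)
    have sv: "sqrt (vol1 * y) = vol1 * sqrt (y / vol1)" for y
    proof -
      have "vol1 * y = vol1^2 * (y / vol1)" using vol1_pos by (simp add: power2_eq_square)
      then show ?thesis using vol1_pos by (metis real_sqrt_mult real_sqrt_abs abs_of_pos)
    qed
    have pt: "ennreal (norm (f x)) <= ennreal (sqrt (e0 x / vol1)) + (NN sigma. indicator {0..1} sigma * ennreal (phi x sigma))" for x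
    proof -
      let ?S = "%(sigma::real) z. indicator {0..1} sigma * ennreal (m * sigma ^ (m - 1) * norm (G (x + sigma ^ m *R z)))" and ?P = "\<integral>\<^sup>+sigma. indicator {0..1} sigma * ennreal (phi x sigma) \<partial>lborel"
      have "ennreal vol1 * ennreal (norm (f x)) = (NN z. indicator B z * ennreal (norm (f x)))"
        by (simp only: B_def ball1_const)
      also have "\<dots> <= (\<integral>\<^sup>+z. indicator B z * ennreal (norm (f (x + z))) +
          (NN sigma. indicator B z * (?S sigma z)) \<partial>lborel)"
        by (rule nn_integral_mono) (use nice_segment[OF n _ m1, of _ x] in \<open>auto simp: B_def split: split_indicator\<close>)
      also have "\<dots> = (NN z. indicator B z * ennreal (norm (f (x + z)))) +
          (\<integral>\<^sup>+z. (NN sigma. indicator B z * (?S sigma z)) \<partial>lborel)"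
        by (rule nn_integral_add) measurable
      also have "(\<integral>\<^sup>+z. (NN sigma. indicator B z * (?S sigma z)) \<partial>lborel)
        = (\<integral>\<^sup>+sigma. (NN z. indicator B z * (?S sigma z)) \<partial>lborel)"
        by (rule lborel_pair.Fubini') measurable
      also have "\<dots> <= (NN sigma. ennreal vol1 * (indicator {0..1} sigma * ennreal (phi x sigma)))"
      proof (rule nn_integral_mono_AE)
        show "AE sigma in lborel. (NN z. indicator B z * (?S sigma z))
          <= ennreal vol1 * (indicator {0..1} sigma * ennreal (phi x sigma))"
          using AE_lborel_singleton[of "0::real"]
        proof eventually_elim
          case (elim sigma)
          show ?case
          proof (cases "sigma \<in> {0..1}")
            case True
            with elim have s: "0 < sigma" by simp
            have "(NN z. indicator B z * (?S sigma z))
              = ennreal (m * sigma ^ (m - 1)) * (NN z. indicator B z * ennreal (norm (G (x + sigma ^ m *R z))))"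
              using True s by (subst nn_integral_cmult[symmetric]) (auto intro!: nn_integral_cong simp: ennreal_mult split: split_indicator)
            also have "\<dots> <= ennreal (m * sigma ^ (m - 1)) * ennreal (vol1 * sqrt (e sigma x / vol1))"
              using ball1_average[OF GsL(1)[OF s, of x]] unfolding B_def[symmetric] e_def[symmetric] sv
              by (intro mult_left_mono) auto
            also have "\<dots> = ennreal vol1 * ennreal (phi x sigma)"
              using s vol1_pos e_nonneg by (simp add: phi_def ennreal_mult[symmetric] mult_ac)
            finally show ?thesis using True by simp
          qed simp
        qed
      qed
      also have "\<dots> = ennreal vol1 * ?P"
        by (rule nn_integral_cmult) measurable
      also have "(NN z. indicator B z * ennreal (norm (f (x + z)))) <= ennreal vol1 * ennreal (sqrt (e0 x / vol1))"
        using ball1_average[OF fsL(1)[of x]] vol1_pos e_nonneg(2)[of x] unfolding B_def[symmetric] e0_def[symmetric] sv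
        by (simp add: ennreal_mult)
      finally have "ennreal vol1 * ennreal (norm (f x)) <= ennreal vol1 * (ennreal (sqrt (e0 x / vol1)) + ?P)"
        by (simp add: distrib_left add_right_mono add_left_mono)
      then show ?thesis using vol1_pos by (simp add: ennreal_mult_le_mult_iff)
    qed
    \<comment> \<open>Splits the power \<open>t\<close> of a local mean: the global bound
      \<open>M\<close> takes the exponent \<open>t - 2\<close>, and \<open>y\<close> is left to the
      first power.\<close>
    have rt: "sqrt (y / vol1) powr t <= vol1 powr (- t / 2) * M powr (t - 2) * y" if "0 <= y" "y <= M^2" "0 <= M" for y M
    proof (cases "y = 0")
      case False
      have "sqrt (y / vol1) powr t = vol1 powr (- t / 2) * y powr (t / 2)"
        using that vol1_pos by (simp add: powr_half_sqrt[symmetric] powr_powr powr_divide powr_minus_divide)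
      also have "y powr (t / 2) = y powr (t / 2 - 1) * y" using False that by (simp add: powr_diff)
      also have "y powr (t / 2 - 1) <= (M^2) powr (t / 2 - 1)" using that t by (intro powr_mono2) auto
      also have "(M^2) powr (t / 2 - 1) = M powr (t - 2)"
        using that False by (cases "M = 0") (auto simp: powr_powr simp flip: powr_numeral)
      finally show ?thesis using that vol1_pos by (simp add: mult_ac mult_left_mono mult_right_mono)
    qed simp
    have phit: "phi x sigma powr t <= real m powr t * (vol1 powr (- t / 2) * n2 G powr (t - 2) * e sigma x)" if s: "sigma \<in> {0..1}" for x sigma
    proof (cases "sigma = 0")
      case True then show ?thesis using vol1_pos e_nonneg by (simp add: phi_def)
    next
      case False
      with s have s0: "0 < sigma" "sigma <= 1" by auto
      have "phi x sigma powr t = real m powr t * (sigma powr (real (m - 1) * t) * sqrt (e sigma x / vol1) powr t)"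
        using s0 by (simp add: phi_def powr_mult powr_powr e_nonneg vol1_pos less_imp_le flip: powr_realpow)
      also have "sqrt (e sigma x / vol1) powr t <= vol1 powr (- t / 2) * (n2 G / sigma powr (3 * m / 2)) powr (t - 2) * e sigma x"
      proof (rule rt)
        have "e sigma x <= (n2 G)^2 / sigma ^ (3 * m)" using e_le[OF s0(1), of x] s0 by (simp add: field_simps)
        also have "\<dots> = (n2 G / sigma powr (3 * m / 2))^2"
        proof -
          have "(sigma powr (3 * m / 2))^2 = sigma powr (3 * m)"
            using s0 by (simp add: power2_eq_square flip: powr_add)
          also have "\<dots> = sigma ^ (3 * m)" using s0 powr_realpow[of sigma "3 * m"] by simp
          finally show ?thesis by (simp add: power_divide)
        qed
        finally show "e sigma x <= (n2 G / sigma powr (3 * m / 2))^2" .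
      qed (use e_nonneg s0 in auto)
      also have "(n2 G / sigma powr (3 * m / 2)) powr (t - 2) = n2 G powr (t - 2) * sigma powr (- (3 * m / 2 * (t - 2)))"
        using s0 by (simp add: powr_divide powr_powr powr_minus_divide)
      finally have "phi x sigma powr t <= real m powr t * (sigma powr (real (m - 1) * t) * (vol1 powr (- t / 2) * (n2 G powr (t - 2) * sigma powr (- (3 * m / 2 * (t - 2)))) * e sigma x))"
        by (simp add: mult_left_mono)
      also have "\<dots> = real m powr t * (sigma powr (real (m - 1) * t - 3 * m / 2 * (t - 2)) * (vol1 powr (- t / 2) * n2 G powr (t - 2) * e sigma x))"
        using s0 by (simp add: powr_diff powr_minus_divide)
      also have "\<dots> <= real m powr t * (1 * (vol1 powr (- t / 2) * n2 G powr (t - 2) * e sigma x))"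
      proof (intro mult_left_mono mult_right_mono)
        have "0 <= real (m - 1) * t - 3 * m / 2 * (t - 2)"
        proof -
          have "real (m - 1) * t - 3 * m / 2 * (t - 2) = real m * (3 - t / 2) - t"
            using m1 by (simp add: of_nat_diff field_simps)
          then show ?thesis using mt by simp
        qed
        then show "sigma powr (real (m - 1) * t - 3 * m / 2 * (t - 2)) <= 1"
          using s0 powr_mono_both[of 0 "real (m - 1) * t - 3 * m / 2 * (t - 2)" sigma 1] powr_le1 by auto
      qed (use e_nonneg in auto)
      finally show ?thesis by simp
    qed
    let ?v = "vol1 powr (- t / 2)"
    let ?cf = "2 powr t * ?v * n2 f powr (t - 2)" and ?k = "real m powr t * ?v * n2 G powr (t - 2)" and ?cg = "2 powr t * real m powr t * ?v * n2 G powr (t - 2)"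
      and ?E = "%x. \<integral>\<^sup>+sigma. indicator {0..1} sigma * ennreal (e sigma x) \<partial>lborel"
    have ptt: "ennreal (norm (f x) powr t) <= ennreal (?cf) * ennreal (e0 x)
        + ennreal (?cg) * ?E x" for x
    proof -
      let ?A = "sqrt (e0 x / vol1)"
      \<comment> \<open>The excess of \<open>|f x|\<close> over the local mean of \<open>f\<close>,
        the part that the gradient integral has to control.\<close>
      define X where "X = max 0 (norm (f x) - ?A)"
      have A0: "0 <= ?A" using e_nonneg vol1_pos by simp
      have "ennreal X <= (NN sigma. indicator {0..1} sigma * ennreal (phi x sigma))"
      proof (cases "norm (f x) <= ?A")
        case False
        then have "norm (f x) = ?A + X" "0 <= X" by (auto simp: X_def)
        then have "ennreal (norm (f x)) = ennreal ?A + ennreal X" using A0 by (simp add: ennreal_plus)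
        then show ?thesis using pt[of x] by (simp add: ennreal_add_left_cancel_le)
      qed (simp add: X_def)
      from unit_interval_Jensen[OF _ _ phi0 _ this, of t] t
      have "ennreal (X powr t) <= (NN sigma. indicator {0..1} sigma * ennreal (phi x sigma powr t))"
        by (simp add: X_def)
      also have "\<dots> <= (NN sigma. ennreal (?k) * (indicator {0..1} sigma * ennreal (e sigma x)))"
      proof (rule nn_integral_mono)
        fix sigma :: real
        show "indicator {0..1} sigma * ennreal (phi x sigma powr t) <= ennreal (?k) * (indicator {0..1} sigma * ennreal (e sigma x))"
          using phit[of sigma x] e_nonneg(1)[of sigma x] by (auto simp: ennreal_mult[symmetric] ennreal_leI mult_ac split: split_indicator)
      qed
      also have "\<dots> = ennreal (?k) * ?E x"
        by (rule nn_integral_cmult) measurable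
      finally have X: "ennreal (X powr t) <= \<dots>" .
      have "norm (f x) <= ?A + X" by (simp add: X_def)
      moreover have "?A <= max ?A X" "X <= max ?A X" by simp_all
      ultimately have "norm (f x) <= 2 * max ?A X" by linarith
      then have "norm (f x) powr t <= (2 * max ?A X) powr t" using t by (intro powr_mono2) auto
      also have "\<dots> = 2 powr t * (max ?A X) powr t" using A0 by (simp add: powr_mult max_def X_def)
      also have "\<dots> <= 2 powr t * (?A powr t + X powr t)" by (intro mult_left_mono) (auto simp: max_def)
      also have "?A powr t <= ?v * n2 f powr (t - 2) * e0 x" by (rule rt) (use e_nonneg e0_le in auto)
      finally have "norm (f x) powr t <= 2 powr t * (?v * n2 f powr (t - 2)) * e0 x + 2 powr t * X powr t"
        by (simp add: distrib_left mult_ac)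
      then have "ennreal (norm (f x) powr t) <= ennreal (2 powr t * (?v * n2 f powr (t - 2)) * e0 x) + ennreal (2 powr t * X powr t)"
        using e_nonneg by (simp add: ennreal_leI flip: ennreal_plus)
      also have "ennreal (2 powr t * X powr t) = ennreal (2 powr t) * ennreal (X powr t)" by (simp add: ennreal_mult)
      also have "\<dots> <= ennreal (2 powr t) * (ennreal (?k) * ?E x)"
        by (intro mult_left_mono X) simp
      finally show ?thesis using e_nonneg(2)[of x]
        by (simp add: ennreal_mult mult_ac add_left_mono)
    qed
    have Ee: "(NN x. ennreal (e sigma x)) = ennreal (vol1 * (n2 G)^2)" if "0 < sigma" for sigma
      unfolding e_def B_def by (rule ball1_L2_integral[OF GL]) (use that in simp)
    have Ee0: "(NN x. ennreal (e0 x)) = ennreal (vol1 * (n2 f)^2)"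
      unfolding e0_def B_def using ball1_L2_integral[OF fL, of 1] by simp
    have "(NN x. ennreal (norm (f x) powr t)) <= (NN x. ennreal (?cf) * ennreal (e0 x)
        + ennreal (?cg) * ?E x)"
      by (rule nn_integral_mono) (rule ptt)
    also have "\<dots> = ennreal (?cf) * (NN x. ennreal (e0 x))
        + ennreal (?cg) * (NN x. ?E x)"
      by (subst nn_integral_add) (auto simp: nn_integral_cmult)
    also have "(NN x. ?E x) = (\<integral>\<^sup>+sigma. (NN x. indicator {0..1} sigma * ennreal (e sigma x)) \<partial>lborel)"
      by (rule lborel_pair.Fubini') measurable
    also have "\<dots> = (\<integral>\<^sup>+sigma. indicator {0..1} sigma * ennreal (vol1 * (n2 G)^2) \<partial>(lborel::real measure))"
    proof (rule nn_integral_cong_AE)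
      show "AE sigma in lborel. (NN x. indicator {0..1} sigma * ennreal (e sigma x)) = indicator {0..1} sigma * ennreal (vol1 * (n2 G)^2)"
        using AE_lborel_singleton[of "0::real"]
        by eventually_elim (auto simp: nn_integral_cmult Ee split: split_indicator)
    qed
    also have "\<dots> = ennreal (vol1 * (n2 G)^2)" by (simp add: nn_integral_multc)
    also note Ee0
    also have "ennreal (?cf) * ennreal (vol1 * (n2 f)^2)
        + ennreal (?cg) * ennreal (vol1 * (n2 G)^2)
        = ennreal ((?cf) * (vol1 * (n2 f)^2) + (?cg) * (vol1 * (n2 G)^2))"
      using vol1_pos by (simp add: ennreal_mult ennreal_plus)
    also have "\<dots> <= ennreal (C1 * (n2 f powr t + n2 G powr t))"
    proof (rule ennreal_leI)
      have v: "?v * vol1 = vol1 powr (1 - t / 2)" using vol1_pos by (simp add: powr_diff powr_minus_divide)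
      have p: "y powr (t - 2) * y^2 = y powr t" if "0 <= y" for y :: real
        using that by (cases "y = 0") (auto simp: powr_diff)
      have mm: "1 <= real m powr t" using m1 t by (intro ge_one_powr_ge_zero) auto
      have "(?cf) * (vol1 * (n2 f)^2) = 2 powr t * 1 * (?v * vol1) * (n2 f powr (t - 2) * (n2 f)^2)" by simp
      also have "\<dots> <= 2 powr t * real m powr t * (?v * vol1) * (n2 f powr (t - 2) * (n2 f)^2)"
        using mm vol1_pos by (intro mult_right_mono mult_left_mono) auto
      also have "\<dots> = C1 * n2 f powr t" by (simp only: p[OF n2_nonneg] v C1_def)
      finally have 1: "(?cf) * (vol1 * (n2 f)^2) <= C1 * n2 f powr t" .
      have "(?cg) * (vol1 * (n2 G)^2) = 2 powr t * real m powr t * (?v * vol1) * (n2 G powr (t - 2) * (n2 G)^2)" by simp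
      also have "\<dots> = C1 * n2 G powr t" by (simp only: p[OF n2_nonneg] v C1_def)
      finally show "(?cf) * (vol1 * (n2 f)^2) + (?cg) * (vol1 * (n2 G)^2)
        <= C1 * (n2 f powr t + n2 G powr t)" using 1 by (simp add: distrib_left)
    qed
    finally show "(NN x. ennreal (norm (f x) powr t)) <= ennreal (C1 * (n2 f powr t + n2 G powr t))" .
  qed
qed

definition pw :: "real => (real^3 => complex) => real" where
  "pw t u = (LBINT x. norm (u x) powr t)"

lemma pw_nonneg [simp]: "0 <= pw t u" by (simp add: pw_def)

lemma grad_norm_nonneg [simp]: "0 <= grad_norm u" by (simp add: grad_norm_def)

text \<open>Fatou's lemma along an almost everywhere convergent subsequence of mollifications
  transfers the inequality from \<open>nice\<close> functions; the norms on the right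
  converge.\<close>

lemma H1_pw_bound:
  assumes t: "2 < t" "t < 6"
  obtains C where "0 < C" "!!u. u \<in> H1 ==> integrable lborel (%x. norm (u x) powr t)"
    "!!u. u \<in> H1 ==> pw t u <= C * (n2 u powr t + grad_norm u powr t)"
proof -
  obtain C where C: "0 < C" "!!f G. nice f G ==>
    (NN x. ennreal (norm (f x) powr t)) <= ennreal (C * (n2 f powr t + n2 G powr t))"
    using GN_nice[OF t] by blast
  have *: "integrable lborel (%x. norm (u x) powr t) \<and> pw t u <= C * (n2 u powr t + grad_norm u powr t)"
    if u: "u \<in> H1" for u
  proof -
    note uL = H1_L2[OF u] and gL = weak_grad_L2[OF u]
    have [measurable]: "u \<in> bmeas" by (rule L2_measurable[OF uL])
    let ?f = "%n. conv (mol n) u" and ?G = "%n. conv (mol n) (weak_grad u)"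
    note lims = conv_mol_tendsto[OF uL] conv_mol_tendsto[OF gL]
    obtain r where r: "strict_mono r" "AE x in lborel. (%n. ?f (r n) x) ----> u x"
      using L2_AE_subseq[OF conv_mol_L2[OF uL] uL lims(1)] by blast
    have [measurable]: "?f n \<in> bmeas" for n by (rule conv_measurable[OF mol_test uL])
    have "(NN x. ennreal (norm (u x) powr t)) <= (NN x. liminf (%n. ennreal (norm (?f (r n) x) powr t)))"
    proof (rule nn_integral_mono_AE)
      show "AE x in lborel. ennreal (norm (u x) powr t) <= liminf (%n. ennreal (norm (?f (r n) x) powr t))"
        using r(2)
      proof eventually_elim
        case (elim x)
        have "(%n. ennreal (norm (?f (r n) x) powr t)) ----> ennreal (norm (u x) powr t)"
          by (intro tendsto_ennrealI tendsto_powr2 tendsto_norm elim tendsto_const) (use t in auto)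
        then show ?case using lim_imp_Liminf[OF sequentially_bot] by fastforce
      qed
    qed
    also have "\<dots> <= liminf (%n. \<integral>\<^sup>+x. ennreal (norm (?f (r n) x) powr t) \<partial>lborel)"
      by (rule nn_integral_liminf) auto
    also have "\<dots> <= liminf (%n. ennreal (C * (n2 (?f (r n)) powr t + n2 (?G (r n)) powr t)))"
      by (rule Liminf_mono, rule always_eventually) (use C(2) wg_mollify[OF uL H1_wg[OF u]] in blast)
    also have "\<dots> = ennreal (C * (n2 u powr t + n2 (weak_grad u) powr t))"
    proof (rule lim_imp_Liminf)
      have 1: "(%n. n2 (?f n)) ----> n2 u" "(%n. n2 (?G n)) ----> n2 (weak_grad u)"
        by (rule n2_tendsto[OF conv_mol_L2[OF uL] uL lims(1)], rule n2_tendsto[OF conv_mol_L2[OF gL] gL lims(2)])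
      show "(%n. ennreal (C * (n2 (?f (r n)) powr t + n2 (?G (r n)) powr t))) ----> ennreal (C * (n2 u powr t + n2 (weak_grad u) powr t))"
        by (intro tendsto_ennrealI tendsto_mult tendsto_add tendsto_powr2 tendsto_const
          LIMSEQ_subseq_LIMSEQ[OF 1(1) r(1), unfolded o_def] LIMSEQ_subseq_LIMSEQ[OF 1(2) r(1), unfolded o_def])
          (use t in auto)
    qed simp
    finally have le: "(NN x. ennreal (norm (u x) powr t)) <= ennreal (C * (n2 u powr t + grad_norm u powr t))"
      by (simp add: grad_norm_eq)
    then have "(NN x. ennreal (norm (u x) powr t)) < \<infinity>"
      by (simp add: le_less_trans)
    then have i: "integrable lborel (%x. norm (u x) powr t)"
      by (intro integrableI_bounded) auto
    moreover have "pw t u <= C * (n2 u powr t + grad_norm u powr t)"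
      using le nn_integral_eq_integral[OF i] C(1) by (simp add: pw_def)
    ultimately show ?thesis by simp
  qed
  show thesis by (rule that[OF C(1)]) (use * in auto)
qed

lemma H1_pw_integrable:
  assumes "2 < t" "t < 6" "u \<in> H1" shows "integrable lborel (%x. norm (u x) powr t)"
  using H1_pw_bound[OF assms(1,2)] assms(3) by metis

lemma pw_zero_imp:
  assumes t: "2 < t" "t < 6" and u: "u \<in> H1" and z: "pw t u = 0" shows "n2 u = 0"
proof -
  have "AE x in lborel. norm (u x) powr t = 0"
    using z integral_nonneg_eq_0_iff_AE[OF H1_pw_integrable[OF t u]] by (simp add: pw_def)
  then have "AE x in lborel. u x = 0" by eventually_elim simp
  then show ?thesis by (simp add: n2_eq_0_iff[OF H1_L2[OF u]])
qed

lemma pw_zero: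
  assumes u: "u \<in> H1" and z: "n2 u = 0" shows "pw t u = 0"
proof -
  have [measurable]: "u \<in> bmeas" by (rule L2_measurable[OF H1_L2[OF u]])
  have "AE x in lborel. u x = 0" using z n2_eq_0_iff[OF H1_L2[OF u]] by simp
  then have "AE x in lborel. norm (u x) powr t = 0" by eventually_elim simp
  then have "pw t u = (\<integral>x. 0 \<partial>(lborel :: (real^3) measure))" unfolding pw_def by (intro integral_cong_AE) auto
  then show ?thesis by simp
qed

subsection \<open>Dilations\<close>

definition dil :: "real => (real^3 => 'b::euclidean_space) => real^3 => 'b" where
  "dil s f = (%x. exp (3 * s / 2) *R f (exp s *R x))"

lemma dilate_dil: "dilate s u = dil s u" by (simp add: dilate_def dil_def)

lemma exp_3: "exp (3 * s :: real) = exp s ^ 3"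
  using exp_of_nat_mult[of 3 s] by simp

lemma L2_dil:
  fixes f :: "real^3 => 'b::euclidean_space"
  assumes f: "f \<in> L2" shows "dil s f \<in> L2" "n2 (dil s f) = n2 f"
proof -
  have a: "(%x. f (exp s *R x)) \<in> L2" "(n2 f)^2 = exp s ^ 3 * (n2 (%x. f (exp s *R x)))^2"
    using L2_affine[OF f, of "exp s" 0] by auto
  show "dil s f \<in> L2" unfolding dil_def by (rule L2_scaleR(1)[OF a(1)])
  have "(n2 (dil s f))^2 = (exp (3 * s / 2))^2 * (n2 (%x. f (exp s *R x)))^2"
    unfolding dil_def L2_scaleR(2)[OF a(1)] by (simp add: power_mult_distrib)
  also have "(exp (3 * s / 2))^2 = exp s ^ 3"
    by (simp add: power2_eq_square exp_3[symmetric] flip: exp_add)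
  finally have "(n2 (dil s f))^2 = (n2 f)^2" using a(2) by simp
  then show "n2 (dil s f) = n2 f" by (simp add: power2_eq_iff_nonneg)
qed

lemma pw_dilate:
  assumes u: "u \<in> bmeas"
  shows "pw t (dilate s u) = exp (3 * (t / 2 - 1) * s) * pw t u"
proof -
  have [measurable]: "u \<in> bmeas" by fact
  have "pw t u = exp s ^ 3 * (LBINT x. norm (u (exp s *R x)) powr t)"
    unfolding pw_def using lborel_integral_affine[of "%x. norm (u x) powr t" "exp s" 0] by simp
  moreover have "pw t (dilate s u) = exp (3 * s / 2) powr t * (LBINT x. norm (u (exp s *R x)) powr t)"
    by (simp add: pw_def dilate_def powr_mult)
  moreover have "exp (3 * s / 2) powr t = exp (3 * (t / 2 - 1) * s) * exp s ^ 3"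
  proof -
    have "exp (3 * s / 2) powr t = exp (3 * (t / 2 - 1) * s + 3 * s)"
      by (simp add: powr_def algebra_simps)
    then show ?thesis by (simp only: exp_add exp_3)
  qed
  ultimately show ?thesis by simp
qed

lemma wg_dilate:
  assumes u: "u \<in> L2" and w: "wgrad u g"
  shows "wgrad (dilate s u) (%x. exp s *R dil s g x)"
proof (rule wgI)
  note [simp del] = iterated_partial.simps
  note gL = wgD(1)[OF w]
  have [measurable]: "u \<in> bmeas" "g \<in> bmeas"
    using u gL by (auto intro: L2_measurable)
  have [measurable]: "(%x. g x $ i) \<in> bmeas" for i using L2_measurable[OF L2_component(1)[OF gL]] .
  show "(%x. exp s *R dil s g x) \<in> L2" by (intro L2_scaleR L2_dil gL)
  fix f i assume t: "test_function f"
  let ?c = "exp s"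
  let ?k = "%y. f ((1 / ?c) *R y)"
  have tk: "test_function ?k" using test_function_affine[OF t, of "1 / ?c" 0] by simp
  have [measurable]: "f \<in> bmeas" "pd i f \<in> bmeas"
    using test_function_L2(3)[OF t] test_function_L2(3)[OF test_function_partial[OF t]] by auto
  have gd: "gderiv ?k (%i. (1 / ?c) *R pd i f ((1 / ?c) *R y)) y" for y
    using gderiv_affine[of f "%i. pd i f ((1 / ?c) *R y)" 0 "1 / ?c" y]
      test_function_gderiv[OF t, of "(1 / ?c) *R y"] by simp
  have eq: "(LBINT y. ((1 / ?c) *R pd i f ((1 / ?c) *R y)) *R u y) = - (LBINT y. ?k y *R (g y $ i))"
    using wgD(2)[OF w tk, of i] unfolding gderiv_iterated_partial[OF gd] .
  have l: "(LBINT y. ((1 / ?c) *R pd i f ((1 / ?c) *R y)) *R u y)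
     = ?c ^ 3 *R (1 / ?c) *R (LBINT x. pd i f x *R u (?c *R x))"
    using lborel_integral_affine[of "%y. ((1 / ?c) *R pd i f ((1 / ?c) *R y)) *R u y" ?c 0]
    by (simp flip: integral_scaleR_right)
  have r: "(LBINT y. ?k y *R (g y $ i)) = ?c ^ 3 *R (LBINT x. f x *R (g (?c *R x) $ i))"
    using lborel_integral_affine[of "%y. ?k y *R (g y $ i)" ?c 0] by simp
  have "?c ^ 3 *R ((1 / ?c) *R (LBINT x. pd i f x *R u (?c *R x))) = ?c ^ 3 *R (- (LBINT x. f x *R (g (?c *R x) $ i)))"
    using eq unfolding l r by simp
  then have "(1 / ?c) *R (LBINT x. pd i f x *R u (?c *R x)) = - (LBINT x. f x *R (g (?c *R x) $ i))"
    by (subst (asm) real_vector.scale_cancel_left) auto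
  then have "?c *R ((1 / ?c) *R (LBINT x. pd i f x *R u (?c *R x))) = ?c *R (- (LBINT x. f x *R (g (?c *R x) $ i)))"
    by simp
  then have key: "(LBINT x. pd i f x *R u (?c *R x)) = - (?c *R (LBINT x. f x *R (g (?c *R x) $ i)))"
    by simp
  have "(LBINT x. pd i f x *R dilate s u x) = exp (3 * s / 2) *R (LBINT x. pd i f x *R u (?c *R x))"
    unfolding dilate_def by (subst integral_scaleR_right[symmetric]) (simp add: mult.commute)
  also have "\<dots> = - (exp (3 * s / 2) *R (?c *R (LBINT x. f x *R (g (?c *R x) $ i))))"
    unfolding key by simp
  also have "exp (3 * s / 2) *R (?c *R (LBINT x. f x *R (g (?c *R x) $ i))) = (LBINT x. f x *R ((?c *R dil s g x) $ i))"
    unfolding dil_def by (simp add: mult_ac flip: integral_scaleR_right)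
  finally show "(LBINT x. pd i f x *R dilate s u x) = - (LBINT x. f x *R ((?c *R dil s g x) $ i))" .
qed

lemma H1_dilate: "u \<in> H1 ==> dilate s u \<in> H1"
  using H1I[OF L2_dil(1) wg_dilate[unfolded dilate_dil]] H1_L2 H1_wg unfolding dilate_dil by blast

lemma n2_dilate: "u \<in> L2 ==> n2 (dilate s u) = n2 u"
  by (simp add: dilate_dil L2_dil)

lemma grad_norm_dilate:
  assumes u: "u \<in> H1" shows "grad_norm (dilate s u) = exp s * grad_norm u"
proof -
  have "grad_norm (dilate s u) = n2 (%x. exp s *R dil s (weak_grad u) x)"
    by (rule grad_norm_wg[OF H1_L2[OF H1_dilate[OF u]] wg_dilate[OF H1_L2[OF u] H1_wg[OF u]]])
  also have "\<dots> = exp s * grad_norm u"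
    using L2_scaleR(2)[OF L2_dil(1)[OF weak_grad_L2[OF u]]] L2_dil(2)[OF weak_grad_L2[OF u]]
    by (simp add: grad_norm_eq)
  finally show ?thesis .
qed

subsection \<open>The sharp constant\<close>

lemma gam_times: "0 < t ==> t * gam t = 3 * (t / 2 - 1)"
  by (simp add: gam_def field_simps)

lemma gam_bounds: "2 < t ==> t < 6 ==> 0 < gam t \<and> gam t < 1"
  by (auto simp: gam_def field_simps)

text \<open>The additive inequality is applied to every dilation of \<open>u\<close>. The choice
  \<open>s = ln (n2 u / grad_norm u)\<close> makes both terms equal to the scale invariant product,
  whence the factor 2; if the gradient vanishes, \<open>s\<close> tends to infinity and forces
  \<open>pw t u = 0\<close>. An admissible constant is what gives the infimum \<open>GN\<close> its
  meaning.\<close>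

lemma GN_set_nonempty:
  assumes t: "2 < t" "t < 6"
  obtains C where "0 <= C" "!!u. u \<in> H1 ==> Lnorm t u <= C * Lnorm 2 u powr (1 - gam t) * grad_norm u powr gam t"
proof -
  obtain C where C: "0 < C" "!!u. u \<in> H1 ==> pw t u <= C * (n2 u powr t + grad_norm u powr t)"
    using H1_pw_bound[OF t] by metis
  note gb = gam_bounds[OF t]
  have tg: "t * gam t = 3 * (t / 2 - 1)" using gam_times t by simp
  have sc: "pw t u <= C * (exp (- (t * gam t * s)) * n2 u powr t + exp (t * (1 - gam t) * s) * grad_norm u powr t)"
    if u: "u \<in> H1" for u s
  proof -
    have "exp (t * gam t * s) * pw t u <= C * (n2 u powr t + (exp s * grad_norm u) powr t)"
      using C(2)[OF H1_dilate[OF u, of s]] unfolding pw_dilate[OF L2_measurable[OF H1_L2[OF u]]]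
        n2_dilate[OF H1_L2[OF u]] grad_norm_dilate[OF u] tg by simp
    also have "(exp s * grad_norm u) powr t = exp (t * s) * grad_norm u powr t"
      by (simp add: powr_mult) (simp add: powr_def mult.commute)
    finally have "exp (- (t * gam t * s)) * (exp (t * gam t * s) * pw t u) <= exp (- (t * gam t * s)) * (C * (n2 u powr t + exp (t * s) * grad_norm u powr t))"
      by (intro mult_left_mono) auto
    also have "exp (- (t * gam t * s)) * (exp (t * gam t * s) * pw t u) = pw t u" by (simp add: exp_minus)
    finally have "pw t u <= C * (exp (- (t * gam t * s)) * n2 u powr t + exp (- (t * gam t * s)) * exp (t * s) * grad_norm u powr t)"
      by (simp add: distrib_left mult_ac)
    also have "exp (- (t * gam t * s)) * exp (t * s) = exp (t * (1 - gam t) * s)"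
      by (simp add: algebra_simps flip: exp_add)
    finally show ?thesis .
  qed
  show thesis
  proof (rule that[of "(2 * C) powr (1 / t)"])
    fix u assume u: "u \<in> H1"
    have L: "Lnorm t u = pw t u powr (1 / t)" by (simp add: Lnorm_def pw_def)
    have "pw t u <= 2 * C * (n2 u powr (1 - gam t) * grad_norm u powr gam t) powr t"
    proof (cases "n2 u = 0")
      case True
      then show ?thesis using pw_zero[OF u True] C(1) by simp
    next
      case n: False
      then have n0: "0 < n2 u" using n2_nonneg[of u] by linarith
      show ?thesis
      proof (cases "grad_norm u = 0")
        case True
        have "((%s. C * (exp (- (t * gam t * s)) * n2 u powr t)) \<longlongrightarrow> C * (0 * n2 u powr t)) at_top"
        proof (intro tendsto_mult tendsto_const)
          have "filterlim (%s. t * gam t * s) at_top at_top"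
            by (rule filterlim_tendsto_pos_mult_at_top[OF tendsto_const _ filterlim_ident]) (use gb t in auto)
          then show "((%s. exp (- (t * gam t * s))) \<longlongrightarrow> 0) at_top"
            by (intro filterlim_compose[OF exp_at_bot] filterlim_compose[OF filterlim_uminus_at_bot_at_top])
        qed
        moreover have "\<forall>\<^sub>F s in at_top. pw t u <= C * (exp (- (t * gam t * s)) * n2 u powr t)"
          using sc[OF u] True t by (intro always_eventually) simp
        ultimately have "pw t u <= C * (0 * n2 u powr t)"
          by (intro tendsto_lowerbound) auto
        then show ?thesis using C(1) by (simp add: order_trans)
      next
        case False
        then have g0: "0 < grad_norm u" using grad_norm_nonneg[of u] by linarith
        define s where "s = ln (n2 u / grad_norm u)"
        have e: "exp (c * s) = n2 u powr c / grad_norm u powr c" for c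
          using n0 g0 by (simp add: s_def powr_def ln_div exp_diff algebra_simps flip: exp_diff)
        have 1: "exp (- (t * gam t * s)) * n2 u powr t = n2 u powr (t - t * gam t) * grad_norm u powr (t * gam t)"
          using e[of "- (t * gam t)"] n0 g0 by (simp add: powr_diff powr_minus_divide)
        have 2: "exp (t * (1 - gam t) * s) * grad_norm u powr t = n2 u powr (t - t * gam t) * grad_norm u powr (t * gam t)"
          using e[of "t * (1 - gam t)"] n0 g0 by (simp add: powr_diff algebra_simps)
        have 3: "(n2 u powr (1 - gam t) * grad_norm u powr gam t) powr t = n2 u powr (t - t * gam t) * grad_norm u powr (t * gam t)"
          using n0 g0 by (simp add: powr_mult powr_powr algebra_simps)
        show ?thesis using sc[OF u, of s] unfolding 1 2 3 by (simp add: mult_ac)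
      qed
    qed
    then have "pw t u powr (1 / t) <= (2 * C * (n2 u powr (1 - gam t) * grad_norm u powr gam t) powr t) powr (1 / t)"
      using t by (intro powr_mono2) auto
    also have "\<dots> = (2 * C) powr (1 / t) * (n2 u powr (1 - gam t) * grad_norm u powr gam t)"
      using C(1) t by (simp add: powr_mult powr_powr)
    finally show "Lnorm t u <= (2 * C) powr (1 / t) * Lnorm 2 u powr (1 - gam t) * grad_norm u powr gam t"
      by (simp add: L Lnorm_2)
  qed simp
qed

text \<open>The inequality is a closed condition on the constant, so the infimum satisfies it as
  well; a vanishing product is treated apart because it is divided by.\<close>

lemma GN_Lnorm:
  assumes t: "2 < t" "t < 6" and u: "u \<in> H1"
  shows "Lnorm t u <= GN t * n2 u powr (1 - gam t) * grad_norm u powr gam t" "0 <= GN t"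
proof -
  let ?M = "{C. 0 <= C \<and> (\<forall>u\<in>H1. Lnorm t u <= C * Lnorm 2 u powr (1 - gam t) * grad_norm u powr gam t)}"
  obtain C where "0 <= C" "!!u. u \<in> H1 ==> Lnorm t u <= C * Lnorm 2 u powr (1 - gam t) * grad_norm u powr gam t"
    using GN_set_nonempty[OF t] by metis
  then have C: "C \<in> ?M" by simp
  show g0: "0 <= GN t" unfolding GN_def by (rule cInf_greatest) (use C in auto)
  define X where "X = n2 u powr (1 - gam t) * grad_norm u powr gam t"
  have X0: "0 <= X" by (simp add: X_def)
  have le: "Lnorm t u <= C * X" if "C \<in> ?M" for C using that u by (auto simp: Lnorm_2 X_def mult.assoc)
  show "Lnorm t u <= GN t * n2 u powr (1 - gam t) * grad_norm u powr gam t"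
  proof (cases "X = 0")
    case True
    then have "GN t * n2 u powr (1 - gam t) * grad_norm u powr gam t = 0" by (simp add: X_def)
    moreover have "Lnorm t u <= 0" using le[OF C] True by simp
    ultimately show ?thesis by linarith
  next
    case False
    then have X: "0 < X" using X0 by simp
    have "Lnorm t u / X <= GN t" unfolding GN_def
    proof (rule cInf_greatest)
      show "Lnorm t u / X <= C" if "C \<in> ?M" for C using le[OF that] X by (simp add: field_simps)
    qed (use C in auto)
    then show ?thesis using X by (simp add: X_def field_simps)
  qed
qed

lemma GN_pw:
  assumes t: "2 < t" "t < 6" and u: "u \<in> H1"
  shows "pw t u <= GN t powr t * n2 u powr (t * (1 - gam t)) * grad_norm u powr (t * gam t)"
proof -
  have L: "Lnorm t u = pw t u powr (1 / t)" by (simp add: Lnorm_def pw_def)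
  have "pw t u = Lnorm t u powr t" using t by (simp add: L powr_powr)
  also have "\<dots> <= (GN t * n2 u powr (1 - gam t) * grad_norm u powr gam t) powr t"
    using GN_Lnorm[OF t u] t by (intro powr_mono2) (auto simp: L)
  also have "\<dots> = GN t powr t * n2 u powr (t * (1 - gam t)) * grad_norm u powr (t * gam t)"
    using GN_Lnorm(2)[OF t u] by (simp add: powr_mult powr_powr mult.commute)
  finally show ?thesis .
qed

lemma nice_test_function:
  assumes k: "test_function k"
  shows "nice (%x. cor (k x)) (%x. \<chi> i. cor (pd i k x))"
proof -
  note [simp del] = iterated_partial.simps
  let ?G = "%x. \<chi> i. cor (pd i k x)"
  have gd: "gderiv (%x. cor (k x)) (%i. ?G x $ i) x" for x
    using gderiv_bounded_linear[OF bounded_linear_of_real[where 'a=complex] test_function_gderiv[OF k, of x]] by simp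
  have c: "continuous_on UNIV ?G"
    by (intro continuous_on_vec_lambda continuous_intros test_function_continuous test_function_partial k)
  obtain R where R: "!!x. R <= norm x ==> k x = 0" using test_function_vanish[OF k] by blast
  have "\<exists>R. \<forall>x. R <= norm x \<longrightarrow> pd j k x = 0" for j
    using test_function_vanish[OF test_function_partial[OF k]] by metis
  then obtain Ri where Ri: "!!j x. Ri j <= norm x ==> pd j k x = 0" by metis
  have le: "\<bar>Ri i\<bar> <= (\<Sum>i\<in>UNIV. \<bar>Ri i\<bar>)" for i by (rule member_le_sum) auto
  have z: "?G x = 0" if "(\<Sum>i\<in>UNIV. \<bar>Ri i\<bar>) <= norm x" for x
  proof -
    have "pd i k x = 0" for i using that le[of i] by (intro Ri) linarith
    then show ?thesis by (simp add: vec_eq_iff)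
  qed
  have "(%x. cor (k x)) \<in> L2" by (rule L2_cont_compact(1)[OF gderiv_continuous[OF gd], of R]) (simp add: R)
  moreover have "?G \<in> L2" by (rule L2_cont_compact(1)[OF c z])
  ultimately show ?thesis using gd c by (simp add: nice_def)
qed

text \<open>A fixed nonzero radial element of H1, the seed of all test configurations: for
  positivity of \<open>GN\<close>, for the constraint set being nonempty, and for the cloud.\<close>

definition cbump :: "real^3 => complex" where "cbump x = cor (bump x)"

lemma nice_cbump: "nice cbump (%x. \<chi> i. cor (pd i bump x))"
  unfolding cbump_def[abs_def] by (rule nice_test_function[OF bump_test])

lemma cbump_H1: "cbump \<in> H1"
  using nice_weak_gradient[OF nice_cbump] nice_cbump by (auto simp: H1_iff nice_def)

lemma cbump_n2: "0 < n2 cbump"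
proof (rule ccontr)
  assume "\<not> 0 < n2 cbump"
  then have "n2 cbump = 0" using n2_nonneg[of cbump] by linarith
  then have "AE x in lborel. bump x = 0" using n2_eq_0_iff[OF H1_L2[OF cbump_H1]] by (simp add: cbump_def)
  then have "(LBINT x. bump x) = (\<integral>x. 0 \<partial>(lborel :: (real^3) measure))"
    by (intro integral_cong_AE) (use test_function_L2(3)[OF bump_test] in auto)
  then show False using bump_integral_pos by simp
qed

lemma GN_pos:
  assumes t: "2 < t" "t < 6" shows "0 < GN t"
proof (rule ccontr)
  assume "\<not> 0 < GN t"
  then have "GN t = 0" using GN_Lnorm(2)[OF t cbump_H1] by simp
  then have "pw t cbump <= 0" using GN_pw[OF t cbump_H1] t by simp
  then have "pw t cbump = 0" using pw_nonneg[of t cbump] by linarith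
  then show False using pw_zero_imp[OF t cbump_H1] cbump_n2 by simp
qed

text \<open>Gagliardo-Nirenberg at the exponent 3 makes \<open>pw 3 u\<close> vanish with the
  gradient norm; any exponent strictly between 2 and 6 would serve.\<close>

lemma H1_grad_zero:
  assumes u: "u \<in> H1" and z: "grad_norm u = 0" shows "n2 u = 0"
proof (rule pw_zero_imp[of 3, OF _ _ u])
  have "pw 3 u <= 0" using GN_pw[of 3 u] u z by (simp add: gam_def)
  then show "pw 3 u = 0" using pw_nonneg[of 3 u] by linarith
qed auto

section \<open>A representation theorem\<close>

text \<open>The minimising sequence of the quadratic functional \<open>B v v / 2 - T v\<close> is Cauchy by the
  parallelogram law and represents \<open>T\<close> in the limit. The vector space operations are parameters
  because the lemma is applied to spaces of functions.\<close>

lemma Riesz_sequence: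
  fixes pl :: "'v => 'v => 'v" and sm :: "real => 'v => 'v" and B :: "'v => 'v => real" and T :: "'v => real"
  assumes ne: "z0 \<in> V" and add: "!!x y. x \<in> V ==> y \<in> V ==> pl x y \<in> V"
    and scale: "!!c x. x \<in> V ==> sm c x \<in> V"
    and Badd: "!!x y z. x \<in> V ==> y \<in> V ==> z \<in> V ==> B (pl x y) z = B x z + B y z"
    and Bscale: "!!c x z. x \<in> V ==> z \<in> V ==> B (sm c x) z = c * B x z"
    and Bsym: "!!x y. x \<in> V ==> y \<in> V ==> B x y = B y x"
    and Bpos: "!!x. x \<in> V ==> 0 <= B x x"
    and Tadd: "!!x y. x \<in> V ==> y \<in> V ==> T (pl x y) = T x + T y"
    and Tscale: "!!c x. x \<in> V ==> T (sm c x) = c * T x"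
    and Tb: "!!x. x \<in> V ==> \<bar>T x\<bar> <= k * sqrt (B x x)"
  obtains v :: "nat => 'v" where "!!n. v n \<in> V"
    "!!e. 0 < e ==> \<exists>N. \<forall>m\<ge>N. \<forall>n\<ge>N. B (pl (v m) (sm (-1) (v n))) (pl (v m) (sm (-1) (v n))) < e"
    "!!w. w \<in> V ==> (%n. B (v n) w) ----> T w"
proof -
  note simps = Badd Bscale Tadd Tscale add scale
  have Badd': "B z (pl x y) = B z x + B z y" if "x \<in> V" "y \<in> V" "z \<in> V" for x y z
    using that by (metis Badd Bsym add)
  have Bscale': "B z (sm c x) = c * B z x" if "x \<in> V" "z \<in> V" for c x z
    using that by (metis Bscale Bsym scale)
  define I where "I x = B x x / 2 - T x" for x
  have lower: "- (k^2) / 2 <= I x" if "x \<in> V" for x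
  proof -
    have "0 <= (sqrt (B x x) - k)^2" by simp
    then have "k * sqrt (B x x) <= (B x x + k^2) / 2" using Bpos[OF that] by (simp add: power2_diff mult_ac)
    then show ?thesis using Tb[OF that] by (simp add: I_def abs_le_iff)
  qed
  define I0 where "I0 = Inf (I ` V)"
  have bdd: "bdd_below (I ` V)" by (rule bdd_belowI[of _ "- (k^2) / 2"]) (use lower in auto)
  have I0: "I0 <= I x" if "x \<in> V" for x unfolding I0_def by (rule cInf_lower) (use that bdd in auto)
  have "\<exists>x\<in>V. I x < I0 + inverse (real (Suc n))" for n
    using cInf_lessD[of "I ` V" "I0 + inverse (real (Suc n))"] ne unfolding I0_def by auto
  then obtain v where v: "!!n. v n \<in> V" "!!n. I (v n) < I0 + inverse (real (Suc n))" by metis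
  show thesis
  proof (rule that[OF v(1)])
    fix e :: real assume "0 < e"
    then obtain N where N: "inverse (real (Suc N)) < e / 8" using reals_Archimedean[of "e/8"] by auto
    have "B (pl (v m) (sm (-1) (v n))) (pl (v m) (sm (-1) (v n))) < e" if mn: "m \<ge> N" "n \<ge> N" for m n
    proof -
      let ?d = "pl (v m) (sm (-1) (v n))" and ?c = "sm (1/2) (pl (v m) (v n))"
      have 1: "B ?d ?d = B (v m) (v m) - 2 * B (v m) (v n) + B (v n) (v n)"
        using v(1) by (simp add: simps Badd' Bscale' Bsym[of "v n" "v m"])
      have 2: "B ?c ?c = (B (v m) (v m) + 2 * B (v m) (v n) + B (v n) (v n)) / 4"
        using v(1) by (simp add: simps Badd' Bscale' Bsym[of "v n" "v m"] field_simps)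
      have 3: "T ?c = (T (v m) + T (v n)) / 2" using v(1) by (simp add: simps)
      have "I0 <= I ?c" using v(1) by (intro I0 add scale)
      then have "B ?d ?d / 4 <= I (v m) + I (v n) - 2 * I0" unfolding I_def 1 2 3 by (simp add: field_simps)
      also have "\<dots> < inverse (real (Suc m)) + inverse (real (Suc n))" using v(2)[of m] v(2)[of n] by linarith
      also have "\<dots> <= inverse (real (Suc N)) + inverse (real (Suc N))"
        using mn by (intro add_mono le_imp_inverse_le) auto
      finally show ?thesis using N by simp
    qed
    then show "\<exists>N. \<forall>m\<ge>N. \<forall>n\<ge>N. B (pl (v m) (sm (-1) (v n))) (pl (v m) (sm (-1) (v n))) < e" by blast
  next
    fix w assume w: "w \<in> V"
    let ?s = "%n. sqrt (inverse (real (Suc n)))"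
    have bnd: "\<bar>B (v n) w - T w\<bar> <= ?s n * (B w w / 2 + 1)" for n
    proof -
      have s: "0 < ?s n" "?s n * ?s n = inverse (real (Suc n))" by auto
      \<comment> \<open>Near minimality of \<open>v n\<close> against the competitor
        \<open>v n + c w\<close>. Taking \<open>c\<close> to be plus or minus \<open>?s n\<close>
        balances the quadratic term with the error \<open>1 / Suc n\<close>.\<close>
      have q: "0 <= c * (B (v n) w - T w) + c^2 / 2 * B w w + inverse (real (Suc n))" for c
      proof -
        have "I0 <= I (pl (v n) (sm c w))" using v(1) w by (intro I0 add scale)
        also have "\<dots> = I (v n) + c * (B (v n) w - T w) + c^2 / 2 * B w w"
          using v(1) w by (simp add: I_def simps Badd' Bscale' Bsym[of w "v n"] power2_eq_square field_simps)
        finally show ?thesis using v(2)[of n] by linarith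
      qed
      have "?s n * (B (v n) w - T w) <= ?s n * (?s n * (B w w / 2 + 1))"
        using q[of "- ?s n"] s(2) by (simp add: power2_eq_square algebra_simps)
      moreover have "?s n * (T w - B (v n) w) <= ?s n * (?s n * (B w w / 2 + 1))"
        using q[of "?s n"] s(2) by (simp add: power2_eq_square algebra_simps)
      ultimately have "B (v n) w - T w <= ?s n * (B w w / 2 + 1)" "T w - B (v n) w <= ?s n * (B w w / 2 + 1)"
        using s(1) by (simp_all only: mult_le_cancel_left_pos)
      then show ?thesis by linarith
    qed
    have lim0: "(%n. ?s n * (B w w / 2 + 1)) ----> 0"
    proof (rule tendsto_mult_left_zero)
      show "?s ----> 0" using tendsto_real_sqrt[OF LIMSEQ_inverse_real_of_nat] by simp
    qed
    have "(%n. B (v n) w - T w) ----> 0"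
      by (rule Lim_null_comparison[OF _ lim0], rule always_eventually) (simp only: real_norm_def bnd, blast)
    then show "(%n. B (v n) w) ----> T w" by (rule LIM_zero_cancel)
  qed
qed

section \<open>The modulus\<close>

text \<open>The modulus smoothed at its zero; subtracting \<open>d\<close> afterwards makes it
  vanish at 0, which keeps compositions square integrable.\<close>

definition reg_abs :: "real => complex => real" where "reg_abs d z = sqrt ((norm z)^2 + d^2)"

lemma reg_abs_ge: "norm z <= reg_abs d z" "0 <= d ==> d <= reg_abs d z"
  by (auto simp: reg_abs_def intro: real_le_rsqrt)

lemma reg_abs_le: "0 <= d ==> reg_abs d z <= norm z + d"
  unfolding reg_abs_def by (rule real_le_lsqrt) (auto simp: power2_sum)

lemma reg_abs_lipschitz: "\<bar>reg_abs d z - reg_abs d w\<bar> <= norm (z - w)"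
proof -
  have e: "reg_abs d z = norm (norm z, d)" for z by (simp add: reg_abs_def norm_Pair)
  have "\<bar>reg_abs d z - reg_abs d w\<bar> <= norm ((norm z, d) - (norm w, d))" unfolding e by (rule norm_triangle_ineq3)
  also have "\<dots> = \<bar>norm z - norm w\<bar>" by (simp add: norm_Pair)
  also have "\<dots> <= norm (z - w)" by (rule norm_triangle_ineq3)
  finally show ?thesis .
qed

lemma gderiv_reg_abs:
  assumes d: "0 < d" and g: "gderiv f H x"
  shows "gderiv (%x. reg_abs d (f x)) (%i. (f x \<bullet> H i) / reg_abs d (f x)) x"
proof -
  let ?L = "%v. \<Sum>i\<in>UNIV. v $ i *R H i"
  have p: "0 < (norm (f x))^2 + d^2" using d by (simp add: add_nonneg_pos)
  have 1: "((%x. f x \<bullet> f x + d^2) has_derivative (%v. f x \<bullet> ?L v + ?L v \<bullet> f x + 0)) (at x)"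
    using g unfolding gderiv_def by (intro has_derivative_add has_derivative_inner has_derivative_const)
  have 2: "(sqrt has_derivative (%y. y * (inverse (sqrt (f x \<bullet> f x + d^2)) / 2))) (at (f x \<bullet> f x + d^2))"
  proof -
    have "(%y. y * (inverse (sqrt (f x \<bullet> f x + d^2)) / 2)) = (*) (inverse (sqrt (f x \<bullet> f x + d^2)) / 2)"
      by (simp add: fun_eq_iff mult.commute)
    then show ?thesis using DERIV_real_sqrt[of "f x \<bullet> f x + d^2"] p
      by (simp add: has_field_derivative_def power2_norm_eq_inner)
  qed
  have 3: "((%x. reg_abs d (f x)) has_derivative (%v. (f x \<bullet> ?L v + ?L v \<bullet> f x) * (inverse (sqrt (f x \<bullet> f x + d^2)) / 2))) (at x)"
    using diff_chain_at[OF 1 2] by (simp add: o_def reg_abs_def power2_norm_eq_inner)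
  have 4: "(f x \<bullet> ?L v + ?L v \<bullet> f x) * (inverse (sqrt (f x \<bullet> f x + d^2)) / 2) = (\<Sum>i\<in>UNIV. v $ i *R ((f x \<bullet> H i) / reg_abs d (f x)))" for v
  proof -
    have e: "f x \<bullet> ?L v = (\<Sum>i\<in>UNIV. v $ i * (f x \<bullet> H i))" by (simp add: inner_sum_right)
    have r: "reg_abs d (f x) = sqrt (f x \<bullet> f x + d^2)" by (simp add: reg_abs_def power2_norm_eq_inner)
    have "(f x \<bullet> ?L v + ?L v \<bullet> f x) * (inverse (sqrt (f x \<bullet> f x + d^2)) / 2) = (f x \<bullet> ?L v) * inverse (sqrt (f x \<bullet> f x + d^2))"
      unfolding inner_commute[of "?L v" "f x"] by simp
    also have "\<dots> = (\<Sum>i\<in>UNIV. v $ i * (f x \<bullet> H i) * inverse (sqrt (f x \<bullet> f x + d^2)))"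
      unfolding e by (rule sum_distrib_right)
    finally show ?thesis unfolding r divide_inverse real_scaleR_def mult.assoc[symmetric] .
  qed
  show ?thesis using 3 unfolding gderiv_def 4 .
qed

lemma norm_vec_le: "(!!i. norm (x $ i) <= norm (y $ i)) ==> norm (x :: complex^3) <= norm (y :: complex^3)"
  by (simp add: norm_vec_def L2_set_mono)

text \<open>The gradient of \<open>reg_abs d\<close> of a function with value \<open>z\<close> and
  gradient \<open>w\<close>. For \<open>d = 0\<close> it becomes the gradient of the modulus, equal
  to 0 on the zero set.\<close>

definition gabs :: "real => complex => complex^3 => complex^3" where
  "gabs d z w = (\<chi> i. cor ((z \<bullet> w $ i) / reg_abs d z))"

lemma gabs_norm: "norm (gabs d z w) <= norm w"
proof (rule norm_vec_le)
  fix i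
  have "\<bar>(z \<bullet> w $ i)\<bar> <= norm z * norm (w $ i)" by (rule Cauchy_Schwarz_ineq2)
  also have "\<dots> <= reg_abs d z * norm (w $ i)" by (intro mult_right_mono reg_abs_ge) auto
  finally have "\<bar>(z \<bullet> w $ i)\<bar> <= reg_abs d z * norm (w $ i)" .
  then show "norm (gabs d z w $ i) <= norm (w $ i)"
    using order_trans[OF norm_ge_zero reg_abs_ge(1)[of z d]]
    by (cases "reg_abs d z = 0") (auto simp: gabs_def abs_divide divide_le_eq mult.commute simp flip: of_real_divide)
qed

lemma gabs_diff: "gabs d z w - gabs d z w' = gabs d z (w - w')"
  by (simp add: gabs_def vec_eq_iff inner_diff_right diff_divide_distrib)

lemma reg_abs_measurable: "reg_abs d \<in> bmeas"
  unfolding reg_abs_def by (intro borel_measurable_continuous_onI continuous_intros)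

lemma axis_continuous:
  fixes f :: "real => complex"
  assumes "continuous_on UNIV f" shows "continuous_on UNIV (%y. axis i (f y) :: complex^3)"
  unfolding axis_def
proof (rule continuous_on_vec_lambda)
  show "continuous_on UNIV (%y. if j = i then f y else 0)" for j using assms by (cases "j = i") auto
qed

lemma gabs_measurable [measurable]:
  assumes [measurable]: "v \<in> bmeas" "w \<in> bmeas"
  shows "(%x. gabs d (v x) (w x :: complex^3)) \<in> bmeas"
proof -
  have c: "(%x. w x $ i) \<in> bmeas" for i
    by (rule borel_measurable_continuous_on[OF _ assms(2), of "%y. y $ i"]) (intro continuous_intros)
  have "(%x. (v x \<bullet> w x $ i) / reg_abs d (v x)) \<in> bmeas" for i
    by (intro borel_measurable_divide borel_measurable_inner assms c measurable_compose[OF assms(1) reg_abs_measurable])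
  then have *: "(%x. axis i (cor ((v x \<bullet> w x $ i) / reg_abs d (v x))) :: complex^3) \<in> bmeas" for i
    by (intro borel_measurable_continuous_on[OF axis_continuous[OF continuous_on_of_real[OF continuous_on_id]]])
  have eq: "gabs d (v x) (w x) = (\<Sum>i\<in>UNIV. axis i (cor ((v x \<bullet> w x $ i) / reg_abs d (v x))))" for x
    by (simp add: vec_eq_iff gabs_def axis_def if_distrib cong: if_cong)
  show ?thesis unfolding eq by (intro borel_measurable_sum *)
qed

lemma nice_reg_abs:
  assumes n: "nice f G" and d: "0 < d"
  shows "nice (%x. cor (reg_abs d (f x) - d)) (%x. gabs d (f x) (G x))"
proof -
  have gd: "!!x. gderiv f (%i. G x $ i) x" and Gc: "continuous_on UNIV G" and fL: "f \<in> L2" and GL: "G \<in> L2"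
    using n by (auto simp: nice_def)
  have [measurable]: "f \<in> bmeas" "G \<in> bmeas" using fL GL by (auto intro: L2_measurable)
  have fc: "continuous_on UNIV f" by (rule gderiv_continuous[OF gd])
  have c: "gderiv (%x. - d) (%i. 0) x" for x by (simp add: gderiv_def)
  have 1: "gderiv (%x. cor (reg_abs d (f x) - d)) (%i. gabs d (f x) (G x) $ i) x" for x
    using gderiv_bounded_linear[OF bounded_linear_of_real[where 'a=complex] gderiv_add[OF gderiv_reg_abs[OF d gd] c]]
    by (simp add: gabs_def)
  have 2: "continuous_on UNIV (%x. gabs d (f x) (G x))"
    unfolding gabs_def reg_abs_def
    by (intro continuous_on_vec_lambda continuous_intros fc Gc) (use d in \<open>auto simp: add_nonneg_eq_0_iff\<close>)
  have 3: "(%x. gabs d (f x) (G x)) \<in> L2" by (rule L2_bound1(1)[OF GL]) (auto simp: gabs_norm)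
  have "\<bar>reg_abs d (f x) - d\<bar> <= norm (f x)" for x
    using reg_abs_ge(2)[of d "f x"] reg_abs_le[of d "f x"] d by auto
  then have 4: "(%x. cor (reg_abs d (f x) - d)) \<in> L2"
    by (intro L2_bound1(1)[OF fL]) (auto simp: reg_abs_def simp del: of_real_diff)
  from 1 2 3 4 show ?thesis by (simp add: nice_def)
qed

text \<open>Closedness of the weak gradient along mollifications. The field depends on the function
  and on its gradient, so its error is split: contraction of \<open>gabs\<close> in the gradient,
  then dominated convergence in the function.\<close>

lemma wg_reg_abs:
  assumes u: "u \<in> L2" and w: "wgrad u g" and d: "0 < d"
  shows "wgrad (%x. cor (reg_abs d (u x) - d)) (%x. gabs d (u x) (g x))"
proof -
  note gL = wgD(1)[OF w]
  let ?P = "%z. cor (reg_abs d z - d)"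
  obtain r where r: "strict_mono r" "AE x in lborel. (%n. conv (mol (r n)) u x) ----> u x"
    using L2_AE_subseq[OF conv_mol_L2[OF u] u conv_mol_tendsto[OF u]] by blast
  define f where "f n = conv (mol (r n)) u" for n
  define G where "G n = conv (mol (r n)) g" for n
  have L: "f n \<in> L2" "G n \<in> L2" for n by (simp_all add: f_def G_def conv_mol_L2 u gL)
  have lim: "(%n. n2 (%x. f n x - u x)) ----> 0" "(%n. n2 (%x. G n x - g x)) ----> 0"
    using LIMSEQ_subseq_LIMSEQ[OF conv_mol_tendsto[OF u] r(1)] LIMSEQ_subseq_LIMSEQ[OF conv_mol_tendsto[OF gL] r(1)]
    by (simp_all add: f_def G_def o_def)
  note [measurable] = L2_measurable[OF u] L2_measurable[OF gL] L2_measurable[OF L(1)] L2_measurable[OF L(2)] reg_abs_measurable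
  have nf: "nice (%x. ?P (f n x)) (%x. gabs d (f n x) (G n x))" for n
    unfolding f_def G_def by (rule nice_reg_abs[OF wg_mollify[OF u w] d])
  then have PL: "(%x. ?P (f n x)) \<in> L2" and GL: "(%x. gabs d (f n x) (G n x)) \<in> L2" for n by (simp_all add: nice_def)
  have b: "norm (?P z - ?P z') <= 1 * norm (z - z')" for z z' using reg_abs_lipschitz[of d z z'] by (simp flip: of_real_diff)
  have bd: "(%x. ?P (f n x) - ?P (u x)) \<in> L2" "n2 (%x. ?P (f n x) - ?P (u x)) <= 1 * n2 (%x. f n x - u x)" for n
    by (rule L2_bound[OF L2_diff[OF L(1) u] _ AE_I2[OF b]]; simp)+
  have uL: "(%x. ?P (u x)) \<in> L2" using L2_diff[OF PL[of 0] bd(1)[of 0]] by simp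
  have dg: "norm (gabs d (f n x) (G n x) - gabs d (f n x) (g x)) <= 1 * norm (G n x - g x)" for n x
    using gabs_norm[of d "f n x" "G n x - g x"] by (simp add: gabs_diff)
  have d2: "n2 (%x. gabs d (f n x) (G n x) - gabs d (f n x) (g x)) <= 1 * n2 (%x. G n x - g x)" for n
    by (rule L2_bound(2)[OF L2_diff[OF L(2) gL] _ AE_I2[OF dg]]) simp_all
  have l: "AE x in lborel. (%n. gabs d (f n x) (g x)) ----> gabs d (u x) (g x)"
    using r(2) unfolding f_def[symmetric]
  proof eventually_elim
    case (elim x)
    then show ?case unfolding gabs_def reg_abs_def
      by (intro vec_tendstoI) (auto intro!: tendsto_intros simp: add_nonneg_eq_0_iff d less_imp_neq[symmetric])
  qed
  have "!!n. (%x. gabs d (f n x) (g x)) \<in> bmeas" by measurable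
  note D = L2_dominated[OF this gL _ l]
  have D1: "(%x. gabs d (u x) (g x)) \<in> L2" "!!n. (%x. gabs d (f n x) (g x)) \<in> L2"
    "(%n. n2 (%x. gabs d (f n x) (g x) - gabs d (u x) (g x))) ----> 0"
    by (rule D; simp add: gabs_norm)+
  show ?thesis
  proof (rule wg_closed[OF nice_weak_gradient[OF nf] PL uL D1(1)])
    show "(%n. n2 (%x. ?P (f n x) - ?P (u x))) ----> 0"
      by (rule tendsto_sandwich[OF _ _ tendsto_const lim(1)]) (use bd(2) in auto)
    have "(%n. n2 (%x. G n x - g x) + n2 (%x. gabs d (f n x) (g x) - gabs d (u x) (g x))) ----> 0"
      using tendsto_add[OF lim(2) D1(3)] by simp
    then show "(%n. n2 (%x. gabs d (f n x) (G n x) - gabs d (u x) (g x))) ----> 0"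
      by (rule tendsto_sandwich[OF _ _ tendsto_const, rotated 2])
        (use order_trans[OF n2_triangle3[OF GL D1(2,1)] add_right_mono[OF d2]] in \<open>auto simp: always_eventually\<close>)
  qed
qed

text \<open>The regularisation parameter tends to 0 with majorants \<open>|u|\<close> and
  \<open>|g|\<close>; the pointwise bound on \<open>h\<close> is the diamagnetic inequality.\<close>

lemma wg_modulus:
  assumes u: "u \<in> L2" and w: "wgrad u g"
  obtains h where "wgrad (%x. cor (norm (u x))) h" "!!x. norm (h x) <= norm (g x)"
proof -
  note gL = wgD(1)[OF w]
  have [measurable]: "u \<in> bmeas" "g \<in> bmeas" using u gL by (auto intro: L2_measurable)
  define e where "e n = inverse (real (Suc n))" for n
  have e0: "e ----> 0" unfolding e_def by (rule LIMSEQ_inverse_real_of_nat)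
  let ?h = "%x. gabs 0 (u x) (g x)"
  have d: "0 < e n" for n by (simp add: e_def)
  have lim: "(%n. reg_abs (e n) z) ----> norm z" for z
  proof -
    have "(%n. reg_abs (e n) z) ----> sqrt ((norm z)^2 + 0\<^sup>2)"
      unfolding reg_abs_def by (intro tendsto_intros e0)
    then show ?thesis by simp
  qed
  have b: "\<bar>reg_abs (e n) (u x) - e n\<bar> <= norm (u x)" for x n
    using reg_abs_ge(2)[of "e n" "u x"] reg_abs_le[of "e n" "u x"] d[of n] by simp
  have m: "(%x. cor (reg_abs (e n) (u x) - e n)) \<in> bmeas" for n
    unfolding reg_abs_def by measurable
  have l1: "(%n. cor (reg_abs (e n) (u x) - e n)) ----> cor (norm (u x))" for x
    using tendsto_of_real[OF tendsto_diff[OF lim[of "u x"] e0], where 'a=complex] by simp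
  note D = L2_dominated[OF m u _ AE_I2[OF l1]]
  have D1: "(%x. cor (norm (u x))) \<in> L2" "!!n. (%x. cor (reg_abs (e n) (u x) - e n)) \<in> L2"
    "(%n. n2 (%x. cor (reg_abs (e n) (u x) - e n) - cor (norm (u x)))) ----> 0"
    by (rule D; use b in \<open>simp del: of_real_diff\<close>)+
  have l2: "(%n. gabs (e n) (u x) (g x)) ----> ?h x" for x
  proof (cases "u x = 0")
    case True then show ?thesis by (simp add: gabs_def)
  next
    case False
    then show ?thesis
      unfolding gabs_def by (intro vec_tendstoI) (auto intro!: tendsto_intros tendsto_divide lim simp: reg_abs_def[of 0])
  qed
  have "!!n. (%x. gabs (e n) (u x) (g x)) \<in> bmeas" by measurable
  note E = L2_dominated[OF this gL _ AE_I2[OF l2]]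
  have E1: "?h \<in> L2" "(%n. n2 (%x. gabs (e n) (u x) (g x) - ?h x)) ----> 0"
    by (rule E; simp add: gabs_norm)+
  have "wgrad (%x. cor (norm (u x))) ?h"
    by (rule wg_closed[OF wg_reg_abs[OF u w d] D1(2,1) E1(1) D1(3) E1(2)])
  then show thesis by (rule that) (rule gabs_norm)
qed

lemma H1_modulus:
  assumes u: "u \<in> H1"
  shows "(%x. cor (norm (u x))) \<in> H1" "grad_norm (%x. cor (norm (u x))) <= grad_norm u"
proof -
  note uL = H1_L2[OF u]
  have [measurable]: "u \<in> bmeas" by (rule L2_measurable[OF uL])
  have mL: "(%x. cor (norm (u x))) \<in> L2" by (rule L2_bound1(1)[OF uL]) auto
  obtain h where h: "wgrad (%x. cor (norm (u x))) h" "!!x. norm (h x) <= norm (weak_grad u x)"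
    using wg_modulus[OF uL H1_wg[OF u]] by blast
  show "(%x. cor (norm (u x))) \<in> H1" using H1I[OF mL h(1)] .
  have "n2 h <= n2 (weak_grad u)"
    by (rule L2_bound1(2)[OF weak_grad_L2[OF u] L2_measurable[OF wgD(1)[OF h(1)]]]) (use h(2) in auto)
  then show "grad_norm (%x. cor (norm (u x))) <= grad_norm u"
    unfolding grad_norm_wg[OF mL h(1)] by (simp add: grad_norm_eq)
qed

section \<open>Rotations\<close>

lemma orthogonal_distr_lborel:
  fixes R :: "real^3 => real^3"
  assumes R: "orth R"
  shows "distr lborel borel R = lborel"
proof (rule sym, rule lborel_eqI)
  have lin: "linear R" using R by (simp add: orthogonal_transformation_linear)
  have [measurable]: "R \<in> bmeas"
    by (rule borel_measurable_continuous_onI[OF linear_continuous_on[OF linear_conv_bounded_linear[THEN iffD1, OF lin]]])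
  have Ri: "orth (inv R)" by (rule orthogonal_transformation_inv[OF R])
  have bij: "bij R" by (rule orthogonal_transformation_bij[OF R])
  fix l u :: "real^3" assume le: "!!b. b \<in> Basis ==> l \<bullet> b <= u \<bullet> b"
  have m: "box l u \<in> lmeasurable" by simp
  have v: "R -` box l u = inv R ` box l u" using bij by (simp add: bij_vimage_eq_inv_image)
  have b: "R -` box l u \<in> sets borel" using measurable_sets[of R borel borel "box l u"] by simp
  have "emeasure (distr lborel borel R) (box l u) = emeasure lborel (R -` box l u)"
    by (subst emeasure_distr) auto
  also have "\<dots> = emeasure lebesgue (inv R ` box l u)" using b by (simp add: v)
  also have "\<dots> = ennreal (measure lebesgue (inv R ` box l u))"
    using measurable_orthogonal_image[OF Ri m] by (simp add: emeasure_eq_measure2)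
  also have "\<dots> = ennreal (measure lebesgue (box l u))" by (simp add: measure_orthogonal_image[OF Ri m])
  also have "\<dots> = (\<Prod>b\<in>Basis. (u - l) \<bullet> b)" using le by (simp add: measure_lborel_box_eq)
  finally show "emeasure (distr lborel borel R) (box l u) = (\<Prod>b\<in>Basis. (u - l) \<bullet> b)" .
qed simp

lemma orthogonal_measurable:
  fixes R :: "real^3 => real^3"
  assumes R: "orth R" shows "R \<in> bmeas"
  by (rule borel_measurable_continuous_onI[OF linear_continuous_on[OF linear_conv_bounded_linear[THEN iffD1, OF orthogonal_transformation_linear[OF R]]]])

lemma orthogonal_integral:
  fixes R :: "real^3 => real^3" and f :: "real^3 => 'b::euclidean_space"
  assumes R: "orth R" and f: "f \<in> bmeas"
  shows "(LBINT x. f (R x)) = (LBINT x. f x)"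
    "integrable lborel f ==> integrable lborel (%x. f (R x))"
proof -
  note m = orthogonal_measurable[OF R]
  show "(LBINT x. f (R x)) = (LBINT x. f x)"
    using integral_distr[of R lborel borel f] m f by (simp add: orthogonal_distr_lborel[OF R])
  show "integrable lborel f ==> integrable lborel (%x. f (R x))"
    using integrable_distr_eq[of R lborel borel f] m f by (simp add: orthogonal_distr_lborel[OF R])
qed

lemma orthogonal_AE:
  assumes R: "orth (R :: real^3 => real^3)" and ae: "AE x in lborel. Q x"
  shows "AE x in lborel. Q (R x)"
proof -
  from ae obtain N where N: "{x. \<not> Q x} \<subseteq> N" "N \<in> sets lborel" "emeasure lborel N = 0"
    by (auto elim!: AE_E)
  have "emeasure lborel (R -` N) = emeasure (distr lborel borel R) N"
    using N orthogonal_measurable[OF R] by (subst emeasure_distr) auto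
  also have "\<dots> = 0" using N by (simp add: orthogonal_distr_lborel[OF R])
  finally show ?thesis
    using N measurable_sets[OF orthogonal_measurable[OF R], of N]
    by (intro AE_I[of _ _ "R -` N"]) auto
qed

lemma L2_rotate:
  fixes R :: "real^3 => real^3" and f :: "real^3 => 'b::euclidean_space"
  assumes R: "orth R" and f: "f \<in> L2"
  shows "(%x. f (R x)) \<in> L2" "n2 (%x. f (R x)) = n2 f"
proof -
  have [measurable]: "f \<in> bmeas" "R \<in> bmeas"
    using f L2_measurable orthogonal_measurable[OF R] by auto
  show "(%x. f (R x)) \<in> L2" unfolding L2_def
    using orthogonal_integral(2)[OF R _ L2_integrable[OF f]] by simp
  show "n2 (%x. f (R x)) = n2 f" unfolding n2_def
    using orthogonal_integral(1)[OF R, of "%x. (norm (f x))^2"] by simp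
qed

text \<open>The transpose of \<open>R\<close> applied to a complex vector, as it appears in the
  chain rule for the composition of \<open>u\<close> with \<open>R\<close>.\<close>

definition rgrad :: "(real^3 => real^3) => complex^3 => complex^3" where
  "rgrad R w = (\<chi> i. \<Sum>j\<in>UNIV. (R (axis i 1)) $ j *R w $ j)"

lemma rgrad_inner:
  assumes R: "orth R" shows "rgrad R a \<bullet> rgrad R b = a \<bullet> b"
proof -
  let ?c = "%i j. R (axis i 1) $ j"
  \<comment> \<open>The coefficients of \<open>R\<close> are the transposed ones of
    \<open>inv R\<close>, which is orthogonal too; this gives the orthogonality relations when the
    first index is summed.\<close>
  have o: "(\<Sum>i\<in>UNIV. ?c i j * ?c i k) = (if j = k then 1 else 0)" for j k
  proof -
    have Ri: "orth (inv R)" by (rule orthogonal_transformation_inv[OF R])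
    have c: "?c i j = inv R (axis j 1) $ i" for i j
    proof -
      have "?c i j = R (axis i 1) \<bullet> axis j 1" by (simp add: inner_axis)
      also have "axis j 1 = R (inv R (axis j 1))" using orthogonal_transformation_surj[OF R] by (simp add: surj_f_inv_f)
      also have "R (axis i 1) \<bullet> R (inv R (axis j 1)) = axis i 1 \<bullet> inv R (axis j 1)" using R by (simp add: orthogonal_transformation_def)
      finally show ?thesis by (simp add: inner_axis')
    qed
    have "(\<Sum>i\<in>UNIV. ?c i j * ?c i k) = inv R (axis j 1) \<bullet> inv R (axis k 1)" unfolding c by (simp add: inner_vec_def)
    also have "\<dots> = axis j 1 \<bullet> (axis k 1 :: real^3)" using Ri by (simp add: orthogonal_transformation_def)
    finally show ?thesis by (simp add: inner_axis_axis)
  qed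
  have "rgrad R a \<bullet> rgrad R b = (\<Sum>i\<in>UNIV. \<Sum>k\<in>UNIV. \<Sum>j\<in>UNIV. (?c i j * ?c i k) * (a $ j \<bullet> b $ k))"
    by (simp add: rgrad_def inner_vec_def inner_sum_left inner_sum_right sum_distrib_left mult_ac)
  also have "\<dots> = (\<Sum>k\<in>UNIV. \<Sum>j\<in>UNIV. \<Sum>i\<in>UNIV. (?c i j * ?c i k) * (a $ j \<bullet> b $ k))"
    by (subst sum.swap, rule sum.cong[OF refl], subst sum.swap, rule refl)
  also have "\<dots> = (\<Sum>k\<in>UNIV. \<Sum>j\<in>UNIV. (if j = k then 1 else 0) * (a $ j \<bullet> b $ k))"
    by (simp add: o flip: sum_distrib_right)
  also have "\<dots> = a \<bullet> b" by (simp add: inner_vec_def if_distrib[of "%c. c * _"] cong: if_cong)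
  finally show ?thesis .
qed

lemma rgrad_norm: "orth R ==> norm (rgrad R a) = norm a"
  by (simp add: norm_eq_sqrt_inner rgrad_inner)

lemma rgrad_diff: "rgrad R a - rgrad R b = rgrad R (a - b)"
  by (simp add: rgrad_def vec_eq_iff scaleR_diff_right sum_subtractf)

lemma rgrad_continuous: "continuous_on UNIV (rgrad R)"
  unfolding rgrad_def by (intro continuous_on_vec_lambda continuous_intros)

lemma L2_rgrad:
  assumes R: "orth R" and g: "g \<in> L2"
  shows "(%x. rgrad R (g (R x))) \<in> L2" "n2 (%x. rgrad R (g (R x))) = n2 g"
proof -
  have 1: "(%x. rgrad R (g (R x))) \<in> bmeas"
    by (rule borel_measurable_continuous_on[OF rgrad_continuous L2_measurable[OF L2_rotate(1)[OF R g]]])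
  show "(%x. rgrad R (g (R x))) \<in> L2" by (rule L2_bound1(1)[OF L2_rotate(1)[OF R g] 1]) (simp add: rgrad_norm[OF R])
  show "n2 (%x. rgrad R (g (R x))) = n2 g"
    using L2_rotate(2)[OF R g] by (simp add: n2_def rgrad_norm[OF R])
qed

lemma wg_rotate:
  assumes R: "orth R" and u: "u \<in> L2" and w: "wgrad u g"
  shows "wgrad (%x. u (R x)) (%x. rgrad R (g (R x)))"
proof (rule wg_closed)
  note gL = wgD(1)[OF w]
  let ?f = "%n. conv (mol n) u" and ?G = "%n. conv (mol n) g"
  have bl: "bounded_linear R" using orthogonal_transformation_linear[OF R] by (simp add: linear_conv_bounded_linear)
  have "nice (%x. ?f n (R x)) (%x. rgrad R (?G n (R x)))" for n
    unfolding nice_def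
  proof safe
    have n: "nice (?f n) (?G n)" by (rule wg_mollify[OF u w])
    fix x
    have 1: "(?f n has_derivative (%v. \<Sum>j\<in>UNIV. v $ j *R ?G n (R x) $ j)) (at (R x))"
      using n by (simp add: nice_def gderiv_def)
    have "((%x. ?f n (R x)) has_derivative (%v. \<Sum>j\<in>UNIV. R v $ j *R ?G n (R x) $ j)) (at x)"
      using diff_chain_at[OF bounded_linear_imp_has_derivative[OF bl] 1] by (simp add: o_def)
    moreover have "(\<Sum>j\<in>UNIV. R v $ j *R ?G n (R x) $ j) = (\<Sum>i\<in>UNIV. v $ i *R rgrad R (?G n (R x)) $ i)" for v
    proof -
      have "v = (\<Sum>i\<in>UNIV. v $ i *R axis i 1)"
        using basis_expansion[of v] by (simp add: scalar_mult_eq_scaleR)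
      then have "R v = (\<Sum>i\<in>UNIV. v $ i *R R (axis i 1))"
        using linear_sum[OF orthogonal_transformation_linear[OF R], of "%i. v $ i *R axis i 1" UNIV]
        by (simp add: linear_scale[OF orthogonal_transformation_linear[OF R]])
      then have "(\<Sum>j\<in>UNIV. R v $ j *R ?G n (R x) $ j) = (\<Sum>j\<in>UNIV. \<Sum>i\<in>UNIV. v $ i *R (R (axis i 1) $ j *R ?G n (R x) $ j))"
        by (simp add: scaleR_sum_left)
      also have "\<dots> = (\<Sum>i\<in>UNIV. \<Sum>j\<in>UNIV. v $ i *R (R (axis i 1) $ j *R ?G n (R x) $ j))" by (rule sum.swap)
      finally show ?thesis by (simp add: rgrad_def scaleR_sum_right)
    qed
    ultimately show "gderiv (%x. ?f n (R x)) (%i. rgrad R (?G n (R x)) $ i) x" by (simp add: gderiv_def)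
    show "continuous_on UNIV (%x. rgrad R (?G n (R x)))"
      by (rule continuous_on_compose2[OF rgrad_continuous continuous_on_compose2[OF conv_continuous[OF mol_test gL] linear_continuous_on[OF bl]]]) auto
  qed (use L2_rotate(1)[OF R conv_mol_L2[OF u]] L2_rgrad(1)[OF R conv_mol_L2[OF gL]] in auto)
  then show "wgrad (%x. ?f n (R x)) (%x. rgrad R (?G n (R x)))" for n by (rule nice_weak_gradient)
  show "(%n. n2 (%x. ?f n (R x) - u (R x))) ----> 0"
    using conv_mol_tendsto[OF u] L2_rotate(2)[OF R L2_diff[OF conv_mol_L2[OF u] u]] by simp
  show "(%n. n2 (%x. rgrad R (?G n (R x)) - rgrad R (g (R x)))) ----> 0"
    using conv_mol_tendsto[OF gL] L2_rgrad(2)[OF R L2_diff[OF conv_mol_L2[OF gL] gL]] by (simp add: rgrad_diff)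
qed (use L2_rotate(1)[OF R conv_mol_L2[OF u]] L2_rotate(1)[OF R u] L2_rgrad(1)[OF R wgD(1)[OF w]] in auto)

section \<open>Radial functions\<close>

lemma emeasure_cball3: "0 <= r ==> emeasure lborel (cball (0::real^3) r) = ennreal (vol1 * r ^ 3)"
  by (simp add: emeasure_cball vol1_def content_ball)

text \<open>Both measures give the half line up to \<open>a >= 0\<close> the volume
  \<open>vol1 * a ^ 3\<close> of a ball, the density side by the fundamental theorem of calculus,
  and half lines generate the Borel sets. The constant \<open>3 * vol1\<close> is the area of the
  unit sphere.\<close>

lemma polar_distr:
  "distr lborel borel (norm :: real^3 => real) = density lborel (%r. ennreal (3 * vol1 * r^2) * indicator {0..} r)"
proof (rule measure_eqI_generator_eq[where \<Omega>=UNIV and E="range (%a::real. {..a})" and A="%i. {..real i}"])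
  show "Int_stable (range (%a::real. {..a}))" by (auto simp: Int_stable_def)
  show "sets (distr lborel borel (norm :: real^3 => real)) = sigma_sets UNIV (range (%a::real. {..a}))"
    "sets (density lborel (%r. ennreal (3 * vol1 * r^2) * indicator {0..} r)) = sigma_sets UNIV (range (%a::real. {..a}))"
    by (simp_all add: borel_eq_atMost)
  have a: "emeasure (distr lborel borel (norm :: real^3 => real)) {..a} = (if a < 0 then 0 else ennreal (vol1 * a ^ 3))" for a
  proof -
    have "emeasure (distr lborel borel (norm :: real^3 => real)) {..a} = emeasure lborel ((norm :: real^3 => real) -` {..a})"
      by (subst emeasure_distr) auto
    also have "(norm :: real^3 => real) -` {..a} = cball 0 a" by auto
    finally show ?thesis by (simp add: emeasure_cball3)
  qed
  have b: "emeasure (density lborel (%r. ennreal (3 * vol1 * r^2) * indicator {0..} r)) {..a} = (if a < 0 then 0 else ennreal (vol1 * a ^ 3))" for a :: real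
  proof (cases "a < 0")
    case True
    have "(NN r. ennreal (3 * vol1 * r^2) * indicator {0..} r * indicator {..a} r) = (\<integral>\<^sup>+r. 0 \<partial>(lborel::real measure))"
      by (rule nn_integral_cong) (use True in \<open>auto split: split_indicator\<close>)
    then show ?thesis using True by (simp add: emeasure_density)
  next
    case False
    have "emeasure (density lborel (%r. ennreal (3 * vol1 * r^2) * indicator {0..} r)) {..a}
        = (NN r. ennreal (3 * vol1 * r^2) * indicator {0..a} r)"
      by (subst emeasure_density) (auto intro!: nn_integral_cong split: split_indicator)
    also have "\<dots> = ennreal (vol1 * a ^ 3 - vol1 * 0 ^ 3)"
    proof (rule nn_integral_FTC_Icc)
      show "DERIV (%r. vol1 * r ^ 3) r :> 3 * vol1 * r^2" for r
        by (auto intro!: derivative_eq_intros)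
    qed (use False vol1_pos in auto)
    finally show ?thesis using False by simp
  qed
  show "emeasure (distr lborel borel (norm :: real^3 => real)) X = emeasure (density lborel (%r. ennreal (3 * vol1 * r^2) * indicator {0..} r)) X"
    if "X \<in> range (%a::real. {..a})" for X using that a b by auto
  show "(\<Union>i. {..real i}) = UNIV" using real_arch_simple by auto
  show "emeasure (distr lborel borel (norm :: real^3 => real)) {..real i} \<noteq> \<infinity>" for i by (simp add: a)
qed auto

lemma polar:
  assumes [measurable]: "h \<in> bmeas"
  shows "(NN x. h (norm (x::real^3))) = (NN r. ennreal (3 * vol1 * r^2) * indicator {0..} r * h r)"
proof -
  have "(NN x. h (norm (x::real^3))) = (\<integral>\<^sup>+r. h r \<partial>(distr lborel borel (norm :: real^3 => real)))"
    by (subst nn_integral_distr) auto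
  also have "\<dots> = (NN r. ennreal (3 * vol1 * r^2) * indicator {0..} r * h r)"
    unfolding polar_distr by (subst nn_integral_density) auto
  finally show ?thesis .
qed

text \<open>Radial symmetry at every point, for continuous functions such as mollifications;
  \<open>radial\<close> asks for it almost everywhere.\<close>

definition xrad :: "(real^3 => 'b) => bool" where
  "xrad f \<longleftrightarrow> (\<forall>x y. norm x = norm y \<longrightarrow> f x = f y)"

definition e1 :: "real^3" where "e1 = axis 1 1"

lemma norm_e1 [simp]: "norm e1 = 1" by (simp add: e1_def)

lemma xrad_e1: "xrad f ==> f x = f (norm x *R e1)"
  unfolding xrad_def by (metis norm_e1 norm_scaleR abs_norm_cancel mult.right_neutral)

text \<open>Along the ray, Cauchy-Schwarz bounds the squared increment by \<open>s - r\<close> times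
  the integral of the squared radial derivative. On \<open>{r..s}\<close> the polar weight
  \<open>3 * vol1 * t^2\<close> is at least its value at \<open>r\<close>, which turns that integral
  into a part of the gradient norm.\<close>

lemma nice_radial_Hoelder:
  fixes F :: "real^3 => complex"
  assumes n: "nice F G" and rad: "xrad F" and r: "0 < r" "r <= s"
  shows "(norm (F (s *R e1) - F (r *R e1)))^2 <= (s - r) / (3 * vol1 * r^2) * (n2 G)^2"
proof -
  have gd: "!!x. gderiv F (%i. G x $ i) x" and Gc: "continuous_on UNIV G" and GL: "G \<in> L2"
    using n by (auto simp: nice_def)
  let ?h = "%t. F (t *R e1)"
  have line: "((%t. F (t *R y)) has_vector_derivative (\<Sum>i\<in>UNIV. y $ i *R G (t *R y) $ i)) (at t)" for t y
  proof -
    have "((%t. t *R y) has_derivative (%h. h *R y)) (at t)" by (auto intro!: derivative_eq_intros)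
    from diff_chain_at[OF this gd[of "t *R y", unfolded gderiv_def]]
    show ?thesis by (simp add: has_vector_derivative_def o_def scaleR_sum_right)
  qed
  have G1: "(\<Sum>i\<in>UNIV. e1 $ i *R G x $ i) = G x $ 1" for x
    unfolding e1_def by (rule gderiv_sum_axis)
  have d: "(?h has_vector_derivative G (t *R e1) $ 1) (at t)" for t
    using line[of e1 t] unfolding G1 by simp
  define gamm where "gamm t = norm (G (t *R e1) $ 1)" for t
  have gc: "continuous_on UNIV (%t. G (t *R e1) $ 1)"
    by (intro continuous_intros continuous_on_compose2[OF Gc]) auto
  have [measurable]: "gamm \<in> bmeas" unfolding gamm_def
    by (intro borel_measurable_continuous_onI continuous_intros gc)
  have [measurable]: "G \<in> bmeas" by (rule borel_measurable_continuous_onI[OF Gc])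
  \<comment> \<open>By symmetry the derivative along the ray through \<open>e1\<close> at distance
    \<open>norm x\<close> equals the derivative at \<open>x\<close> in the direction of
    \<open>x\<close>.\<close>
  have gle: "gamm (norm x) <= norm (G x)" if x: "x \<noteq> 0" for x
  proof -
    let ?y = "(1 / norm x) *R x"
    have "((%t. F (t *R ?y)) has_vector_derivative (\<Sum>i\<in>UNIV. ?y $ i *R G x $ i)) (at (norm x))"
      using line[of ?y "norm x"] x by simp
    then have "(?h has_vector_derivative (\<Sum>i\<in>UNIV. ?y $ i *R G x $ i)) (at (norm x))"
    proof (rule has_vector_derivative_transform_within_open[where S="{0<..}"])
      show "F (t *R ?y) = ?h t" if "t \<in> {0<..}" for t
        using rad x that unfolding xrad_def by simp
    qed (use x in auto)
    then have "G (norm x *R e1) $ 1 = (\<Sum>i\<in>UNIV. ?y $ i *R G x $ i)"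
      using vector_derivative_unique_at[OF d[of "norm x"]] x by simp
    then have "gamm (norm x) = norm (\<Sum>i\<in>UNIV. ?y $ i *R G x $ i)" by (simp add: gamm_def)
    also have "\<dots> <= norm ?y * norm (G x)" by (rule gderiv_norm_vec)
    finally show ?thesis using x by simp
  qed
  have bi: "has_bochner_integral lborel (%t. indicator {r..s} t *R G (t *R e1) $ 1) (?h s - ?h r)"
    by (rule has_bochner_integral_FTC_Icc[OF r(2)])
      (use d r in \<open>auto intro: has_vector_derivative_at_within continuous_on_subset[OF gc]\<close>)
  have eq: "?h s - ?h r = (LBINT t. indicator {r..s} t *R G (t *R e1) $ 1)"
    using has_bochner_integral_integral_eq[OF bi] by simp
  have "ennreal (norm (?h s - ?h r)) <= (NN t. ennreal (norm (indicator {r..s} t *R G (t *R e1) $ 1)))"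
    unfolding eq by (rule integral_norm_bound_ennreal) (use bi in \<open>simp add: has_bochner_integral_iff\<close>)
  also have "\<dots> = (NN t. indicator {r..s} t * (indicator {r..s} t * ennreal (gamm t)))"
    by (rule nn_integral_cong) (auto simp: gamm_def split: split_indicator)
  finally have "(ennreal (norm (?h s - ?h r)))^2 <= (NN t. indicator {r..s} t * (indicator {r..s} t * ennreal (gamm t)))^2"
    by (intro power_mono) auto
  also have "\<dots> <= (NN t. (indicator {r..s} t)^2) * (NN t. (indicator {r..s} t * ennreal (gamm t))^2)"
    by (rule Cauchy_Schwarz_nn_integral) auto
  also have "(NN t. (indicator {r..s} t :: ennreal)^2) = (NN t. indicator {r..s} t)"
    by (rule nn_integral_cong) (auto split: split_indicator)
  also have "\<dots> = ennreal (s - r)" using r by simp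
  also have "(NN t. (indicator {r..s} t * ennreal (gamm t))^2)
     <= (NN t. ennreal (1 / (3 * vol1 * r^2)) * (ennreal (3 * vol1 * t^2) * indicator {0..} t * (indicator {r..s} t * ennreal ((gamm t)^2))))"
  proof (rule nn_integral_mono)
    fix t
    show "(indicator {r..s} t * ennreal (gamm t))^2 <= ennreal (1 / (3 * vol1 * r^2)) * (ennreal (3 * vol1 * t^2) * indicator {0..} t * (indicator {r..s} t * ennreal ((gamm t)^2)))"
    proof (cases "t \<in> {r..s}")
      case True
      then have "1 <= (1 / (3 * vol1 * r^2)) * (3 * vol1 * t^2)" using r vol1_pos power_mono[of r t 2] by (simp add: field_simps)
      then have "1 * (gamm t)^2 <= (1 / (3 * vol1 * r^2)) * (3 * vol1 * t^2) * (gamm t)^2" by (intro mult_right_mono) auto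
      then have "ennreal ((gamm t)^2) <= ennreal (1 / (3 * vol1 * r^2)) * (ennreal (3 * vol1 * t^2) * ennreal ((gamm t)^2))"
        using vol1_pos by (simp add: ennreal_leI mult.assoc flip: ennreal_mult)
      then show ?thesis using True r by (simp add: ennreal_power gamm_def)
    qed simp
  qed
  also have "\<dots> = ennreal (1 / (3 * vol1 * r^2)) * (NN t. ennreal (3 * vol1 * t^2) * indicator {0..} t * (indicator {r..s} t * ennreal ((gamm t)^2)))"
    by (rule nn_integral_cmult) measurable
  also have "(NN t. ennreal (3 * vol1 * t^2) * indicator {0..} t * (indicator {r..s} t * ennreal ((gamm t)^2)))
     = (NN x. indicator {r..s} (norm (x::real^3)) * ennreal ((gamm (norm x))^2))"
    by (rule polar[symmetric]) measurable
  also have "\<dots> <= (NN x. ennreal ((norm (G x))^2))"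
  proof (rule nn_integral_mono)
    fix x :: "real^3"
    show "indicator {r..s} (norm x) * ennreal ((gamm (norm x))^2) <= ennreal ((norm (G x))^2)"
      using gle[of x] r by (cases "x = 0") (auto simp: gamm_def intro!: ennreal_leI power_mono split: split_indicator)
  qed
  also have "\<dots> = ennreal ((n2 G)^2)" using nn_integral_eq_integral[OF L2_integrable[OF GL]] by (simp add: n2_sq)
  finally have "(ennreal (norm (?h s - ?h r)))^2 <= ennreal (s - r) * (ennreal (1 / (3 * vol1 * r^2)) * ennreal ((n2 G)^2))"
    by (simp add: mult_left_mono)
  also have "\<dots> = ennreal ((s - r) / (3 * vol1 * r^2) * (n2 G)^2)"
    using r vol1_pos by (simp add: mult.assoc[symmetric] flip: ennreal_mult)
  finally show ?thesis using r vol1_pos by (simp add: ennreal_power)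
qed

text \<open>A Strauss type bound. Where \<open>|f|\<close> is minimal on \<open>{r..2*r}\<close> it
  is controlled by the mass of the shell, and the Hoelder estimate reaches \<open>r\<close> from
  there. The shell factor 7 is weakened to 3 so that both parts share the constant
  \<open>sqrt (3 * vol1)\<close>.\<close>

lemma nice_radial_decay:
  assumes n: "nice f G" and rad: "xrad f" and r: "0 < r"
  shows "norm (f (r *R e1)) <= (n2 f / (r * sqrt r) + n2 G / sqrt r) / sqrt (3 * vol1)"
proof -
  have fc: "continuous_on UNIV f" and fL: "f \<in> L2"
    using n gderiv_continuous[of f "%x i. G x $ i"] by (auto simp: nice_def)
  have [measurable]: "f \<in> bmeas" by (rule L2_measurable[OF fL])
  have "continuous_on {r..2*r} (%s. (norm (f (s *R e1)))^2)"
    by (intro continuous_intros continuous_on_compose2[OF fc]) auto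
  then obtain s0 where s0: "s0 \<in> {r..2*r}" "!!s. s \<in> {r..2*r} ==> (norm (f (s0 *R e1)))\<^sup>2 <= (norm (f (s *R e1)))^2"
    using continuous_attains_inf[of "{r..2*r}" "%s. (norm (f (s *R e1)))^2"] r by auto
  let ?m = "(norm (f (s0 *R e1)))^2"
  let ?A = "cball (0::real^3) (2 * r) - cball 0 r"
  have "emeasure lborel ?A = ennreal (vol1 * (2 * r) ^ 3) - ennreal (vol1 * r ^ 3)"
    using r by (subst emeasure_Diff) (auto simp: emeasure_cball3)
  also have "\<dots> = ennreal (7 * (vol1 * r ^ 3))" using r vol1_pos by (subst ennreal_minus) (auto simp: power_mult_distrib)
  finally have A: "emeasure lborel ?A = ennreal (7 * (vol1 * r ^ 3))" .
  have "ennreal (?m * (7 * (vol1 * r ^ 3))) = (NN x. ennreal ?m * indicator ?A x)"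
    using A r vol1_pos by (simp add: nn_integral_cmult ennreal_mult)
  also have "\<dots> <= (NN x. ennreal ((norm (f x))^2))"
  proof (rule nn_integral_mono)
    fix x
    show "ennreal ?m * indicator ?A x <= ennreal ((norm (f x))^2)"
      using s0(2)[of "norm x"] xrad_e1[OF rad, of x] by (auto intro!: ennreal_leI split: split_indicator)
  qed
  also have "\<dots> = ennreal ((n2 f)^2)"
    using nn_integral_eq_integral[OF L2_integrable[OF fL]] by (simp add: n2_sq)
  finally have "?m * (7 * (vol1 * r ^ 3)) <= (n2 f)^2" by simp
  moreover have "?m * (3 * vol1 * r ^ 3) <= ?m * (7 * (vol1 * r ^ 3))" using r vol1_pos by (intro mult_left_mono) auto
  ultimately have "?m * (3 * vol1 * r ^ 3) <= (n2 f)^2" by linarith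
  then have "?m <= (n2 f)^2 / (3 * vol1 * r ^ 3)" using r vol1_pos by (simp add: field_simps)
  also have "\<dots> = (n2 f / (r * sqrt r) / sqrt (3 * vol1))^2"
  proof -
    have "(r * sqrt r)^2 = r ^ 3" using r by (simp add: power_mult_distrib) (simp add: power3_eq_cube power2_eq_square)
    moreover have "(sqrt (3 * vol1))^2 = 3 * vol1" using vol1_pos by simp
    ultimately show ?thesis by (simp only: power_divide) (simp add: mult.commute)
  qed
  finally have "?m <= (n2 f / (r * sqrt r) / sqrt (3 * vol1))^2" .
  then have 1: "norm (f (s0 *R e1)) <= n2 f / (r * sqrt r) / sqrt (3 * vol1)"
    by (rule power2_le_imp_le) (use r vol1_pos in simp)
  have "(norm (f (s0 *R e1) - f (r *R e1)))^2 <= (s0 - r) / (3 * vol1 * r^2) * (n2 G)^2"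
    by (rule nice_radial_Hoelder[OF n rad r]) (use s0 in auto)
  also have "\<dots> <= r / (3 * vol1 * r^2) * (n2 G)^2"
    using s0 r vol1_pos by (intro mult_right_mono divide_right_mono) auto
  also have "\<dots> = (n2 G / sqrt r / sqrt (3 * vol1))^2"
    using r vol1_pos by (simp add: power_divide power_mult_distrib field_simps power2_eq_square)
  finally have 2: "norm (f (s0 *R e1) - f (r *R e1)) <= n2 G / sqrt r / sqrt (3 * vol1)"
    by (rule power2_le_imp_le) (use r vol1_pos in simp)
  have "norm (f (r *R e1)) <= norm (f (s0 *R e1)) + norm (f (s0 *R e1) - f (r *R e1))"
    using norm_triangle_ineq4[of "f (s0 *R e1)" "f (s0 *R e1) - f (r *R e1)"] by simp
  with 1 2 show ?thesis by (simp add: add_divide_distrib)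
qed

lemma equi_Hoelder_convergent:
  fixes phi :: "nat => real => complex"
  assumes H: "!!n r s. 0 < r ==> r <= s ==> (norm (phi n s - phi n r))\<^sup>2 <= (s - r) / r^2 * C" and C: "0 <= C"
    and D: "!!a b. 0 < a ==> a < b ==> \<exists>r. a < r \<and> r < b \<and> convergent (%n. phi n r)"
    and r: "0 < r"
  shows "convergent (%n. phi n r)"
proof -
  have "Cauchy (%n. phi n r)"
  proof (rule metric_CauchyI)
    fix e :: real assume e: "0 < e"
    \<comment> \<open>The first entry keeps \<open>q >= r / 2\<close>, so that the Hoelder factor is
      bounded; the second makes the increment at most \<open>e / 3\<close>; \<open>C + 1\<close>
      avoids a division by 0.\<close>
    define d where "d = min (r / 2) ((e / 3)^2 * (r^2 / 4) / (C + 1))"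
    have d: "0 < d" using e r C by (simp add: d_def)
    have "d <= r / 2" unfolding d_def by (rule min.cobounded1)
    then obtain q where q: "r - d < q" "q < r" "convergent (%n. phi n q)"
      using D[of "r - d" r] d r by auto
    have q2: "r / 2 <= q" using q d by (auto simp: d_def)
    have n: "norm (phi n r - phi n q) <= e / 3" for n
    proof (rule power2_le_imp_le)
      have "(norm (phi n r - phi n q))^2 <= (r - q) / q^2 * C" using H[of q r n] q2 q r by simp
      also have "\<dots> <= d / (r / 2)^2 * (C + 1)"
        using q q2 r C d by (intro mult_mono frac_le power_mono) auto
      also have "d <= (e / 3)^2 * (r^2 / 4) / (C + 1)" by (simp add: d_def)
      then have "d / (r / 2)^2 * (C + 1) <= ((e / 3)^2 * (r^2 / 4) / (C + 1)) / (r / 2)^2 * (C + 1)"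
        using C r by (intro mult_right_mono divide_right_mono) auto
      also have "\<dots> = (e / 3)^2"
      proof -
        have c: "x / y / z * y = x / z" if "y \<noteq> 0" for x y z :: real using that by simp
        have "C + 1 \<noteq> 0" using C by simp
        from c[OF this, of "(e / 3)^2 * (r^2 / 4)" "(r / 2)^2"] show ?thesis using r by (simp add: power_divide)
      qed
      finally show "(norm (phi n r - phi n q))^2 <= (e / 3)^2" .
    qed (use e in simp)
    have "Cauchy (%n. phi n q)" using q(3) by (simp add: Cauchy_convergent_iff)
    then obtain N where N: "!!m n. m \<ge> N ==> n \<ge> N ==> dist (phi m q) (phi n q) < e / 3"
      using e metric_CauchyD[of "%n. phi n q" "e/3"] by auto
    have "dist (phi m r) (phi k r) < e" if "m \<ge> N" "k \<ge> N" for m k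
    proof -
      have "dist (phi m r) (phi k r) <= dist (phi m r) (phi m q) + dist (phi m q) (phi k q) + dist (phi k q) (phi k r)"
        by (smt (verit) dist_triangle)
      then show ?thesis using n[of m] n[of k] N[OF that] by (simp add: dist_norm norm_minus_commute[of "phi k q"])
    qed
    then show "\<exists>N. \<forall>m\<ge>N. \<forall>n\<ge>N. dist (phi m r) (phi n r) < e" by blast
  qed
  then show ?thesis by (simp add: Cauchy_convergent_iff)
qed

lemma conv_mol_xrad:
  fixes u :: "real^3 => 'b::euclidean_space"
  assumes u: "u \<in> L2" and inv: "!!R. orth R ==> AE x in lborel. u (R x) = u x"
  shows "xrad (conv (mol n) u)"
  unfolding xrad_def
proof safe
  fix x y :: "real^3" assume "norm x = norm y"
  then obtain R where R: "orth R" "R x = y" using orthogonal_transformation_exists by blast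
  have [measurable]: "u \<in> bmeas" "mol n \<in> bmeas" "R \<in> bmeas"
    using L2_measurable[OF u] test_function_L2(3)[OF mol_test] orthogonal_measurable[OF R(1)] by auto
  have [measurable]: "(%z. u (R z)) \<in> bmeas" by measurable
  have "conv (mol n) u y = (LBINT z. mol n (y - R z) *R u (R z))"
    unfolding conv_def using orthogonal_integral(1)[OF R(1), of "%z. mol n (y - z) *R u z"] by simp
  also have "\<dots> = (LBINT z. mol n (x - z) *R u (R z))"
  proof (rule Bochner_Integration.integral_cong[OF refl])
    fix z
    have "norm (y - R z) = norm (x - z)"
      using linear_diff[OF orthogonal_transformation_linear[OF R(1)], of x z] orthogonal_transformation_norm[OF R(1), of "x - z"] R(2) by simp
    then show "mol n (y - R z) *R u (R z) = mol n (x - z) *R u (R z)" using mol_radial by metis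
  qed
  also have "\<dots> = conv (mol n) u x" unfolding conv_def
    by (rule integral_cong_AE) (use inv[OF R(1)] in \<open>auto elim: eventually_mono\<close>)
  finally show "conv (mol n) u x = conv (mol n) u y" ..
qed

lemma radial_rotate:
  assumes "radial u" "orth R" shows "AE x in lborel. u (R x) = u x"
proof -
  obtain f where f: "AE x in lborel. u x = f (norm x)" using assms(1) by (auto simp: radial_def)
  from orthogonal_AE[OF assms(2) f] f show ?thesis
    by eventually_elim (simp add: orthogonal_transformation_norm[OF assms(2)])
qed

text \<open>The exceptional null set may depend on the rotation, so a profile cannot be read off
  from \<open>u\<close> directly. Mollifications are invariant at every point, and their limit along
  one ray is a profile.\<close>

lemma radialI:
  assumes u: "u \<in> L2" and inv: "!!R. orth R ==> AE x in lborel. u (R x) = u x"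
  shows "radial u"
proof -
  obtain r where r: "strict_mono r" "AE x in lborel. (%n. conv (mol (r n)) u x) ----> u x"
    using L2_AE_subseq[OF conv_mol_L2[OF u] u conv_mol_tendsto[OF u]] by blast
  show ?thesis unfolding radial_def
  proof (rule exI[of _ "%t. lim (%n. conv (mol (r n)) u (t *R e1))"])
    show "AE x in lborel. u x = lim (%n. conv (mol (r n)) u (norm x *R e1))"
      using r(2)
    proof eventually_elim
      case (elim x)
      then show ?case using xrad_e1[OF conv_mol_xrad[OF u inv], of _ x] by (simp add: limI)
    qed
  qed
qed

lemma H1rD: "u \<in> H1r ==> u \<in> H1" "u \<in> H1r ==> radial u" by (auto simp: H1r_def)

text \<open>The Hoelder bound makes the mollifications converge at every positive radius, so
  \<open>U\<close> is determined there and inherits both estimates in the limit. The approximating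
  sequence is exported too, for the positivity argument.\<close>

lemma H1r_profile:
  assumes u: "u \<in> H1r"
  obtains U ro where "AE x in lborel. u x = U (norm x)"
    "!!r s. 0 < r ==> r <= s ==> (norm (U s - U r))\<^sup>2 <= (s - r) / r^2 * ((grad_norm u)^2 / (3 * vol1))"
    "!!r. 0 < r ==> norm (U r) <= (n2 u / (r * sqrt r) + grad_norm u / sqrt r) / sqrt (3 * vol1)"
    "strict_mono ro" "!!r. 0 < r ==> (%n. conv (mol (ro n)) u (r *R e1)) ----> U r"
    "!!n. xrad (conv (mol n) u)"
proof -
  note uL = H1_L2[OF H1rD(1)[OF u]] and gL = weak_grad_L2[OF H1rD(1)[OF u]] and w = H1_wg[OF H1rD(1)[OF u]]
  let ?f = "%n. conv (mol n) u" and ?G = "%n. conv (mol n) (weak_grad u)"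
  have nice: "nice (?f n) (?G n)" for n by (rule wg_mollify[OF uL w])
  have rad: "xrad (?f n)" for n by (rule conv_mol_xrad[OF uL radial_rotate[OF H1rD(2)[OF u]]])
  obtain ro where r: "strict_mono ro" "AE x in lborel. (%n. ?f (ro n) x) ----> u x"
    using L2_AE_subseq[OF conv_mol_L2[OF uL] uL conv_mol_tendsto[OF uL]] by blast
  have lim: "(%n. n2 (?f (ro n))) ----> n2 u" "(%n. n2 (?G (ro n))) ----> grad_norm u"
    using LIMSEQ_subseq_LIMSEQ[OF n2_tendsto[OF conv_mol_L2[OF uL] uL conv_mol_tendsto[OF uL]] r(1)]
      LIMSEQ_subseq_LIMSEQ[OF n2_tendsto[OF conv_mol_L2[OF gL] gL conv_mol_tendsto[OF gL]] r(1)]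
    by (simp_all add: o_def grad_norm_eq)
  obtain B where B: "!!n. n2 (?G (ro n)) <= B"
    using convergent_imp_Bseq[OF convergentI[OF lim(2)]] unfolding Bseq_def by (auto simp: abs_le_iff)
  have B0: "0 <= B" using B[of 0] n2_nonneg order_trans by blast
  have conv: "convergent (%n. ?f (ro n) (t *R e1))" if t: "0 < t" for t
  proof (rule equi_Hoelder_convergent[where C="B^2 / (3 * vol1)", OF _ _ _ t])
    fix n and a b :: real assume a: "0 < a" "a <= b"
    have "(norm (?f (ro n) (b *R e1) - ?f (ro n) (a *R e1)))^2 <= (b - a) / (3 * vol1 * a^2) * (n2 (?G (ro n)))^2"
      by (rule nice_radial_Hoelder[OF nice rad a])
    also have "\<dots> <= (b - a) / (3 * vol1 * a^2) * B^2"
      using a vol1_pos by (intro mult_left_mono power_mono B) auto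
    finally show "(norm (?f (ro n) (b *R e1) - ?f (ro n) (a *R e1)))^2 <= (b - a) / a^2 * (B^2 / (3 * vol1))"
      by (simp add: mult.commute)
  next
    fix a b :: real assume a: "0 < a" "a < b"
    show "\<exists>t. a < t \<and> t < b \<and> convergent (%n. ?f (ro n) (t *R e1))"
    proof (rule ccontr)
      \<comment> \<open>Almost everywhere convergence supplies good radii in every interval, because
        a spherical shell contains a ball of positive measure.\<close>
      assume c: "\<not> ?thesis"
      have "AE x in lborel. x \<notin> ball (((a + b) / 2) *R e1) ((b - a) / 2)"
        using r(2)
      proof eventually_elim
        case (elim x)
        then have "convergent (%n. ?f (ro n) (norm x *R e1))" using xrad_e1[OF rad, of _ x] by (simp add: convergentI)
        then have "\<not> (a < norm x \<and> norm x < b)" using c by blast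
        moreover have "a < norm x \<and> norm x < b" if "x \<in> ball (((a + b) / 2) *R e1) ((b - a) / 2)"
        proof -
          have 1: "norm (((a + b) / 2) *R e1 - x) < (b - a) / 2" using that by (simp add: dist_norm)
          have 2: "norm (((a + b) / 2) *R e1) = (a + b) / 2" using a by simp
          show ?thesis using norm_triangle_ineq3[of "((a + b) / 2) *R e1" x] 1 2 unfolding abs_le_iff by (simp add: field_simps)
        qed
        ultimately show ?case by blast
      qed
      then have "emeasure lborel (ball (((a + b) / 2) *R e1) ((b - a) / 2)) = 0"
        by (subst (asm) AE_iff_measurable[OF _ refl]) (auto simp: ball_def)
      then show False using content_ball_pos[of "(b - a) / 2" "((a + b) / 2) *R e1"] a by (simp add: measure_def)
    qed
  qed (use B0 vol1_pos in auto)
  define U where "U t = lim (%n. ?f (ro n) (t *R e1))" for t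
  have Ul: "(%n. ?f (ro n) (t *R e1)) ----> U t" if "0 < t" for t
    using conv[OF that] by (simp add: U_def convergent_LIMSEQ_iff)
  show thesis
  proof (rule that[OF _ _ _ r(1) Ul rad])
    show "AE x in lborel. u x = U (norm x)"
      using r(2)
    proof eventually_elim
      case (elim x)
      then show ?case using xrad_e1[OF rad, of _ x] by (simp add: limI U_def)
    qed
    show "(norm (U s - U t))^2 <= (s - t) / t^2 * ((grad_norm u)^2 / (3 * vol1))" if t: "0 < t" "t <= s" for s t
    proof -
      have "(norm (U s - U t))^2 <= (s - t) / (3 * vol1 * t^2) * (grad_norm u)^2"
      proof (rule LIMSEQ_le)
        show "(%n. (norm (?f (ro n) (s *R e1) - ?f (ro n) (t *R e1)))^2) ----> (norm (U s - U t))\<^sup>2"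
          using t by (intro tendsto_intros Ul) auto
        show "(%n. (s - t) / (3 * vol1 * t^2) * (n2 (?G (ro n)))^2) ----> (s - t) / (3 * vol1 * t^2) * (grad_norm u)^2"
          by (intro tendsto_mult tendsto_const tendsto_power lim)
      qed (use nice_radial_Hoelder[OF nice rad t] in auto)
      then show ?thesis by (simp add: mult.commute)
    qed
    show "norm (U t) <= (n2 u / (t * sqrt t) + grad_norm u / sqrt t) / sqrt (3 * vol1)" if t: "0 < t" for t
    proof (rule LIMSEQ_le)
      show "(%n. norm (?f (ro n) (t *R e1))) ----> norm (U t)" using t by (intro tendsto_intros Ul)
      show "(%n. (n2 (?f (ro n)) / (t * sqrt t) + n2 (?G (ro n)) / sqrt t) / sqrt (3 * vol1)) ----> (n2 u / (t * sqrt t) + grad_norm u / sqrt t) / sqrt (3 * vol1)"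
        using t vol1_pos by (intro tendsto_divide tendsto_add tendsto_const lim) auto
    qed (use nice_radial_decay[OF nice rad t] in auto)
  qed
qed

subsection \<open>Compactness\<close>

text \<open>Arzela-Ascoli for the radial profiles: at each radius they are bounded and Hoelder
  continuous with constants depending on \<open>M\<close> alone, so a diagonal subsequence that
  converges at positive rational radii converges at all positive radii.\<close>

lemma radial_subsequence:
  fixes V :: "nat => real^3 => complex"
  assumes V: "!!n. V n \<in> H1r" and b: "!!n. n2 (V n) <= M" "!!n. grad_norm (V n) <= M"
  obtains ro W where "strict_mono ro" "AE x in lborel. (%n. V (ro n) x) ----> W (norm x)"
proof -
  have "\<exists>U. (AE x in lborel. V n x = U (norm x)) \<and>
    (\<forall>r s. 0 < r \<longrightarrow> r <= s \<longrightarrow> (norm (U s - U r))\<^sup>2 <= (s - r) / r^2 * ((grad_norm (V n))^2 / (3 * vol1))) \<and>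
    (\<forall>r. 0 < r \<longrightarrow> norm (U r) <= (n2 (V n) / (r * sqrt r) + grad_norm (V n) / sqrt r) / sqrt (3 * vol1))" for n
    by (rule H1r_profile[OF V[of n]]) blast
  then have "\<exists>U. \<forall>n. (AE x in lborel. V n x = U n (norm x)) \<and>
    (\<forall>r s. 0 < r \<longrightarrow> r <= s \<longrightarrow> (norm (U n s - U n r))\<^sup>2 <= (s - r) / r^2 * ((grad_norm (V n))^2 / (3 * vol1))) \<and>
    (\<forall>r. 0 < r \<longrightarrow> norm (U n r) <= (n2 (V n) / (r * sqrt r) + grad_norm (V n) / sqrt r) / sqrt (3 * vol1))"
    by (intro choice allI)
  then obtain U where U: "!!n. AE x in lborel. V n x = U n (norm x)"
    "!!n r s. 0 < r ==> r <= s ==> (norm (U n s - U n r))\<^sup>2 <= (s - r) / r^2 * ((grad_norm (V n))^2 / (3 * vol1))"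
    "!!n r. 0 < r ==> norm (U n r) <= (n2 (V n) / (r * sqrt r) + grad_norm (V n) / sqrt r) / sqrt (3 * vol1)"
    by blast
  have M0: "0 <= M" using b(1)[of 0] n2_nonneg order_trans by blast
  have U2: "(norm (U n s - U n r))^2 <= (s - r) / r^2 * (M^2 / (3 * vol1))" if "0 < r" "r <= s" for n r s
    using that vol1_pos b(2)[of n] by (intro order_trans[OF U(2)] mult_left_mono divide_right_mono power_mono) auto
  have U3: "norm (U n r) <= (M / (r * sqrt r) + M / sqrt r) / sqrt (3 * vol1)" if "0 < r" for n r
    using that vol1_pos b[of n] by (intro order_trans[OF U(3)] divide_right_mono add_mono) auto
  \<comment> \<open>An enumeration of the positive rationals; codes of other rationals are sent to
    the harmless value 1.\<close>
  define q :: "nat => real" where "q n = (let x = real_of_rat (from_nat n) in if 0 < x then x else 1)" for n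
  have q0: "0 < q n" for n by (simp add: q_def Let_def)
  interpret subseqs "%k s. convergent (%n. U (s n) (q k))"
  proof
    fix k and s :: "nat => nat"
    have "bounded (range (%n. U (s n) (q k)))"
      using U3[OF q0] by (intro boundedI) auto
    then obtain l r where "strict_mono r" "((%n. U (s n) (q k)) \<circ> r) ----> l"
      using bounded_imp_convergent_subsequence by blast
    then show "\<exists>r'. strict_mono r' \<and> convergent (%n. U ((s \<circ> r') n) (q k))"
      by (auto simp: o_def convergent_def)
  qed
  have cq: "convergent (%n. U (diagseq n) (q k))" for k
  proof -
    have "convergent (%n. U ((diagseq \<circ> ((+) (Suc k))) n) (q k))"
    proof (rule diagseq_holds)
      fix r s :: "nat => nat" and n assume "strict_mono r" "convergent (%m. U (s m) (q n))"
      then show "convergent (%m. U ((s \<circ> r) m) (q n))"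
        using convergent_subseq_convergent[of "%m. U (s m) (q n)" r] by (simp add: o_def)
    qed
    then show ?thesis
      using convergent_ignore_initial_segment[of "%n. U (diagseq n) (q k)" "Suc k"] by (simp add: o_def add.commute)
  qed
  have conv: "convergent (%n. U (diagseq n) r)" if "0 < r" for r
  proof (rule equi_Hoelder_convergent[where C="M^2 / (3 * vol1)", OF U2 _ _ that])
    fix a b :: real assume a: "0 < a" "a < b"
    obtain y where y: "a < real_of_rat y" "real_of_rat y < b" using of_rat_dense[OF a(2)] by blast
    have "0 < real_of_rat y" using y a by linarith
    then have "q (to_nat y) = real_of_rat y" by (simp add: q_def Let_def)
    then show "\<exists>r. a < r \<and> r < b \<and> convergent (%n. U (diagseq n) r)" using y cq[of "to_nat y"] by metis
  qed (use vol1_pos in auto)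
  show thesis
  proof (rule that[OF subseq_diagseq])
    have "AE x in lborel. \<forall>n. V n x = U n (norm x)" using U(1) by (simp add: AE_all_countable)
    then show "AE x in lborel. (%n. V (diagseq n) x) ----> lim (%n. U (diagseq n) (norm x))"
      using AE_lborel_singleton[of "0::real^3"]
    proof eventually_elim
      case (elim x)
      then show ?case using conv[of "norm x"] by (simp add: convergent_LIMSEQ_iff)
    qed
  qed
qed

lemma weak_tendsto:
  fixes W :: "nat => real^3 => 'b::euclidean_space"
  assumes W: "!!n. W n \<in> L2" "v \<in> L2" and b: "!!n. n2 (W n) <= c"
    and lim: "AE x in lborel. (%n. W n x) ----> v x" and p: "f \<in> L2"
  shows "(%n. \<integral>x. f x *R W n x \<partial>lborel) ----> (LBINT x. f x *R v x)"
proof (rule LIM_zero_cancel)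
  have 0: "(%n. \<integral>x. norm (f x) * norm (W n x - v x) \<partial>lborel) ----> 0"
  proof (rule weak_null[OF L2_diff[OF W] _ _ p])
    show "n2 (%x. W n x - v x) <= c + n2 v" for n using n2_triangle_diff[OF W(1)[of n] W(2)] b[of n] by linarith
    show "AE x in lborel. (%n. W n x - v x) ----> 0" using lim by eventually_elim (rule LIM_zero)
  qed
  have "norm ((LBINT x. f x *R W n x) - (LBINT x. f x *R v x)) <= (LBINT x. norm (f x) * norm (W n x - v x))" for n
  proof -
    have "(LBINT x. f x *R W n x) - (LBINT x. f x *R v x) = (LBINT x. f x *R (W n x - v x))"
      using L2_scaleR_integrable[OF p W(1)[of n]] L2_scaleR_integrable[OF p W(2)] by (simp add: scaleR_diff_right)
    then show ?thesis using integral_norm_bound[of lborel "%x. f x *R (W n x - v x)"] by simp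
  qed
  then show "(%n. (LBINT x. f x *R W n x) - (LBINT x. f x *R v x)) ----> 0"
    by (intro Lim_null_comparison[OF _ 0] always_eventually) simp
qed

text \<open>The limit of the gradients is found as the representative of the functional
  \<open>\<Phi> \<mapsto> lim \<langle>\<nabla> V\<^sub>n, \<Phi>\<rangle>\<close> on the space of fields on which the limit exists.\<close>

lemma gradient_lsc:
  assumes V: "!!n. V n \<in> H1" and b: "!!n. n2 (V n) <= M"
    and lim: "AE x in lborel. (%n. V n x) ----> v x" and v: "v \<in> bmeas"
    and l: "(%n. grad_norm (V n)) ----> l"
  shows "v \<in> H1" "grad_norm v <= l"
proof -
  note [simp del] = iterated_partial.simps
  define g where "g n = weak_grad (V n)" for n
  have gL: "g n \<in> L2" and wg: "wgrad (V n) (g n)" for n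
    using weak_grad_L2[OF V] H1_wg[OF V] by (auto simp: g_def)
  have VL: "V n \<in> L2" for n by (rule H1_L2[OF V])
  have vL: "v \<in> L2" by (rule L2_Fatou(1)[OF VL b lim v])
  have l0: "0 <= l" by (rule LIMSEQ_le_const[OF l]) auto
  define X where "X = {Phi. Phi \<in> L2 \<and> convergent (%n. ip (g n) Phi)}"
  define T where "T Phi = lim (%n. ip (g n) Phi)" for Phi
  have T: "(%n. ip (g n) Phi) ----> T Phi" if "Phi \<in> X" for Phi
    using that by (simp add: X_def T_def convergent_LIMSEQ_iff)
  have XI: "Phi \<in> X \<and> T Phi = t" if "Phi \<in> L2" "(%n. ip (g n) Phi) ----> t" for Phi t
    using that by (auto simp: X_def T_def limI intro: convergentI)
  have ipa: "ip (g n) (%x. Phi x + Psi x) = ip (g n) Phi + ip (g n) Psi" if "Phi \<in> L2" "Psi \<in> L2" for n Phi Psi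
    using ip_add_left[OF that gL[of n]] by (simp only: ip_commute[of "g n"])
  have ips: "ip (g n) (%x. c *R Phi x) = c * ip (g n) Phi" for n c Phi
    using ip_scaleR_left[of c Phi "g n"] by (simp only: ip_commute[of "g n"])
  have Xadd: "(%x. Phi x + Psi x) \<in> X \<and> T (%x. Phi x + Psi x) = T Phi + T Psi" if "Phi \<in> X" "Psi \<in> X" for Phi Psi
  proof (rule XI)
    show "(%x. Phi x + Psi x) \<in> L2" using that by (auto simp: X_def intro: L2_add)
    show "(%n. ip (g n) (%x. Phi x + Psi x)) ----> T Phi + T Psi"
      using tendsto_add[OF T[OF that(1)] T[OF that(2)]] that by (simp add: ipa X_def)
  qed
  have Xsc: "(%x. c *R Phi x) \<in> X \<and> T (%x. c *R Phi x) = c * T Phi" if "Phi \<in> X" for c Phi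
  proof (rule XI)
    show "(%x. c *R Phi x) \<in> L2" using that by (auto simp: X_def intro: L2_scaleR)
    show "(%n. ip (g n) (%x. c *R Phi x)) ----> c * T Phi"
      unfolding ips by (intro tendsto_mult tendsto_const T that)
  qed
  have Tb: "\<bar>T Phi\<bar> <= l * n2 Phi" if "Phi \<in> X" for Phi
  proof (rule LIMSEQ_le)
    show "(%n. \<bar>ip (g n) Phi\<bar>) ----> \<bar>T Phi\<bar>" by (intro tendsto_rabs T that)
    show "(%n. n2 (g n) * n2 Phi) ----> l * n2 Phi"
      using l by (intro tendsto_mult tendsto_const) (simp add: g_def grad_norm_eq)
    show "\<exists>N. \<forall>n\<ge>N. \<bar>ip (g n) Phi\<bar> <= n2 (g n) * n2 Phi"
      using ip_bound[OF gL] that by (auto simp: X_def)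
  qed
  have XL: "Phi \<in> L2" if "Phi \<in> X" for Phi using that by (simp add: X_def)
  have z: "(%x. 0) \<in> X" using XI[of "%x. 0" 0] by (simp add: ip_def)
  obtain Phi where Phi: "!!n. Phi n \<in> X"
    "!!e. 0 < e ==> \<exists>N. \<forall>m\<ge>N. \<forall>n\<ge>N. ip (%x. Phi m x + (-1) *R Phi n x) (%x. Phi m x + (-1) *R Phi n x) < e"
    "!!w. w \<in> X ==> (%n. ip (Phi n) w) ----> T w"
  proof (rule Riesz_sequence[where V=X and pl="%Phi Psi x. Phi x + Psi x" and sm="%c Phi x. c *R Phi x" and B=ip and T=T and k=l, OF z])
    show "\<bar>T x\<bar> <= l * sqrt (ip x x)" if "x \<in> X" for x using Tb[OF that] by (simp add: ip_self)
    show "ip x y = ip y x" for x y by (rule ip_commute)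
    show "0 <= ip x x" for x by (simp add: ip_self)
    show "ip (%t. x t + y t) z = ip x z + ip y z" if "x \<in> X" "y \<in> X" "z \<in> X" for x y z
      using that by (intro ip_add_left XL)
  qed (use Xadd Xsc ip_scaleR_left in auto)
  obtain h where h: "h \<in> L2" "(%n. n2 (%x. Phi n x - h x)) ----> 0"
  proof (rule L2_complete[of Phi])
    show "Phi n \<in> L2" for n using Phi(1) XL by blast
    fix e :: real assume e: "0 < e"
    then have "0 < e^2" by simp
    from Phi(2)[OF this] obtain N where N: "!!m n. m \<ge> N ==> n \<ge> N ==> (n2 (%x. Phi m x - Phi n x))\<^sup>2 < e^2"
      by (auto simp: ip_self)
    have "n2 (%x. Phi m x - Phi n x) < e" if "m \<ge> N" "n \<ge> N" for m n
      by (rule power2_less_imp_less[OF N[OF that]]) (use e in simp)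
    then show "\<exists>N. \<forall>m\<ge>N. \<forall>n\<ge>N. n2 (%x. Phi m x - Phi n x) < e" by blast
  qed
  have Th: "T w = ip h w" if "w \<in> X" for w
    by (rule LIMSEQ_unique[OF Phi(3)[OF that] ip_tendsto[OF XL[OF Phi(1)] h(1) h(2) XL[OF that]]])
  have "wgrad v h"
  proof (rule wg_weak_limit[OF wg h(1)])
    show "(%n. \<integral>x. f x *R V n x \<partial>lborel) ----> (LBINT x. f x *R v x)" if "test_function f" for f
      by (rule weak_tendsto[OF VL vL b lim test_function_L2(1)[OF that]])
    fix f i assume t: "test_function f"
    have c1: "(%n. \<integral>x. f x *R (g n x $ i) \<partial>lborel) ----> - (LBINT x. pd i f x *R v x)"
    proof -
      have "(%n. - (LBINT x. pd i f x *R V n x)) ----> - (LBINT x. pd i f x *R v x)"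
        by (intro tendsto_minus weak_tendsto[OF VL vL b lim test_function_L2(1)[OF test_function_partial[OF t]]])
      then show ?thesis using wgD(2)[OF wg t] by simp
    qed
    have fL: "f \<in> L2" and [measurable]: "f \<in> bmeas" using test_function_L2[OF t] by auto
    \<comment> \<open>Pairing with a field concentrated in component \<open>i\<close> and direction
      \<open>c\<close> gives the real inner product of \<open>c\<close> with the complex integral;
      as \<open>c\<close> varies, these values determine the integral.\<close>
    have comp: "ip k (%x. axis i (f x *R c)) = (LBINT x. f x *R (k x $ i)) \<bullet> c" if k: "k \<in> L2" for k :: "real^3 => complex^3" and c
    proof -
      have "ip k (%x. axis i (f x *R c)) = (LBINT x. (f x *R (k x $ i)) \<bullet> c)"
        unfolding ip_def by (simp add: inner_axis)
      also have "\<dots> = (LBINT x. f x *R (k x $ i)) \<bullet> c"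
        by (rule integral_inner_left) (rule L2_scaleR_integrable[OF fL L2_component(1)[OF k]])
      finally show ?thesis .
    qed
    have aL: "(%x. axis i (f x *R c) :: complex^3) \<in> L2" for c
    proof (rule L2_bound(1)[OF fL, of _ "norm c"])
      show "(%x. axis i (f x *R c) :: complex^3) \<in> bmeas"
        by (rule borel_measurable_continuous_on[OF axis_continuous]) (intro continuous_intros, simp)
      show "AE x in lborel. norm (axis i (f x *R c) :: complex^3) <= norm c * norm (f x)"
        by (simp add: norm_vec_def axis_def L2_set_def if_distrib[of norm] if_distrib[of "%x. x^2"] mult.commute cong: if_cong)
    qed
    have eqc: "(LBINT x. f x *R (h x $ i)) \<bullet> c = (- (LBINT x. pd i f x *R v x)) \<bullet> c" for c
    proof -
      have "(%n. ip (g n) (%x. axis i (f x *R c))) ----> (- (LBINT x. pd i f x *R v x)) \<bullet> c"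
        unfolding comp[OF gL] by (intro tendsto_inner c1 tendsto_const)
      from XI[OF aL this] Th comp[OF h(1)] show ?thesis by metis
    qed
    have "(LBINT x. f x *R (h x $ i)) = - (LBINT x. pd i f x *R v x)"
      by (rule vector_eq_rdot[THEN iffD1, OF allI, OF eqc])
    with c1 show "(%n. \<integral>x. f x *R (g n x $ i) \<partial>lborel) ----> (LBINT x. f x *R (h x $ i))" by simp
  qed
  then show "v \<in> H1" and gv: "grad_norm v <= l"
  proof -
    assume w: "wgrad v h"
    show "v \<in> H1" by (rule H1I[OF vL w])
    \<comment> \<open>The function \<open>h\<close> is known only as a limit of elements of
      \<open>X\<close>, so the bound on \<open>T\<close> is used at \<open>Phi n\<close> and passed
      to the limit.\<close>
    have "(n2 h)^2 <= l * n2 h"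
    proof (rule LIMSEQ_le)
      show "(%n. ip h (Phi n)) ----> (n2 h)\<^sup>2"
        using ip_tendsto[OF XL[OF Phi(1)] h(1) h(2) h(1)] by (simp add: ip_commute[of h] ip_self)
      show "(%n. l * n2 (Phi n)) ----> l * n2 h"
        by (intro tendsto_mult tendsto_const n2_tendsto XL Phi h)
      show "\<exists>N. \<forall>n\<ge>N. ip h (Phi n) <= l * n2 (Phi n)"
        using Tb[OF Phi(1)] Th[OF Phi(1)] by (auto simp: abs_le_iff)
    qed
    then have "n2 h <= l" using l0 n2_nonneg[of h] by (cases "n2 h = 0") (auto simp: power2_eq_square)
    then show "grad_norm v <= l" using grad_norm_wg[OF vL w] by simp
  qed
qed

text \<open>The pointwise decay bound depends on \<open>u\<close> only through \<open>M\<close>, so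
  one radius serves the whole bounded family.\<close>

lemma H1r_decay:
  assumes k: "0 < k"
  obtains R where "0 < R" "!!u. u \<in> H1r ==> n2 u <= M ==> grad_norm u <= M ==> AE x in lborel. R <= norm x \<longrightarrow> norm (u x) <= k"
proof -
  have "((%r. (M / (r * sqrt r) + M / sqrt r) / sqrt (3 * vol1)) \<longlongrightarrow> (0 + 0) / sqrt (3 * vol1)) at_top"
    using vol1_pos
    by (intro tendsto_divide tendsto_add tendsto_const)
       (auto intro!: tendsto_divide_0[OF tendsto_const] filterlim_at_top_imp_at_infinity filterlim_at_top_mult_at_top filterlim_ident sqrt_at_top)
  then have "\<forall>\<^sub>F r in at_top. (M / (r * sqrt r) + M / sqrt r) / sqrt (3 * vol1) < k"
    by (intro order_tendstoD(2)) (use k in auto)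
  then obtain R0 where R0: "!!r. r \<ge> R0 ==> (M / (r * sqrt r) + M / sqrt r) / sqrt (3 * vol1) < k"
    by (auto simp: eventually_at_top_linorder)
  show thesis
  proof (rule that[of "max 1 R0"])
    fix u assume u: "u \<in> H1r" "n2 u <= M" "grad_norm u <= M"
    obtain U ro where U: "AE x in lborel. u x = U (norm x)"
      "!!r. 0 < r ==> norm (U r) <= (n2 u / (r * sqrt r) + grad_norm u / sqrt r) / sqrt (3 * vol1)"
      "strict_mono (ro :: nat => nat)"
      by (rule H1r_profile[OF u(1)]) blast
    from U(1) show "AE x in lborel. max 1 R0 <= norm x \<longrightarrow> norm (u x) <= k"
    proof eventually_elim
      case (elim x)
      show ?case
      proof
        assume x: "max 1 R0 <= norm x"
        then have x0: "0 < norm x" by linarith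
        have "norm (u x) <= (n2 u / (norm x * sqrt (norm x)) + grad_norm u / sqrt (norm x)) / sqrt (3 * vol1)"
          unfolding elim by (rule U(2)[OF x0])
        also have "\<dots> <= (M / (norm x * sqrt (norm x)) + M / sqrt (norm x)) / sqrt (3 * vol1)"
          using u x0 vol1_pos by (intro divide_right_mono add_mono) auto
        also have "\<dots> < k" using x by (intro R0) simp
        finally show "norm (u x) <= k" by simp
      qed
    qed
  qed simp
qed

text \<open>The part of \<open>y\<^sup>t\<close> exceeding \<open>e (y\<^sup>2 + y\<^sup>t\<^sup>a\<^sup>u)\<close> is bounded and vanishes for small and for large \<open>y\<close>.\<close>

lemma powr_excess:
  fixes t tau e :: real
  assumes t: "2 < t" "t < tau" and e: "0 < e"
  obtains k L where "0 < k" "!!y. 0 <= y ==> y <= k ==> y powr t <= e * (y^2 + y powr tau)"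
    "!!y. 0 <= y ==> y powr t - e * (y^2 + y powr tau) <= L" "0 <= L"
proof (rule that[of "e powr (1 / (t - 2))" "(e powr (- 1 / (tau - t))) powr t"])
  have two: "y powr 2 = y^2" if "0 <= y" for y :: real using that by simp
  fix y :: real assume y: "0 <= y"
  have p: "0 <= y powr tau" by simp
  show "y powr t <= e * (y^2 + y powr tau)" if "y <= e powr (1 / (t - 2))"
  proof (cases "y = 0")
    case False
    have "y powr (t - 2) <= (e powr (1 / (t - 2))) powr (t - 2)" using y that t by (intro powr_mono2) auto
    also have "\<dots> = e" using t e by (simp add: powr_powr)
    finally have "y powr (t - 2) * y^2 <= e * y^2" by (intro mult_right_mono) auto
    moreover have "y powr (t - 2) * y^2 = y powr t" using y False by (simp add: powr_diff)
    ultimately show ?thesis using e by (simp add: distrib_left add_increasing2)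
  qed (use t in auto)
  show "y powr t - e * (y^2 + y powr tau) <= (e powr (- 1 / (tau - t))) powr t"
  proof (cases "y <= e powr (- 1 / (tau - t))")
    case True
    then have "y powr t <= (e powr (- 1 / (tau - t))) powr t" using y t by (intro powr_mono2) auto
    moreover have "0 <= e * (y^2 + y powr tau)" using e by simp
    ultimately show ?thesis by linarith
  next
    case False
    then have y0: "0 < y" using powr_ge_zero[of e "- 1 / (tau - t)"] by linarith
    have "inverse e = (e powr (- 1 / (tau - t))) powr (tau - t)" using t e powr_minus[of e 1] by (simp add: powr_powr)
    also have "\<dots> <= y powr (tau - t)" using False t by (intro powr_mono2) auto
    finally have "1 <= e * y powr (tau - t)" using e by (simp add: field_simps)
    then have "1 * y powr t <= e * y powr (tau - t) * y powr t" by (intro mult_right_mono) auto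
    also have "\<dots> = e * y powr tau" using y0 by (simp add: powr_diff)
    finally have "y powr t <= e * (y^2 + y powr tau)" using e by (simp add: distrib_left add_increasing)
    moreover have "0 <= (e powr (- 1 / (tau - t))) powr t" by simp
    ultimately show ?thesis by linarith
  qed
qed (use e in auto)

text \<open>The excess \<open>phi\<close> is bounded by \<open>L\<close> and vanishes on small
  values, hence outside one ball for all \<open>V n\<close> by uniform decay; dominated convergence
  applies to it. What is left of the power is at most \<open>d * B < e / 2\<close>, uniformly in
  \<open>n\<close>.\<close>

lemma pw_tendsto_radial:
  fixes V :: "nat => real^3 => complex"
  assumes V: "!!n. V n \<in> H1r" and b: "!!n. n2 (V n) <= M" "!!n. grad_norm (V n) <= M"
    and lim: "AE x in lborel. (%n. V n x) ----> v x" and v: "v \<in> H1" and t: "2 < t" "t < 6"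
  shows "(%n. pw t (V n)) ----> pw t v"
proof (rule LIMSEQ_I)
  \<comment> \<open>An exponent above \<open>t\<close> but still below 6, so that large values are
    controlled by a bounded integral.\<close>
  define tau where "tau = (t + 6) / 2"
  have tau: "2 < tau" "t < tau" "tau < 6" using t by (auto simp: tau_def)
  note VH = H1rD(1)[OF V]
  have meas[measurable]: "v \<in> bmeas" "!!n. V n \<in> bmeas"
    using L2_measurable[OF H1_L2] v VH by auto
  obtain C where C: "0 < C" "!!u. u \<in> H1 ==> pw tau u <= C * (n2 u powr tau + grad_norm u powr tau)"
    using H1_pw_bound[OF tau(1,3)] by metis
  define N where "N = max M (max (n2 v) (grad_norm v))"
  define B where "B = N^2 + C * (N powr tau + N powr tau)"
  have B: "(n2 u)^2 + pw tau u <= B" if "u \<in> H1" "n2 u <= N" "grad_norm u <= N" for u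
    unfolding B_def
    using that tau C(1) by (intro add_mono power_mono order_trans[OF C(2)] mult_left_mono powr_mono2) auto
  have N: "n2 (V n) <= N" "grad_norm (V n) <= N" "n2 v <= N" "grad_norm v <= N" for n
    using b[of n] by (auto simp: N_def)
  have B0: "0 <= B" using B[OF v N(3,4)] pw_nonneg[of tau v] zero_le_power2[of "n2 v"] by linarith
  fix e :: real assume e: "0 < e"
  define d where "d = e / (4 * (B + 1))"
  have d: "0 < d" using e B0 by (simp add: d_def)
  obtain k L where kL: "0 < k" "!!y. 0 <= y ==> y <= k ==> y powr t <= d * (y^2 + y powr tau)"
    "!!y. 0 <= y ==> y powr t - d * (y^2 + y powr tau) <= L" "0 <= L"
    using powr_excess[OF t(1) tau(2) d] by blast
  define phi where "phi z = max 0 (norm z powr t - d * ((norm z)^2 + norm z powr tau))" for z :: complex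
  have phiL: "0 <= phi z" "phi z <= L" for z using kL(3)[of "norm z"] kL(4) by (auto simp: phi_def)
  have phik: "phi z = 0" if "norm z <= k" for z using kL(2)[of "norm z"] that by (simp add: phi_def)
  have phib: "phi z <= norm z powr t" "norm z powr t <= phi z + d * ((norm z)^2 + norm z powr tau)" for z
    using d by (auto simp: phi_def)
  have "continuous_on UNIV phi" unfolding phi_def using t tau
    by (intro continuous_on_max continuous_on_diff continuous_on_add continuous_on_mult continuous_on_powr' continuous_on_const continuous_on_norm continuous_on_id continuous_on_power) auto
  then have phic: "isCont phi z" for z by (simp add: continuous_on_eq_continuous_at)
  have [measurable]: "phi \<in> bmeas"
    by (rule borel_measurable_continuous_onI) (use phic continuous_at_imp_continuous_on in blast)
  obtain R where R: "0 < R" "!!u. u \<in> H1r ==> n2 u <= M ==> grad_norm u <= M ==> AE x in lborel. R <= norm x \<longrightarrow> norm (u x) <= k"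
    using H1r_decay[OF kL(1), of M] by blast
  have "(%n. \<integral>x. phi (V n x) \<partial>lborel) ----> (LBINT x. phi (v x))"
  proof (rule integral_dominated_convergence[where w="%x. L * indicat_real (cball (0::real^3) R) x"])
    show "integrable lborel (%x. L * indicat_real (cball (0::real^3) R) x)"
      by (intro integrable_mult_right integrable_real_indicator) (simp_all add: emeasure_cball_finite')
    show "AE x in lborel. (%n. phi (V n x)) ----> phi (v x)"
      using lim by eventually_elim (rule isCont_tendsto_compose[OF phic])
    show "AE x in lborel. norm (phi (V n x)) <= L * indicat_real (cball 0 R) x" for n
      using R(2)[OF V[of n] b[of n]]
    proof eventually_elim
      case (elim x)
      then show ?case using phiL[of "V n x"] phik[of "V n x"] by (cases "norm x <= R") auto
    qed
  qed auto
  then obtain n0 where n0: "!!n. n \<ge> n0 ==> \<bar>(LBINT x. phi (V n x)) - (LBINT x. phi (v x))\<bar> < e / 2"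
    using e unfolding LIMSEQ_iff by (metis half_gt_zero real_norm_def)
  have close: "(LBINT x. phi (u x)) <= pw t u \<and> pw t u <= (LBINT x. phi (u x)) + d * B"
    if u: "u \<in> H1" "n2 u <= N" "grad_norm u <= N" for u
  proof -
    have [measurable]: "u \<in> bmeas" using L2_measurable[OF H1_L2[OF u(1)]] .
    note it = H1_pw_integrable[OF t u(1)] H1_pw_integrable[OF tau(1,3) u(1)] L2_integrable[OF H1_L2[OF u(1)]]
    have i: "integrable lborel (%x. phi (u x))"
      by (rule integrable_boundI[OF it(1)]) (use phiL phib in auto)
    have "(LBINT x. phi (u x)) <= pw t u" unfolding pw_def
      by (rule integral_mono[OF i it(1)]) (rule phib)
    moreover have "pw t u <= (LBINT x. phi (u x) + d * ((norm (u x))^2 + norm (u x) powr tau))" unfolding pw_def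
      by (rule integral_mono) (use it i phib in auto)
    moreover have "\<dots> = (LBINT x. phi (u x)) + d * ((n2 u)^2 + pw tau u)"
      using it i by (simp add: n2_sq pw_def)
    moreover have "\<dots> <= (LBINT x. phi (u x)) + d * B" using B[OF u] d by (intro add_left_mono mult_left_mono) auto
    ultimately show ?thesis by linarith
  qed
  have dB: "d * B < e / 2"
  proof -
    have "d * B <= d * (B + 1)" using d by (intro mult_left_mono) auto
    also have "\<dots> = e / 4" using B0 by (simp add: d_def field_simps)
    also have "\<dots> < e / 2" using e by simp
    finally show ?thesis .
  qed
  have "norm (pw t (V n) - pw t v) < e" if "n \<ge> n0" for n
    using close[OF VH[of n] N(1,2)] close[OF v N(3,4)] n0[OF that] dB unfolding real_norm_def abs_less_iff by linarith
  then show "\<exists>n0. \<forall>n\<ge>n0. norm (pw t (V n) - pw t v) < e" by blast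
qed

lemma LIMSEQ_by_subseq:
  fixes f :: "nat => real"
  assumes "!!r :: nat => nat. strict_mono r ==> \<exists>s :: nat => nat. strict_mono s \<and> (%n. f (r (s n))) ----> l"
  shows "f ----> l"
proof (rule ccontr)
  assume "\<not> f ----> l"
  then obtain e where e: "0 < e" "!!N. \<exists>n\<ge>N. \<not> norm (f n - l) < e" unfolding LIMSEQ_iff by blast
  have "\<exists>r :: nat => nat. strict_mono r \<and> (\<forall>n. \<not> norm (f (r n) - l) < e)"
    using infinite_enumerate[of "{n. \<not> norm (f n - l) < e}"] e(2) unfolding infinite_nat_iff_unbounded_le by auto
  then obtain r :: "nat => nat" where r: "strict_mono r" "!!n. \<not> norm (f (r n) - l) < e" by blast
  obtain s :: "nat => nat" where "strict_mono s" "(%n. f (r (s n))) ----> l" using assms[OF r(1)] by blast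
  with e(1) r(2) show False unfolding LIMSEQ_iff by blast
qed

lemma pw_tendsto_L2:
  fixes V :: "nat => real^3 => complex"
  assumes V: "!!n. V n \<in> H1r" and b: "!!n. n2 (V n) <= M" "!!n. grad_norm (V n) <= M"
    and lim: "(%n. n2 (%x. V n x - v x)) ----> 0" and v: "v \<in> H1" and t: "2 < t" "t < 6"
  shows "(%n. pw t (V n)) ----> pw t v"
proof (rule LIMSEQ_by_subseq)
  fix r :: "nat => nat" assume r: "strict_mono r"
  have VL: "V n \<in> L2" for n by (rule H1_L2[OF H1rD(1)[OF V]])
  obtain s where s: "strict_mono s" "AE x in lborel. (%n. V (r (s n)) x) ----> v x"
    using L2_AE_subseq[OF VL H1_L2[OF v] LIMSEQ_subseq_LIMSEQ[OF lim r, unfolded o_def]] by blast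
  show "\<exists>s. strict_mono s \<and> (%n. pw t (V (r (s n)))) ----> pw t v"
    using pw_tendsto_radial[OF V b s(2) v t] s(1) by blast
qed

section \<open>The Coulomb energy\<close>

text \<open>Densities in L1 and L2. They contain \<open>|u|^2\<close> for \<open>u\<close> in H1,
  because \<open>pw 4\<close> is finite, and have bounded Newtonian potential.\<close>

definition X12 :: "(real^3 => real) set" where
  "X12 = {f. f \<in> bmeas \<and> integrable lborel f \<and> integrable lborel (%x. (f x)^2)}"

definition pot :: "(real^3 => real) => real^3 => real" where
  "pot f x = (LBINT y. f y / norm (x - y))"

text \<open>The mutual Coulomb energy as a bilinear form; \<open>coulomb_energy\<close> is its
  diagonal value at the density.\<close>

definition dd :: "(real^3 => real) => (real^3 => real) => real" where
  "dd f g = (LBINT x. f x * pot g x)"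

lemma X12D: "f \<in> X12 ==> f \<in> bmeas" "f \<in> X12 ==> integrable lborel f"
  "f \<in> X12 ==> integrable lborel (%x. (f x)^2)" by (auto simp: X12_def)

lemma X12_bound:
  assumes f: "f \<in> X12" and g: "g \<in> bmeas" and b: "!!x. \<bar>g x\<bar> <= \<bar>f x\<bar>"
  shows "g \<in> X12"
proof -
  have "integrable lborel g" by (rule integrable_boundI[OF integrable_abs[OF X12D(2)[OF f]]]) (use g b in auto)
  moreover have "integrable lborel (%x. (g x)^2)"
    by (rule integrable_boundI[OF X12D(3)[OF f]]) (use g power_mono[OF b, of _ 2] in auto)
  ultimately show ?thesis using g by (simp add: X12_def)
qed

lemma X12_add: assumes "f \<in> X12" "g \<in> X12" shows "(%x. f x + g x) \<in> X12"
proof -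
  note [measurable] = X12D(1)[OF assms(1)] X12D(1)[OF assms(2)]
  have b: "norm ((f x + g x)^2) <= 2 * (f x)^2 + 2 * (g x)^2" for x using norm_add_sq_le[of "f x" "g x"] by simp
  have "integrable lborel (%x. 2 * (f x)^2 + 2 * (g x)^2)"
    by (intro Bochner_Integration.integrable_add integrable_mult_right X12D(3) assms)
  then have "integrable lborel (%x. (f x + g x)^2)" by (rule integrable_boundI[OF _ _ b]) measurable
  then show ?thesis using assms by (auto simp: X12_def)
qed

lemma X12_cmult: "f \<in> X12 ==> (%x. c * f x) \<in> X12"
  by (auto simp: X12_def power_mult_distrib)

lemma X12_abs: "f \<in> X12 ==> (%x. \<bar>f x\<bar>) \<in> X12"
  by (rule X12_bound) (auto dest: X12D)

lemma X12_diff: "f \<in> X12 ==> g \<in> X12 ==> (%x. f x - g x) \<in> X12"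
  using X12_add[of f "%x. -1 * g x"] X12_cmult[of g "-1"] by simp

text \<open>The square of the singular part of the Coulomb kernel, integrable in three dimensions
  since the polar weight cancels \<open>1 / r^2\<close>.\<close>

definition ker2 :: "real^3 => real" where "ker2 y = indicator (cball 0 1) y * (1 / (norm y)^2)"

lemma ker2_integrable: "integrable lborel ker2"
proof (rule integrableI_bounded)
  show [measurable]: "ker2 \<in> borel_measurable lborel" unfolding ker2_def by measurable
  let ?h = "%r::real. indicator {..1} r * ennreal (1 / r^2)"
  have "(NN y. ennreal (norm (ker2 y))) = (\<integral>\<^sup>+y. ?h (norm y) \<partial>(lborel :: (real^3) measure))"
    by (rule nn_integral_cong) (auto simp: ker2_def split: split_indicator)
  also have "\<dots> = (NN r. ennreal (3 * vol1 * r^2) * indicator {0..} r * ?h r)"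
    by (rule polar) measurable
  also have "\<dots> <= (NN r. ennreal (3 * vol1) * indicator {0..1} (r::real))"
  proof (rule nn_integral_mono)
    fix r :: real
    show "ennreal (3 * vol1 * r^2) * indicator {0..} r * ?h r <= ennreal (3 * vol1) * indicator {0..1} r"
      using vol1_pos by (cases "r = 0") (auto simp flip: ennreal_mult split: split_indicator)
  qed
  also have "\<dots> < \<infinity>" by (simp add: nn_integral_cmult ennreal_mult_less_top)
  finally show "(NN y. ennreal (norm (ker2 y))) < \<infinity>" .
qed

definition kc :: real where "kc = (LBINT y. ker2 y)"

text \<open>Near the diagonal the product is split by the inequality between geometric and
  arithmetic mean; away from it the kernel is at most 1. Integrated in \<open>y\<close>, the bound
  no longer depends on \<open>x\<close>.\<close>

lemma pot_pointwise: "\<bar>a\<bar> / norm (x - y) <= \<bar>a\<bar> + (a^2 + ker2 (x - y)) / 2"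
proof (cases "norm (x - y) <= 1")
  case True
  have "2 * \<bar>a\<bar> * (1 / norm (x - y)) <= \<bar>a\<bar>\<^sup>2 + (1 / norm (x - y))^2" by (rule sum_squares_bound)
  also have "(1 / norm (x - y))^2 = ker2 (x - y)" using True by (simp add: ker2_def power_divide)
  finally have "\<bar>a\<bar> / norm (x - y) <= (a^2 + ker2 (x - y)) / 2" by (simp add: mult.commute)
  then show ?thesis using abs_ge_zero[of a] by linarith
next
  case False
  then have "\<bar>a\<bar> / norm (x - y) <= \<bar>a\<bar>" by (simp add: divide_le_eq mult_left_mono[of 1 "norm (x - y)" "\<bar>a\<bar>", simplified])
  moreover have "0 <= (a^2 + ker2 (x - y)) / 2" by (simp add: ker2_def)
  ultimately show ?thesis by linarith
qed

lemma pot_integrable: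
  assumes f: "f \<in> X12"
  shows "integrable lborel (%y. f y / norm (x - y))"
    "(LBINT y. \<bar>f y\<bar> / norm (x - y)) <= (LBINT y. \<bar>f y\<bar>) + ((LBINT y. (f y)^2) + kc) / 2"
proof -
  note [measurable] = X12D(1)[OF f]
  have k: "integrable lborel (%y. ker2 (x - y))" "(LBINT y. ker2 (x - y)) = kc"
    using lborel_integrable_affine[OF ker2_integrable, of "-1" x] lborel_integral_affine[of ker2 "-1" x] ker2_integrable
    by (auto simp: kc_def)
  have i: "integrable lborel (%y. \<bar>f y\<bar> + ((f y)^2 + ker2 (x - y)) / 2)"
    using X12D(2,3)[OF f] k by auto
  show j: "integrable lborel (%y. f y / norm (x - y))"
    by (rule integrable_boundI[OF i]) (use pot_pointwise in auto)
  have "(LBINT y. \<bar>f y\<bar> / norm (x - y)) <= (LBINT y. \<bar>f y\<bar> + ((f y)^2 + ker2 (x - y)) / 2)"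
    by (rule integral_mono[OF _ i]) (use integrable_abs[OF j] pot_pointwise in auto)
  also have "\<dots> = (LBINT y. \<bar>f y\<bar>) + ((LBINT y. (f y)^2) + kc) / 2"
    using X12D(2,3)[OF f] k by simp
  finally show "(LBINT y. \<bar>f y\<bar> / norm (x - y)) <= (LBINT y. \<bar>f y\<bar>) + ((LBINT y. (f y)^2) + kc) / 2" .
qed

lemma pot_bound:
  assumes f: "f \<in> X12"
  shows "\<bar>pot f x\<bar> <= (LBINT y. \<bar>f y\<bar>) + ((LBINT y. (f y)^2) + kc) / 2"
proof -
  have "\<bar>pot f x\<bar> <= (LBINT y. \<bar>f y / norm (x - y)\<bar>)" unfolding pot_def by (rule integral_abs_bound)
  then show ?thesis using pot_integrable(2)[OF f, of x] by simp
qed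

lemma pot_measurable [measurable]: "f \<in> X12 ==> pot f \<in> bmeas"
proof -
  assume "f \<in> X12"
  note [measurable] = X12D(1)[OF this]
  show ?thesis unfolding pot_def by measurable
qed

lemma pot_nonneg: "(!!x. 0 <= f x) ==> 0 <= pot f x"
  unfolding pot_def by (rule Bochner_Integration.integral_nonneg) simp

lemma pot_add: "f \<in> X12 ==> g \<in> X12 ==> pot (%x. f x + g x) x = pot f x + pot g x"
  unfolding pot_def by (simp add: add_divide_distrib pot_integrable)

lemma pot_cmult: "pot (%x. c * f x) x = c * pot f x"
  unfolding pot_def by (simp flip: integral_mult_right_zero)

lemma dd_integrable:
  assumes f: "f \<in> X12" and g: "g \<in> X12" shows "integrable lborel (%x. f x * pot g x)"
proof -
  note [measurable] = X12D(1)[OF f] pot_measurable[OF g]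
  let ?c = "(LBINT y. \<bar>g y\<bar>) + ((LBINT y. (g y)^2) + kc) / 2"
  show ?thesis
    by (rule integrable_boundI[OF integrable_mult_right[OF integrable_abs[OF X12D(2)[OF f]], of ?c]])
      (use pot_bound[OF g] in \<open>auto simp: abs_mult mult.commute[of _ "\<bar>f _\<bar>"] intro!: mult_left_mono\<close>)
qed

lemma dd_bound:
  assumes f: "f \<in> X12" and g: "g \<in> X12" and b: "!!x. \<bar>pot g x\<bar> <= c"
  shows "\<bar>dd f g\<bar> <= c * (LBINT x. \<bar>f x\<bar>)"
proof -
  have "\<bar>dd f g\<bar> <= (LBINT x. \<bar>f x * pot g x\<bar>)" unfolding dd_def by (rule integral_abs_bound)
  also have "\<dots> <= (LBINT x. c * \<bar>f x\<bar>)"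
    by (rule integral_mono) (use integrable_abs[OF dd_integrable[OF f g]] X12D(2)[OF f] b in \<open>auto simp: abs_mult mult.commute[of c] intro!: mult_left_mono\<close>)
  finally show ?thesis by simp
qed

lemma dd_add_left: "f \<in> X12 ==> g \<in> X12 ==> h \<in> X12 ==> dd (%x. f x + g x) h = dd f h + dd g h"
  unfolding dd_def by (simp add: distrib_right dd_integrable)

lemma dd_add_right: "f \<in> X12 ==> g \<in> X12 ==> h \<in> X12 ==> dd h (%x. f x + g x) = dd h f + dd h g"
  unfolding dd_def by (simp add: pot_add distrib_left dd_integrable)

lemma dd_cmult_left: "dd (%x. c * f x) g = c * dd f g"
  unfolding dd_def by (simp add: mult.assoc)

lemma dd_cmult_right: "dd g (%x. c * f x) = c * dd g f"
  unfolding dd_def pot_cmult by (simp add: mult.left_commute)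

lemma dd_nonneg: "(!!x. 0 <= f x) ==> (!!x. 0 <= g x) ==> 0 <= dd f g"
  unfolding dd_def by (rule Bochner_Integration.integral_nonneg) (simp add: pot_nonneg)

lemma dd_commute:
  assumes f: "f \<in> X12" and g: "g \<in> X12" shows "dd f g = dd g f"
proof -
  note [measurable] = X12D(1)[OF f] X12D(1)[OF g]
  let ?h = "%x y. f x * g y / norm (x - y)"
  have i: "integrable (lborel \<Otimes>\<^sub>M lborel) (%(x, y). ?h x y)"
  proof (rule lborel_pair.Fubini_integrable)
    have "(LBINT y. norm (?h x y)) = \<bar>f x\<bar> * pot (%y. \<bar>g y\<bar>) x" for x
      unfolding pot_def by (simp add: abs_mult flip: integral_mult_right_zero)
    then show "integrable lborel (%x. \<integral>y. norm (case (x, y) of (x, y) => ?h x y) \<partial>lborel)"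
      using dd_integrable[OF X12_abs[OF f] X12_abs[OF g]] by simp
    show "AE x in lborel. integrable lborel (%y. case (x, y) of (x, y) => ?h x y)"
      using integrable_mult_right[OF pot_integrable(1)[OF g]] by simp
  qed measurable
  have "dd f g = (LBINT x. (LBINT y. ?h x y))"
    unfolding dd_def pot_def by (simp flip: integral_mult_right_zero)
  also have "\<dots> = (LBINT y. (LBINT x. ?h x y))"
    using lborel_pair.Fubini_integral[OF i] by simp
  also have "\<dots> = dd g f"
    unfolding dd_def pot_def by (simp add: norm_minus_commute mult.commute flip: integral_mult_right_zero)
  finally show ?thesis .
qed

lemma H1_X12:
  assumes u: "u \<in> H1" shows "(%x. (norm (u x))^2) \<in> X12"
proof -
  have [measurable]: "u \<in> bmeas" using L2_measurable[OF H1_L2[OF u]] .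
  have "norm (u x) powr 4 = ((norm (u x))^2)^2" for x
    using powr_realpow'[of "norm (u x)" 4] by simp
  then have "integrable lborel (%x. ((norm (u x))^2)^2)"
    using H1_pw_integrable[of 4 u] u by simp
  then show ?thesis using L2_integrable[OF H1_L2[OF u]] by (simp add: X12_def)
qed

lemma H1_inner_X12:
  assumes u: "u \<in> H1" and v: "v \<in> H1" shows "(%x. u x \<bullet> v x) \<in> X12"
proof (rule X12_bound[OF X12_add[OF H1_X12[OF u] H1_X12[OF v]]])
  have [measurable]: "u \<in> bmeas" "v \<in> bmeas" using L2_measurable[OF H1_L2] u v by auto
  show "(%x. u x \<bullet> v x) \<in> bmeas" by measurable
  show "\<bar>u x \<bullet> v x\<bar> <= \<bar>(norm (u x))\<^sup>2 + (norm (v x))^2\<bar>" for x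
    using Cauchy_Schwarz_ineq2[of "u x" "v x"] sum_squares_bound[of "norm (u x)" "norm (v x)"]
      mult_nonneg_nonneg[OF norm_ge_zero[of "u x"] norm_ge_zero[of "v x"]] by linarith
qed

lemma coulomb_dd: "CE u = dd (%x. (norm (u x))^2) (%x. (norm (u x))^2)"
  unfolding coulomb_energy_def dd_def pot_def by (simp flip: integral_mult_right_zero)

lemma coulomb_potential_pot: "coulomb_potential u = pot (%x. (norm (u x))^2)"
  by (simp add: coulomb_potential_def pot_def fun_eq_iff)

lemma coulomb_nonneg: "0 <= CE u"
  unfolding coulomb_dd by (rule dd_nonneg) auto

lemma pot_L4_bound:
  assumes u: "u \<in> H1"
  shows "\<bar>pot (%x. (norm (u x))^2) x\<bar> <= (n2 u)^2 + (pw 4 u + kc) / 2"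
proof -
  have "norm (u x) powr 4 = ((norm (u x))^2)^2" for x
    using powr_realpow'[of "norm (u x)" 4] by simp
  then show ?thesis using pot_bound[OF H1_X12[OF u], of x] by (simp add: n2_sq pw_def)
qed

lemma pot_dilate:
  assumes u: "u \<in> bmeas"
  shows "pot (%x. (norm (dilate s u x))^2) x = exp s * pot (%x. (norm (u x))^2) (exp s *R x)"
proof -
  have [measurable]: "u \<in> bmeas" by fact
  have "(exp (3 * s / 2))^2 = exp s ^ 3" by (simp add: power2_eq_square exp_3[symmetric] flip: exp_add)
  then have e: "(norm (dilate s u y))^2 = exp s ^ 3 * (norm (u (exp s *R y)))^2" for y
    by (simp add: dilate_def power_mult_distrib)
  have "pot (%x. (norm (u x))^2) (exp s *R x) = exp s ^ 3 * (LBINT y. (norm (u (exp s *R y)))^2 / norm (exp s *R x - exp s *R y))"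
    unfolding pot_def
    using lborel_integral_affine[of "%y. (norm (u y))^2 / norm (exp s *R x - y)" "exp s" 0] by simp
  also have "(%y. (norm (u (exp s *R y)))^2 / norm (exp s *R x - exp s *R y)) = (%y. (norm (u (exp s *R y)))^2 / (exp s * norm (x - y)))"
    by (simp flip: scaleR_diff_right)
  also have "exp s ^ 3 * (LBINT y. (norm (u (exp s *R y)))^2 / (exp s * norm (x - y))) = pot (%x. (norm (dilate s u x))^2) x / exp s"
    unfolding pot_def e by (simp add: field_simps flip: integral_mult_right_zero integral_divide_zero)
  finally show ?thesis by simp
qed

lemma coulomb_dilate:
  assumes u: "u \<in> H1" shows "CE (dilate s u) = exp s * CE u"
proof -
  have [measurable]: "u \<in> bmeas" using L2_measurable[OF H1_L2[OF u]] .
  have [measurable]: "pot (%x. (norm (u x))^2) \<in> bmeas" by (rule pot_measurable[OF H1_X12[OF u]])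
  have "(exp (3 * s / 2))^2 = exp s ^ 3" by (simp add: power2_eq_square exp_3[symmetric] flip: exp_add)
  then have e: "(norm (dilate s u y))^2 = exp s ^ 3 * (norm (u (exp s *R y)))^2" for y
    by (simp add: dilate_def power_mult_distrib)
  have "CE (dilate s u) = exp s * (exp s ^ 3 * (LBINT x. (norm (u (exp s *R x)))^2 * pot (%x. (norm (u x))^2) (exp s *R x)))"
    unfolding coulomb_dd dd_def pot_dilate[OF \<open>u \<in> bmeas\<close>] unfolding e by (simp add: mult_ac flip: integral_mult_right_zero)
  also have "exp s ^ 3 * (LBINT x. (norm (u (exp s *R x)))^2 * pot (%x. (norm (u x))^2) (exp s *R x)) = CE u"
    unfolding coulomb_dd dd_def
    using lborel_integral_affine[of "%x. (norm (u x))^2 * pot (%x. (norm (u x))^2) x" "exp s" 0] by simp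
  finally show ?thesis .
qed

lemma coulomb_nn:
  assumes u: "u \<in> H1"
  shows "(\<integral>\<^sup>+x. (NN y. ennreal ((norm (u x))^2 * (norm (u y))^2 / norm (x - y))) \<partial>lborel) = ennreal (CE u)"
proof -
  let ?r = "%x. (norm (u x))^2"
  note X = H1_X12[OF u]
  have "(NN y. ennreal (?r x * ?r y / norm (x - y))) = ennreal (?r x * pot ?r x)" for x
  proof -
    have "(NN y. ennreal (?r x * ?r y / norm (x - y))) = ennreal (LBINT y. ?r x * ?r y / norm (x - y))"
      by (rule nn_integral_eq_integral) (use integrable_mult_right[OF pot_integrable(1)[OF X, of x], of "?r x"] in auto)
    also have "(LBINT y. ?r x * ?r y / norm (x - y)) = ?r x * pot ?r x"
      unfolding pot_def by (simp flip: integral_mult_right_zero)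
    finally show ?thesis .
  qed
  then show ?thesis
    using nn_integral_eq_integral[OF dd_integrable[OF X X]] by (simp add: pot_nonneg coulomb_dd dd_def)
qed

text \<open>Fatou's lemma in both variables. Lower semicontinuity suffices for the minimisation,
  since the Coulomb term enters the energy with a positive sign.\<close>

lemma coulomb_Fatou:
  assumes V: "!!n. V n \<in> H1" and v: "v \<in> H1" and lim: "AE x in lborel. (%n. V n x) ----> v x"
    and l: "(%n. CE (V n)) ----> l"
  shows "CE v <= l"
proof -
  have [measurable]: "v \<in> bmeas" "!!n. V n \<in> bmeas" using L2_measurable[OF H1_L2] v V by auto
  let ?k = "%u x y. ennreal ((norm (u x))^2 * (norm (u y))^2 / norm (x - y))"
  have "ennreal (CE v) = (NN x. (NN y. ?k v x y))" by (rule coulomb_nn[OF v, symmetric])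
  also have "\<dots> <= (\<integral>\<^sup>+x. (NN y. liminf (%n. ?k (V n) x y)) \<partial>lborel)"
  proof (rule nn_integral_mono_AE)
    show "AE x in lborel. (NN y. ?k v x y) <= (NN y. liminf (%n. ?k (V n) x y))"
      using lim
    proof eventually_elim
      case x: (elim x)
      show ?case
      proof (rule nn_integral_mono_AE)
        show "AE y in lborel. ?k v x y <= liminf (%n. ?k (V n) x y)"
          using lim
        proof eventually_elim
          case (elim y)
          have "(%n. ?k (V n) x y) ----> ?k v x y"
            unfolding divide_inverse by (intro tendsto_ennrealI tendsto_mult tendsto_power tendsto_norm x elim tendsto_const)
          then show ?case using lim_imp_Liminf[OF sequentially_bot] by fastforce
        qed
      qed
    qed
  qed
  also have "\<dots> <= (\<integral>\<^sup>+x. liminf (%n. \<integral>\<^sup>+y. ?k (V n) x y \<partial>lborel) \<partial>lborel)"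
    by (intro nn_integral_mono nn_integral_liminf) measurable
  also have "\<dots> <= liminf (%n. \<integral>\<^sup>+x. (NN y. ?k (V n) x y) \<partial>lborel)"
    by (intro nn_integral_liminf) measurable
  also have "\<dots> = liminf (%n. ennreal (CE (V n)))" by (simp add: coulomb_nn[OF V])
  also have "\<dots> = ennreal l" by (rule lim_imp_Liminf) (auto intro: tendsto_ennrealI l)
  finally show ?thesis using LIMSEQ_le_const[OF l, of 0] coulomb_nonneg by (simp add: ennreal_le_iff)
qed

text \<open>By bilinearity and symmetry the difference of the energies is \<open>dd\<close> of the
  difference of the densities against their sum. The potential of the sum is bounded uniformly in
  \<open>n\<close>, and the difference of the densities tends to 0 in L1 by Cauchy-Schwarz.\<close>

lemma coulomb_tendsto:
  assumes V: "!!n. V n \<in> H1" and v: "v \<in> H1" and b: "!!n. n2 (V n) <= M" "!!n. grad_norm (V n) <= M"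
    and lim: "(%n. n2 (%x. V n x - v x)) ----> 0"
  shows "(%n. CE (V n)) ----> CE v"
proof -
  let ?r = "%u x. (norm (u x :: complex))^2"
  note VL = H1_L2[OF V] and vL = H1_L2[OF v] and X = H1_X12[OF V] and Y = H1_X12[OF v]
  have [measurable]: "v \<in> bmeas" "!!n. V n \<in> bmeas" using L2_measurable VL vL by auto
  obtain C where C: "0 < C" "!!u. u \<in> H1 ==> pw 4 u <= C * (n2 u powr 4 + grad_norm u powr 4)"
    by (rule H1_pw_bound[of 4]) auto
  define c where "c = (M^2 + (C * (M powr 4 + M powr 4) + kc) / 2) + ((n2 v)^2 + (pw 4 v + kc) / 2)"
  have "pw 4 (V n) <= C * (M powr 4 + M powr 4)" for n
    using b[of n] C(1) by (intro order_trans[OF C(2)[OF V]] mult_left_mono add_mono powr_mono2) auto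
  moreover have "(n2 (V n))^2 <= M^2" for n using b(1)[of n] by (intro power_mono) auto
  ultimately have pb: "\<bar>pot (%x. ?r (V n) x + ?r v x) x\<bar> <= c" for n x
    unfolding pot_add[OF X Y] c_def
    by (intro order_trans[OF abs_triangle_ineq] add_mono order_trans[OF pot_L4_bound[OF V]] pot_L4_bound[OF v] divide_right_mono) auto
  have c0: "0 <= c" using pb[of 0 0] by linarith
  have M0: "0 <= M" using b(1)[of 0] n2_nonneg order_trans by blast
  have bd: "\<bar>CE (V n) - CE v\<bar> <= n2 (%x. V n x - v x) * (c * (M + n2 v))" for n
  proof -
    have "CE (V n) - CE v = dd (%x. ?r (V n) x - ?r v x) (%x. ?r (V n) x + ?r v x)"
      using dd_add_left[OF X[of n] X12_cmult[OF Y, of "-1"] X12_add[OF X[of n] Y]]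
      by (simp add: coulomb_dd dd_add_right[OF X Y] X Y dd_cmult_left[of "-1", simplified] dd_commute[OF Y X])
    also have "\<bar>\<dots>\<bar> <= c * (LBINT x. \<bar>?r (V n) x - ?r v x\<bar>)"
      by (rule dd_bound[OF X12_diff[OF X Y] X12_add[OF X Y] pb])
    also have "(LBINT x. \<bar>?r (V n) x - ?r v x\<bar>) <= (LBINT x. norm (V n x - v x) * norm (norm (V n x) + norm (v x)))"
    proof (rule integral_mono)
      show "integrable lborel (%x. \<bar>?r (V n) x - ?r v x\<bar>)" by (rule integrable_abs[OF X12D(2)[OF X12_diff[OF X Y]]])
      have "(%x. norm (V n x) + norm (v x)) \<in> L2"
        by (intro L2_add; rule L2_bound1(1)[OF VL[of n]] L2_bound1(1)[OF vL]) auto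
      then show "integrable lborel (%x. norm (V n x - v x) * norm (norm (V n x) + norm (v x)))"
        by (rule L2_mult_integrable[OF L2_diff[OF VL vL]])
      show "\<bar>?r (V n) x - ?r v x\<bar> <= norm (V n x - v x) * norm (norm (V n x) + norm (v x))" for x
      proof -
        have "\<bar>?r (V n) x - ?r v x\<bar> = \<bar>norm (V n x) - norm (v x)\<bar> * (norm (V n x) + norm (v x))"
          by (simp add: power2_eq_square square_diff_square_factored abs_mult mult.commute)
        also have "\<dots> <= norm (V n x - v x) * (norm (V n x) + norm (v x))"
          by (intro mult_right_mono norm_triangle_ineq3) auto
        finally show ?thesis by simp
      qed
    qed
    also have "\<dots> <= n2 (%x. V n x - v x) * n2 (%x. norm (V n x) + norm (v x))"
      by (rule Cauchy_Schwarz_n2[OF L2_diff[OF VL vL]]) (intro L2_add; rule L2_bound1(1)[OF VL[of n]] L2_bound1(1)[OF vL]; simp)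
    also have "n2 (%x. norm (V n x) + norm (v x)) <= n2 (%x. norm (V n x)) + n2 (%x. norm (v x))"
      by (rule n2_triangle; rule L2_bound1(1)[OF VL[of n]] L2_bound1(1)[OF vL]) auto
    also have "\<dots> <= M + n2 v" using b(1)[of n] by (simp add: n2_def)
    finally show ?thesis using c0 by (simp add: mult_left_mono mult_right_mono n2_nonneg mult_ac)
  qed
  have "(%n. CE (V n) - CE v) ----> 0"
    by (rule Lim_null_comparison[OF _ tendsto_mult_left_zero[OF lim, of "c * (M + n2 v)"]])
      (rule always_eventually, use bd in simp)
  then show ?thesis by (rule LIM_zero_cancel)
qed

section \<open>Fibre maps: the energy along dilations as an exponential sum in four real
  coefficients\<close>

definition fib :: "real => real => real => real => real => real => real => real" where
  "fib alpha beta A C F G s = A * exp (2 * s) / 2 + C * exp s / 4 - F * exp (alpha * s) - G * exp (beta * s)"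

definition fib1 :: "real => real => real => real => real => real => real => real" where
  "fib1 alpha beta A C F G s = A * exp (2 * s) + C * exp s / 4 - alpha * F * exp (alpha * s) - beta * G * exp (beta * s)"

definition fib2 :: "real => real => real => real => real => real => real => real" where
  "fib2 alpha beta A C F G s = 2 * A * exp (2 * s) + C * exp s / 4 - alpha^2 * F * exp (alpha * s) - beta^2 * G * exp (beta * s)"

lemma fib_deriv: "(fib alpha beta A C F G has_real_derivative fib1 alpha beta A C F G s) (at s)"
  unfolding fib_def[abs_def] fib1_def by (auto intro!: derivative_eq_intros)

lemma fib1_deriv: "(fib1 alpha beta A C F G has_real_derivative fib2 alpha beta A C F G s) (at s)"
  unfolding fib1_def[abs_def] fib2_def by (auto intro!: derivative_eq_intros simp: power2_eq_square)

lemma fib_cont: "continuous_on T (fib alpha beta A C F G)"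
  by (intro continuous_at_imp_continuous_on ballI DERIV_isCont[OF fib_deriv])

lemma fib1_isCont: "isCont (fib1 alpha beta A C F G) s"
  by (rule DERIV_isCont[OF fib1_deriv])

text \<open>Linearity in the coefficients separates the effect of perturbing the four integrals from
  that of moving the dilation parameter.\<close>

lemma fib_add:
  "fib alpha beta (A + A') (C + C') (F + F') (G + G') s = fib alpha beta A C F G s + fib alpha beta A' C' F' G' s"
  "fib1 alpha beta (A + A') (C + C') (F + F') (G + G') s = fib1 alpha beta A C F G s + fib1 alpha beta A' C' F' G' s"
  by (simp_all add: fib_def fib1_def add_divide_distrib algebra_simps)

lemma fib_mono:
  assumes "A <= A'" "C <= C'" "F' <= F" "G' <= G"
  shows "fib alpha beta A C F G s <= fib alpha beta A' C' F' G' s"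
  unfolding fib_def using assms by (intro diff_mono add_mono divide_right_mono mult_right_mono) auto

text \<open>The factor \<open>exp (- beta s)\<close> makes the derivative of \<^term>\<open>fib1 alpha beta A C F G\<close> have the sign of the
  decreasing function \<open>k\<close>.\<close>

locale fibre =
  fixes alpha beta A C F G :: real
  assumes ab: "2 < alpha" "0 < beta" "beta < 1" and A: "0 < A" and C: "0 <= C"
begin

definition h where "h s = A * exp ((2 - beta) * s) + C / 4 * exp ((1 - beta) * s) - alpha * F * exp ((alpha - beta) * s) - beta * G"
definition k where "k s = (2 - beta) * A * exp ((2 - alpha) * s) + (1 - beta) * C / 4 * exp ((1 - alpha) * s) - alpha * (alpha - beta) * F"

lemma fib1_h: "fib1 alpha beta A C F G s = exp (beta * s) * h s"
  by (simp add: fib1_def h_def algebra_simps flip: exp_add)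

lemma h_deriv: "(h has_real_derivative exp ((alpha - beta) * s) * k s) (at s)"
  unfolding h_def[abs_def] k_def
  by (auto intro!: derivative_eq_intros simp: algebra_simps add_divide_distrib diff_divide_distrib simp flip: exp_add)

lemma fib2_k: assumes "fib1 alpha beta A C F G s = 0" shows "fib2 alpha beta A C F G s = exp (alpha * s) * k s"
proof -
  have "fib2 alpha beta A C F G s = fib2 alpha beta A C F G s - beta * fib1 alpha beta A C F G s" using assms by simp
  then show ?thesis by (simp add: fib1_def fib2_def k_def algebra_simps add_divide_distrib diff_divide_distrib power2_eq_square flip: exp_add)
qed

lemma k_strict: "s < t ==> k t < k s"
  unfolding k_def using ab A C
  by (intro diff_strict_right_mono add_less_le_mono mult_strict_left_mono mult_left_mono) auto

lemma h_sign: "0 < h s \<longleftrightarrow> 0 < fib1 alpha beta A C F G s" "h s < 0 \<longleftrightarrow> fib1 alpha beta A C F G s < 0" "h s = 0 \<longleftrightarrow> fib1 alpha beta A C F G s = 0"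
  by (simp_all add: fib1_h zero_less_mult_iff mult_less_0_iff)

lemma h_mvt: "s < t ==> \<exists>z. s < z \<and> z < t \<and> h t - h s = (t - s) * (exp ((alpha - beta) * z) * k z)"
  by (rule MVT2) (auto intro: h_deriv)

text \<open>The mean value theorem between \<open>z\<close> and \<open>s0\<close> finds a point with
  \<open>k > 0\<close>; as \<open>k\<close> decreases, it is positive on everything to the left, so
  \<open>h\<close> increases up to \<open>z\<close>. The lemma \<open>right\<close> is the mirror
  image.\<close>

lemma left:
  assumes s0: "0 < h s0" and z: "z < s0" "h z <= 0" shows "0 < k z" "s < z ==> h s < h z"
proof -
  obtain y where y: "z < y" "h s0 - h z = (s0 - z) * (exp ((alpha - beta) * y) * k y)" using h_mvt[OF z(1)] by blast
  have "0 < (s0 - z) * (exp ((alpha - beta) * y) * k y)" using s0 z(2) y(2) by linarith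
  then have "0 < k y" using z(1) by (auto simp: zero_less_mult_iff)
  then show kz: "0 < k z" using k_strict[OF y(1)] by linarith
  assume "s < z"
  then obtain x where x: "x < z" "h z - h s = (z - s) * (exp ((alpha - beta) * x) * k x)" using h_mvt by blast
  have "0 < k x" using kz k_strict[OF x(1)] by linarith
  then have "0 < (z - s) * (exp ((alpha - beta) * x) * k x)" using \<open>s < z\<close> by simp
  then show "h s < h z" using x(2) by linarith
qed

lemma right:
  assumes s0: "0 < h s0" and z: "s0 < z" "h z <= 0" shows "k z < 0" "z < s ==> h s < h z"
proof -
  obtain y where y: "y < z" "h z - h s0 = (z - s0) * (exp ((alpha - beta) * y) * k y)" using h_mvt[OF z(1)] by blast
  have "(z - s0) * (exp ((alpha - beta) * y) * k y) < 0" using s0 z(2) y(2) by linarith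
  then have "k y < 0" using z(1) by (auto simp: mult_less_0_iff)
  then show kz: "k z < 0" using k_strict[OF y(1)] by linarith
  assume "z < s"
  then obtain x where x: "z < x" "h s - h z = (s - z) * (exp ((alpha - beta) * x) * k x)" using h_mvt by blast
  have "k x < 0" using kz k_strict[OF x(1)] by linarith
  then have "(s - z) * (exp ((alpha - beta) * x) * k x) < 0" using \<open>z < s\<close> by (simp add: mult_pos_neg)
  then show "h s < h z" using x(2) by linarith
qed

text \<open>At a zero of \<open>fib1\<close> the second derivative has the sign of \<open>k\<close>.
  Hence a critical point to the left of a point \<open>s0\<close> of increase is a strict local
  minimum, and one to the right a strict local maximum.\<close>

lemma side:
  assumes s0: "0 < fib1 alpha beta A C F G s0" and z: "fib1 alpha beta A C F G z = 0"
  shows "0 < fib2 alpha beta A C F G z \<longleftrightarrow> z < s0" "fib2 alpha beta A C F G z < 0 \<longleftrightarrow> s0 < z"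
  using left(1)[of s0 z] right(1)[of s0 z] s0 z
  by (cases z s0 rule: linorder_cases; simp add: fib2_k[OF z] h_sign[symmetric] zero_less_mult_iff mult_less_0_iff)+

lemma sign_right:
  assumes s0: "0 < fib1 alpha beta A C F G s0" and z: "fib1 alpha beta A C F G z <= 0" "s0 < z"
  shows "z < s ==> fib1 alpha beta A C F G s < 0"
    and "fib1 alpha beta A C F G z = 0 ==> s0 <= s ==> s < z ==> 0 < fib1 alpha beta A C F G s"
proof -
  have hz: "h z <= 0" using z(1) h_sign(1)[of z] by linarith
  have h0: "0 < h s0" using s0 by (simp add: h_sign)
  show "fib1 alpha beta A C F G s < 0" if "z < s" using right(2)[OF h0 z(2) hz that] hz by (simp flip: h_sign)
  show "0 < fib1 alpha beta A C F G s" if *: "fib1 alpha beta A C F G z = 0" "s0 <= s" "s < z"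
  proof (rule ccontr)
    assume "\<not> 0 < fib1 alpha beta A C F G s"
    then have hs: "h s <= 0" by (simp flip: h_sign)
    then have "s0 < s" using *(2) h0 by (cases "s = s0") auto
    from right(2)[OF h0 this hs *(3)] hs * show False by (simp flip: h_sign)
  qed
qed

lemma sign_left:
  assumes s0: "0 < fib1 alpha beta A C F G s0" and z: "fib1 alpha beta A C F G z = 0" "z < s0"
  shows "s < z ==> fib1 alpha beta A C F G s < 0"
    and "z < s ==> s <= s0 ==> 0 < fib1 alpha beta A C F G s"
proof -
  have hz: "h z = 0" using z(1) by (simp add: h_sign)
  have h0: "0 < h s0" using s0 by (simp add: h_sign)
  show "fib1 alpha beta A C F G s < 0" if "s < z" using left(2)[OF h0 z(2) _ that] hz by (simp flip: h_sign)
  show "0 < fib1 alpha beta A C F G s" if *: "z < s" "s <= s0"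
  proof (rule ccontr)
    assume "\<not> 0 < fib1 alpha beta A C F G s"
    then have hs: "h s <= 0" by (simp flip: h_sign)
    then have "s < s0" using *(2) h0 by (cases "s = s0") auto
    from left(2)[OF h0 this hs *(1)] hs hz show False by simp
  qed
qed

lemma max_at:
  assumes s0: "0 < fib1 alpha beta A C F G s0" and z: "fib1 alpha beta A C F G z = 0" "s0 < z" and s: "s0 <= s" "s \<noteq> z"
  shows "fib alpha beta A C F G s < fib alpha beta A C F G z"
proof (cases "s < z")
  case True
  then show ?thesis
  proof (rule DERIV_pos_imp_increasing_open)
    show "\<exists>y. (fib alpha beta A C F G has_real_derivative y) (at x) \<and> 0 < y" if "s < x" "x < z" for x
      using that s(1) sign_right(2)[OF s0 _ z(2) z(1), of x] fib_deriv z(1) by (intro exI[of _ "fib1 alpha beta A C F G x"]) simp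
  qed (rule fib_cont)
next
  case False
  then have "z < s" using s by simp
  then show ?thesis
  proof (rule DERIV_neg_imp_decreasing_open)
    show "\<exists>y. (fib alpha beta A C F G has_real_derivative y) (at x) \<and> y < 0" if "z < x" "x < s" for x
      using that sign_right(1)[OF s0 _ z(2), of x] fib_deriv z(1) by (intro exI[of _ "fib1 alpha beta A C F G x"]) simp
  qed (rule fib_cont)
qed

text \<open>The function \<open>h\<close> tends to \<open>- beta * G < 0\<close> at minus infinity
  and is negative for large \<open>s\<close>, where the \<open>F\<close> term dominates as
  \<open>alpha > 2\<close>; the intermediate value theorem gives a zero on each side of
  \<open>s0\<close>.\<close>

lemma zeros:
  assumes s0: "0 < fib1 alpha beta A C F G s0" and FG: "0 < F" "0 < G"
  obtains z y where "z < s0" "s0 < y" "fib1 alpha beta A C F G z = 0" "fib1 alpha beta A C F G y = 0"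
proof -
  have cont: "!!x. isCont h x" by (rule DERIV_isCont[OF h_deriv])
  have "(h \<longlongrightarrow> A * 0 + C / 4 * 0 - alpha * F * 0 - beta * G) at_bot" unfolding h_def[abs_def]
    by (intro tendsto_intros filterlim_compose[OF exp_at_bot] filterlim_tendsto_pos_mult_at_bot[OF tendsto_const _ filterlim_ident])
      (use ab in auto)
  then have "eventually (%s. h s < 0) at_bot" using ab FG by (auto intro!: order_tendstoD(2))
  then obtain l where l: "l < s0" "h l < 0" unfolding eventually_at_bot_linorder by (metis less_le_not_le lt_ex linorder_linear order_trans)
  have e: "LIM s at_top. exp ((alpha - beta) * s) :> at_top"
    by (intro filterlim_compose[OF exp_at_top] filterlim_tendsto_pos_mult_at_top[OF tendsto_const _ filterlim_ident]) (use ab in auto)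
  have "((%s. A * exp ((2 - alpha) * s) + C / 4 * exp ((1 - alpha) * s) - alpha * F) \<longlongrightarrow> A * 0 + C / 4 * 0 - alpha * F) at_top"
    by (intro tendsto_intros filterlim_compose[OF exp_at_bot] filterlim_tendsto_neg_mult_at_bot[OF tendsto_const _ filterlim_ident])
      (use ab in auto)
  then have "eventually (%s. A * exp ((2 - alpha) * s) + C / 4 * exp ((1 - alpha) * s) - alpha * F < 0) at_top"
    by (rule order_tendstoD(2)) (use ab FG in simp)
  then have "eventually (%s. h s < 0 \<and> s0 < s) at_top"
    using eventually_gt_at_top[of s0]
  proof eventually_elim
    case (elim s)
    have "h s = exp ((alpha - beta) * s) * (A * exp ((2 - alpha) * s) + C / 4 * exp ((1 - alpha) * s) - alpha * F) - beta * G"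
      by (simp add: h_def algebra_simps flip: exp_add)
    moreover have "exp ((alpha - beta) * s) * (A * exp ((2 - alpha) * s) + C / 4 * exp ((1 - alpha) * s) - alpha * F) < 0"
      using elim by (simp add: mult_less_0_iff)
    moreover have "0 < beta * G" using ab FG by simp
    ultimately show ?case using elim by linarith
  qed
  then obtain r where r: "s0 < r" "h r < 0" using eventually_happens'[OF trivial_limit_at_top_linorder] by blast
  have h0: "0 < h s0" using s0 by (simp add: h_sign)
  obtain z where z: "l <= z" "z <= s0" "h z = 0" using IVT[of h l 0 s0] l h0 cont by auto
  obtain y where y: "s0 <= y" "y <= r" "h y = 0" using IVT2[of h r 0 s0] r h0 cont by auto
  have "z \<noteq> s0" "y \<noteq> s0" using z y h0 by auto
  with that[of z y] z y show ?thesis by (auto simp flip: h_sign)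
qed

end

text \<open>The point 0 lies to the right of the gap scale, so it is the nondegenerate maximum of
  the fibre map \<open>f\<close> on \<open>s1 <= s <= 1\<close>, with
  \<open>f s <= f 0 - k * s^2\<close>. The perturbation is linear in the increments and Lipschitz in
  \<open>s\<close> with constant \<open>B * delta\<close>, and
  \<open>B * delta * |s| - k * s^2\<close> never exceeds
  \<open>B^2 * delta^2 / (4 * k)\<close>.\<close>

lemma envelope:
  assumes f: "fibre alpha beta A C" and z: "fib1 alpha beta A C F G 0 = 0" and X: "0 < X" "X^2 < A"
    and gap: "0 < fib1 alpha beta A C F G (ln (X / sqrt A))"
  obtains L e where "0 < e" "!!dA dC dF dG s. \<bar>dA\<bar> + \<bar>dC\<bar> + \<bar>dF\<bar> + \<bar>dG\<bar> <= e ==> 0 <= C + dC ==>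
      X\<^sup>2 <= (A + dA) * exp (2 * s) ==> fib alpha beta (A + dA) (C + dC) (F + dF) (G + dG) s \<le>
      fib alpha beta A C F G 0 + dA / 2 + dC / 4 - dF - dG + L * (\<bar>dA\<bar> + \<bar>dC\<bar> + \<bar>dF\<bar> + \<bar>dG\<bar>)^2"
proof -
  interpret fibre alpha beta A C F G by (rule f)
  define s0 where "s0 = ln (X / sqrt A)"
  have "X < sqrt A" by (rule real_less_rsqrt) (rule X(2))
  then have s0: "s0 < 0" using X A by (simp add: s0_def)
  have "exp s0 = X / sqrt A" unfolding s0_def by (rule exp_ln) (use X A in simp)
  then have "exp s0 ^ 2 = X^2 / A" using A by (simp add: power_divide)
  then have es0: "A * exp (2 * s0) = X^2" using A exp_of_nat_mult[of 2 s0] by simp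
  have gap: "0 < fib1 alpha beta A C F G s0" using gap by (simp add: s0_def)
  \<comment> \<open>A margin to the left of the gap point: a change of \<open>A\<close> shifts the
    admissible range of \<open>s\<close>, which for small perturbations still stays to the right of
    \<open>s1\<close>.\<close>
  obtain s1 where s1: "s1 < s0" "0 < fib1 alpha beta A C F G s1"
  proof -
    have "eventually (%s. 0 < fib1 alpha beta A C F G s) (at_left s0)"
      by (rule order_tendstoD(1)[OF tendsto_within_subset[OF fib1_isCont[unfolded isCont_def] subset_UNIV] gap])
    moreover have "eventually (%s. s < s0) (at_left s0)" by (simp add: eventually_at_filter)
    ultimately have "eventually (%s. s < s0 \<and> 0 < fib1 alpha beta A C F G s) (at_left s0)" by eventually_elim simp
    then show ?thesis using that eventually_happens'[OF trivial_limit_at_left_real] by blast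
  qed
  have s10: "s1 < 0" using s1 s0 by simp
  have f1: "fib1 alpha beta A C F G 1 < 0" by (rule sign_right(1)[OF gap _ s0]) (simp_all add: z)
  define f2 where "f2 = fib2 alpha beta A C F G"
  have f20: "f2 0 < 0" using side(2)[OF gap z] s0 by (simp add: f2_def)
  \<comment> \<open>Half of the curvature at 0 persists in a neighbourhood by continuity.\<close>
  define c where "c = - f2 0 / 2"
  have c: "0 < c" using f20 by (simp add: c_def)
  have "isCont f2 0" unfolding f2_def fib2_def[abs_def] by (simp add: isCont_exp')
  moreover have "f2 0 < - c" using f20 by (simp add: c_def)
  ultimately have "eventually (%s. f2 s < - c) (at 0)" by (intro order_tendstoD(2)) (simp_all add: isCont_def)
  then obtain d0 where d0: "0 < d0" "!!s. \<bar>s\<bar> < d0 ==> f2 s < - c"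
    unfolding eventually_at using \<open>f2 0 < - c\<close> by (metis dist_real_def diff_zero UNIV_I)
  define d where "d = min (d0 / 2) 1"
  have d: "0 < d" "d <= 1" "d < d0" using d0 by (auto simp: d_def)
  let ?f = "fib alpha beta A C F G"
  have near: "?f s <= ?f 0 - c / 2 * s^2" if s: "\<bar>s\<bar> <= d" for s
  proof (cases "s = 0")
    case False
    define D where "D m = (if m = 0 then ?f else if m = 1 then fib1 alpha beta A C F G else f2)" for m :: nat
    have "\<exists>t. (if s < 0 then s < t \<and> t < 0 else 0 < t \<and> t < s) \<and>
        ?f s = (\<Sum>m<2. D m 0 / fact m * (s - 0) ^ m) + D 2 t / fact 2 * (s - 0) ^ 2"
      using s d False by (intro Taylor[where a="-d" and b=d and c=0])
        (auto simp: D_def f2_def less_2_cases_iff fib_deriv fib1_deriv)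
    then obtain t where t: "if s < 0 then s < t \<and> t < 0 else 0 < t \<and> t < s"
        "?f s = (\<Sum>m<2. D m 0 / fact m * (s - 0) ^ m) + D 2 t / fact 2 * (s - 0) ^ 2"
      by blast
    have "\<bar>t\<bar> <= \<bar>s\<bar>" using t(1) by (auto split: if_splits)
    then have "f2 t < - c" using s d by (intro d0(2)) linarith
    then have "f2 t / 2 * s^2 <= - c / 2 * s^2" by (intro mult_right_mono) auto
    then show ?thesis using t(2) by (simp add: D_def numeral_2_eq_2 z lessThan_Suc)
  qed simp
  have incr: "?f s <= ?f t" if "s1 <= s" "s <= t" "t <= 0" for s t
    by (rule DERIV_nonneg_imp_nondecreasing[OF that(2)])
      (use that fib_deriv sign_right(2)[OF s1(2) _ s10 z] z in \<open>metis less_eq_real_def order_trans\<close>)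
  have decr: "?f t <= ?f s" if "0 <= s" "s <= t" for s t
    by (rule DERIV_nonpos_imp_nonincreasing[OF that(2)])
      (use that fib_deriv sign_right(1)[OF gap _ s0] z in \<open>metis less_eq_real_def order_trans\<close>)
  define N where "N = s1^2 + 1"
  have N: "0 < N" by (simp add: N_def add_nonneg_pos)
  \<comment> \<open>One constant for the near and the far range: \<open>k <= c / 2\<close> because
    \<open>d^2 <= N\<close>, and \<open>k * s^2 <= c / 2 * d^2\<close> because
    \<open>s^2 <= N\<close> on the whole interval.\<close>
  define k where "k = c / 2 * d^2 / N"
  have k: "0 < k" using c d N by (simp add: k_def)
  have quad: "?f s <= ?f 0 - k * s^2" if s: "s1 <= s" "s <= 1" for s
  proof (cases "\<bar>s\<bar> <= d")
    case True
    have "d^2 <= N" using d power_le_one[of d 2] unfolding N_def by (intro add_increasing) auto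
    then have "c / 2 * d^2 <= c / 2 * N" using c by (intro mult_left_mono) auto
    then have "k <= c / 2" using N by (simp only: k_def pos_divide_le_eq)
    then have "k * s^2 <= c / 2 * s^2" by (intro mult_right_mono) auto
    then show ?thesis using near[OF True] by linarith
  next
    case False
    have "?f s <= ?f 0 - c / 2 * d^2"
    proof (cases "0 <= s")
      case True
      then show ?thesis using False decr[of d s] near[of d] d by simp
    next
      case False': False
      then show ?thesis using False incr[of s "-d"] near[of "-d"] d s by simp
    qed
    moreover have "k * s^2 <= c / 2 * d^2"
    proof -
      have "s^2 <= N"
      proof (cases "0 <= s")
        case True then show ?thesis using s power_le_one[of s 2] unfolding N_def by (intro add_increasing) auto
      next
        case False then have "(- s)^2 <= (- s1)^2" using s by (intro power_mono) auto
        then show ?thesis by (simp add: N_def)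
      qed
      then have "k * s^2 <= k * N" using k by (intro mult_left_mono) auto
      also have "\<dots> = c / 2 * d^2" using N by (simp add: k_def)
      finally show ?thesis .
    qed
    ultimately show ?thesis by linarith
  qed
  define B where "B = 2 * exp 2 + 2 * exp 1 + alpha * exp alpha + 2 * exp beta"
  have B: "0 < B" using ab by (auto simp: B_def intro!: add_pos_pos)
  have dl: "\<bar>fib1 alpha beta a' c' f' g' s\<bar> <= B * (\<bar>a'\<bar> + \<bar>c'\<bar> + \<bar>f'\<bar> + \<bar>g'\<bar>)" if s: "s <= 1" for a' c' f' g' s :: real
  proof -
    have "\<bar>fib1 alpha beta a' c' f' g' s\<bar> <= \<bar>a' * exp (2 * s)\<bar> + \<bar>c' * exp s / 4\<bar> + \<bar>alpha * f' * exp (alpha * s)\<bar> + \<bar>beta * g' * exp (beta * s)\<bar>"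
      unfolding fib1_def by linarith
    also have "\<dots> = \<bar>a'\<bar> * exp (2 * s) + \<bar>c'\<bar> * (exp s / 4) + \<bar>f'\<bar> * (alpha * exp (alpha * s)) + \<bar>g'\<bar> * (beta * exp (beta * s))"
      using ab by (simp add: abs_mult)
    also have "\<dots> <= \<bar>a'\<bar> * B + \<bar>c'\<bar> * B + \<bar>f'\<bar> * B + \<bar>g'\<bar> * B"
    proof (intro add_mono mult_left_mono)
      have e: "exp (2 * s) <= exp 2" "exp s <= exp 1" "exp (alpha * s) <= exp alpha" "exp (beta * s) <= exp beta"
        using s ab mult_left_mono[OF s, of alpha] mult_left_mono[OF s, of beta] by auto
      have p: "0 <= exp (2::real)" "0 <= exp (1::real)" "0 <= alpha * exp alpha" "0 <= exp beta" using ab by auto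
      show "exp (2 * s) <= B" "exp s / 4 <= B" unfolding B_def using e p by linarith+
      have "alpha * exp (alpha * s) <= alpha * exp alpha" "beta * exp (beta * s) <= 1 * exp beta"
        using e ab by (auto intro!: mult_left_mono mult_mono[of beta 1 _ "exp beta", simplified])
      then show "alpha * exp (alpha * s) <= B" "beta * exp (beta * s) <= B" unfolding B_def using p by linarith+
    qed auto
    finally show ?thesis by (simp add: algebra_simps)
  qed
  \<comment> \<open>The four entries keep \<open>A + dA\<close> positive, keep admissible
    \<open>s\<close> to the right of \<open>s1\<close>, and preserve the signs of
    \<open>fib1\<close> at \<open>s1\<close> and at 1.\<close>
  define e where "e = min (A / 2) (min (A * (exp (2 * (s0 - s1)) - 1)) (min (fib1 alpha beta A C F G s1 / (2 * B)) (- fib1 alpha beta A C F G 1 / (2 * B))))"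
  show ?thesis
  proof (rule that[of e "B^2 / (4 * k)"])
    show "0 < e" using A s1 f1 B by (auto simp: e_def divide_neg_pos)
    fix dA dC dF dG s :: real
    define delta where "delta = \<bar>dA\<bar> + \<bar>dC\<bar> + \<bar>dF\<bar> + \<bar>dG\<bar>"
    assume e: "\<bar>dA\<bar> + \<bar>dC\<bar> + \<bar>dF\<bar> + \<bar>dG\<bar> <= e" and C': "0 <= C + dC" and s: "X^2 <= (A + dA) * exp (2 * s)"
    have delta: "0 <= delta" "\<bar>dA\<bar> <= delta" "delta <= A / 2" "delta <= A * (exp (2 * (s0 - s1)) - 1)"
      "B * delta <= fib1 alpha beta A C F G s1 / 2" "B * delta <= - fib1 alpha beta A C F G 1 / 2"
      using e B by (auto simp: delta_def e_def field_simps)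
    interpret T: fibre alpha beta "A + dA" "C + dC" "F + dF" "G + dG"
      by unfold_locales (use ab C' A delta in auto)
    have ss1: "s1 <= s"
    proof -
      have "A + dA <= A * exp (2 * (s0 - s1))" using delta by (simp add: algebra_simps)
      then have "(A + dA) * exp (2 * s) <= A * exp (2 * (s0 - s1)) * exp (2 * s)" by (intro mult_right_mono) auto
      also have "\<dots> = X^2 * exp (2 * (s - s1))" unfolding es0[symmetric] by (simp add: algebra_simps flip: exp_add)
      finally have "X^2 * 1 <= X^2 * exp (2 * (s - s1))" using s by linarith
      then show ?thesis using X by (simp add: mult_le_cancel_left)
    qed
    let ?T = "fib alpha beta (A + dA) (C + dC) (F + dF) (G + dG)" and ?d = "fib alpha beta dA dC dF dG"
    have bd: "?T s <= ?f 0 + ?d 0 + B^2 / (4 * k) * delta^2" if s: "s1 <= s" "s <= 1" for s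
    proof -
      have "\<bar>?d s - ?d 0\<bar> <= B * delta * \<bar>s - 0\<bar>"
        using s s10 by (intro field_differentiable_bound[of "{..1}" ?d "fib1 alpha beta dA dC dF dG", unfolded real_norm_def])
          (auto simp: delta_def intro!: dl has_field_derivative_at_within[OF fib_deriv])
      moreover have "B * delta * \<bar>s\<bar> <= k * s^2 + B^2 / (4 * k) * delta^2"
      proof -
        have "0 <= (2 * k * \<bar>s\<bar> - B * delta)^2 / (4 * k)" using k by simp
        also have "\<dots> = k * s^2 + B^2 / (4 * k) * delta^2 - B * delta * \<bar>s\<bar>"
          using k by (simp add: power2_diff power_mult_distrib field_simps power2_eq_square)
        finally show ?thesis by simp
      qed
      ultimately show ?thesis using quad[OF s] fib_add(1)[of alpha beta A dA C dC F dF G dG s] unfolding diff_zero by linarith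
    qed
    have "?T s <= ?f 0 + ?d 0 + B^2 / (4 * k) * delta^2"
    proof (cases "s <= 1")
      \<comment> \<open>The perturbed derivative is positive at \<open>s1\<close> and negative at 1,
        hence negative beyond 1, so the value at 1 dominates.\<close>
      case False
      have T1: "0 < fib1 alpha beta (A + dA) (C + dC) (F + dF) (G + dG) s1"
        using dl[of s1 dA dC dF dG] delta s1 s10 unfolding fib_add(2) delta_def[symmetric] by linarith
      have T2: "fib1 alpha beta (A + dA) (C + dC) (F + dF) (G + dG) 1 < 0"
        using dl[of 1 dA dC dF dG] delta f1 unfolding fib_add(2) delta_def[symmetric] by linarith
      have "?T s <= ?T 1"
        by (rule DERIV_nonpos_imp_nonincreasing)
          (use False fib_deriv T.sign_right(1)[OF T1, of 1] T2 s10 in \<open>auto, metis less_eq_real_def\<close>)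
      then show ?thesis using bd[of 1] s10 by simp
    qed (use bd ss1 in blast)
    then show "?T s <= ?f 0 + dA / 2 + dC / 4 - dF - dG + B^2 / (4 * k) * (\<bar>dA\<bar> + \<bar>dC\<bar> + \<bar>dF\<bar> + \<bar>dG\<bar>)^2"
      by (simp add: delta_def fib_def)
  qed
qed

text \<open>The base of the power of \<open>a\<close> in \<^const>\<open>a0_bar\<close> lacks the factors \<open>2 / alpha\<close> and \<open>2 / beta\<close>, whose weighted
  geometric mean is at least 1 by \<open>ln x \<le> x - 1\<close>.\<close>

lemma gap_exists:
  fixes p q \<mu> a :: real
  assumes \<mu>: "0 < \<mu>" and q: "2 < q" "q <= 12/5" and p: "10/3 < p" "p < 6" and a: "0 < a" "a < a0_bar p q \<mu>"
  obtains X where "0 < X" "p * gam p * (GN p powr p * a powr (p - p * gam p) / p) * X powr (p * gam p)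
     + q * gam q * (\<mu> * GN q powr q * a powr (q - q * gam q) / q) * X powr (q * gam q) < X^2"
proof -
  define alpha beta where "alpha = p * gam p" and "beta = q * gam q"
  have al: "alpha = 3 * (p - 2) / 2" and be: "beta = 3 * (q - 2) / 2" using gam_times[of p] gam_times[of q] p q by (auto simp: alpha_def beta_def)
  have ab: "2 < alpha" "0 < beta" "beta < 1" "0 < p - alpha" "0 < q - beta" unfolding al be using p q by auto
  have ab2: "0 < alpha / 2" "0 < beta / 2" "0 < a powr (p - alpha)" "0 < a powr (q - beta)" using ab a by auto
  have gn: "0 < GN p" "0 < GN q" using GN_pos p q by auto
  define kp kq where "kp = GN p powr p * a powr (p - alpha) / p" and "kq = \<mu> * GN q powr q * a powr (q - beta) / q"
  have k: "0 < kp" "0 < kq" using gn p q \<mu> a by (auto simp: kp_def kq_def)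
  \<comment> \<open>Chosen so that \<open>alpha * kp * Y + beta * kq * Z = 1\<close>; the gap then
    follows from a scale with \<open>X powr alpha = Y * X^2\<close> and
    \<open>X powr beta < Z * X^2\<close>.\<close>
  define Y where "Y = (2 - beta) / ((alpha - beta) * (alpha * kp))"
  define Z where "Z = (alpha - 2) / ((alpha - beta) * (beta * kq))"
  have YZ: "0 < Y" "0 < Z" using ab k by (auto simp: Y_def Z_def)
  define x1 x2 where "x1 = p * (2 - beta) / (2 * GN p powr p * (alpha - beta))" and "x2 = q * (alpha - 2) / (2 * \<mu> * GN q powr q * (alpha - beta))"
  have x: "0 < x1" "0 < x2" using ab gn p q \<mu> by (auto simp: x1_def x2_def)
  have b: "\<B> p q = (q - beta) * (alpha - 2) + (p - alpha) * (2 - beta)" by (simp add: \<B>_def alpha_def beta_def)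
  have b0: "0 < \<B> p q" unfolding b using ab by (intro add_pos_pos mult_pos_pos) auto
  have "a < x1 powr ((2 - beta) / \<B> p q) * x2 powr ((alpha - 2) / \<B> p q)"
    using a(2) by (simp add: a0_bar_def x1_def x2_def alpha_def beta_def)
  then have "ln a < ln (x1 powr ((2 - beta) / \<B> p q) * x2 powr ((alpha - 2) / \<B> p q))" using a x by (subst ln_less_cancel_iff) auto
  also have "\<dots> = ((2 - beta) * ln x1 + (alpha - 2) * ln x2) / \<B> p q" using x by (simp add: ln_mult ln_powr add_divide_distrib)
  finally have "ln a * \<B> p q < (2 - beta) * ln x1 + (alpha - 2) * ln x2" using b0 by (simp add: less_divide_eq)
  moreover have "ln x1 = ln Y + ln (alpha / 2) + (p - alpha) * ln a"
  proof -
    have "x1 = Y * (alpha / 2) * a powr (p - alpha)" using ab gn p a by (simp add: x1_def Y_def kp_def field_simps)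
    then show ?thesis using YZ ab2 a by (simp only: ln_mult_pos ln_powr mult_pos_pos powr_gt_zero)
  qed
  moreover have "ln x2 = ln Z + ln (beta / 2) + (q - beta) * ln a"
  proof -
    have "x2 = Z * (beta / 2) * a powr (q - beta)" using ab gn q a \<mu> by (simp add: x2_def Z_def kq_def field_simps)
    then show ?thesis using YZ ab2 a by (simp only: ln_mult_pos ln_powr mult_pos_pos powr_gt_zero)
  qed
  ultimately have "0 < (2 - beta) * ln Y + (alpha - 2) * ln Z + ((2 - beta) * ln (alpha / 2) + (alpha - 2) * ln (beta / 2))"
    unfolding b by (simp add: algebra_simps)
  moreover have "(2 - beta) * ln (alpha / 2) + (alpha - 2) * ln (beta / 2) <= (2 - beta) * (alpha / 2 - 1) + (alpha - 2) * (beta / 2 - 1)"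
    using ab by (intro add_mono mult_left_mono ln_le_minus_one) auto
  moreover have "(2 - beta) * (alpha / 2 - 1) + (alpha - 2) * (beta / 2 - 1) = 0" by (simp add: field_simps)
  ultimately have YZp: "0 < (2 - beta) * ln Y + (alpha - 2) * ln Z" by linarith
  define X where "X = exp (ln Y / (alpha - 2))"
  have X0: "0 < X" by (simp add: X_def)
  have "X powr (alpha - 2) = Y" using ab YZ by (simp add: X_def powr_def)
  then have Xa: "X powr alpha = Y * X^2" using X0 by (simp add: powr_diff field_simps)
  have "- ln Z < (2 - beta) * (ln Y / (alpha - 2))" using YZp ab by (simp add: field_simps)
  then have "exp (- ln Z) < exp ((2 - beta) * (ln Y / (alpha - 2)))" by simp
  then have "1 / Z < X powr (2 - beta)" using YZ by (simp add: X_def powr_def exp_minus inverse_eq_divide)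
  then have Xb: "X powr beta < Z * X^2" using X0 YZ by (simp add: powr_diff field_simps)
  show ?thesis
  proof (rule that[OF X0])
    have "alpha * kp * X powr alpha + beta * kq * X powr beta < alpha * kp * (Y * X^2) + beta * kq * (Z * X^2)"
      using Xa Xb ab k by simp
    also have "\<dots> = (alpha * kp * Y + beta * kq * Z) * X^2" by (simp add: algebra_simps)
    also have "alpha * kp * Y + beta * kq * Z = (2 - beta) / (alpha - beta) + (alpha - 2) / (alpha - beta)"
      using ab k by (simp add: Y_def Z_def)
    also have "\<dots> = 1" using ab by (simp flip: add_divide_distrib)
    finally show "p * gam p * (GN p powr p * a powr (p - p * gam p) / p) * X powr (p * gam p)
     + q * gam q * (\<mu> * GN q powr q * a powr (q - q * gam q) / q) * X powr (q * gam q) < X^2"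
      by (simp add: kp_def kq_def alpha_def beta_def)
  qed
qed

section \<open>Closure properties of the radial class and inequalities for competitors\<close>

lemma H1r_iff: "u \<in> H1r \<longleftrightarrow> u \<in> H1 \<and> radial u" by (simp add: H1r_def)

lemma radial_dilate: "radial u ==> radial (dilate s u)"
proof -
  assume "radial u"
  then obtain f where f: "AE x in lborel. u x = f (norm x)" by (auto simp: radial_def)
  have "AE x in lborel. u (0 + exp s *R x) = f (norm (0 + exp s *R x))" by (rule lborel_AE_affine) (use f in auto)
  then have "AE x in lborel. dilate s u x = exp (3 * s / 2) *R f (exp s * norm x)"
    by eventually_elim (simp add: dilate_def)
  then show ?thesis unfolding radial_def by (rule exI[of _ "%r. exp (3 * s / 2) *R f (exp s * r)"])
qed

lemma radial_comp2:
  assumes "radial u" "radial v" shows "radial (%x. Phi (u x) (v x))"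
proof -
  obtain f g where "AE x in lborel. u x = f (norm x)" "AE x in lborel. v x = g (norm x)"
    using assms by (auto simp: radial_def)
  then have "AE x in lborel. Phi (u x) (v x) = Phi (f (norm x)) (g (norm x))" by eventually_elim simp
  then show ?thesis unfolding radial_def by (rule exI[of _ "%r. Phi (f r) (g r)"])
qed

lemma H1r_dilate: "u \<in> H1r ==> dilate s u \<in> H1r"
  by (simp add: H1r_iff H1_dilate radial_dilate)

lemma H1r_cmult: "u \<in> H1r ==> (%x. c * u x) \<in> H1r"
  using radial_comp2[of u u "%z _. c * z"] by (simp add: H1r_iff H1_cmult)

lemma H1r_add: "u \<in> H1r ==> v \<in> H1r ==> (%x. u x + v x) \<in> H1r"
  using radial_comp2[of u v "(+)"] by (simp add: H1r_iff H1_add)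

lemma H1r_modulus: "u \<in> H1r ==> (%x. cor (norm (u x))) \<in> H1r"
  using radial_comp2[of u u "%z _. cor (norm z)"] by (simp add: H1r_iff H1_modulus)

lemma cbump_H1r: "cbump \<in> H1r"
proof -
  have "radial cbump" unfolding radial_def
    by (rule exI[of _ "%r. cor (hexp 0 (1 - r^2))"]) (simp add: cbump_def bump_def power2_norm_eq_inner)
  then show ?thesis by (simp add: H1r_iff cbump_H1)
qed

lemma grad_norm_cmult: "u \<in> H1 ==> grad_norm (%x. c * u x) = norm c * grad_norm u"
proof -
  assume u: "u \<in> H1"
  have "grad_norm (%x. c * u x) = n2 (%x. c *s weak_grad u x)"
    by (rule grad_norm_wg[OF L2_mult_complex(1)[OF H1_L2[OF u]] wg_cmult[OF H1_L2[OF u] H1_wg[OF u]]])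
  also have "\<dots> = norm c * grad_norm u"
    using n2_nonneg[of "weak_grad u"]
    by (simp add: grad_norm_eq n2_def norm_smult_vec power_mult_distrib real_sqrt_mult)
  finally show ?thesis .
qed

text \<open>One of the two combinations has gradient energy at most the sum of the two energies,
  without any information on the mixed term.\<close>

lemma grad_norm_parallelogram:
  assumes u: "u \<in> H1" and v: "v \<in> H1"
  shows "(grad_norm (%x. u x + v x))^2 + (grad_norm (%x. u x + - v x))^2 = 2 * (grad_norm u)^2 + 2 * (grad_norm v)^2"
proof -
  let ?g = "weak_grad u" and ?h = "weak_grad v"
  have L: "u \<in> L2" "v \<in> L2" "?g \<in> L2" "?h \<in> L2" using u v H1_L2 weak_grad_L2 by auto
  have w: "wgrad (%x. - v x) (%x. - ?h x)" using wg_cmult[OF L(2) H1_wg[OF v], of "-1"]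
    by (simp add: vector_smult_lneg)
  have "grad_norm (%x. u x + v x) = n2 (%x. ?g x + ?h x)"
    by (rule grad_norm_wg[OF L2_add[OF L(1,2)] wg_add[OF L(1,2) H1_wg[OF u] H1_wg[OF v]]])
  moreover have "grad_norm (%x. u x + - v x) = n2 (%x. ?g x + - ?h x)"
    by (rule grad_norm_wg[OF L2_add[OF L(1) L2_minus(1)[OF L(2)]] wg_add[OF L(1) L2_minus(1)[OF L(2)] H1_wg[OF u] w]])
  moreover have "ip ?g (%x. - ?h x) = - ip ?g ?h" by (simp add: ip_def)
  ultimately show ?thesis
    using n2_add_sq[OF L(3,4)] n2_add_sq[OF L(3) L2_minus(1)[OF L(4)]]
    by (simp add: L2_minus(2)[OF L(4)] grad_norm_eq)
qed

lemma coulomb_cong: "(!!x. norm (u x) = norm (v x)) ==> CE u = CE v"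
  by (simp add: coulomb_energy_def)

lemma pw_cong: "(!!x. norm (u x) = norm (v x)) ==> pw t u = pw t v"
  by (simp add: pw_def)

lemma n2_cong: "(!!x. norm (u x) = norm (v x)) ==> n2 u = n2 v"
  by (simp add: n2_def)

text \<open>Additive densities let the Coulomb energy expand bilinearly; the mixed term is small
  when the potential of \<open>v\<close> is, as for a spread out \<open>v\<close>.\<close>

lemma coulomb_orthogonal_bound:
  assumes u: "u \<in> H1" and v: "v \<in> H1" and c: "!!x. pot (%x. (norm (v x))^2) x <= c"
    and w: "!!x. (norm (w x))^2 = (norm (u x))^2 + (norm (v x))^2"
  shows "CE w <= CE u + 2 * c * (n2 u)^2 + CE v"
proof -
  let ?r = "%u x. (norm (u x :: complex))^2"
  note X = H1_X12[OF u] and Y = H1_X12[OF v]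
  have "CE w = CE u + 2 * dd (?r u) (?r v) + CE v"
    unfolding coulomb_dd w by (simp add: dd_add_left dd_add_right X12_add X Y dd_commute[OF Y X])
  moreover have "\<bar>dd (?r u) (?r v)\<bar> <= c * (LBINT x. \<bar>?r u x\<bar>)"
    by (rule dd_bound[OF X Y]) (use c pot_nonneg[of "?r v"] in simp)
  ultimately show ?thesis by (simp add: n2_sq)
qed

text \<open>Applied to densities with exponent \<open>t / 2\<close>, it makes the power integrals of
  functions out of phase at least additive.\<close>

lemma powr_superadditive:
  fixes x y t :: real assumes "0 <= x" "0 <= y" "1 <= t" shows "x powr t + y powr t <= (x + y) powr t"
proof (cases "x = 0 \<or> y = 0")
  case False
  then have p: "0 < x" "0 < y" using assms by auto
  have "x powr t = x powr (t - 1) * x" "y powr t = y powr (t - 1) * y" "(x + y) powr t = (x + y) powr (t - 1) * (x + y)"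
    using p by (simp_all add: powr_mult_base[symmetric] powr_diff)
  moreover have "x powr (t - 1) * x <= (x + y) powr (t - 1) * x" "y powr (t - 1) * y <= (x + y) powr (t - 1) * y"
    using p assms by (intro mult_right_mono powr_mono2; simp)+
  ultimately show ?thesis by (simp add: algebra_simps)
qed (use assms in auto)

lemma powr_Bernoulli:
  fixes x t :: real assumes "0 <= x" "x < 1" "1 <= t" shows "1 - t * x <= (1 - x) powr t"
  using powr_tangent[of t "1 - x" 1] assms by (cases "t = 1") (auto simp: algebra_simps)

section \<open>The minimisation problem at mass at most \<open>a\<close>, with the gap scale
  \<open>X\<close> fixed\<close>

locale nls =
  fixes p q \<mu> a X :: real
  assumes par: "0 < \<mu>" "2 < q" "q <= 12/5" "10/3 < p" "p < 6" "0 < a" and X0: "0 < X"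
    and gapX: "p * gam p * (GN p powr p * a powr (p - p * gam p) / p) * X powr (p * gam p)
     + q * gam q * (\<mu> * GN q powr q * a powr (q - q * gam q) / q) * X powr (q * gam q) < X^2"
begin

definition "alpha = p * gam p"
definition "beta = q * gam q"

lemma pq: "2 < p" "p < 6" "2 < q" "q < 6" using par by auto

lemma ab_eq: "alpha = 3 * (p / 2 - 1)" "beta = 3 * (q / 2 - 1)"
  using gam_times[of p] gam_times[of q] pq by (auto simp: alpha_def beta_def)

lemma ab: "2 < alpha" "0 < beta" "beta < 1" unfolding ab_eq using par by auto

text \<open>The coefficients of the fibre map of \<open>u\<close>, besides its Coulomb energy;
  \<open>TF\<close> and \<open>TG\<close> absorb \<open>1 / p\<close> and \<open>\<mu> / q\<close>,
  whereas the factors 1/2 and 1/4 stay in \<open>fib\<close>.\<close>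

definition "TA u = (grad_norm u)^2"
definition "TF u = pw p u / p"
definition "TG u = \<mu> / q * pw q u"
abbreviation "ff u \<equiv> fib alpha beta (TA u) (CE u) (TF u) (TG u)"
abbreviation "ff1 u \<equiv> fib1 alpha beta (TA u) (CE u) (TF u) (TG u)"
abbreviation "ff2 u \<equiv> fib2 alpha beta (TA u) (CE u) (TF u) (TG u)"

lemma TA_int: "TA u = (LBINT x. (norm (weak_grad u x))^2)"
  by (simp add: TA_def grad_norm_eq n2_sq)

lemma J_ff: "J p q \<mu> u = ff u 0"
  by (simp add: J_def fib_def TA_int TF_def TG_def pw_def)

lemma P_ff: "P p q \<mu> u = ff1 u 0"
  using pq by (simp add: P_def fib1_def TA_int TF_def TG_def pw_def alpha_def beta_def)

lemma tuple_dilate: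
  assumes "u \<in> H1"
  shows "TA (dilate s u) = exp (2 * s) * TA u" "CE (dilate s u) = exp s * CE u"
    "TF (dilate s u) = exp (alpha * s) * TF u" "TG (dilate s u) = exp (beta * s) * TG u"
  using assms pw_dilate[OF L2_measurable[OF H1_L2[OF assms]], of p s, folded ab_eq] pw_dilate[OF L2_measurable[OF H1_L2[OF assms]], of q s, folded ab_eq]
  by (simp_all add: TA_def TF_def TG_def grad_norm_dilate coulomb_dilate power_mult_distrib exp_double)

lemma ff_dilate:
  assumes "u \<in> H1"
  shows "ff (dilate s u) t = ff u (s + t)" "ff1 (dilate s u) t = ff1 u (s + t)" "ff2 (dilate s u) t = ff2 u (s + t)"
  unfolding fib_def fib1_def fib2_def tuple_dilate[OF assms] by (simp_all add: distrib_left exp_add mult_ac)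

lemma psi_ff: "u \<in> H1 ==> \<psi> p q \<mu> u = ff u"
  by (rule ext) (simp add: \<psi>_def J_ff ff_dilate(1))

lemma psi_deriv2: "u \<in> H1 ==> deriv (deriv (\<psi> p q \<mu> u)) s = ff2 u s"
proof -
  assume "u \<in> H1"
  moreover have "deriv (ff u) = ff1 u" by (intro ext DERIV_imp_deriv fib_deriv)
  ultimately show ?thesis by (simp add: psi_ff DERIV_imp_deriv fib1_deriv)
qed

lemma tuple_nonneg: "0 <= TF u" "0 <= TG u" using par by (simp_all add: TF_def TG_def)

lemma tuple_pos:
  assumes u: "u \<in> H1" "0 < n2 u" shows "0 < TA u" "0 < TF u" "0 < TG u"
proof -
  have "grad_norm u \<noteq> 0" "pw p u \<noteq> 0" "pw q u \<noteq> 0" using H1_grad_zero[OF u(1)] pw_zero_imp[OF _ _ u(1)] u pq by force+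
  then show "0 < TA u" "0 < TF u" "0 < TG u" using par pw_nonneg[of p u] pw_nonneg[of q u]
    by (simp_all add: TA_def TF_def TG_def less_le)
qed

lemma fibre: assumes u: "u \<in> H1" "0 < n2 u" shows "fibre alpha beta (TA u) (CE u)"
  by unfold_locales (use ab tuple_pos[OF u] coulomb_nonneg in auto)

text \<open>The dilation parameter that brings the gradient norm of \<open>u\<close> to the gap
  scale \<open>X\<close>.\<close>

definition "s0 u = ln (X / sqrt (TA u))"

lemma exp_s0: assumes u: "u \<in> H1" "0 < n2 u"
  shows "TA u * exp (2 * s) < X^2 \<longleftrightarrow> s < s0 u" "X^2 < TA u * exp (2 * s) \<longleftrightarrow> s0 u < s" "X^2 <= TA u * exp (2 * s) \<longleftrightarrow> s0 u <= s"
proof -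
  have A: "0 < TA u" by (rule tuple_pos[OF u])
  have "X^2 = TA u * exp (2 * s0 u)"
    using A X0 by (simp add: s0_def exp_double power_divide)
  then show "TA u * exp (2 * s) < X^2 \<longleftrightarrow> s < s0 u" "X^2 < TA u * exp (2 * s) \<longleftrightarrow> s0 u < s" "X^2 <= TA u * exp (2 * s) \<longleftrightarrow> s0 u <= s"
    using A by simp_all
qed

lemma GN_s0:
  assumes u: "u \<in> H1" "0 < n2 u" "n2 u <= a" and t: "2 < t" "t < 6"
  shows "pw t u * exp (t * gam t * s0 u) <= GN t powr t * a powr (t - t * gam t) * X powr (t * gam t)"
proof -
  have g: "0 < grad_norm u" using tuple_pos(1)[OF u(1,2)] grad_norm_nonneg[of u] by (auto simp: TA_def less_le)
  have tg: "0 < t - t * gam t" using gam_bounds[OF t] t by auto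
  have "exp (t * gam t * s0 u) = (X / grad_norm u) powr (t * gam t)" using g X0 by (simp add: s0_def TA_def powr_def)
  then have "pw t u * exp (t * gam t * s0 u) = pw t u * (X / grad_norm u) powr (t * gam t)" by simp
  also have "\<dots> <= (GN t powr t * n2 u powr (t * (1 - gam t)) * grad_norm u powr (t * gam t)) * (X / grad_norm u) powr (t * gam t)"
    by (intro mult_right_mono GN_pw t u) auto
  also have "\<dots> = GN t powr t * n2 u powr (t - t * gam t) * X powr (t * gam t)"
    using g X0 by (simp add: powr_divide right_diff_distrib)
  also have "\<dots> <= GN t powr t * a powr (t - t * gam t) * X powr (t * gam t)"
    using u tg by (intro mult_right_mono mult_left_mono powr_mono2) auto
  finally show ?thesis .
qed

text \<open>At \<open>s0 u\<close> the gradient energy is \<open>X^2\<close>, and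
  Gagliardo-Nirenberg with mass at most \<open>a\<close> bounds the two power terms by the left hand
  side of \<open>gapX\<close>; the Coulomb term only helps. The scale is thus the same for all
  admissible \<open>u\<close>.\<close>

lemma gap: assumes u: "u \<in> H1" "0 < n2 u" "n2 u <= a" shows "0 < ff1 u (s0 u)"
proof -
  have A: "0 < TA u" by (rule tuple_pos[OF u(1,2)])
  have e: "TA u * exp (2 * s0 u) = X^2" using A X0 by (simp add: s0_def exp_double power_divide)
  note t = alpha_def[symmetric] beta_def[symmetric]
  have "alpha * TF u * exp (alpha * s0 u) <= alpha * (GN p powr p * a powr (p - alpha) / p) * X powr alpha"
    using mult_left_mono[OF GN_s0[OF u, of p], of "alpha / p"] ab pq by (simp add: TF_def t mult_ac)
  moreover have "beta * TG u * exp (beta * s0 u) <= beta * (\<mu> * GN q powr q * a powr (q - beta) / q) * X powr beta"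
    using mult_left_mono[OF GN_s0[OF u, of q], of "beta * \<mu> / q"] ab pq par by (simp add: TG_def t mult_ac)
  ultimately have "alpha * TF u * exp (alpha * s0 u) + beta * TG u * exp (beta * s0 u) < X^2"
    using gapX unfolding t by linarith
  moreover have "0 <= CE u * exp (s0 u) / 4" using coulomb_nonneg by simp
  ultimately show ?thesis unfolding fib1_def e by linarith
qed

text \<open>Zeros of the Pohozaev functional above the gap scale, that is, functions sitting at the
  maximum of their own fibre. Mass at most \<open>a\<close>, instead of exactly \<open>a\<close>,
  lets the projection of a weak limit belong to the set again.\<close>

definition "Nm = {u \<in> H1r. 0 < n2 u \<and> n2 u <= a \<and> ff1 u 0 = 0 \<and> X\<^sup>2 < TA u}"

lemma NmD: assumes "u \<in> Nm" shows "u \<in> H1r" "u \<in> H1" "0 < n2 u" "n2 u <= a" "ff1 u 0 = 0" "s0 u < 0" "X^2 < TA u"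
  using assms exp_s0(2)[of u 0] by (auto simp: Nm_def H1r_iff)

lemma Nm_max:
  assumes u: "u \<in> Nm" and s: "X^2 <= TA u * exp (2 * s)"
  shows "ff u s <= J p q \<mu> u" "s \<noteq> 0 ==> ff u s < J p q \<mu> u"
proof -
  note N = NmD[OF u]
  have "s0 u <= s" using s exp_s0(3)[OF N(2,3)] by simp
  from fibre.max_at[OF fibre[OF N(2,3)] gap[OF N(2-4)] N(5,6) this]
  show "s \<noteq> 0 ==> ff u s < J p q \<mu> u" by (simp add: J_ff)
  then show "ff u s <= J p q \<mu> u" by (cases "s = 0") (auto simp: J_ff less_imp_le)
qed

lemma project:
  assumes u: "u \<in> H1" "0 < n2 u" "n2 u <= a"
  obtains z y where "z < s0 u" "s0 u < y" "ff1 u z = 0" "ff1 u y = 0" "0 < ff2 u z"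
proof -
  obtain z y where zy: "z < s0 u" "s0 u < y" "ff1 u z = 0" "ff1 u y = 0"
    using fibre.zeros[OF fibre[OF u(1,2)] gap[OF u] tuple_pos(2,3)[OF u(1,2)]] by metis
  moreover have "0 < ff2 u z" using fibre.side(1)[OF fibre[OF u(1,2)] gap[OF u] zy(3)] zy by simp
  ultimately show ?thesis using that by blast
qed

lemma dilate_Nm:
  assumes u: "u \<in> H1r" "0 < n2 u" "n2 u <= a" and y: "s0 u < y" "ff1 u y = 0"
  shows "dilate y u \<in> Nm" "J p q \<mu> (dilate y u) = ff u y"
proof -
  have uH: "u \<in> H1" using u H1rD by blast
  show "dilate y u \<in> Nm"
    using u y exp_s0(2)[OF uH u(2), of y]
    by (simp add: Nm_def H1r_dilate n2_dilate H1_L2 uH ff_dilate(2)) (simp add: tuple_dilate uH mult.commute)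
  show "J p q \<mu> (dilate y u) = ff u y" by (simp add: J_ff ff_dilate uH)
qed

text \<open>The constraint eliminates \<open>TF\<close>. What remains is
  \<open>1/2 - 1/alpha\<close> times \<open>TA\<close>, a nonnegative Coulomb part, and the
  \<open>q\<close> term, which by Gagliardo-Nirenberg is of order \<open>beta < 1\<close> in the
  gradient norm.\<close>

lemma Nm_coercive:
  obtains d c where "0 < d" "!!u. u \<in> Nm ==> d * TA u - c <= J p q \<mu> u"
proof -
  define delta where "delta = 1 / 2 - 1 / alpha"
  have delta: "0 < delta" using ab by (simp add: delta_def field_simps)
  define k where "k = \<mu> / q * (GN q powr q * a powr (q - q * gam q))"
  have k: "0 <= k" using par by (simp add: k_def)
  note t = beta_def[symmetric]
  show ?thesis
  proof (rule that[of "delta / 2" "k + k^2 / (2 * delta)"])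
    fix u assume "u \<in> Nm"
    note N = NmD[OF this]
    let ?g = "grad_norm u"
    have "TG u <= k * ?g powr beta"
    proof -
      have "pw q u <= GN q powr q * n2 u powr (q * (1 - gam q)) * ?g powr (q * gam q)" by (rule GN_pw[OF pq(3,4) N(2)])
      also have "\<dots> <= GN q powr q * a powr (q - q * gam q) * ?g powr (q * gam q)"
        using N gam_bounds[OF pq(3,4)] pq by (intro mult_right_mono mult_left_mono) (auto simp: right_diff_distrib intro!: powr_mono2)
      finally have "\<mu> / q * pw q u <= \<mu> / q * (GN q powr q * a powr (q - q * gam q) * ?g powr (q * gam q))"
        using par by (intro mult_left_mono) auto
      then show ?thesis by (simp add: TG_def k_def t mult_ac)
    qed
    also have "?g powr beta <= 1 + ?g"
    proof (cases "?g <= 1")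
      case True then show ?thesis using ab powr_mono2[of beta ?g 1] grad_norm_nonneg[of u] by (simp add: add_increasing2)
    next
      case False then show ?thesis using powr_mono[of beta 1 ?g] ab by simp
    qed
    finally have G: "TG u <= k + k * ?g" using k by (simp add: mult_left_mono distrib_left)
    have "k * ?g <= delta / 2 * TA u + k^2 / (2 * delta)"
    proof -
      have "0 <= (delta * ?g - k)^2 / (2 * delta)" using delta by simp
      also have "\<dots> = delta / 2 * TA u + k^2 / (2 * delta) - k * ?g"
        using delta by (simp add: TA_def power2_diff power_mult_distrib field_simps power2_eq_square)
      finally show ?thesis by simp
    qed
    moreover have "delta * TA u - TG u <= J p q \<mu> u"
    proof -
      have "TF u = (TA u + CE u / 4 - beta * TG u) / alpha" using N(5) ab by (simp add: fib1_def field_simps)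
      then have "J p q \<mu> u - (delta * TA u - TG u) = CE u * ((1 - 1 / alpha) / 4) + beta * TG u / alpha"
        unfolding J_ff fib_def delta_def by (simp add: add_divide_distrib diff_divide_distrib algebra_simps)
      moreover have "0 <= CE u * ((1 - 1 / alpha) / 4)"
        using ab by (intro mult_nonneg_nonneg coulomb_nonneg) simp
      moreover have "0 <= beta * TG u / alpha" using ab tuple_nonneg by simp
      ultimately show ?thesis by linarith
    qed
    ultimately show "delta / 2 * TA u - (k + k^2 / (2 * delta)) <= J p q \<mu> u" using G by (simp add: algebra_simps)
  qed (use delta in simp)
qed

lemma Nm_nonempty: "Nm \<noteq> {}"
proof -
  define u where "u x = cor (a / n2 cbump) * cbump x" for x
  have u: "u \<in> H1r" unfolding u_def by (rule H1r_cmult[OF cbump_H1r])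
  have n: "n2 u = a" unfolding u_def L2_mult_complex(2)[OF H1_L2[OF cbump_H1]] norm_of_real using cbump_n2 par by simp
  obtain z y where "z < s0 u" "s0 u < y" "ff1 u z = 0" "ff1 u y = 0" "0 < ff2 u z"
    by (rule project[of u]) (use u n par H1rD in auto)
  then show ?thesis using dilate_Nm(1)[OF u _ _ \<open>s0 u < y\<close>] n par by auto
qed

text \<open>The limit of a minimising sequence may violate the constraint, so its modulus
  \<open>w\<close> is moved back by its own dilation \<open>y\<close>. Each \<open>U n\<close> is
  maximal on its fibre beyond the gap scale, so its fibre value at the same \<open>y\<close> is at
  most its energy, and lower semicontinuity passes this on to \<open>w\<close>.\<close>

lemma minimizer:
  obtains u where "u \<in> Nm" "!!x. u x = cor (norm (u x))" "!!v. v \<in> Nm ==> J p q \<mu> u <= J p q \<mu> v"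
proof -
  obtain d c where dc: "0 < d" "!!u. u \<in> Nm ==> d * TA u - c <= J p q \<mu> u" using Nm_coercive by metis
  define m where "m = Inf (J p q \<mu> ` Nm)"
  have bdd: "bdd_below (J p q \<mu> ` Nm)"
  proof (rule bdd_belowI2)
    fix u assume "u \<in> Nm"
    moreover have "0 <= d * TA u" using dc(1) by (simp add: TA_def)
    ultimately show "- c <= J p q \<mu> u" using dc(2)[of u] by linarith
  qed
  have m: "m <= J p q \<mu> v" if "v \<in> Nm" for v unfolding m_def by (rule cINF_lower[OF bdd that])
  have "\<exists>u\<in>Nm. J p q \<mu> u < m + 1 / real (Suc n)" for n
    unfolding m_def by (rule cINF_less_iff[THEN iffD1, OF Nm_nonempty bdd]) simp
  then obtain V where V: "!!n. V n \<in> Nm" "!!n. J p q \<mu> (V n) < m + 1 / real (Suc n)" by metis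
  note VN = NmD[OF V(1)]
  have A: "TA (V n) <= (m + 1 + c) / d" for n
  proof -
    have "1 / real (Suc n) <= 1" by simp
    then have "d * TA (V n) <= m + 1 + c" using dc(2)[OF V(1)[of n]] V(2)[of n] by linarith
    then show ?thesis using dc(1) by (simp add: pos_le_divide_eq mult.commute)
  qed
  define M where "M = max a (sqrt ((m + 1 + c) / d))"
  have b: "n2 (V n) <= M" "grad_norm (V n) <= M" for n
    using VN(4)[of n] real_le_rsqrt[OF A[of n, unfolded TA_def]] by (auto simp: M_def)
  obtain ro W where ro: "strict_mono ro" and W: "AE x in lborel. (%n. V (ro n) x) ----> W (norm x)"
    by (rule radial_subsequence[OF VN(1) b])
  have "bounded (range (%n. grad_norm (V (ro n))))" unfolding bounded_iff using b by (auto intro!: exI[of _ M])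
  then obtain l r where r: "strict_mono r" and l: "(%n. grad_norm (V (ro (r n)))) ----> l"
    using bounded_imp_convergent_subsequence[of "%n. grad_norm (V (ro n))"] by (auto simp: o_def)
  define U where "U n = V (ro (r n))" for n
  have UN: "U n \<in> Nm" for n by (simp add: U_def V)
  note D = NmD[OF UN]
  have bU: "n2 (U n) <= M" "grad_norm (U n) <= M" for n by (simp_all add: U_def b)
  have [measurable]: "U n \<in> bmeas" for n by (rule L2_measurable[OF H1_L2[OF D(2)]])
  define v where "v x = lim (%n. U n x)" for x
  have vm: "v \<in> bmeas" unfolding v_def by (rule borel_measurable_lim_metric) measurable
  have vW: "AE x in lborel. (%n. U n x) ----> W (norm x)"
    using W by eventually_elim (use LIMSEQ_subseq_LIMSEQ[OF _ r] in \<open>auto simp: U_def o_def\<close>)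
  then have v: "AE x in lborel. (%n. U n x) ----> v x" by eventually_elim (simp add: v_def limI)
  have "AE x in lborel. v x = W (norm x)" using vW by eventually_elim (simp add: v_def limI)
  then have vr: "radial v" unfolding radial_def by blast
  have lU: "(%n. grad_norm (U n)) ----> l" using l by (simp add: U_def)
  have vH: "v \<in> H1" "grad_norm v <= l" by (rule gradient_lsc[OF D(2) bU(1) v vm lU])+
  have va: "n2 v <= a" by (rule L2_Fatou(2)[OF H1_L2[OF D(2)] D(4) v vm])
  have tA: "(%n. TA (U n)) ----> l\<^sup>2" unfolding TA_def by (intro tendsto_power lU)
  have tF: "(%n. TF (U n)) ----> TF v" unfolding TF_def
    by (intro tendsto_divide tendsto_const pw_tendsto_radial[OF D(1) bU v vH(1)]) (use pq in auto)
  have tG: "(%n. TG (U n)) ----> TG v" unfolding TG_def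
    by (intro tendsto_mult tendsto_const pw_tendsto_radial[OF D(1) bU v vH(1)]) (use pq in auto)
  \<comment> \<open>The constraint expresses the Coulomb energy through quantities already known to
    converge.\<close>
  have "CE (U n) = 4 * (alpha * TF (U n) + beta * TG (U n) - TA (U n))" for n
    using D(5)[of n] by (simp add: fib1_def)
  then have tC: "(%n. CE (U n)) ----> 4 * (alpha * TF v + beta * TG v - l^2)"
    by (simp only:) (intro tendsto_intros tA tF tG)
  define Cl where "Cl = 4 * (alpha * TF v + beta * TG v - l^2)"
  have Cv: "CE v <= Cl" unfolding Cl_def by (rule coulomb_Fatou[OF D(2) vH(1) v tC])
  \<comment> \<open>If the limit vanished, the power terms would tend to 0 and the constraint would
    give the Coulomb energies the limit \<open>- 4 * l^2\<close>; the gap keeps \<open>l\<close>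
    away from 0, so this would be negative.\<close>
  have v0: "0 < n2 v"
  proof (rule ccontr)
    assume "\<not> 0 < n2 v"
    then have "n2 v = 0" using n2_nonneg[of v] by linarith
    then have "TF v = 0" "TG v = 0" using pw_zero[OF vH(1)] by (simp_all add: TF_def TG_def)
    then have "Cl = - 4 * l^2" by (simp add: Cl_def)
    moreover have "0 <= Cl" by (rule order_trans[OF coulomb_nonneg Cv])
    moreover have "X^2 <= l^2" by (rule LIMSEQ_le_const[OF tA]) (use D(7) less_imp_le in blast)
    moreover have "0 < X^2" using X0 by simp
    ultimately show False by linarith
  qed
  define w where "w x = cor (norm (v x))" for x
  have w: "w \<in> H1r" "w \<in> H1" unfolding w_def using H1r_modulus vr vH(1) H1_modulus by (auto simp: H1r_iff)
  have wn: "n2 w = n2 v" by (rule n2_cong) (simp add: w_def)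
  have wT: "CE w = CE v" "TF w = TF v" "TG w = TG v"
    using pw_cong[of w v] coulomb_cong[of w v] by (simp_all add: TF_def TG_def w_def)
  have "grad_norm w <= l" unfolding w_def by (rule order_trans[OF H1_modulus(2)[OF vH(1)] vH(2)])
  then have wA: "TA w <= l^2" by (simp add: TA_def power_mono)
  obtain z y where y: "s0 w < y" "ff1 w y = 0"
    by (rule project[of w]) (use w wn v0 va in auto)
  have N: "dilate y w \<in> Nm" "J p q \<mu> (dilate y w) = ff w y"
    by (rule dilate_Nm[OF w(1) _ _ y]; use wn v0 va in simp)+
  \<comment> \<open>The parameter \<open>y\<close> lies beyond the gap scale for \<open>w\<close>,
    hence eventually for \<open>U n\<close>, whose gradient energies tend to
    \<open>l^2 >= TA w\<close>.\<close>
  have "X^2 < TA w * exp (2 * y)" using exp_s0(2)[OF w(2)] y(1) wn v0 by simp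
  also have "\<dots> <= l^2 * exp (2 * y)" using wA by simp
  finally have "eventually (%n. X^2 < TA (U n) * exp (2 * y)) sequentially"
    by (intro order_tendstoD(1)[OF tendsto_mult[OF tA tendsto_const]])
  then have ev: "eventually (%n. ff (U n) y <= J p q \<mu> (U n)) sequentially"
    by eventually_elim (rule Nm_max(1)[OF UN], simp)
  have tJ: "(%n. J p q \<mu> (U n)) ----> m"
  proof (rule tendsto_sandwich[of "%_. m"])
    have "strict_mono (%n. ro (r n))" using strict_mono_o[OF ro r] by (simp add: o_def)
    from tendsto_add[OF tendsto_const[of m] LIMSEQ_subseq_LIMSEQ[OF LIMSEQ_inverse_real_of_nat this]]
    show "(%n. m + 1 / real (Suc (ro (r n)))) ----> m" by (simp add: o_def inverse_eq_divide)
    show "\<forall>\<^sub>F n in sequentially. J p q \<mu> (U n) <= m + 1 / real (Suc (ro (r n)))"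
      by (intro always_eventually allI, unfold U_def, rule less_imp_le[OF V(2)])
  qed (use m[OF UN] in auto)
  have "(%n. ff (U n) y) ----> fib alpha beta (l^2) Cl (TF v) (TG v) y" unfolding fib_def
    by (intro tendsto_intros tA tF tG tC[folded Cl_def]) auto
  from tendsto_le[OF sequentially_bot tJ this ev]
  have "fib alpha beta (l^2) Cl (TF v) (TG v) y <= m" .
  moreover have "ff w y <= fib alpha beta (l^2) Cl (TF v) (TG v) y" unfolding wT by (rule fib_mono) (use wA Cv in auto)
  ultimately have "J p q \<mu> (dilate y w) <= m" using N by simp
  moreover have "dilate y w x = cor (norm (dilate y w x))" for x
    by (simp add: dilate_def w_def complex_eq_iff)
  ultimately show ?thesis using that[OF N(1)] m by fastforce
qed

end

section \<open>First variation of the power, Coulomb and gradient terms\<close>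

lemma powr_diff_le:
  fixes x y t :: real assumes "1 < t" "0 <= y" "0 <= x" shows "x powr t - y powr t <= t * x powr (t - 1) * (x - y)"
proof (cases "x = 0")
  case False
  then have "x powr t = x powr (t - 1) * x" using assms by (simp add: powr_diff)
  then show ?thesis using powr_tangent[OF assms(1,2), of x] False assms(3) by (simp add: algebra_simps)
qed (use assms in auto)

text \<open>Provides an integrable majorant of the difference quotients, for differentiating
  \<open>pw\<close> under the integral.\<close>

lemma norm_powr_lipschitz:
  fixes z w :: "'a::real_normed_vector"
  assumes t: "1 < t" and h: "\<bar>h\<bar> <= 1"
  shows "\<bar>norm (z + h *R w) powr t - norm z powr t\<bar> <= \<bar>h\<bar> * (t * 2 powr t * (norm z powr t + norm w powr t))"
proof -
  define M where "M = norm z + norm w"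
  have le: "norm (z + h *R w) <= M" "norm z <= M"
    using norm_triangle_ineq[of z "h *R w"] mult_left_le_one_le[of "norm w" "\<bar>h\<bar>"] h by (auto simp: M_def)
  have d: "\<bar>norm (z + h *R w) - norm z\<bar> <= \<bar>h\<bar> * M"
  proof -
    have "\<bar>norm (z + h *R w) - norm z\<bar> <= norm (h *R w)" using norm_triangle_ineq3[of "z + h *R w" z] by simp
    also have "\<dots> <= \<bar>h\<bar> * M" by (simp add: M_def mult_left_mono)
    finally show ?thesis .
  qed
  have one: "x powr t - y powr t <= t * M powr (t - 1) * (\<bar>h\<bar> * M)"
    if "0 <= x" "0 <= y" "x <= M" "\<bar>x - y\<bar> <= \<bar>h\<bar> * M" for x y
  proof -
    have "x powr t - y powr t <= t * x powr (t - 1) * (x - y)" by (rule powr_diff_le[OF t that(2,1)])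
    also have "\<dots> <= t * x powr (t - 1) * \<bar>x - y\<bar>" using t by (intro mult_left_mono) auto
    also have "\<dots> <= t * M powr (t - 1) * (\<bar>h\<bar> * M)" using t that by (intro mult_mono powr_mono2) auto
    finally show ?thesis .
  qed
  have "\<bar>norm (z + h *R w) powr t - norm z powr t\<bar> <= t * M powr (t - 1) * (\<bar>h\<bar> * M)"
    using one[of "norm (z + h *R w)" "norm z"] one[of "norm z" "norm (z + h *R w)"] le d
    by (simp add: abs_minus_commute abs_le_iff)
  also have "\<dots> = \<bar>h\<bar> * (t * M powr t)"
  proof (cases "M = 0")
    case False
    then have "0 < M" using le(2) norm_ge_zero[of z] by linarith
    then have "M powr t = M powr (t - 1) * M" by (simp add: powr_diff)
    then show ?thesis by (simp add: mult_ac)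
  qed simp
  also have "M powr t <= 2 powr t * (norm z powr t + norm w powr t)"
  proof (cases "norm z <= norm w")
    case True
    have "M powr t <= (2 * norm w) powr t" using t True by (intro powr_mono2) (auto simp: M_def)
    then show ?thesis by (simp add: powr_mult distrib_left add_increasing)
  next
    case False
    have "M powr t <= (2 * norm z) powr t" using t False by (intro powr_mono2) (auto simp: M_def)
    then show ?thesis by (simp add: powr_mult distrib_left add_increasing2)
  qed
  finally show ?thesis using t by (simp add: mult_left_mono mult.assoc)
qed

text \<open>Away from \<open>z = 0\<close> the norm power is the power \<open>t / 2\<close> of a
  quadratic polynomial in \<open>h\<close> that is positive near 0. For \<open>z = 0\<close> the
  difference quotient has modulus \<open>|h| powr (t - 1)\<close> times a constant and tends to
  0.\<close>

lemma norm_powr_deriv: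
  fixes z w :: "'a::real_inner"
  assumes t: "2 < t"
  shows "((%h. norm (z + h *R w) powr t) has_real_derivative t * norm z powr (t - 2) * (z \<bullet> w)) (at 0)"
proof (cases "z = 0")
  case True
  have "((%h::real. \<bar>h\<bar> powr (t - 1) * norm w powr t) \<longlongrightarrow> 0 * norm w powr t) (at 0)"
    by (intro tendsto_mult tendsto_const tendsto_zero_powrI[of _ _ _ "t - 1"] tendsto_rabs_zero tendsto_ident_at) (use t in auto)
  moreover have "norm ((norm (h *R w) powr t) / h) = \<bar>h\<bar> powr (t - 1) * norm w powr t" for h :: real
    by (cases "h = 0") (auto simp: powr_mult powr_diff)
  ultimately have "((%h. norm ((norm (h *R w) powr t) / h)) \<longlongrightarrow> 0) (at 0)" by simp
  then show ?thesis using True t unfolding has_field_derivative_iff tendsto_norm_zero_iff by simp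
next
  case False
  have sq: "norm y powr t = (y \<bullet> y) powr (t / 2)" for y :: 'a
    using powr_powr[of "norm y" 2 "t / 2"] by (simp add: power2_norm_eq_inner flip: powr_numeral[of "norm y"])
  have "((%h. (z + h *R w) \<bullet> (z + h *R w)) has_real_derivative 2 * (z \<bullet> w)) (at 0)"
    unfolding inner_add_left inner_add_right by (auto intro!: derivative_eq_intros simp: inner_commute)
  from DERIV_fun_powr[OF this, of "t / 2"] False
  have "((%h. ((z + h *R w) \<bullet> (z + h *R w)) powr (t / 2)) has_real_derivative t / 2 * (z \<bullet> z) powr (t / 2 - 1) * (2 * (z \<bullet> w))) (at 0)"
    by simp
  moreover have "(z \<bullet> z) powr (t / 2 - 1) = norm z powr (t - 2)"
    using powr_powr[of "norm z" 2 "t / 2 - 1"] by (simp add: power2_norm_eq_inner flip: powr_numeral[of "norm z"])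
  ultimately show ?thesis unfolding sq by (simp add: mult_ac)
qed

lemma powr_Young:
  fixes x y t :: real assumes "1 <= t" "0 <= x" "0 <= y" shows "x powr (t - 1) * y <= x powr t + y powr t"
proof (cases "x = 0 \<or> y = 0")
  case False
  then have p: "0 < x" "0 < y" using assms by auto
  have "x powr (t - 1) * y <= max x y powr (t - 1) * max x y" using p assms by (intro mult_mono powr_mono2) auto
  also have "\<dots> = max x y powr t" using p by (simp add: powr_diff)
  also have "\<dots> <= x powr t + y powr t" by (simp add: max_def)
  finally show ?thesis .
qed (use assms in auto)

text \<open>The derivative of \<open>pw t / t\<close> at \<open>u\<close> in the direction
  \<open>v\<close>, with the real inner product of complex numbers.\<close>

definition pf :: "real => (real^3 => complex) => (real^3 => complex) => real" where
  "pf t u v = (LBINT x. norm (u x) powr (t - 2) * (u x \<bullet> v x))"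

lemma pf_pointwise:
  fixes z w :: complex
  assumes t: "2 < t" shows "norm (norm z powr (t - 2) *R (z * cnj w)) <= norm z powr t + norm w powr t"
proof -
  have "norm (norm z powr (t - 2) *R (z * cnj w)) = norm z powr (t - 1) * norm w"
  proof (cases "z = 0")
    case False
    then have "norm z powr (t - 1) = norm z powr (t - 2) * norm z" using powr_add[of "norm z" "t - 2" 1] by simp
    then show ?thesis by (simp add: norm_mult mult_ac)
  qed (use t in simp)
  also have "\<dots> <= norm z powr t + norm w powr t" using t by (intro powr_Young) auto
  finally show ?thesis .
qed

lemma inner_Re_cnj: "z \<bullet> w = Re (z * cnj w)" by (simp add: inner_complex_def)

lemma cnj_measurable [measurable]: "cnj \<in> bmeas"
  by (intro borel_measurable_continuous_onI continuous_intros)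

lemma pf_integrable:
  assumes t: "2 < t" "t < 6" and u: "u \<in> H1" and v: "v \<in> H1"
  shows "integrable lborel (%x. norm (u x) powr (t - 2) *R (u x * cnj (v x)))"
    and "integrable lborel (%x. norm (u x) powr (t - 2) * (u x \<bullet> v x))"
proof -
  have [measurable]: "u \<in> bmeas" "v \<in> bmeas" using L2_measurable[OF H1_L2] u v by auto
  show i: "integrable lborel (%x. norm (u x) powr (t - 2) *R (u x * cnj (v x)))"
    by (rule integrable_boundI[OF Bochner_Integration.integrable_add[OF H1_pw_integrable[OF t u] H1_pw_integrable[OF t v]] _ pf_pointwise[OF t(1)]])
      measurable
  show "integrable lborel (%x. norm (u x) powr (t - 2) * (u x \<bullet> v x))"
    using integrable_bounded_linear[OF bounded_linear_Re i] by (simp add: inner_Re_cnj)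
qed

lemma pf_bound: 
  assumes t: "2 < t" "t < 6" and u: "u \<in> H1" and v: "v \<in> H1"
  shows "\<bar>pf t u v\<bar> <= pw t u + pw t v"
proof -
  have "\<bar>norm (u x) powr (t - 2) * (u x \<bullet> v x)\<bar> <= norm (u x) powr t + norm (v x) powr t" for x
    using order_trans[OF abs_Re_le_cmod pf_pointwise[OF t(1), of "u x" "v x"]] by (simp add: inner_Re_cnj)
  then have "\<bar>pf t u v\<bar> <= (LBINT x. norm (u x) powr t + norm (v x) powr t)" unfolding pf_def
    by (intro order_trans[OF integral_abs_bound] integral_mono integrable_abs pf_integrable(2) Bochner_Integration.integrable_add
        H1_pw_integrable t u v) auto
  also have "\<dots> = pw t u + pw t v" unfolding pw_def
    by (rule Bochner_Integration.integral_add[OF H1_pw_integrable[OF t u] H1_pw_integrable[OF t v]])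
  finally show ?thesis .
qed

lemma pw_deriv:
  assumes t: "2 < t" "t < 6" and u: "u \<in> H1" and v: "v \<in> H1"
  shows "((%h. pw t (%x. u x + h *R v x)) has_real_derivative t * pf t u v) (at 0)"
proof -
  have [measurable]: "u \<in> bmeas" "v \<in> bmeas" using L2_measurable[OF H1_L2] u v by auto
  let ?f = "%h x. norm (u x + h *R v x) powr t"
  let ?w = "%x. t * 2 powr t * (norm (u x) powr t + norm (v x) powr t)"
  have it: "integrable lborel (?f h)" for h by (rule H1_pw_integrable[OF t H1_add[OF u H1_scaleR[OF v]]])
  have "(%n. (pw t (%x. u x + s n *R v x) - pw t u) / s n) ----> t * pf t u v"
    if s: "!!n. s n \<noteq> 0" "s ----> 0" for s :: "nat => real"
  proof -
    obtain N where N: "!!n. N <= n ==> \<bar>s n\<bar> <= 1"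
      using s(2) unfolding LIMSEQ_iff by (metis less_imp_le diff_zero real_norm_def zero_less_one)
    have "(%n. \<integral>x. (?f (s (n + N)) x - ?f 0 x) / s (n + N) \<partial>lborel) ----> (LBINT x. t * norm (u x) powr (t - 2) * (u x \<bullet> v x))"
    proof (rule integral_dominated_convergence[where w="?w"])
      show "integrable lborel ?w"
        by (intro integrable_mult_right Bochner_Integration.integrable_add H1_pw_integrable t u v)
      show "AE x in lborel. (%n. (?f (s (n + N)) x - ?f 0 x) / s (n + N)) ----> t * norm (u x) powr (t - 2) * (u x \<bullet> v x)"
      proof (rule AE_I2)
        fix x
        have "(%h. (?f h x - ?f 0 x) / h) \<midarrow>0\<rightarrow> t * norm (u x) powr (t - 2) * (u x \<bullet> v x)"
          using norm_powr_deriv[OF t(1), of "u x" "v x"] unfolding has_field_derivative_iff by simp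
        then have "((%h. (?f h x - ?f 0 x) / h) \<circ> s) ----> t * norm (u x) powr (t - 2) * (u x \<bullet> v x)"
          unfolding tendsto_at_iff_sequentially using s by auto
        from LIMSEQ_ignore_initial_segment[OF this, of N]
        show "(%n. (?f (s (n + N)) x - ?f 0 x) / s (n + N)) ----> t * norm (u x) powr (t - 2) * (u x \<bullet> v x)" by (simp add: o_def)
      qed
      show "AE x in lborel. norm ((?f (s (n + N)) x - ?f 0 x) / s (n + N)) <= ?w x" for n
      proof (rule AE_I2)
        fix x
        have "\<bar>?f (s (n + N)) x - ?f 0 x\<bar> <= \<bar>s (n + N)\<bar> * ?w x"
          using norm_powr_lipschitz[OF _ N, of t "n + N" "u x" "v x"] t by simp
        then show "norm ((?f (s (n + N)) x - ?f 0 x) / s (n + N)) <= ?w x"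
          using s(1)[of "n + N"] by (simp add: abs_divide pos_divide_le_eq mult.commute)
      qed
    qed measurable
    moreover have "(LBINT x. (?f (s (n + N)) x - ?f 0 x) / s (n + N)) = (pw t (%x. u x + s (n + N) *R v x) - pw t u) / s (n + N)" for n
      using Bochner_Integration.integral_diff[OF it it[of 0]] by (simp add: pw_def)
    moreover have "(LBINT x. t * norm (u x) powr (t - 2) * (u x \<bullet> v x)) = t * pf t u v"
      by (simp add: pf_def mult.assoc)
    ultimately have "(%n. (pw t (%x. u x + s (n + N) *R v x) - pw t u) / s (n + N)) ----> t * pf t u v" by (simp only:)
    then show ?thesis by (rule LIMSEQ_offset)
  qed
  then show ?thesis unfolding has_field_derivative_iff tendsto_at_iff_sequentially by (simp add: o_def)
qed

lemma pf_add: assumes "2 < t" "t < 6" "u \<in> H1" "v \<in> H1" "w \<in> H1"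
  shows "pf t u (%x. v x + w x) = pf t u v + pf t u w"
  using Bochner_Integration.integral_add[OF pf_integrable(2)[OF assms(1-4)] pf_integrable(2)[OF assms(1-3,5)]]
  by (simp add: pf_def inner_add_right distrib_left)

lemma pf_scaleR: "pf t u (%x. c *R v x) = c * pf t u v"
  by (simp add: pf_def mult.left_commute)

lemma H1_norm_bounds: "n2 u <= H1_norm u" "grad_norm u <= H1_norm u" "0 <= H1_norm u"
  by (auto simp: H1_norm_eq intro!: real_le_rsqrt)

text \<open>The pointwise bound is not homogeneous in \<open>v\<close>; it is applied to \<open>v\<close> divided by its norm.\<close>

lemma pf_bounded:
  assumes t: "2 < t" "t < 6" and u: "u \<in> H1"
  obtains k where "0 <= k" "!!v. v \<in> H1 ==> \<bar>pf t u v\<bar> <= k * H1_norm v"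
proof -
  obtain C where C: "0 < C" "!!u. u \<in> H1 ==> pw t u <= C * (n2 u powr t + grad_norm u powr t)"
    by (rule H1_pw_bound[OF t]) blast
  show ?thesis
  proof (rule that[of "pw t u + 2 * C"])
    fix v assume v: "v \<in> H1"
    show "\<bar>pf t u v\<bar> <= (pw t u + 2 * C) * H1_norm v"
    proof (cases "H1_norm v = 0")
      case True
      then have "n2 v = 0" using H1_norm_bounds(1)[of v] n2_nonneg[of v] by linarith
      then have "AE x in lborel. v x = 0" using n2_eq_0_iff[OF H1_L2[OF v]] by simp
      moreover have [measurable]: "u \<in> bmeas" "v \<in> bmeas" using L2_measurable[OF H1_L2] u v by auto
      ultimately have "pf t u v = (\<integral>x. 0 \<partial>(lborel :: (real^3) measure))" unfolding pf_def by (intro integral_cong_AE) auto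
      then show ?thesis using True by simp
    next
      case False
      then have N: "0 < H1_norm v" using H1_norm_bounds(3)[of v] by simp
      define c where "c = 1 / H1_norm v"
      have c: "0 < c" using N by (simp add: c_def)
      have le: "c * n2 v <= 1" "c * grad_norm v <= 1" using H1_norm_bounds(1,2)[of v] N by (simp_all add: c_def)
      have w: "(%x. c *R v x) \<in> H1" by (rule H1_scaleR[OF v])
      have "n2 (%x. c *R v x) <= 1" "grad_norm (%x. c *R v x) <= 1"
        using le c L2_scaleR(2)[OF H1_L2[OF v], of c] grad_norm_cmult[OF v, of "of_real c"] by (simp_all add: scaleR_conv_of_real)
      then have "C * (n2 (%x. c *R v x) powr t + grad_norm (%x. c *R v x) powr t) <= C * (1 powr t + 1 powr t)"
        using C(1) t by (intro mult_left_mono add_mono powr_mono2) auto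
      then have "\<bar>pf t u (%x. c *R v x)\<bar> <= pw t u + 2 * C"
        using pf_bound[OF t u w] C(2)[OF w] by simp
      then show ?thesis using N by (simp add: pf_scaleR c_def abs_mult pos_divide_le_eq)
    qed
  qed (use C in simp)
qed

lemma coulomb_scaleR: "CE (%x. c *R u x) = c ^ 4 * CE u"
proof -
  have "(%x. (norm (c *R u x))^2) = (%x. c^2 * (norm (u x))^2)" by (simp add: power_mult_distrib)
  then show ?thesis unfolding coulomb_dd by (simp only: dd_cmult_left dd_cmult_right) (simp add: power4_eq_xxxx power2_eq_square mult_ac)
qed

lemma pw_scaleR: "pw t (%x. c *R u x) = \<bar>c\<bar> powr t * pw t u"
  by (simp add: pw_def powr_mult)

lemma grad_norm_scaleR: "u \<in> H1 ==> grad_norm (%x. c *R u x) = \<bar>c\<bar> * grad_norm u"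
  using grad_norm_cmult[of u "of_real c"] by (simp add: scaleR_conv_of_real)

lemma dd_quad:
  assumes "f \<in> X12" "g \<in> X12" "h \<in> X12"
  shows "dd (%x. f x + (s * g x + t * h x)) (%x. f x + (s * g x + t * h x)) =
    dd f f + 2 * s * dd f g + 2 * t * dd f h + s^2 * dd g g + 2 * s * t * dd g h + t^2 * dd h h"
  using assms dd_commute[OF assms(2,1)] dd_commute[OF assms(3,1)] dd_commute[OF assms(3,2)]
  by (simp add: dd_add_left dd_add_right X12_add X12_cmult dd_cmult_left dd_cmult_right)
    (simp add: algebra_simps power2_eq_square)

text \<open>Along a line the density is quadratic in \<open>h\<close>, so the energy is a polynomial
  of degree 4 whose linear coefficient is the derivative.\<close>

lemma coulomb_deriv:
  assumes u: "u \<in> H1" and v: "v \<in> H1"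
  shows "((%h. CE (%x. u x + h *R v x)) has_real_derivative 4 * dd (%x. (norm (u x))^2) (%x. u x \<bullet> v x)) (at 0)"
proof -
  let ?a = "%x. (norm (u x))^2" and ?b = "%x. u x \<bullet> v x" and ?c = "%x. (norm (v x))^2"
  note X = H1_X12[OF u] H1_inner_X12[OF u v] H1_X12[OF v]
  have e: "(norm (u x + h *R v x))^2 = ?a x + ((2 * h) * ?b x + h^2 * ?c x)" for x h
    unfolding power2_norm_eq_inner
    by (simp add: inner_add_left inner_add_right inner_commute[of "v x" "u x"] power2_eq_square algebra_simps)
  have "CE (%x. u x + h *R v x) =
      dd ?a ?a + 4 * h * dd ?a ?b + h^2 * (2 * dd ?a ?c + 4 * dd ?b ?b) + 4 * h ^ 3 * dd ?b ?c + h ^ 4 * dd ?c ?c" for h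
    unfolding coulomb_dd e dd_quad[OF X] by (simp add: algebra_simps power2_eq_square power3_eq_cube power4_eq_xxxx)
  then show ?thesis by (simp only:) (auto intro!: derivative_eq_intros)
qed

definition gip :: "(real^3 => complex) => (real^3 => complex) => real" where
  "gip u v = ip (weak_grad u) (weak_grad v)"

lemma gip_wg:
  assumes "u \<in> L2" "wgrad u g" "v \<in> L2" "wgrad v h" shows "gip u v = ip g h"
proof -
  have "weak_grad u \<in> L2" "weak_grad v \<in> L2" using assms H1I weak_grad_L2 by blast+
  note [measurable] = this[THEN L2_measurable] wgD(1)[OF assms(2), THEN L2_measurable] wgD(1)[OF assms(4), THEN L2_measurable]
  have "AE x in lborel. weak_grad u x \<bullet> weak_grad v x = g x \<bullet> h x"
    using weak_grad_AE[OF assms(1,2)] weak_grad_AE[OF assms(3,4)] by eventually_elim simp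
  then show ?thesis unfolding gip_def ip_def by (intro integral_cong_AE) measurable
qed

lemma gip_commute: "gip u v = gip v u" unfolding gip_def by (rule ip_commute)

lemma gip_add: assumes "u \<in> H1" "v \<in> H1" "w \<in> H1" shows "gip (%x. u x + v x) w = gip u w + gip v w"
  using gip_wg[OF L2_add[OF assms(1,2)[THEN H1_L2]] wg_add[OF assms(1,2)[THEN H1_L2] assms(1,2)[THEN H1_wg]] H1_L2 H1_wg, OF assms(3,3)]
    ip_add_left[OF assms[THEN weak_grad_L2]] by (simp add: gip_def)

lemma wg_scaleR: "u \<in> L2 ==> wgrad u g ==> wgrad (%x. c *R u x) (%x. c *R g x)"
  using wg_cmult[of u g "of_real c"] by (simp add: scaleR_conv_of_real vec_eq_iff vector_scalar_mult_def scaleR_vec_def)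

lemma gip_scaleR: assumes "u \<in> H1" "w \<in> H1" shows "gip (%x. c *R u x) w = c * gip u w"
  using gip_wg[OF L2_scaleR(1)[OF H1_L2] wg_scaleR[OF H1_L2 H1_wg] H1_L2 H1_wg, OF assms(1,1,1) assms(2,2), of c]
  by (simp add: gip_def ip_scaleR_left)

lemma gip_self: "gip u u = (grad_norm u)^2" by (simp add: gip_def ip_self grad_norm_eq)

lemma gip_bound: "u \<in> H1 ==> v \<in> H1 ==> \<bar>gip u v\<bar> <= grad_norm u * grad_norm v"
  unfolding gip_def grad_norm_eq by (intro ip_bound weak_grad_L2)

lemma gip_rotate:
  assumes R: "orth R" and u: "u \<in> H1" and v: "v \<in> H1"
  shows "(%x. u (R x)) \<in> H1" "gip (%x. u (R x)) (%x. v (R x)) = gip u v" "ip (%x. u (R x)) (%x. v (R x)) = ip u v"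
proof -
  note uv = u[THEN H1_L2] v[THEN H1_L2] and w = wg_rotate[OF R H1_L2 H1_wg]
  note [measurable] = uv[THEN L2_measurable] weak_grad_L2[OF u, THEN L2_measurable] weak_grad_L2[OF v, THEN L2_measurable]
  show "(%x. u (R x)) \<in> H1" by (rule H1I[OF L2_rotate(1)[OF R uv(1)] w[OF u u]])
  show "ip (%x. u (R x)) (%x. v (R x)) = ip u v" unfolding ip_def
    by (rule orthogonal_integral[OF R]) measurable
  have "gip (%x. u (R x)) (%x. v (R x)) = (LBINT x. weak_grad u (R x) \<bullet> weak_grad v (R x))"
    unfolding gip_wg[OF L2_rotate(1)[OF R uv(1)] w[OF u u] L2_rotate(1)[OF R uv(2)] w[OF v v]] by (simp add: ip_def rgrad_inner[OF R])
  also have "\<dots> = gip u v" unfolding gip_def ip_def by (rule orthogonal_integral[OF R]) measurable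
  finally show "gip (%x. u (R x)) (%x. v (R x)) = gip u v" .
qed

text \<open>Symmetric criticality: the Riesz representative of an invariant functional is radial.\<close>

lemma symmetric_criticality:
  fixes T :: "(real^3 => complex) => real"
  assumes Tadd: "!!u v. u \<in> H1 ==> v \<in> H1 ==> T (%x. u x + v x) = T u + T v"
    and Tscale: "!!c u. u \<in> H1 ==> T (%x. c *R u x) = c * T u"
    and Tb: "!!u. u \<in> H1 ==> \<bar>T u\<bar> <= k * H1_norm u"
    and Tinv: "!!R u. orth R ==> u \<in> H1 ==> T (%x. u (R x)) = T u"
    and Tr: "!!u. u \<in> H1r ==> T u = 0" and w: "w \<in> H1"
  shows "T w = 0"
proof -
  define B where "B u v = gip u v + ip u v" for u v :: "real^3 => complex"
  have Bself: "B u u = (grad_norm u)^2 + (n2 u)^2" for u by (simp add: B_def gip_self ip_self)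
  have Bn: "sqrt (B u u) = H1_norm u" for u by (simp add: Bself H1_norm_eq)
  have Badd: "B (%x. u x + v x) z = B u z + B v z" if "u \<in> H1" "v \<in> H1" "z \<in> H1" for u v z
    using that H1_L2 by (simp add: B_def gip_add ip_add_left)
  have Bsc: "B (%x. c *R u x) z = c * B u z" if "u \<in> H1" "z \<in> H1" for c u z
    using that by (simp add: B_def gip_scaleR ip_scaleR_left distrib_left)
  have Bsym: "B u v = B v u" for u v unfolding B_def using gip_commute[of u v] ip_commute[of u v] by simp
  obtain v where v: "!!n. v n \<in> H1"
    "!!e. 0 < e ==> \<exists>N. \<forall>m\<ge>N. \<forall>n\<ge>N. B (%x. v m x + -1 *R v n x) (%x. v m x + -1 *R v n x) < e"
    "!!w. w \<in> H1 ==> (%n. B (v n) w) ----> T w"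
    by (rule Riesz_sequence[of cbump H1 "%u v x. u x + v x" "%c u x. c *R u x" B T k])
      (use cbump_H1 H1_add H1_scaleR Badd Bsc Bsym Tadd Tscale Tb Bn in \<open>auto simp: Bself\<close>)
  have d: "n2 (%x. v m x - v n x) <= sqrt (B (%x. v m x + -1 *R v n x) (%x. v m x + -1 *R v n x))"
    "n2 (%x. weak_grad (v m) x - weak_grad (v n) x) <= sqrt (B (%x. v m x + -1 *R v n x) (%x. v m x + -1 *R v n x))" for m n
  proof -
    have "wgrad (%x. v m x + -1 *R v n x) (%x. weak_grad (v m) x + -1 *R weak_grad (v n) x)"
      by (intro wg_add wg_scaleR L2_scaleR(1) H1_L2 H1_wg v(1))
    from grad_norm_wg[OF L2_add[OF H1_L2[OF v(1)] L2_scaleR(1)[OF H1_L2[OF v(1)]]] this]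
    have "n2 (%x. weak_grad (v m) x - weak_grad (v n) x) = grad_norm (%x. v m x + -1 *R v n x)" by simp
    then show "n2 (%x. weak_grad (v m) x - weak_grad (v n) x) <= sqrt (B (%x. v m x + -1 *R v n x) (%x. v m x + -1 *R v n x))"
      using H1_norm_bounds(2)[of "%x. v m x + -1 *R v n x"] unfolding Bn by simp
    show "n2 (%x. v m x - v n x) <= sqrt (B (%x. v m x + -1 *R v n x) (%x. v m x + -1 *R v n x))"
      using H1_norm_bounds(1)[of "%x. v m x + -1 *R v n x"] unfolding Bn by simp
  qed
  have small: "\<exists>N. \<forall>m\<ge>N. \<forall>n\<ge>N. sqrt (B (%x. v m x + -1 *R v n x) (%x. v m x + -1 *R v n x)) < e" if "0 < e" for e
  proof -
    have "0 < e^2" using that by simp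
    from v(2)[OF this] obtain N where N: "\<forall>m\<ge>N. \<forall>n\<ge>N. B (%x. v m x + -1 *R v n x) (%x. v m x + -1 *R v n x) < e^2" by blast
    have "sqrt (e^2) = e" using that by simp
    then show ?thesis using N real_sqrt_less_mono[of _ "e^2"] by (intro exI[of _ N]) simp
  qed
  obtain z where z: "z \<in> L2" "(%n. n2 (%x. v n x - z x)) ----> 0"
  proof (rule L2_complete[of v, OF H1_L2[OF v(1)]])
    show "\<exists>N. \<forall>m\<ge>N. \<forall>n\<ge>N. n2 (%x. v m x - v n x) < e" if "0 < e" for e
      using small[OF that] le_less_trans[OF d(1)] by meson
  qed
  obtain g where g: "g \<in> L2" "(%n. n2 (%x. weak_grad (v n) x - g x)) ----> 0"
  proof (rule L2_complete[of "%n. weak_grad (v n)", OF weak_grad_L2[OF v(1)]])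
    show "\<exists>N. \<forall>m\<ge>N. \<forall>n\<ge>N. n2 (%x. weak_grad (v m) x - weak_grad (v n) x) < e" if "0 < e" for e
      using small[OF that] le_less_trans[OF d(2)] by meson
  qed
  have wz: "wgrad z g" by (rule wg_closed[OF H1_wg[OF v(1)] H1_L2[OF v(1)] z(1) g(1) z(2) g(2)])
  have zH: "z \<in> H1" by (rule H1I[OF z(1) wz])
  have rep: "B z u = T u" if u: "u \<in> H1" for u
  proof -
    have "(%n. B (v n) u) ----> ip g (weak_grad u) + ip z u" unfolding B_def gip_def
      by (intro tendsto_add ip_tendsto[OF weak_grad_L2[OF v(1)] g weak_grad_L2[OF u]] ip_tendsto[OF H1_L2[OF v(1)] z H1_L2[OF u]])
    then have "T u = ip g (weak_grad u) + ip z u" using v(3)[OF u] LIMSEQ_unique by blast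
    then show ?thesis using gip_wg[OF z(1) wz H1_L2[OF u] H1_wg[OF u]] by (simp add: B_def)
  qed
  have "AE x in lborel. z (R x) = z x" if R: "orth R" for R
  proof -
    let ?r = "%x. z (R x)"
    note r = gip_rotate[OF R zH zH]
    let ?d = "%x. ?r x + -1 *R z x"
    have dH: "?d \<in> H1" by (intro H1_add H1_scaleR r(1) zH)
    \<comment> \<open>The rotated representative has the same norm as \<open>z\<close> and, by
      invariance of \<open>T\<close>, the pairing \<open>B z z\<close> with it; the squared distance
      of the two therefore cancels.\<close>
    have "B ?d ?d = B ?r ?r - 2 * B z ?r + B z z"
      using Badd[OF r(1) H1_scaleR[OF zH, of "-1"] dH] Bsc[OF zH dH, of "-1"] Badd[OF r(1) H1_scaleR[OF zH, of "-1"] r(1)]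
        Badd[OF r(1) H1_scaleR[OF zH, of "-1"] zH] Bsc[OF zH r(1), of "-1"] Bsc[OF zH zH, of "-1"]
        Bsym[of ?r ?d] Bsym[of z ?d] Bsym[of ?r z] by simp
    moreover have "B ?r ?r = B z z" using r by (simp add: B_def)
    moreover have "B z ?r = B z z" unfolding rep[OF r(1)] rep[OF zH] by (rule Tinv[OF R zH])
    ultimately have "(n2 ?d)^2 <= 0" unfolding Bself by (simp add: sum_power2_le_zero_iff)
    then have "n2 ?d = 0" by simp
    then show ?thesis using n2_eq_0_iff[OF H1_L2[OF dH]] by simp
  qed
  then have "z \<in> H1r" using radialI[OF z(1)] zH by (simp add: H1r_iff)
  then have "B z z = 0" using rep[OF zH] Tr by simp
  then have "grad_norm z = 0" "n2 z = 0" by (simp_all add: Bself sum_power2_eq_zero_iff)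
  then have "B z w = 0" using gip_bound[OF zH w] ip_bound[OF z(1) H1_L2[OF w]] by (simp add: B_def)
  then show ?thesis using rep[OF w] by simp
qed

text \<open>Bounding the squared sum of moduli by four times the sum of squares gives a
  differentiable function \<open>E >= 0 = E 0\<close> near 0. The squares have vanishing derivative
  there, so Fermat's rule leaves the linear part.\<close>

lemma envelope_critical:
  fixes f1 f2 f3 f4 :: "real => real"
  assumes D: "(f1 has_real_derivative d1) (at 0)" "(f2 has_real_derivative d2) (at 0)"
      "(f3 has_real_derivative d3) (at 0)" "(f4 has_real_derivative d4) (at 0)"
    and e: "0 < e" and L: "0 <= L"
    and le: "eventually (%t. \<bar>f1 t - f1 0\<bar> + \<bar>f2 t - f2 0\<bar> + \<bar>f3 t - f3 0\<bar> + \<bar>f4 t - f4 0\<bar> <= e \<longrightarrow>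
      0 <= (f1 t - f1 0) / 2 + (f2 t - f2 0) / 4 - (f3 t - f3 0) - (f4 t - f4 0)
        + L * (\<bar>f1 t - f1 0\<bar> + \<bar>f2 t - f2 0\<bar> + \<bar>f3 t - f3 0\<bar> + \<bar>f4 t - f4 0\<bar>)^2) (at 0)"
  shows "d1 / 2 + d2 / 4 - d3 - d4 = 0"
proof -
  let ?s = "%t. \<bar>f1 t - f1 0\<bar> + \<bar>f2 t - f2 0\<bar> + \<bar>f3 t - f3 0\<bar> + \<bar>f4 t - f4 0\<bar>"
  define E where "E t = (f1 t - f1 0) / 2 + (f2 t - f2 0) / 4 - (f3 t - f3 0) - (f4 t - f4 0)
     + 4 * L * ((f1 t - f1 0)^2 + (f2 t - f2 0)^2 + (f3 t - f3 0)^2 + (f4 t - f4 0)^2)" for t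
  have c: "(f1 \<longlongrightarrow> f1 0) (at 0)" "(f2 \<longlongrightarrow> f2 0) (at 0)" "(f3 \<longlongrightarrow> f3 0) (at 0)" "(f4 \<longlongrightarrow> f4 0) (at 0)"
    using D[THEN DERIV_isCont] by (simp_all add: isCont_def)
  have "(?s \<longlongrightarrow> \<bar>f1 0 - f1 0\<bar> + \<bar>f2 0 - f2 0\<bar> + \<bar>f3 0 - f3 0\<bar> + \<bar>f4 0 - f4 0\<bar>) (at 0)"
    by (intro tendsto_add tendsto_rabs tendsto_diff c tendsto_const)
  then have "eventually (%t. ?s t < e) (at 0)" using e by (intro order_tendstoD(2)) simp_all
  with le have "eventually (%t. 0 <= E t) (at 0)"
  proof eventually_elim
    case (elim t)
    have sq: "(\<bar>x\<bar> + \<bar>y\<bar> + \<bar>z\<bar> + \<bar>w\<bar>)^2 <= 4 * (x^2 + y^2 + z^2 + w^2)" for x y z w :: real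
    proof -
      have 2: "(r + s)^2 <= 2 * r^2 + 2 * s^2" for r s :: real using norm_add_sq_le[of r s] by simp
      show ?thesis using 2[of "\<bar>x\<bar> + \<bar>y\<bar>" "\<bar>z\<bar> + \<bar>w\<bar>"] 2[of "\<bar>x\<bar>" "\<bar>y\<bar>"] 2[of "\<bar>z\<bar>" "\<bar>w\<bar>"] by (simp add: add.assoc)
    qed
    show ?case using mult_left_mono[OF sq[of "f1 t - f1 0" "f2 t - f2 0" "f3 t - f3 0" "f4 t - f4 0"] L] elim
      by (simp add: E_def mult_ac)
  qed
  then obtain r where r: "0 < r" "!!t. t \<noteq> 0 ==> \<bar>t\<bar> < r ==> 0 <= E t" unfolding eventually_at by (auto simp: dist_real_def)
  have E0: "E 0 = 0" by (simp add: E_def)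
  have "\<forall>y. \<bar>0 - y\<bar> < r \<longrightarrow> E 0 <= E y" using r(2) E0 by (metis abs_minus_commute diff_zero order_refl)
  moreover have "(E has_real_derivative d1 / 2 + d2 / 4 - d3 - d4) (at 0)"
    unfolding E_def[abs_def] by (auto intro!: derivative_eq_intros D)
  ultimately show ?thesis using DERIV_local_min[OF _ r(1)] by blast
qed

section \<open>The minimiser: comparison, mass, multiplier and equation\<close>

locale nls_min = nls +
  fixes u
  assumes uN: "u \<in> Nm" and ureal: "!!x. u x = cor (norm (u x))"
    and umin: "!!v. v \<in> Nm ==> J p q \<mu> u <= J p q \<mu> v"
begin

lemmas uD = NmD[OF uN]
lemmas uL = H1_L2[OF uD(2)]

text \<open>The increments \<open>dA\<close>, \<open>dC\<close>, \<open>dF\<close>,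
  \<open>dG\<close> are one-sided bounds, in the direction that raises the fibre map, so that
  estimates for a competitor can be inserted directly.\<close>

definition "quadratic_comparison L e \<longleftrightarrow> (\<forall>w dA dC dF dG. w \<in> H1r \<longrightarrow> 0 < n2 w \<longrightarrow> n2 w <= a \<longrightarrow> \<bar>dA\<bar> + \<bar>dC\<bar> + \<bar>dF\<bar> + \<bar>dG\<bar> <= e \<longrightarrow>
   TA w <= TA u + dA \<longrightarrow> CE w <= CE u + dC \<longrightarrow> TF u + dF <= TF w \<longrightarrow> TG u + dG <= TG w \<longrightarrow>
   0 <= dA / 2 + dC / 4 - dF - dG + L * (\<bar>dA\<bar> + \<bar>dC\<bar> + \<bar>dF\<bar> + \<bar>dG\<bar>)^2)"

text \<open>The competitor is projected to \<open>Nm\<close>, where \<open>u\<close> is minimal. Its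
  fibre value there is at most that of the coefficients \<open>TA u + dA\<close> and so on, to which
  the envelope estimate applies.\<close>

lemma comparison: obtains L e where "0 < e" "0 <= L" "quadratic_comparison L e"
proof -
  obtain L e where e: "0 < e" and L: "!!dA dC dF dG s. \<bar>dA\<bar> + \<bar>dC\<bar> + \<bar>dF\<bar> + \<bar>dG\<bar> <= e ==> 0 <= CE u + dC ==>
      X\<^sup>2 <= (TA u + dA) * exp (2 * s) ==> fib alpha beta (TA u + dA) (CE u + dC) (TF u + dF) (TG u + dG) s \<le>
      ff u 0 + dA / 2 + dC / 4 - dF - dG + L * (\<bar>dA\<bar> + \<bar>dC\<bar> + \<bar>dF\<bar> + \<bar>dG\<bar>)^2"
    by (rule envelope[OF fibre[OF uD(2,3)] uD(5) X0 uD(7) gap[OF uD(2-4), unfolded s0_def]]) blast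
  show ?thesis
  proof (rule that[OF e, of "\<bar>L\<bar>"], simp, unfold quadratic_comparison_def, intro allI impI)
    fix w dA dC dF dG
    assume w: "w \<in> H1r" "0 < n2 w" "n2 w <= a" and d: "\<bar>dA\<bar> + \<bar>dC\<bar> + \<bar>dF\<bar> + \<bar>dG\<bar> <= e"
      and T: "TA w <= TA u + dA" "CE w <= CE u + dC" "TF u + dF <= TF w" "TG u + dG <= TG w"
    have wH: "w \<in> H1" using w(1) H1rD by blast
    obtain z y where y: "s0 w < y" "ff1 w y = 0" by (rule project[OF wH w(2,3)])
    have "X^2 < TA w * exp (2 * y)" using exp_s0(2)[OF wH w(2)] y(1) by simp
    also have "\<dots> <= (TA u + dA) * exp (2 * y)" using T(1) by (intro mult_right_mono) auto
    finally have X: "X^2 <= (TA u + dA) * exp (2 * y)" by simp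
    have "ff u 0 <= ff w y" using umin[OF dilate_Nm(1)[OF w y]] dilate_Nm(2)[OF w y] by (simp add: J_ff)
    also have "\<dots> <= fib alpha beta (TA u + dA) (CE u + dC) (TF u + dF) (TG u + dG) y" by (rule fib_mono[OF T])
    also have "\<dots> <= ff u 0 + dA / 2 + dC / 4 - dF - dG + L * (\<bar>dA\<bar> + \<bar>dC\<bar> + \<bar>dF\<bar> + \<bar>dG\<bar>)^2"
      by (rule L[OF d order_trans[OF coulomb_nonneg T(2)] X])
    finally have "0 <= dA / 2 + dC / 4 - dF - dG + L * (\<bar>dA\<bar> + \<bar>dC\<bar> + \<bar>dF\<bar> + \<bar>dG\<bar>)^2" by linarith
    moreover have "L * (\<bar>dA\<bar> + \<bar>dC\<bar> + \<bar>dF\<bar> + \<bar>dG\<bar>)^2 <= \<bar>L\<bar> * (\<bar>dA\<bar> + \<bar>dC\<bar> + \<bar>dF\<bar> + \<bar>dG\<bar>)^2"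
      by (intro mult_right_mono) auto
    ultimately show "0 <= dA / 2 + dC / 4 - dF - dG + \<bar>L\<bar> * (\<bar>dA\<bar> + \<bar>dC\<bar> + \<bar>dF\<bar> + \<bar>dG\<bar>)^2" by linarith
  qed
qed

text \<open>The derivative of the energy at \<open>u\<close> in the direction \<open>u\<close>.
  Testing the equation with \<open>u\<close> turns it into \<open>- lam * a^2\<close>, so the
  multiplier has the sign of \<open>- Q\<close>.\<close>

definition "Q = TA u + CE u - p * TF u - q * TG u"

text \<open>A spread out competitor \<open>v\<close> of mass \<open>x\<close>, a quarter turn out of phase with \<open>u\<close>: the costs are of
  order \<open>x\<^sup>2\<close>, while the gain in the lower power term is of order \<open>x\<close> to the power \<open>2 q - 3 < 2\<close>.\<close>

lemma cloud:
  assumes delta: "0 <= delta" "0 <= delta * Q" and x0: "0 < x0"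
    and mass: "!!x. 0 < x ==> x < x0 ==> (1 - delta * x) * (n2 u)^2 + x <= a^2"
  shows False
proof -
  define r where "r x = cor (1 / n2 cbump) * cbump x" for x
  have rH: "r \<in> H1r" "r \<in> H1" unfolding r_def by (rule H1r_cmult[OF cbump_H1r], rule H1_cmult[OF cbump_H1])
  note rL = H1_L2[OF rH(2)]
  have r1: "n2 r = 1" unfolding r_def L2_mult_complex(2)[OF H1_L2[OF cbump_H1]] norm_of_real using cbump_n2 by simp
  obtain c0 where c0: "0 <= c0" "!!x. pot (%x. (norm (r x))^2) x <= c0"
    by (rule that[OF abs_ge_zero order_trans[OF abs_ge_self order_trans[OF pot_L4_bound[OF rH(2)] abs_ge_self]]])
  define cG where "cG = TG r"
  have cG: "0 < cG" unfolding cG_def by (rule tuple_pos(3)[OF rH(2)]) (simp add: r1)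
  obtain L e where e: "0 < e" and L: "0 <= L" and cmp: "quadratic_comparison L e" by (rule comparison)
  note cmp = cmp[unfolded quadratic_comparison_def, rule_format]
  let ?A = "TA u" and ?C = "CE u" and ?F = "TF u" and ?G = "TG u"
  have nn: "0 <= ?A" "0 <= ?C" "0 <= ?F" "0 <= ?G" "0 <= TA r" "0 <= CE r"
    using tuple_nonneg coulomb_nonneg by (simp_all add: TA_def)
  \<comment> \<open>The total increment of the four integrals will be at most \<open>N * x\<close>,
    and \<open>M * x^2\<close> will collect all costs of order two and three together with the
    squared error.\<close>
  define N where "N = (delta * ?A + TA r) + (2 * delta * ?C + delta^2 * ?C + 2 * a^2 * c0 + CE r) + p / 2 * delta * ?F + (q / 2 * delta * ?G + cG)"
  define M where "M = delta^2 * ?C / 4 + a^2 * c0 / 2 + TA r / 2 + CE r / 4 + L * N^2"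
  have main: "cG <= M * x powr (5 - 2 * q)"
    if x: "0 < x" "x < x0" "x < 1" "delta * x < 1" "N * x <= e" for x
  proof -
    \<comment> \<open>Scaling \<open>u\<close> by \<open>theta\<close> frees the mass
      \<open>delta * x * (n2 u)^2\<close> for the cloud; \<open>delta = 0\<close> is the case of
      spare mass.\<close>
    define theta where "theta = sqrt (1 - delta * x)"
    have theta: "0 < theta" "theta <= 1" "theta^2 = 1 - delta * x" using x delta by (auto simp: theta_def)
    \<comment> \<open>The amplitude \<open>sqrt x\<close> gives mass \<open>x\<close>; the dilation
      factor \<open>exp (ln x) = x\<close> spreads the cloud, so that gradient and Coulomb energy
      become of order \<open>x ^ 3\<close>.\<close>
    define v where "v y = sqrt x *R dilate (ln x) r y" for y
    have dH: "dilate (ln x) r \<in> H1" by (rule H1_dilate[OF rH(2)])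
    have vH: "v \<in> H1" "v \<in> H1r" unfolding v_def
      using H1_scaleR[OF dH] H1r_cmult[OF H1r_dilate[OF rH(1)], of "of_real (sqrt x)"] by (auto simp: scaleR_conv_of_real)
    have vT: "TA v = x ^ 3 * TA r" "CE v = x ^ 3 * CE r" "TG v = cG * x powr (2 * q - 3)" "n2 v = sqrt x"
    proof -
      have "exp (2 * ln x) = x^2" using x(1) exp_of_nat_mult[of 2 "ln x"] by simp
      moreover have "TA v = x * TA (dilate (ln x) r)"
        using grad_norm_scaleR[OF dH, of "sqrt x"] x(1) by (simp add: v_def[abs_def] TA_def power_mult_distrib)
      ultimately show "TA v = x ^ 3 * TA r"
        unfolding tuple_dilate(1)[OF rH(2), of "ln x"] by (simp add: power2_eq_square power3_eq_cube)
      show "CE v = x ^ 3 * CE r" using x(1) tuple_dilate(2)[OF rH(2), of "ln x"]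
        unfolding v_def coulomb_scaleR by (simp add: power4_eq_xxxx power3_eq_cube flip: mult.assoc)
      have "sqrt x powr q = x powr (q / 2)" using x(1) by (simp add: powr_half_sqrt[symmetric] powr_powr)
      then have "TG v = x powr (q / 2) * TG (dilate (ln x) r)" using x(1) by (simp add: TG_def v_def[abs_def] pw_scaleR)
      also have "\<dots> = (x powr (q / 2) * x powr beta) * TG r"
        unfolding tuple_dilate(4)[OF rH(2)] using x(1) by (simp add: powr_def)
      also have "x powr (q / 2) * x powr beta = x powr (2 * q - 3)" unfolding ab_eq by (simp flip: powr_add)
      finally show "TG v = cG * x powr (2 * q - 3)" by (simp add: cG_def)
      show "n2 v = sqrt x" unfolding v_def L2_scaleR(2)[OF H1_L2[OF dH]] n2_dilate[OF rL] r1 using x(1) by simp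
    qed
    have vim: "Im (v y) = 0" for y by (simp add: v_def dilate_def r_def cbump_def)
    have uim: "Im (u y) = 0" for y by (subst ureal) simp
    define U where "U y = theta *R u y" for y
    have Uim: "Im (U y) = 0" for y by (simp add: U_def uim)
    have UH: "U \<in> H1" "U \<in> H1r" unfolding U_def
      using H1_scaleR[OF uD(2)] H1r_cmult[OF uD(1), of "of_real theta"] by (auto simp: scaleR_conv_of_real)
    have ivH: "(%y. \<i> * v y) \<in> H1" "(%y. \<i> * v y) \<in> H1r" "(%y. - (\<i> * v y)) \<in> H1r"
      using H1_cmult[OF vH(1), of "\<i>"] H1r_cmult[OF vH(2), of "\<i>"] H1r_cmult[OF vH(2), of "- \<i>"] by simp_all
    obtain w where w: "w \<in> H1r" "TA w <= theta^2 * ?A + TA v" "!!y. (norm (w y))^2 = (norm (U y))^2 + (norm (v y))^2"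
    proof -
      \<comment> \<open>A factor \<open>\<i>\<close> or \<open>- \<i>\<close> removes the mixed term
        in the density, since \<open>U\<close> and \<open>v\<close> are real. For the gradient the
        better of the two signs is taken.\<close>
      let ?w = "%y. U y + \<i> * v y" and ?w' = "%y. U y + - (\<i> * v y)"
      have s: "TA ?w + TA ?w' = 2 * (theta^2 * ?A + TA v)"
        using grad_norm_parallelogram[OF UH(1) ivH(1)] grad_norm_cmult[OF vH(1), of "\<i>"] grad_norm_scaleR[OF uD(2), of theta]
        by (simp add: TA_def U_def[abs_def] power_mult_distrib distrib_left)
      have n: "(norm (?w y))^2 = (norm (U y))^2 + (norm (v y))^2" "(norm (?w' y))^2 = (norm (U y))^2 + (norm (v y))^2" for y
        by (simp_all add: cmod_power2 Uim vim)
      show ?thesis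
      proof (cases "TA ?w <= theta^2 * ?A + TA v")
        case True show ?thesis by (rule that[OF H1r_add[OF UH(2) ivH(2)] True n(1)])
      next
        case False
        have "y <= b" if "\<not> x <= b" "x + y = 2 * b" for x y b :: real using that by linarith
        from this[OF False s] have "TA ?w' <= theta^2 * ?A + TA v" .
        then show ?thesis by (rule that[OF H1r_add[OF UH(2) ivH(3)] _ n(2)])
      qed
    qed
    have wL: "w \<in> L2" using H1_L2 H1rD(1)[OF w(1)] by blast
    have wn: "(n2 w)^2 = theta^2 * (n2 u)^2 + x"
    proof -
      have "(n2 w)^2 = (n2 U)^2 + (n2 v)^2" unfolding n2_sq w(3)
        by (rule Bochner_Integration.integral_add[OF L2_integrable[OF H1_L2[OF UH(1)]] L2_integrable[OF H1_L2[OF vH(1)]]])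
      then show ?thesis using x(1) vT(4) L2_scaleR(2)[OF uL, of theta] by (simp add: U_def[abs_def] power_mult_distrib)
    qed
    have "(n2 w)^2 <= a^2" unfolding wn theta(3) by (rule mass[OF x(1,2)])
    then have wa: "n2 w <= a" using par by (auto intro: power2_le_imp_le)
    have "0 < (n2 w)^2" unfolding wn using x(1) by (intro add_nonneg_pos) auto
    then have w0: "0 < n2 w" by (simp add: less_le)
    define dA dC dF dG where "dA = - delta * x * ?A + x ^ 3 * TA r"
      and "dC = - 2 * delta * x * ?C + delta^2 * x^2 * ?C + 2 * a^2 * c0 * x^2 + x ^ 3 * CE r"
      and "dF = - (p / 2) * delta * x * ?F" and "dG = - (q / 2) * delta * x * ?G + cG * x powr (2 * q - 3)"
    have TA: "TA w <= ?A + dA" using w(2) unfolding theta(3) vT by (simp add: dA_def algebra_simps)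
    have TC: "CE w <= ?C + dC"
    proof -
      have "pot (%y. (norm (v y))^2) y <= x^2 * c0" for y
      proof -
        have "pot (%y. (norm (v y))^2) y = x * pot (%y. (norm (dilate (ln x) r y))^2) y"
          unfolding v_def using x(1) by (simp add: power_mult_distrib pot_cmult)
        also have "\<dots> = x^2 * pot (%y. (norm (r y))^2) (exp (ln x) *R y)"
          unfolding pot_dilate[OF L2_measurable[OF rL]] using x(1) by (simp add: power2_eq_square)
        also have "\<dots> <= x^2 * c0" by (intro mult_left_mono c0) simp
        finally show ?thesis .
      qed
      from coulomb_orthogonal_bound[OF UH(1) vH(1) this w(3)]
      have "CE w <= CE U + 2 * (x^2 * c0) * (n2 U)^2 + x ^ 3 * CE r" unfolding vT .
      moreover have "CE U = (1 - delta * x)^2 * ?C"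
        unfolding U_def coulomb_scaleR theta(3)[symmetric] by (simp flip: power_mult)
      moreover have "2 * (x^2 * c0) * (n2 U)^2 <= 2 * (x^2 * c0) * a^2"
      proof -
        have "n2 U = theta * n2 u" using L2_scaleR(2)[OF uL, of theta] theta by (simp add: U_def[abs_def])
        also have "\<dots> <= 1 * a" using theta uD by (intro mult_mono) auto
        finally show ?thesis using c0 by (intro mult_left_mono power_mono) auto
      qed
      ultimately show ?thesis by (simp add: dC_def power2_diff algebra_simps)
    qed
    \<comment> \<open>The density of \<open>w\<close> is a sum of two densities; superadditivity of
      the power \<open>t / 2\<close> and Bernoulli's inequality for \<open>theta powr t\<close> give
      the lower bound.\<close>
    have pwge: "(1 - t / 2 * (delta * x)) * pw t u + pw t v <= pw t w" if t: "2 < t" "t < 6" for t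
    proof -
      have s: "norm z powr t = ((norm z)^2) powr (t / 2)" for z :: complex
        using powr_powr[of "norm z" 2 "t / 2"] by simp
      have "pw t U + pw t v = (LBINT y. norm (U y) powr t + norm (v y) powr t)" unfolding pw_def
        by (rule Bochner_Integration.integral_add[symmetric, OF H1_pw_integrable[OF t UH(1)] H1_pw_integrable[OF t vH(1)]])
      also have "\<dots> <= pw t w" unfolding pw_def
      proof (rule integral_mono)
        show "norm (U y) powr t + norm (v y) powr t <= norm (w y) powr t" for y
          unfolding s w(3) using t by (intro powr_superadditive) auto
      qed (intro Bochner_Integration.integrable_add H1_pw_integrable t UH(1) vH(1) H1rD(1)[OF w(1)])+
      finally have "pw t U + pw t v <= pw t w" .
      moreover have "pw t U = theta powr t * pw t u" using theta by (simp add: U_def[abs_def] pw_scaleR)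
      moreover have "1 - t / 2 * (delta * x) <= theta powr t"
      proof -
        have "theta powr t = (theta^2) powr (t / 2)" using powr_powr[of theta 2 "t / 2"] theta by simp
        then show ?thesis unfolding theta(3) using powr_Bernoulli[of "delta * x" "t / 2"] x delta t by simp
      qed
      then have "(1 - t / 2 * (delta * x)) * pw t u <= theta powr t * pw t u" by (intro mult_right_mono) auto
      ultimately show ?thesis by linarith
    qed
    have TF: "?F + dF <= TF w"
    proof -
      have "(1 - p / 2 * (delta * x)) * pw p u / p <= pw p w / p"
        using pwge[of p] pw_nonneg[of p v] pq by (intro divide_right_mono) linarith+
      then show ?thesis using pq by (simp add: TF_def dF_def algebra_simps add_divide_distrib diff_divide_distrib)
    qed
    have TG: "?G + dG <= TG w"
    proof -
      have "\<mu> / q * ((1 - q / 2 * (delta * x)) * pw q u + pw q v) <= \<mu> / q * pw q w"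
        using pwge[of q] par pq by (intro mult_left_mono) auto
      moreover have "\<mu> / q * ((1 - q / 2 * (delta * x)) * pw q u + pw q v) = (1 - q / 2 * (delta * x)) * ?G + TG v"
        by (simp add: TG_def distrib_left mult_ac)
      ultimately show ?thesis unfolding vT(3) by (simp add: TG_def dG_def algebra_simps)
    qed
    have x1: "x ^ 2 <= x" "x ^ 3 <= x" "x powr (2 * q - 3) <= x" "x ^ 3 <= x^2"
      using x power_decreasing[of 1 2 x] power_decreasing[of 1 3 x] power_decreasing[of 2 3 x] powr_mono'[of 1 "2 * q - 3" x] par by auto
    let ?d = "\<bar>dA\<bar> + \<bar>dC\<bar> + \<bar>dF\<bar> + \<bar>dG\<bar>"
    have dN: "?d <= N * x"
    proof -
      have t: "\<bar>b * s\<bar> <= c * x" if "\<bar>b\<bar> <= c" "0 <= s" "s <= x" for b s c :: real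
        unfolding abs_mult using that by (intro mult_mono) auto
      have "\<bar>dA\<bar> <= (delta * ?A) * x + TA r * x"
        unfolding dA_def using t[of "- (delta * ?A)" "delta * ?A" x] t[of "TA r" "TA r" "x ^ 3"] delta nn x1 x
        by (intro order_trans[OF abs_triangle_ineq] add_mono) (auto simp: mult_ac)
      moreover have "\<bar>dC\<bar> <= (2 * delta * ?C) * x + (delta^2 * ?C) * x + (2 * a^2 * c0) * x + CE r * x"
        unfolding dC_def using t[of "- (2 * delta * ?C)" "2 * delta * ?C" x] t[of "delta^2 * ?C" "delta^2 * ?C" "x^2"] t[of "2 * a^2 * c0" "2 * a^2 * c0" "x^2"]
          t[of "CE r" "CE r" "x ^ 3"] delta nn x1 x c0
        by (intro order_trans[OF abs_triangle_ineq] add_mono) (auto simp: mult_ac)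
      moreover have "\<bar>dF\<bar> <= (p / 2 * delta * ?F) * x" unfolding dF_def using t[of "- (p / 2 * delta * ?F)" "p / 2 * delta * ?F" x] delta nn x pq
        by (auto simp: mult_ac)
      moreover have "\<bar>dG\<bar> <= (q / 2 * delta * ?G) * x + cG * x"
        unfolding dG_def using t[of "- (q / 2 * delta * ?G)" "q / 2 * delta * ?G" x] t[of cG cG "x powr (2 * q - 3)"] delta nn x x1 pq cG
        by (intro order_trans[OF abs_triangle_ineq] add_mono) (auto simp: mult_ac)
      ultimately show ?thesis unfolding N_def distrib_right by linarith
    qed
    have "0 <= dA / 2 + dC / 4 - dF - dG + L * ?d^2"
      by (rule cmp[OF w(1) w0 wa _ TA TC TF TG]) (use dN x(5) in linarith)
    also have "L * ?d^2 <= L * (N * x)^2" using L dN by (intro mult_left_mono power_mono) auto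
    also have "dA / 2 + dC / 4 - dF - dG = - (delta * Q) * x / 2 + x^2 * (delta^2 * ?C / 4 + a^2 * c0 / 2) + x ^ 3 * (TA r / 2 + CE r / 4)
        - cG * x powr (2 * q - 3)"
      by (simp add: dA_def dC_def dF_def dG_def Q_def field_simps)
    finally have "cG * x powr (2 * q - 3) <= - (delta * Q) * x / 2 + x^2 * (delta^2 * ?C / 4 + a^2 * c0 / 2) + x ^ 3 * (TA r / 2 + CE r / 4) + L * (N * x)^2"
      by linarith
    moreover have "x ^ 3 * (TA r / 2 + CE r / 4) <= x^2 * (TA r / 2 + CE r / 4)"
      using x1 nn by (intro mult_right_mono) auto
    moreover have "0 <= delta * Q * x" using delta x by simp
    ultimately have "cG * x powr (2 * q - 3) <= M * x^2" by (simp add: M_def power_mult_distrib algebra_simps)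
    \<comment> \<open>Dividing by the gain leaves the exponent \<open>5 - 2 * q\<close>, positive
      since \<open>q <= 12/5\<close>; letting \<open>x\<close> tend to 0 will contradict
      \<open>cG > 0\<close>.\<close>
    moreover have "x^2 = x powr (5 - 2 * q) * x powr (2 * q - 3)" using x(1) by (simp flip: powr_add)
    ultimately have "cG * x powr (2 * q - 3) <= (M * x powr (5 - 2 * q)) * x powr (2 * q - 3)" by simp
    then show ?thesis using x(1) by simp
  qed
  have "eventually (%x. cG <= M * x powr (5 - 2 * q)) (at_right 0)"
  proof -
    have 0: "((%x::real. x) \<longlongrightarrow> 0) (at_right 0)" by (rule tendsto_ident_at)
    have "eventually (%x. 0 < x \<and> x < x0 \<and> x < 1 \<and> delta * x < 1 \<and> N * x < e) (at_right (0::real))"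
      using order_tendstoD(2)[OF 0 x0] order_tendstoD(2)[OF 0, of 1] order_tendstoD(2)[OF tendsto_mult_right_zero[OF 0, of delta], of 1]
        order_tendstoD(2)[OF tendsto_mult_right_zero[OF 0, of N] e] eventually_at_right_less[of 0]
      by (simp add: eventually_conj_iff)
    then show ?thesis by eventually_elim (rule main, auto)
  qed
  moreover have "((%x. M * x powr (5 - 2 * q)) \<longlongrightarrow> M * 0) (at_right 0)"
    by (intro tendsto_mult tendsto_const tendsto_zero_powrI[of _ _ _ "5 - 2 * q"] tendsto_ident_at)
      (use par in \<open>auto simp: eventually_at_filter\<close>)
  ultimately have "cG <= M * 0" by (intro tendsto_lowerbound) auto
  then show False using cG by simp
qed

text \<open>Spare mass could be filled by a cloud without shrinking \<open>u\<close>, the case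
  \<open>delta = 0\<close>.\<close>

lemma mass_eq: "n2 u = a"
proof (rule ccontr)
  assume "n2 u \<noteq> a"
  then have "n2 u < a" using uD by simp
  then have "(n2 u)^2 < a^2" using uD by (intro power_strict_mono) auto
  then show False by (intro cloud[of 0 "a^2 - (n2 u)^2"]) auto
qed

text \<open>At full mass, \<open>delta = 1 / a^2\<close> makes the mass freed by shrinking
  \<open>u\<close> exactly \<open>x\<close>. If \<open>Q\<close> were nonnegative, shrinking would
  cost no energy at first order and the cloud would win.\<close>

lemma Q_neg: "Q < 0"
proof (rule ccontr)
  assume "\<not> Q < 0"
  then show False using par by (intro cloud[of "1 / a^2" 1]) (auto simp: mass_eq field_simps)
qed

definition "lam = - Q / a^2"

lemma lam_pos: "0 < lam" using Q_neg par by (simp add: lam_def divide_neg_pos)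

text \<open>The real part of the weak equation tested with \<open>v\<close>; the critical point
  argument works with real directions and real linear functionals.\<close>

definition "EL v = gip u v + lam * ip u v + dd (%x. (norm (u x))^2) (%x. u x \<bullet> v x) - pf p u v - \<mu> * pf q u v"

text \<open>The line \<open>u + t v\<close> is renormalised by \<open>theta t\<close> to mass
  \<open>a\<close>. The derivative of \<open>theta\<close> at 0 is \<open>- ip u v / a^2\<close>;
  multiplied by \<open>Q\<close> it contributes exactly the multiplier term
  \<open>lam * ip u v\<close>.\<close>

lemma EL_radial: assumes v: "v \<in> H1r" shows "EL v = 0"
proof -
  have vH: "v \<in> H1" using v H1rD by blast
  note vL = H1_L2[OF vH]
  let ?y = "%t x. u x + t *R v x"
  have yH: "?y t \<in> H1" "?y t \<in> H1r" for t
    using H1_add[OF uD(2) H1_scaleR[OF vH]] H1r_add[OF uD(1) H1r_cmult[OF v, of "of_real t"]] by (auto simp: scaleR_conv_of_real)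
  define N where "N t = a^2 + 2 * t * ip u v + t^2 * (n2 v)^2" for t
  have N: "(n2 (?y t))^2 = N t" for t
    using n2_add_sq[OF uL L2_scaleR(1)[OF vL, of t]] ip_commute[of u "%x. t *R v x"] ip_commute[of u v]
    by (simp add: L2_scaleR(2)[OF vL] ip_scaleR_left mass_eq N_def power_mult_distrib)
  define theta where "theta t = a / sqrt (N t)" for t
  have theta0: "theta 0 = 1" using par by (simp add: theta_def N_def)
  have Dtheta: "(theta has_real_derivative - ip u v / a^2) (at 0)"
  proof -
    have N0: "0 < N 0" "sqrt (N 0) = a" using par by (simp_all add: N_def)
    have "(N has_real_derivative 2 * ip u v) (at 0)" unfolding N_def[abs_def] by (auto intro!: derivative_eq_intros)
    from DERIV_divide[OF DERIV_const[of a] DERIV_chain2[OF DERIV_real_sqrt[OF N0(1)] this]]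
    show ?thesis unfolding theta_def[abs_def] using N0 par by (simp add: power2_eq_square field_simps)
  qed
  let ?w = "%t x. theta t *R ?y t x"
  have TAy: "TA (?y t) = TA u + 2 * t * gip u v + t^2 * TA v" for t
  proof -
    have "gip (?y t) (?y t) = gip u (?y t) + t * gip v (?y t)"
      using gip_add[OF uD(2) H1_scaleR[OF vH] yH(1), of t] gip_scaleR[OF vH yH(1), of t] by simp
    moreover have "gip z (?y t) = gip z u + t * gip z v" if "z \<in> H1" for z
      using gip_add[OF uD(2) H1_scaleR[OF vH] that, of t] gip_scaleR[OF vH that, of t]
        gip_commute[of z "?y t"] gip_commute[of z u] gip_commute[of z v] by simp
    ultimately have "gip (?y t) (?y t) = gip u u + t * gip u v + t * (gip v u + t * gip v v)" using uD(2) vH by simp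
    then show ?thesis using gip_commute[of v u] by (simp add: TA_def gip_self algebra_simps power2_eq_square)
  qed
  have wT: "TA (?w t) = (theta t)^2 * (TA u + 2 * t * gip u v + t^2 * TA v)" "CE (?w t) = (theta t) ^ 4 * CE (?y t)"
    "TF (?w t) = \<bar>theta t\<bar> powr p * pw p (?y t) / p" "TG (?w t) = \<mu> / q * (\<bar>theta t\<bar> powr q * pw q (?y t))" for t
    using TAy[of t] by (simp_all add: TA_def TF_def TG_def grad_norm_scaleR[OF yH(1)] coulomb_scaleR pw_scaleR power_mult_distrib)
  \<comment> \<open>Near 0 the factor \<open>theta\<close> is positive, so the modulus that arises
    from scaling a norm may be dropped for differentiation.\<close>
  have Dp: "((%t. \<bar>theta t\<bar> powr c) has_real_derivative c * (- ip u v / a^2)) (at 0)" for c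
  proof (rule DERIV_cong_ev[THEN iffD1, OF refl _ refl])
    show "((%t. theta t powr c) has_real_derivative c * (- ip u v / a^2)) (at 0)"
      using DERIV_fun_powr[OF Dtheta, of c] theta0 by simp
    have "eventually (%t. 0 < theta t) (at 0)"
      by (rule order_tendstoD(1)[OF DERIV_isCont[OF Dtheta, unfolded isCont_def]]) (simp add: theta0)
    then have "eventually (%t. 0 < theta t) (nhds 0)" by (simp add: eventually_nhds_conv_at theta0)
    then show "eventually (%t. theta t powr c = \<bar>theta t\<bar> powr c) (nhds 0)" by eventually_elim simp
  qed
  obtain L e where e: "0 < e" and L: "0 <= L" and cmp: "quadratic_comparison L e" by (rule comparison)
  note cmp = cmp[unfolded quadratic_comparison_def, rule_format]
  have w0: "?w 0 = u" by (simp add: theta0)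
  define T where "T = - ip u v / a^2"
  note Dtheta = Dtheta[folded T_def] and Dp = Dp[folded T_def]
  have "(2 * T * TA u + 2 * gip u v) / 2 + (4 * T * CE u + 4 * dd (%x. (norm (u x))^2) (%x. u x \<bullet> v x)) / 4
      - (p * T * pw p u + p * pf p u v) / p - \<mu> / q * (q * T * pw q u + q * pf q u v) = 0"
  proof (rule envelope_critical[OF _ _ _ _ e L])
    show "((%t. TA (?w t)) has_real_derivative 2 * T * TA u + 2 * gip u v) (at 0)"
      unfolding wT by (rule derivative_eq_intros Dtheta refl | simp add: theta0)+
    show "((%t. CE (?w t)) has_real_derivative 4 * T * CE u + 4 * dd (%x. (norm (u x))^2) (%x. u x \<bullet> v x)) (at 0)"
      unfolding wT by (rule derivative_eq_intros Dtheta coulomb_deriv[OF uD(2) vH] refl | simp add: theta0)+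
    show "((%t. TF (?w t)) has_real_derivative (p * T * pw p u + p * pf p u v) / p) (at 0)"
      unfolding wT using pq by (intro DERIV_cong[OF DERIV_cdivide[OF DERIV_mult[OF Dp pw_deriv[OF pq(1,2) uD(2) vH]]]]) (simp add: theta0)
    show "((%t. TG (?w t)) has_real_derivative \<mu> / q * (q * T * pw q u + q * pf q u v)) (at 0)"
      unfolding wT using pq by (intro DERIV_cong[OF DERIV_cmult[OF DERIV_mult[OF Dp pw_deriv[OF pq(3,4) uD(2) vH]]]]) (simp add: theta0)
    have "(N \<longlongrightarrow> N 0) (at 0)" unfolding N_def by (intro tendsto_intros)
    then have "eventually (%t. 0 < N t) (at 0)" by (rule order_tendstoD(1)) (use par in \<open>simp add: N_def\<close>)
    then show "eventually (%t. \<bar>TA (?w t) - TA (?w 0)\<bar> + \<bar>CE (?w t) - CE (?w 0)\<bar> + \<bar>TF (?w t) - TF (?w 0)\<bar> + \<bar>TG (?w t) - TG (?w 0)\<bar> <= e \<longrightarrow>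
      0 <= (TA (?w t) - TA (?w 0)) / 2 + (CE (?w t) - CE (?w 0)) / 4 - (TF (?w t) - TF (?w 0)) - (TG (?w t) - TG (?w 0))
        + L * (\<bar>TA (?w t) - TA (?w 0)\<bar> + \<bar>CE (?w t) - CE (?w 0)\<bar> + \<bar>TF (?w t) - TF (?w 0)\<bar> + \<bar>TG (?w t) - TG (?w 0)\<bar>)^2) (at 0)"
    proof eventually_elim
      case (elim t)
      have "n2 (?y t) = sqrt (N t)" using N[of t] by (metis n2_nonneg real_sqrt_unique)
      then have n: "n2 (?w t) = a" using elim par L2_scaleR(2)[OF H1_L2[OF yH(1)], of "theta t" t] by (simp add: theta_def)
      have wr: "?w t \<in> H1r" using H1r_cmult[OF yH(2), of "of_real (theta t)"] by (simp add: scaleR_conv_of_real)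
      show ?case unfolding w0 by (intro impI cmp[OF wr]) (use n par in auto)
    qed
  qed
  moreover have "(2 * T * TA u + 2 * gip u v) / 2 = T * TA u + gip u v"
      "(4 * T * CE u + 4 * dd (%x. (norm (u x))^2) (%x. u x \<bullet> v x)) / 4 = T * CE u + dd (%x. (norm (u x))^2) (%x. u x \<bullet> v x)"
      "(p * T * pw p u + p * pf p u v) / p = T * (p * TF u) + pf p u v"
      "\<mu> / q * (q * T * pw q u + q * pf q u v) = T * (q * TG u) + \<mu> * pf q u v"
    using pq by (simp_all add: TF_def TG_def field_simps)
  ultimately have "T * Q + gip u v + dd (%x. (norm (u x))^2) (%x. u x \<bullet> v x) - pf p u v - \<mu> * pf q u v = 0"
    unfolding Q_def by (simp only: right_diff_distrib distrib_left)
  moreover have "T * Q = lam * ip u v" by (simp add: T_def lam_def)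
  ultimately show ?thesis unfolding EL_def by linarith
qed

lemma pot_rotate:
  assumes R: "orth R" and v: "radial v" "v \<in> bmeas"
  shows "pot (%x. (norm (v x))^2) (R x) = pot (%x. (norm (v x))^2) x"
proof -
  note [measurable] = v(2) orthogonal_measurable[OF R]
  have "pot (%x. (norm (v x))^2) (R x) = (LBINT y. (norm (v (R y)))^2 / norm (R x - R y))"
    unfolding pot_def by (rule orthogonal_integral(1)[OF R, symmetric]) measurable
  also have "\<dots> = (LBINT y. (norm (v (R y)))^2 / norm (x - y))"
    using R unfolding orthogonal_transformation_isometry by (simp add: dist_norm)
  also have "\<dots> = pot (%x. (norm (v x))^2) x" unfolding pot_def
    by (rule integral_cong_AE) (use radial_rotate[OF v(1) R] in auto)
  finally show ?thesis .
qed

text \<open>\<open>EL\<close> is real linear, bounded in the H1 norm and, \<open>u\<close> being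
  radial, invariant under rotations, so its vanishing on radial directions extends to all
  directions.\<close>

lemma EL_eq_0: assumes v: "v \<in> H1" shows "EL v = 0"
proof -
  let ?r = "%x. (norm (u x))^2"
  note X = H1_X12[OF uD(2)]
  obtain k1 where k1: "!!v. v \<in> H1 ==> \<bar>pf p u v\<bar> <= k1 * H1_norm v" by (rule pf_bounded[OF pq(1,2) uD(2)]) blast
  obtain k2 where k2: "!!v. v \<in> H1 ==> \<bar>pf q u v\<bar> <= k2 * H1_norm v" by (rule pf_bounded[OF pq(3,4) uD(2)]) blast
  define c where "c = (n2 u)^2 + (pw 4 u + kc) / 2"
  have c: "\<bar>pot ?r x\<bar> <= c" for x unfolding c_def by (rule pot_L4_bound[OF uD(2)])
  have c0: "0 <= c" using c[of 0] by linarith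
  show ?thesis
  proof (rule symmetric_criticality[OF _ _ _ _ EL_radial v])
    fix v w assume v: "v \<in> H1" and w: "w \<in> H1"
    note L = v[THEN H1_L2] w[THEN H1_L2]
    have "ip u (%x. v x + w x) = ip u v + ip u w" "gip u (%x. v x + w x) = gip u v + gip u w"
      using ip_add_left[OF L uL] gip_add[OF v w uD(2)] ip_commute[of u] gip_commute[of u] by metis+
    then show "EL (%x. v x + w x) = EL v + EL w"
      using pf_add[OF pq(1,2) uD(2) v w] pf_add[OF pq(3,4) uD(2) v w] dd_add_right[OF H1_inner_X12[OF uD(2) v] H1_inner_X12[OF uD(2) w] X]
      by (simp add: EL_def inner_add_right algebra_simps)
  next
    fix v and c :: real assume v: "v \<in> H1"
    have "ip u (%x. c *R v x) = c * ip u v" "gip u (%x. c *R v x) = c * gip u v"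
      using ip_scaleR_left[of c v u] gip_scaleR[OF v uD(2), of c] ip_commute[of u] gip_commute[of u] by metis+
    then show "EL (%x. c *R v x) = c * EL v"
      by (simp add: EL_def pf_scaleR dd_cmult_right algebra_simps)
  next
    fix v assume v: "v \<in> H1"
    have 1: "\<bar>gip u v\<bar> <= grad_norm u * H1_norm v"
      by (rule order_trans[OF gip_bound[OF uD(2) v]]) (intro mult_left_mono H1_norm_bounds grad_norm_nonneg)
    have 2: "\<bar>ip u v\<bar> <= n2 u * H1_norm v"
      by (rule order_trans[OF ip_bound[OF uL H1_L2[OF v]]]) (intro mult_left_mono H1_norm_bounds n2_nonneg)
    have "\<bar>dd (%x. u x \<bullet> v x) ?r\<bar> <= c * (LBINT x. \<bar>u x \<bullet> v x\<bar>)"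
      by (rule dd_bound[OF H1_inner_X12[OF uD(2) v] X c])
    also have "(LBINT x. \<bar>u x \<bullet> v x\<bar>) <= (LBINT x. norm (u x) * norm (v x))"
      by (intro integral_mono integrable_abs ip_integrable L2_mult_integrable uL H1_L2[OF v] Cauchy_Schwarz_ineq2)
    also have "\<dots> <= n2 u * H1_norm v"
      by (rule order_trans[OF Cauchy_Schwarz_n2[OF uL H1_L2[OF v]]]) (intro mult_left_mono H1_norm_bounds n2_nonneg)
    finally have 3: "\<bar>dd ?r (%x. u x \<bullet> v x)\<bar> <= c * n2 u * H1_norm v"
      using c0 dd_commute[OF X H1_inner_X12[OF uD(2) v]] by (simp add: mult_left_mono mult.assoc)
    have "\<bar>EL v\<bar> <= \<bar>gip u v\<bar> + \<bar>lam * ip u v\<bar> + \<bar>dd ?r (%x. u x \<bullet> v x)\<bar> + \<bar>pf p u v\<bar> + \<bar>\<mu> * pf q u v\<bar>"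
      unfolding EL_def by linarith
    also have "\<dots> <= grad_norm u * H1_norm v + lam * (n2 u * H1_norm v) + c * n2 u * H1_norm v + k1 * H1_norm v + \<mu> * (k2 * H1_norm v)"
      using lam_pos par by (intro add_mono 1 3 k1[OF v]) (auto simp: abs_mult intro!: mult_left_mono 2 k2[OF v])
    finally show "\<bar>EL v\<bar> <= (grad_norm u + lam * n2 u + c * n2 u + k1 + \<mu> * k2) * H1_norm v" by (simp add: algebra_simps)
  next
    fix R :: "real^3 => real^3" and v assume R: "orth R" and v: "v \<in> H1"
    note g = gip_rotate[OF R uD(2) v] and gv = gip_rotate(1)[OF R v v]
    note [measurable] = L2_measurable[OF uL] L2_measurable[OF H1_L2[OF v]] orthogonal_measurable[OF R] pot_measurable[OF X]
    have uR: "AE x in lborel. u (R x) = u x" by (rule radial_rotate[OF H1rD(2)[OF uD(1)] R])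
    \<comment> \<open>The weight is invariant at every point but \<open>u\<close> only almost
      everywhere, so \<open>u\<close> is replaced by its rotation under the integral before the
      change of variables.\<close>
    have int: "(LBINT x. H (u x) (v (R x)) x) = (LBINT x. H (u x) (v x) x)"
      if "!!z w x. H z w (R x) = H z w x" and m: "(%x. H (u x) (v x) x) \<in> bmeas" "(%x. H (u x) (v (R x)) x) \<in> bmeas"
      for H :: "complex => complex => real^3 => real"
    proof -
      have "(%x. H (u (R x)) (v (R x)) x) \<in> bmeas"
        using measurable_compose[OF orthogonal_measurable[OF R] m(1)] that(1) by simp
      then have "(LBINT x. H (u x) (v (R x)) x) = (LBINT x. H (u (R x)) (v (R x)) (R x))"
        using m(2) uR unfolding that(1) by (intro integral_cong_AE) auto
      also have "\<dots> = (LBINT x. H (u x) (v x) x)" by (rule orthogonal_integral[OF R m(1)])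
      finally show ?thesis .
    qed
    have "gip u (%x. v (R x)) = gip (%x. u (R x)) (%x. v (R x))"
      using gip_wg[OF H1_L2[OF g(1)] wg_cong[OF H1_wg[OF uD(2)] L2_measurable[OF uL] L2_measurable[OF H1_L2[OF g(1)]] uR] H1_L2[OF gv] H1_wg[OF gv]]
      by (simp add: gip_def)
    moreover have "ip u (%x. v (R x)) = ip u v" unfolding ip_def by (rule int) auto
    moreover have "pf t u (%x. v (R x)) = pf t u v" for t unfolding pf_def by (rule int) auto
    moreover have "dd ?r (%x. u x \<bullet> v (R x)) = dd ?r (%x. u x \<bullet> v x)"
      unfolding dd_commute[OF X H1_inner_X12[OF uD(2) v]] dd_commute[OF X H1_inner_X12[OF uD(2) gv]] unfolding dd_def
      by (rule int) (auto simp: pot_rotate[OF R H1rD(2)[OF uD(1)] L2_measurable[OF uL]])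
    ultimately show "EL (%x. v (R x)) = EL v" by (simp add: EL_def g(2))
  qed
qed

text \<open>\<open>EL\<close> gives the real part. The weak form is conjugate linear in
  \<open>v\<close>, so the direction \<open>\<i> * v\<close> yields the imaginary part.\<close>

lemma weak_solution: "weak_solution p q \<mu> lam u"
  unfolding weak_solution_def
proof (intro conjI ballI uD(2))
  fix v assume v: "v \<in> H1"
  let ?r = "%x. (norm (u x))^2"
  let ?I1 = "%v. \<integral>x. (\<Sum>i\<in>UNIV. weak_grad u x $ i * cnj (weak_grad v x $ i)) \<partial>lborel"
  let ?I2 = "%v. \<integral>x. u x * cnj (v x) \<partial>lborel"
  let ?I3 = "%v. \<integral>x. cor (coulomb_potential u x) * u x * cnj (v x) \<partial>lborel"
  let ?I4 = "%t v. \<integral>x. cor (norm (u x) powr (t - 2)) * u x * cnj (v x) \<partial>lborel"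
  have Re0: "Re (?I1 v + of_real lam * ?I2 v + ?I3 v - (?I4 p v + of_real \<mu> * ?I4 q v)) = 0" if v: "v \<in> H1" for v
  proof -
    note L = uL H1_L2[OF v] weak_grad_L2[OF uD(2)] weak_grad_L2[OF v]
    note [measurable] = L[THEN L2_measurable] pot_measurable[OF H1_X12[OF uD(2)]]
    have ii: "integrable lborel (%x. f x * cnj (g x))" if "f \<in> L2" "g \<in> L2" for f g :: "real^3 => complex"
    proof -
      note [measurable] = that[THEN L2_measurable]
      show ?thesis by (rule integrable_boundI[OF L2_mult_integrable[OF that]]) (auto simp: norm_mult)
    qed
    have "integrable lborel (%x. \<Sum>i\<in>UNIV. weak_grad u x $ i * cnj (weak_grad v x $ i))"
      by (intro Bochner_Integration.integrable_sum ii L2_component(1) L(3,4))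
    then have 1: "Re (?I1 v) = gip u v"
      by (simp add: gip_def ip_def inner_vec_def inner_Re_cnj del: complex_cnj_mult flip: integral_Re)
    have 2: "Re (?I2 v) = ip u v" using ii[OF L(1,2)] by (simp add: ip_def inner_Re_cnj flip: integral_Re)
    have pL: "(%x. cor (coulomb_potential u x) * u x) \<in> L2"
      by (rule L2_bound(1)[OF L(1), of _ "(n2 u)^2 + (pw 4 u + kc) / 2"])
        (use pot_L4_bound[OF uD(2)] in \<open>auto simp: coulomb_potential_pot norm_mult intro!: AE_I2 mult_right_mono\<close>)
    have 3: "Re (?I3 v) = dd ?r (%x. u x \<bullet> v x)"
      unfolding dd_commute[OF H1_X12[OF uD(2)] H1_inner_X12[OF uD(2) v]] dd_def
      using ii[OF pL L(2)] by (simp add: inner_Re_cnj coulomb_potential_pot algebra_simps flip: integral_Re)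
    have 4: "Re (?I4 t v) = pf t u v" if "2 < t" "t < 6" for t
      using pf_integrable(1)[OF that uD(2) v] by (simp add: pf_def inner_Re_cnj scaleR_conv_of_real algebra_simps flip: integral_Re)
    show ?thesis using EL_eq_0[OF v] 1 2 3 4[OF pq(1,2)] 4[OF pq(3,4)] by (simp add: EL_def)
  qed
  let ?E = "?I1 v + of_real lam * ?I2 v + ?I3 v - (?I4 p v + of_real \<mu> * ?I4 q v)"
  have "?I1 (%x. \<i> * v x) = - \<i> * ?I1 v"
  proof -
    have ae: "AE x in lborel. weak_grad (%x. \<i> * v x) x = \<i> *s weak_grad v x"
      by (rule weak_grad_AE[OF L2_mult_complex(1)[OF H1_L2[OF v]] wg_cmult[OF H1_L2[OF v] H1_wg[OF v]]])
    note [measurable] = L2_component(1)[OF weak_grad_L2[OF uD(2)], THEN L2_measurable] L2_component(1)[OF weak_grad_L2[OF v], THEN L2_measurable]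
      L2_component(1)[OF weak_grad_L2[OF H1_cmult[OF v, of "\<i>"]], THEN L2_measurable]
    have "?I1 (%x. \<i> * v x) = (LBINT x. - \<i> * (\<Sum>i\<in>UNIV. weak_grad u x $ i * cnj (weak_grad v x $ i)))"
    proof (rule integral_cong_AE)
      show "AE x in lborel. (\<Sum>i\<in>UNIV. weak_grad u x $ i * cnj (weak_grad (%x. \<i> * v x) x $ i)) = - \<i> * (\<Sum>i\<in>UNIV. weak_grad u x $ i * cnj (weak_grad v x $ i))"
        using ae by eventually_elim (simp add: sum_distrib_left mult_ac sum_negf)
    qed measurable
    then show ?thesis by simp
  qed
  moreover have "?I2 (%x. \<i> * v x) = - \<i> * ?I2 v" "?I3 (%x. \<i> * v x) = - \<i> * ?I3 v" "?I4 t (%x. \<i> * v x) = - \<i> * ?I4 t v" for t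
    by (simp_all add: mult_ac flip: integral_mult_right_zero)
  ultimately have "Im ?E = 0"
    using Re0[OF H1_cmult[OF v, of "\<i>"]] by simp
  with Re0[OF v] have "?E = 0" by (simp only: complex_eq_iff zero_complex.sel)
  then show "?I1 v + of_real lam * ?I2 v + ?I3 v = ?I4 p v + of_real \<mu> * ?I4 q v" by simp
qed

end

section \<open>Positivity by a Harnack type inequality in the radius\<close>

lemma gderiv_line:
  fixes f :: "real^3 => real"
  assumes "gderiv f H (x + s *R axis i 1)"
  shows "((%s. f (x + s *R axis i 1)) has_real_derivative H i) (at s)"
proof -
  have "((%s. x + s *R axis i 1) has_derivative (%h. h *R axis i 1)) (at s)" by (auto intro!: derivative_eq_intros)
  from diff_chain_at[OF this assms[unfolded gderiv_def]]
  have "((%s. f (x + s *R axis i 1)) has_derivative (%h. \<Sum>j\<in>UNIV. (h *R axis i 1) $ j *R H j)) (at s)" by (simp add: o_def)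
  moreover have "(\<Sum>j\<in>UNIV. (h *R axis i 1) $ j *R H j) = H i * h" for h
  proof -
    have "(\<Sum>j\<in>UNIV. (h *R axis i 1) $ j *R H j) = h * (\<Sum>j\<in>UNIV. axis i 1 $ j *R H j)"
      by (simp only: sum_distrib_left vector_scaleR_component real_scaleR_def mult.assoc)
    then show ?thesis by (simp only: gderiv_sum_axis mult.commute)
  qed
  ultimately show ?thesis by (simp add: has_field_derivative_def)
qed

text \<open>For a radial function the Laplacian is the second derivative of \<open>r f(r)\<close>, divided by \<open>r\<close>.\<close>

lemma radial_Laplacian:
  fixes F :: "real^3 => real"
  assumes g: "!!x. gderiv F (%i. H i x) x" and h: "!!i x. gderiv (H i) (%j. M i j x) x" and rad: "xrad F" and r: "0 < r"
  shows "((%r. r * F (r *R e1)) has_real_derivative F (r *R e1) + r * H 1 (r *R e1)) (at r)"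
    and "((%r. F (r *R e1) + r * H 1 (r *R e1)) has_real_derivative r * (\<Sum>i\<in>UNIV. M i i (r *R e1))) (at r)"
proof -
  have D1: "((%r. F (r *R e1)) has_real_derivative H 1 (s *R e1)) (at s)" for s
    using gderiv_line[of F "%i. H i (s *R e1)" 0 s 1] g by (simp add: e1_def)
  have D2: "((%r. H 1 (r *R e1)) has_real_derivative M 1 1 (s *R e1)) (at s)" for s
    using gderiv_line[of "H 1" "%j. M 1 j (s *R e1)" 0 s 1] h by (simp add: e1_def)
  show "((%r. r * F (r *R e1)) has_real_derivative F (r *R e1) + r * H 1 (r *R e1)) (at r)"
    by (auto intro!: derivative_eq_intros D1)
  \<comment> \<open>In a direction orthogonal to the ray the distance is
    \<open>R s = sqrt (r^2 + s^2)\<close>, stationary at \<open>s = 0\<close>; each transversal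
    second derivative is therefore the radial derivative divided by \<open>r\<close>.\<close>
  have off: "M i i (r *R e1) = H 1 (r *R e1) / r" if i: "i \<noteq> 1" for i
  proof -
    define R where "R s = sqrt (r^2 + s^2)" for s
    have R0: "0 < R s" "R 0 = r" for s using r by (simp_all add: R_def add_pos_nonneg)
    have DR: "(R has_real_derivative s / R s) (at s)" for s
    proof -
      have "((%s. r^2 + s^2) has_real_derivative 2 * s) (at s)" by (auto intro!: derivative_eq_intros)
      moreover have "0 < r^2 + s^2" using r by (simp add: add_pos_nonneg)
      ultimately show ?thesis using DERIV_chain2[OF DERIV_real_sqrt, of "%s. r^2 + s^2" s "2 * s"]
        by (simp add: R_def[abs_def] inverse_eq_divide)
    qed
    have "norm (r *R e1 + s *R axis i 1) = R s" for s
    proof -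
      have "orthogonal (r *R e1) (s *R axis i 1)" using i by (simp add: orthogonal_def e1_def inner_axis_axis)
      from norm_add_Pythagorean[OF this] show ?thesis
        using R0(1)[of s] r by (simp add: R_def e1_def norm_axis_1 real_sqrt_unique power_mult_distrib)
    qed
    then have F: "F (r *R e1 + s *R axis i 1) = F (R s *R e1)" for s using xrad_e1[OF rad, of "r *R e1 + s *R axis i 1"] by simp
    have Hi: "H i (r *R e1 + s *R axis i 1) = H 1 (R s *R e1) * (s / R s)" for s
      using gderiv_line[OF g[of "r *R e1 + s *R axis i 1"]] DERIV_chain2[OF D1 DR[of s]] unfolding F by (rule DERIV_unique)
    have "((%s. H 1 (R s *R e1) * (s / R s)) has_real_derivative H 1 (r *R e1) / r) (at 0)"
      using R0(1)[of 0] R0(2) r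
      by (auto intro!: derivative_eq_intros DERIV_chain2[OF D2 DR] DR)
    moreover have "((%s. H 1 (R s *R e1) * (s / R s)) has_real_derivative M i i (r *R e1)) (at 0)"
      using gderiv_line[of "H i" "%j. M i j (r *R e1)" "r *R e1" 0 i] h[of i "r *R e1"] unfolding Hi by simp
    ultimately show ?thesis by (blast intro: DERIV_unique)
  qed
  have "(\<Sum>i\<in>UNIV. M i i (r *R e1)) = M 1 1 (r *R e1) + 2 * (H 1 (r *R e1) / r)"
    using off[of 2] off[of 3] by (simp add: sum_3)
  then show "((%r. F (r *R e1) + r * H 1 (r *R e1)) has_real_derivative r * (\<Sum>i\<in>UNIV. M i i (r *R e1))) (at r)"
    using r by (auto intro!: derivative_eq_intros D1 D2 simp: algebra_simps)
qed

text \<open>At a maximum point \<open>s\<close> over the interval, the second difference centred at \<open>r\<close> bounds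
  \<open>w s\<close> by \<open>2 w r\<close> plus half of itself.\<close>

lemma second_difference_bound:
  fixes w w1 w2 :: "real => real"
  assumes d: "!!r. 0 < r ==> (w has_real_derivative w1 r) (at r)" "!!r. 0 < r ==> (w1 has_real_derivative w2 r) (at r)"
    and le: "!!r. 0 < r ==> w2 r <= c * w r" and w0: "!!r. 0 < r ==> 0 <= w r" and c: "0 <= c"
    and h: "0 < h" "h < r" "c * h^2 <= 1 / 2" and s: "\<bar>s - r\<bar> <= h"
  shows "w s <= 4 * w r"
proof -
  let ?I = "{r - h..r + h}"
  have "continuous_on ?I w" by (intro continuous_at_imp_continuous_on ballI DERIV_isCont[OF d(1)]) (use h in auto)
  then obtain m where m: "m \<in> ?I" "!!t. t \<in> ?I ==> w t <= w m"
    using continuous_attains_sup[of ?I w] h by (metis atLeastatMost_empty_iff2 compact_Icc add_increasing2 diff_le_eq less_imp_le not_less)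
  define k where "k = \<bar>m - r\<bar>"
  have k: "0 <= k" "k <= h" using m(1) by (auto simp: k_def)
  \<comment> \<open>Taylor expansion at \<open>r\<close>. For \<open>e = k\<close> and
    \<open>e = - k\<close> the first order terms cancel in the sum, and \<open>m\<close> is one of
    the two points.\<close>
  have T: "w (r + e) <= w r + w1 r * e + c * w m / 2 * k^2" if e: "\<bar>e\<bar> = k" for e
  proof (cases "e = 0")
    case False
    define D where "D n = (if n = 0 then w else if n = 1 then w1 else w2)" for n :: nat
    have "\<exists>t. (if r + e < r then r + e < t \<and> t < r else r < t \<and> t < r + e) \<and>
        w (r + e) = (\<Sum>n<2. D n r / fact n * (r + e - r) ^ n) + D 2 t / fact 2 * (r + e - r) ^ 2"
      using e k h False by (intro Taylor[where a="r - h" and b="r + h"]) (auto simp: D_def less_2_cases_iff d)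
    then obtain t where t: "if r + e < r then r + e < t \<and> t < r else r < t \<and> t < r + e"
        "w (r + e) = (\<Sum>n<2. D n r / fact n * (r + e - r) ^ n) + D 2 t / fact 2 * (r + e - r) ^ 2" by blast
    have tI: "t \<in> ?I" "0 < t" using t(1) e k h by (auto split: if_splits)
    have "w2 t <= c * w m" using le[OF tI(2)] mult_left_mono[OF m(2)[OF tI(1)] c] by linarith
    then have "w2 t / 2 * e^2 <= c * w m / 2 * e^2" by (intro mult_right_mono) auto
    moreover have "e^2 = k^2" using e by (metis power2_abs)
    ultimately show ?thesis using t(2) by (simp add: D_def numeral_2_eq_2 lessThan_Suc)
  qed (use e in simp)
  have wm: "0 <= w m" using m(1) h by (intro w0) auto
  have pos: "0 <= w (r + k)" "0 <= w (r - k)" using h k by (auto intro!: w0)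
  have "m = r + k \<or> m = r - k" by (auto simp: k_def)
  then have "w m <= w (r + k) + w (r - k)" using pos by auto
  also have "\<dots> <= 2 * w r + c * k^2 * w m" using T[of k] T[of "- k"] k by (simp add: algebra_simps)
  also have "c * k^2 * w m <= 1 / 2 * w m"
    using wm h(3) mult_left_mono[OF power_mono[OF k(2,1), of 2] c] by (intro mult_right_mono) auto
  finally have "w m <= 4 * w r" by linarith
  moreover have "w s <= w m" using s by (intro m(2)) auto
  ultimately show ?thesis by linarith
qed

context nls_min
begin

lemma u_inner: "u x \<bullet> cor k = norm (u x) * k"
  by (subst ureal) (simp add: inner_complex_def)

lemma mollified_real: "conv (mol n) u x = cor (LBINT y. mol n (x - y) * norm (u y))"
proof -
  have "mol n (x - y) *R u y = cor (mol n (x - y) * norm (u y))" for y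
    by (subst ureal) (simp add: scaleR_conv_of_real)
  then show ?thesis unfolding conv_def by (simp only: integral_complex_of_real)
qed

text \<open>The equation is tested with the kernel \<open>mol n (x - y)\<close>. The power terms
  have the favourable sign and the Coulomb potential is bounded, which leaves a linear bound
  independent of \<open>n\<close>.\<close>

lemma Laplacian_bound:
  obtains c where "0 <= c" "!!n x. (\<Sum>i\<in>UNIV. Re (conv (pd i (pd i (mol n))) u x)) <= c * Re (conv (mol n) u x)"
proof -
  note [simp del] = iterated_partial.simps
  define c where "c = (n2 u)^2 + (pw 4 u + kc) / 2"
  have c: "\<bar>pot (%x. (norm (u x))^2) x\<bar> <= c" for x unfolding c_def by (rule pot_L4_bound[OF uD(2)])
  have c0: "0 <= c" using c[of 0] by linarith
  show ?thesis
  proof (rule that[of "lam + c"])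
    fix n x
    define k where "k y = mol n (x + -1 *R y)" for y
    have kt: "test_function k" unfolding k_def[abs_def] by (rule test_function_affine[OF mol_test]) simp
    have k1: "pd i k = (%y. -1 *R pd i (mol n) (x + -1 *R y))" for i
      unfolding k_def[abs_def] by (rule gderiv_iterated_partial) (rule gderiv_affine[OF test_function_gderiv[OF mol_test]])
    \<comment> \<open>The reflection contributes one minus sign per derivative, so second
      derivatives keep their sign.\<close>
    have k2: "pd i (pd i k) = (%y. pd i (pd i (mol n)) (x - y))" for i
    proof -
      have "gderiv (%y. -1 *R pd i (mol n) (x + -1 *R y))
          (%j. -1 *R (-1 *R pd j (pd i (mol n)) (x + -1 *R y))) y" for y
        by (intro gderiv_scaleR gderiv_affine test_function_gderiv test_function_partial mol_test)
      from gderiv_iterated_partial[OF this] show ?thesis unfolding k1 by simp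
    qed
    let ?v = "%y. cor (k y)"
    note nv = nice_test_function[OF kt]
    have vH: "?v \<in> H1" using H1I[OF _ nice_weak_gradient[OF nv]] nv by (simp add: nice_def)
    have "gip u ?v = (LBINT y. (\<Sum>i\<in>UNIV. Re (pd i k y *R (weak_grad u y $ i))))"
      unfolding gip_wg[OF uL H1_wg[OF uD(2)] H1_L2[OF vH] nice_weak_gradient[OF nv]] ip_def
      by (simp add: inner_vec_def inner_complex_def mult.commute)
    also have "\<dots> = (\<Sum>i\<in>UNIV. Re (LBINT y. pd i k y *R (weak_grad u y $ i)))"
    proof -
      have i: "integrable lborel (%y. pd i k y *R (weak_grad u y $ i))" for i
        by (rule L2_scaleR_integrable[OF test_function_L2(1)[OF test_function_partial[OF kt]] L2_component(1)[OF weak_grad_L2[OF uD(2)]]])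
      show ?thesis by (simp only: Bochner_Integration.integral_sum integral_Re[OF i] integrable_Re[OF i])
    qed
    also have "\<dots> = - (\<Sum>i\<in>UNIV. Re (conv (pd i (pd i (mol n))) u x))"
    proof -
      have "(LBINT y. pd i k y *R (weak_grad u y $ i)) = - conv (pd i (pd i (mol n))) u x" for i
        using wgD(2)[OF H1_wg[OF uD(2)] test_function_partial[OF kt], of i i] by (simp add: k2 conv_def)
      then show ?thesis by (simp add: sum_negf)
    qed
    finally have L: "(\<Sum>i\<in>UNIV. Re (conv (pd i (pd i (mol n))) u x)) = - gip u ?v" by simp
    have cv: "Re (conv (mol n) u x) = (LBINT y. norm (u y) * k y)"
      unfolding mollified_real by (simp add: k_def mult.commute)
    have k0: "0 <= k y" for y by (simp add: k_def mol_nonneg)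
    have ipv: "ip u ?v = Re (conv (mol n) u x)" unfolding cv ip_def u_inner ..
    have "pf t u ?v \<ge> 0" for t unfolding pf_def u_inner by (intro integral_nonneg_AE AE_I2 mult_nonneg_nonneg k0) auto
    then have "0 <= pf p u ?v + \<mu> * pf q u ?v" using par by simp
    moreover have "dd (%x. (norm (u x))^2) (%x. u x \<bullet> ?v x) <= c * Re (conv (mol n) u x)"
    proof -
      have "dd (%x. (norm (u x))^2) (%x. u x \<bullet> ?v x) <= c * (LBINT y. \<bar>u y \<bullet> ?v y\<bar>)"
        using dd_bound[OF H1_inner_X12[OF uD(2) vH] H1_X12[OF uD(2)] c] dd_commute[OF H1_X12[OF uD(2)] H1_inner_X12[OF uD(2) vH]]
        by linarith
      then show ?thesis unfolding cv u_inner by (simp add: abs_mult k0)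
    qed
    ultimately show "(\<Sum>i\<in>UNIV. Re (conv (pd i (pd i (mol n))) u x)) <= (lam + c) * Re (conv (mol n) u x)"
      using EL_eq_0[OF vH] L ipv unfolding EL_def by (simp add: algebra_simps)
  qed (use lam_pos c0 in simp)
qed

text \<open>The radius times the mollified profile satisfies the second difference bound uniformly
  in \<open>n\<close>, so in the limit a zero of \<open>U\<close> at one radius forces zeros at all
  nearby radii. By connectedness of the half line \<open>U\<close> would vanish identically, against
  the positive mass.\<close>

lemma positive: "positive_fun u"
proof -
  obtain U ro where U: "AE x in lborel. u x = U (norm x)" "!!r. 0 < r ==> (%n. conv (mol (ro n)) u (r *R e1)) ----> U r"
    "!!n. xrad (conv (mol n) u)"
    by (rule H1r_profile[OF uD(1)]) blast
  obtain c where c: "0 <= c" "!!n x. (\<Sum>i\<in>UNIV. Re (conv (pd i (pd i (mol n))) u x)) <= c * Re (conv (mol n) u x)"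
    by (rule Laplacian_bound) blast
  define w where "w n r = r * Re (conv (mol n) u (r *R e1))" for n r
  have Re0: "0 <= Re (conv (mol n) u x)" for n x
    unfolding mollified_real by (simp, intro integral_nonneg_AE AE_I2 mult_nonneg_nonneg mol_nonneg) auto
  have step: "w n s <= 4 * w n r" if "0 < h" "h < r" "c * h^2 <= 1 / 2" "\<bar>s - r\<bar> <= h" for n h r s
  proof -
    let ?F = "%x. Re (conv (mol n) u x)" and ?H = "%i x. Re (conv (pd i (mol n)) u x)"
      and ?M = "%i j x. Re (conv (pd j (pd i (mol n))) u x)"
    have g: "gderiv ?F (%i. ?H i x) x" for x
      by (rule gderiv_bounded_linear[OF bounded_linear_Re conv_gderiv[OF mol_test uL]])
    have h: "gderiv (?H i) (%j. ?M i j x) x" for i x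
      by (rule gderiv_bounded_linear[OF bounded_linear_Re conv_gderiv[OF test_function_partial[OF mol_test] uL]])
    have rad: "xrad ?F" using U(3)[of n] unfolding xrad_def by metis
    show ?thesis
    proof (rule second_difference_bound[of "w n" _ _ c, OF _ _ _ _ c(1) that])
      fix r :: real assume r: "0 < r"
      show "(w n has_real_derivative ?F (r *R e1) + r * ?H 1 (r *R e1)) (at r)"
        unfolding w_def[abs_def] by (rule radial_Laplacian(1)[where F="?F" and H="?H" and M="?M", OF g h rad r])
      show "((%r. ?F (r *R e1) + r * ?H 1 (r *R e1)) has_real_derivative r * (\<Sum>i\<in>UNIV. ?M i i (r *R e1))) (at r)"
        by (rule radial_Laplacian(2)[where F="?F" and H="?H" and M="?M", OF g h rad r])
      show "r * (\<Sum>i\<in>UNIV. ?M i i (r *R e1)) <= c * w n r"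
        using mult_left_mono[OF c(2)[of n "r *R e1"], of r] r by (simp add: w_def mult_ac)
      show "0 <= w n r" using Re0 r by (simp add: w_def)
    qed
  qed
  have lim: "(%n. w (ro n) r) ----> r * Re (U r)" if "0 < r" for r
    unfolding w_def by (intro tendsto_mult tendsto_const tendsto_Re U(2) that)
  have U0: "0 <= Re (U r)" "Im (U r) = 0" if "0 < r" for r
  proof -
    show "0 <= Re (U r)" by (rule LIMSEQ_le_const[OF tendsto_Re[OF U(2)[OF that]]]) (use Re0 in blast)
    have "(%n. Im (conv (mol (ro n)) u (r *R e1))) ----> Im (U r)" by (rule tendsto_Im[OF U(2)[OF that]])
    then show "Im (U r) = 0" unfolding mollified_real by (simp add: LIMSEQ_const_iff)
  qed
  have near: "U s = 0" if h: "0 < h" "h < r" "c * h^2 <= 1 / 2" "\<bar>s - r\<bar> <= h" and z: "U r = 0" for r s h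
  proof -
    have s: "0 < s" using h by linarith
    have "s * Re (U s) <= 4 * (r * Re (U r))"
      by (rule LIMSEQ_le[OF lim[OF s] tendsto_mult[OF tendsto_const lim]]) (use h step[OF h] in auto)
    then have "Re (U s) <= 0" using z s by (simp add: mult_le_0_iff)
    then show ?thesis using U0[OF s] by (simp add: complex_eq_iff)
  qed
  have nz: "U r \<noteq> 0" if r: "0 < r" for r
  proof
    assume z: "U r = 0"
    obtain h0 where h0: "0 < h0" "c * h0^2 <= 1 / 2"
    proof (rule that[of "1 / (1 + 2 * c)"])
      show "c * (1 / (1 + 2 * c))^2 <= 1 / 2" using c(1) by (simp add: power_divide divide_le_eq power2_eq_square algebra_simps)
    qed (use c in auto)
    have z0: "U s = 0" if s: "s \<in> {0<..}" for s
    proof (rule connected_induction_simple[of "{0<..}" r s "%s. U s = 0", OF _ _ s z])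
      fix a :: real assume a: "a \<in> {0<..}"
      \<comment> \<open>Points within \<open>h / 2\<close> of \<open>a\<close> are within
        \<open>h\<close> of each other and larger than \<open>h\<close>, as the bound centred at
        either of them requires.\<close>
      define h where "h = min h0 (a / 4)"
      have h: "0 < h" "h <= h0" "h <= a / 4" using h0 a by (auto simp: h_def)
      have ch: "c * h^2 <= 1 / 2" using mult_left_mono[OF power_mono[OF h(2), of 2] c(1)] h h0 by linarith
      have "U y = 0" if "\<bar>x - a\<bar> < h / 2" "\<bar>y - a\<bar> < h / 2" "U x = 0" for x y
        by (rule near[OF h(1) _ ch _ that(3)]) (use that h in linarith)+
      then show "\<exists>T. openin (top_of_set {0<..}) T \<and> a \<in> T \<and> (\<forall>x\<in>T. \<forall>y\<in>T. U x = 0 \<longrightarrow> U y = 0)"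
        using h a by (intro exI[of _ "{0<..} \<inter> ball a (h / 2)"]) (auto simp: openin_open_Int dist_real_def abs_minus_commute)
    qed (use r in auto)
    have "AE x in lborel. u x = 0" using U(1) AE_lborel_singleton[of "0 :: real^3"] by eventually_elim (simp add: z0)
    then show False using n2_eq_0_iff[OF uL] uD(3) by simp
  qed
  show ?thesis unfolding positive_fun_def using U(1) AE_lborel_singleton[of "0 :: real^3"]
  proof eventually_elim
    case (elim x)
    then have "norm (u x) \<noteq> 0" using nz[of "norm x"] by simp
    then show ?case by (subst (1 2) ureal) simp
  qed
qed

end

section \<open>The mountain pass level\<close>

lemma dil_continuous:
  fixes f :: "real^3 => 'b::euclidean_space"
  assumes f: "f \<in> L2" and t: "t ----> 0"
  shows "(%n. n2 (%x. dil (t n) f x - f x)) ----> 0"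
proof -
  obtain B where B: "!!n. \<bar>t n\<bar> <= B" using convergent_imp_Bseq[OF convergentI[OF t]] by (auto simp: Bseq_def)
  have "(%n. n2 (%x. exp (3 * t n / 2) *R f (exp (t n) *R x) - f x)) ----> 0"
  proof (rule L2_transform_continuous[of "%n. exp (3 * t n / 2)" "%n x. exp (t n) *R x", OF _ _ _ _ _ f])
    fix h :: "real^3 => 'b" and n assume "h \<in> L2"
    from L2_dil[OF this, of "t n"]
    show "(%x. exp (3 * t n / 2) *R h (exp (t n) *R x)) \<in> L2" "n2 (%x. exp (3 * t n / 2) *R h (exp (t n) *R x)) = n2 h"
      by (simp_all add: dil_def[abs_def])
  next
    show "(%n. exp (t n) *R x) ----> x" for x :: "real^3" using tendsto_scaleR[OF tendsto_exp[OF t] tendsto_const] by simp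
    show "(%n. exp (3 * t n / 2)) ----> 1"
      using tendsto_exp[OF tendsto_divide[OF tendsto_mult[OF tendsto_const[of 3] t] tendsto_const[of 2]]] by simp
    show "norm x <= exp B * norm (exp (t n) *R x) + exp B" for n and x :: "real^3"
    proof -
      have "0 <= B + t n" using B[of n] by (auto simp: abs_le_iff)
      then have "1 * norm x <= exp (B + t n) * norm x" by (intro mult_right_mono) auto
      then show ?thesis by (simp add: exp_add mult.assoc add_increasing2)
    qed
  qed
  then show ?thesis by (simp add: dil_def)
qed

lemma dilate_add: "dilate s (dilate r u) = dilate (r + s) u"
  by (simp add: dilate_def fun_eq_iff exp_add add_divide_distrib distrib_left mult.commute)

text \<open>With \<open>r = t n - s\<close>, the gradient of the difference is \<open>exp r\<close>
  times the error of a dilated field plus \<open>exp r - 1\<close> times the field, and both parts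
  tend to 0 in L2.\<close>

lemma dilate_H1_continuous:
  assumes u: "u \<in> H1" and t: "t ----> s"
  shows "(%n. H1_norm (%x. dilate (t n) u x - dilate s u x)) ----> 0"
proof -
  let ?v = "dilate s u"
  have v: "?v \<in> H1" by (rule H1_dilate[OF u])
  note vL = H1_L2[OF v] and gL = weak_grad_L2[OF v]
  have t0: "(%n. t n - s) ----> 0" using tendsto_diff[OF t tendsto_const[of s]] by simp
  have eq: "dilate (t n) u = dil (t n - s) ?v" for n using dilate_add[of "t n - s" s u] by (simp add: dilate_dil)
  let ?d = "%n x. dil (t n - s) ?v x - ?v x" and ?g = "weak_grad ?v"
  have n: "(%n. n2 (?d n)) ----> 0" by (rule dil_continuous[OF vL t0])
  have gn: "grad_norm (?d n) <= exp (t n - s) * n2 (%x. dil (t n - s) ?g x - ?g x) + \<bar>exp (t n - s) - 1\<bar> * n2 ?g" for n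
  proof -
    have w: "wgrad (?d n) (%x. exp (t n - s) *R dil (t n - s) ?g x + -1 *R ?g x)"
      using wg_add[OF L2_dil(1)[OF vL] L2_scaleR(1)[OF vL, of "-1"] wg_dilate[OF vL H1_wg[OF v], of "t n - s", unfolded dilate_dil[of "t n - s"]] wg_scaleR[OF vL H1_wg[OF v], of "-1"]]
      by simp
    have "grad_norm (?d n) = n2 (%x. exp (t n - s) *R (dil (t n - s) ?g x - ?g x) + (exp (t n - s) - 1) *R ?g x)"
      unfolding grad_norm_wg[OF L2_diff[OF L2_dil(1)[OF vL] vL] w] by (simp add: algebra_simps)
    also have "\<dots> <= exp (t n - s) * n2 (%x. dil (t n - s) ?g x - ?g x) + \<bar>exp (t n - s) - 1\<bar> * n2 ?g"
      using n2_triangle[OF L2_scaleR(1)[OF L2_diff[OF L2_dil(1)[OF gL, of "t n - s"] gL], of "exp (t n - s)"] L2_scaleR(1)[OF gL, of "exp (t n - s) - 1"]]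
        L2_scaleR(2)[OF L2_diff[OF L2_dil(1)[OF gL, of "t n - s"] gL], of "exp (t n - s)"] L2_scaleR(2)[OF gL, of "exp (t n - s) - 1"] by simp
    finally show ?thesis .
  qed
  have "(%n. exp (t n - s) * n2 (%x. dil (t n - s) ?g x - ?g x) + \<bar>exp (t n - s) - 1\<bar> * n2 ?g) ----> exp 0 * 0 + \<bar>exp 0 - 1\<bar> * n2 ?g"
    by (rule tendsto_add[OF tendsto_mult[OF tendsto_exp[OF t0] dil_continuous[OF gL t0]]
        tendsto_mult[OF tendsto_rabs[OF tendsto_diff[OF tendsto_exp[OF t0] tendsto_const]] tendsto_const]])
  then have gl: "(%n. exp (t n - s) * n2 (%x. dil (t n - s) ?g x - ?g x) + \<bar>exp (t n - s) - 1\<bar> * n2 ?g) ----> 0" by simp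
  have g: "(%n. grad_norm (?d n)) ----> 0"
    by (rule tendsto_sandwich[OF _ _ tendsto_const gl]) (intro always_eventually allI grad_norm_nonneg gn)+
  have "(%n. sqrt ((grad_norm (?d n))^2 + (n2 (?d n))^2)) ----> sqrt (0\<^sup>2 + 0\<^sup>2)"
    by (intro tendsto_intros g n)
  then show ?thesis by (simp add: H1_norm_eq eq)
qed

context nls
begin

lemma Pset_plus_r_iff: "v \<in> Pset_plus_r p q \<mu> a \<longleftrightarrow> v \<in> H1r \<and> n2 v = a \<and> ff1 v 0 = 0 \<and> 0 < ff2 v 0"
  by (auto simp: Pset_plus_r_def Pset_plus_def Pset_def S_def Lnorm_2 P_ff psi_deriv2 H1r_iff)

lemma ff1_ge: assumes "!!s. s < z ==> ff1 v s < 0" "s < z" shows "ff v z < ff v s"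
  by (rule DERIV_neg_imp_decreasing_open[OF assms(2)]) (use assms(1) fib_deriv in \<open>blast, intro fib_cont\<close>)

text \<open>The shape of a whole fibre at mass \<open>a\<close>: decreasing to a local minimum,
  increasing to the maximum, decreasing after it. The minimum has negative energy, because the
  energy tends to 0 for strong spreading and decreases from there.\<close>

lemma project_props:
  assumes v: "v \<in> H1r" "n2 v = a"
  obtains z y where "z < s0 v" "s0 v < y" "ff1 v y = 0" "dilate z v \<in> Pset_plus_r p q \<mu> a" "ff v z < 0"
    "J p q \<mu> (dilate z v) = ff v z" "!!s. s <= y ==> ff v z <= ff v s"
    "!!s. z <= s ==> ff v s <= ff v y" "!!s. y < s ==> ff1 v s < 0"
proof -
  have vH: "v \<in> H1" and n: "0 < n2 v" "n2 v <= a" using v H1rD par by auto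
  note f = fibre[OF vH n(1)] and g = gap[OF vH n]
  obtain z y where zy: "z < s0 v" "s0 v < y" "ff1 v z = 0" "ff1 v y = 0" "0 < ff2 v z" by (rule project[OF vH n])
  have dn: "ff1 v s < 0" if "s < z" for s by (rule fibre.sign_left(1)[OF f g zy(3,1) that])
  have up: "0 < ff1 v s" if "z < s" "s < y" for s
    using fibre.sign_left(2)[OF f g zy(3,1) that(1)] fibre.sign_right(2)[OF f g _ zy(2) zy(4) _ that(2)] zy(4)
    by (cases "s <= s0 v") auto
  have dn2: "ff1 v s < 0" if "y < s" for s using fibre.sign_right(1)[OF f g _ zy(2) that] zy(4) by simp
  have dec: "ff v z < ff v s" if "s < z" for s by (rule ff1_ge[OF dn that])
  have inc: "ff v s <= ff v t" if "z <= s" "s <= t" "t <= y" for s t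
  proof (cases "s = t")
    case False
    then have "s < t" using that by simp
    then have "ff v s < ff v t"
      by (rule DERIV_pos_imp_increasing_open) (use up that fib_deriv in \<open>meson le_less_trans less_le_trans, intro fib_cont\<close>)
    then show ?thesis by simp
  qed simp
  have "((%s. ff v s) \<longlongrightarrow> TA v * 0 / 2 + CE v * 0 / 4 - TF v * 0 - TG v * 0) at_bot" unfolding fib_def
    by (intro tendsto_intros filterlim_compose[OF exp_at_bot] filterlim_tendsto_pos_mult_at_bot[OF tendsto_const _ filterlim_ident] filterlim_ident)
      (use ab in auto)
  moreover have "eventually (%s. ff v (z - 1) <= ff v s) at_bot"
    using eventually_le_at_bot[of "z - 1"]
  proof eventually_elim
    case (elim s)
    show ?case
    proof (cases "s = z - 1")
      case False
      then have "s < z - 1" using elim by simp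
      from ff1_ge[OF dn this] show ?thesis by (simp add: less_imp_le)
    qed simp
  qed
  ultimately have "ff v (z - 1) <= 0" by (intro tendsto_lowerbound[where F=at_bot]) auto
  then have neg: "ff v z < 0" using dec[of "z - 1"] by simp
  have mx: "ff v s <= ff v y" if "z <= s" for s
  proof (cases "s <= y")
    case False
    then show ?thesis using fibre.max_at[OF f g zy(4,2), of s] zy(2) by simp
  qed (use inc that in simp)
  have P: "dilate z v \<in> Pset_plus_r p q \<mu> a"
    using zy by (simp add: Pset_plus_r_iff H1r_dilate v n2_dilate[OF H1_L2[OF vH]] ff_dilate[OF vH])
  show ?thesis
  proof (rule that[OF zy(1,2,4) P neg _ _ mx dn2])
    show "J p q \<mu> (dilate z v) = ff v z" by (simp add: J_ff ff_dilate vH)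
    show "ff v z <= ff v s" if "s <= y" for s using dec[of s] inc[of z s] that by (cases "s < z") auto
  qed
qed

lemma m_r_le: "v \<in> Pset_plus_r p q \<mu> a ==> m_r p q \<mu> a <= ereal (J p q \<mu> v)"
  unfolding m_r_def by (rule INF_lower)

text \<open>A fibre minimum lies below the gap scale, so its gradient norm is at most
  \<open>X\<close> and Gagliardo-Nirenberg bounds the negative terms. The finite lower bound is what
  a path must undercut twofold to end below \<open>2 * m_r\<close>.\<close>

lemma m_r_ge:
  obtains c where "ereal c <= m_r p q \<mu> a"
proof -
  define B where "B t = GN t powr t * a powr (t * (1 - gam t)) * X powr (t * gam t)" for t
  have B: "pw t v <= B t" if t: "2 < t" "t < 6" and v: "v \<in> H1" "n2 v = a" "grad_norm v <= X" for t v
    unfolding B_def using GN_pw[OF t v(1)] v gam_bounds[OF t] t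
    by (elim order_trans) (auto intro!: mult_left_mono powr_mono2)
  have "ereal (- (B p / p) - \<mu> / q * B q) <= m_r p q \<mu> a" unfolding m_r_def
  proof (rule INF_greatest)
    fix v assume "v \<in> Pset_plus_r p q \<mu> a"
    then have v: "v \<in> H1" "n2 v = a" "ff1 v 0 = 0" "0 < ff2 v 0" by (auto simp: Pset_plus_r_iff H1r_iff)
    have n: "0 < n2 v" "n2 v <= a" using v par by auto
    have "0 < s0 v" using fibre.side(1)[OF fibre[OF v(1) n(1)] gap[OF v(1) n] v(3)] v(4) by simp
    then have "TA v < X^2" using exp_s0(1)[OF v(1) n(1), of 0] by simp
    then have g: "grad_norm v <= X" using X0 by (auto simp: TA_def intro: power2_le_imp_le less_imp_le)
    have "TF v <= B p / p" unfolding TF_def using B[OF pq(1,2) v(1,2) g] pq by (intro divide_right_mono) auto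
    moreover have "TG v <= \<mu> / q * B q" unfolding TG_def using B[OF pq(3,4) v(1,2) g] pq par by (intro mult_left_mono) auto
    moreover have "0 <= TA v / 2" "0 <= CE v / 4" using coulomb_nonneg by (simp_all add: TA_def)
    ultimately show "ereal (- (B p / p) - \<mu> / q * B q) <= ereal (J p q \<mu> v)" by (simp add: J_ff fib_def)
  qed
  then show ?thesis by (rule that)
qed

text \<open>Continuity is tested on sequences, where H1 convergence gives convergence of the
  gradient norms, of the power terms by radial compactness, and of the Coulomb energies.\<close>

lemma path_continuous:
  assumes z: "!!t. t \<in> {0..1} ==> zeta t \<in> Sr a" and c: "H1_continuous_path zeta"
  shows "continuous_on {0..1} (%t. TA (zeta t))" "continuous_on {0..1} (%t. ff1 (zeta t) 0)"
proof -
  have seq: "(%n. TA (zeta (s n))) ----> TA (zeta t)" "(%n. ff1 (zeta (s n)) 0) ----> ff1 (zeta t) 0"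
    if t: "t \<in> {0..1}" and s: "!!n. s n \<in> {0..1}" "s ----> t" for s :: "nat => real" and t
  proof -
    let ?V = "%n. zeta (s n)" and ?d = "%n x. zeta (s n) x - zeta t x"
    have V: "?V n \<in> H1r" "?V n \<in> H1" "n2 (?V n) = a" for n using z[OF s(1)] by (auto simp: Sr_def S_def Lnorm_2)
    have v: "zeta t \<in> H1r" "zeta t \<in> H1" using z[OF t] by (auto simp: Sr_def S_def)
    have d: "(%n. H1_norm (?d n)) ----> 0"
    proof (rule LIMSEQ_I)
      fix e :: real assume "0 < e"
      then obtain delta where delta: "0 < delta" "!!r. r \<in> {0..1} ==> \<bar>r - t\<bar> < delta ==> H1_norm (%x. zeta r x - zeta t x) < e"
        using c t unfolding H1_continuous_path_def by meson
      obtain N where "\<forall>n\<ge>N. norm (s n - t) < delta" using LIMSEQ_D[OF s(2) delta(1)] by blast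
      then show "\<exists>N. \<forall>n\<ge>N. norm (H1_norm (?d n) - 0) < e" using delta(2)[OF s(1)] H1_norm_bounds(3) by (intro exI[of _ N]) auto
    qed
    have dn: "(%n. n2 (?d n)) ----> 0" by (rule tendsto_sandwich[OF _ _ tendsto_const d]) (auto simp: H1_norm_bounds)
    have dH: "?d n \<in> H1" for n by (rule H1_diff[OF V(2) v(2)])
    have "\<bar>grad_norm (?V n) - grad_norm (zeta t)\<bar> <= H1_norm (?d n)" for n
    proof -
      have "grad_norm (?d n) = n2 (%x. weak_grad (?V n) x - weak_grad (zeta t) x)"
        using grad_norm_wg[OF L2_add[OF H1_L2[OF V(2)] L2_scaleR(1)[OF H1_L2[OF v(2)], of "-1"]]
          wg_add[OF H1_L2[OF V(2)] L2_scaleR(1)[OF H1_L2[OF v(2)], of "-1"] H1_wg[OF V(2)] wg_scaleR[OF H1_L2[OF v(2)] H1_wg[OF v(2)]]], of n] by simp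
      then show ?thesis using n2_diff_abs[OF weak_grad_L2[OF V(2)] weak_grad_L2[OF v(2)], of n] H1_norm_bounds(2)[of "?d n"]
        by (simp add: grad_norm_eq)
    qed
    then have "(%n. grad_norm (?V n) - grad_norm (zeta t)) ----> 0"
      by (intro Lim_null_comparison[OF _ d] always_eventually allI) simp
    then have gn: "(%n. grad_norm (?V n)) ----> grad_norm (zeta t)" by (rule LIM_zero_cancel)
    obtain M where M: "!!n. grad_norm (?V n) <= M"
      using convergent_imp_Bseq[OF convergentI[OF gn]] by (auto simp: Bseq_def abs_le_iff)
    have b: "n2 (?V n) <= max a M" "grad_norm (?V n) <= max a M" for n using V(3)[of n] M[of n] by auto
    show A: "(%n. TA (?V n)) ----> TA (zeta t)" unfolding TA_def by (intro tendsto_power gn)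
    have "(%n. pw r (?V n)) ----> pw r (zeta t)" if "2 < r" "r < 6" for r by (rule pw_tendsto_L2[OF V(1) b dn v(2) that])
    then have "(%n. TF (?V n)) ----> TF (zeta t)" "(%n. TG (?V n)) ----> TG (zeta t)"
      unfolding TF_def TG_def using pq by (auto intro!: tendsto_intros)
    then show "(%n. ff1 (?V n) 0) ----> ff1 (zeta t) 0" unfolding fib1_def
      by (intro tendsto_intros A coulomb_tendsto[OF V(2) v(2) b dn]) simp
  qed
  show "continuous_on {0..1} (%t. TA (zeta t))" "continuous_on {0..1} (%t. ff1 (zeta t) 0)"
    unfolding continuous_on_sequentially o_def using seq by blast+
qed

end

context nls_min
begin

text \<open>The function \<open>h\<close> is nonnegative at the start, since a fibre minimum lies
  below the gap scale, and nonpositive at the end, so it has a zero. There \<open>X^2 = TA\<close>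
  is impossible, because \<open>ff1\<close> is positive at the gap scale; hence the Pohozaev
  functional vanishes above the scale and the point belongs to \<open>Nm\<close>.\<close>

lemma path_crosses:
  assumes z: "zeta \<in> \<Gamma> p q \<mu> a" obtains t where "t \<in> {0..1}" "J p q \<mu> u <= J p q \<mu> (zeta t)"
proof -
  have zS: "zeta t \<in> Sr a" if "t \<in> {0..1}" for t using z that by (simp add: \<Gamma>_def)
  have zH: "zeta t \<in> H1r" "zeta t \<in> H1" "0 < n2 (zeta t)" "n2 (zeta t) <= a" "n2 (zeta t) = a" if "t \<in> {0..1}" for t
    using zS[OF that] par by (auto simp: Sr_def S_def Lnorm_2)
  have z0: "zeta 0 \<in> Pset_plus_r p q \<mu> a" and z1: "ereal (J p q \<mu> (zeta 1)) < 2 * m_r p q \<mu> a" and zc: "H1_continuous_path zeta"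
    using z by (auto simp: \<Gamma>_def)
  note H0 = zH[of 0, simplified] and H1 = zH[of 1, simplified]
  define h where "h t = max (X^2 - TA (zeta t)) (ff1 (zeta t) 0)" for t
  have "0 < s0 (zeta 0)"
    using fibre.side(1)[OF fibre[OF H0(2,3)] gap[OF H0(2-4)], of 0] z0 by (simp add: Pset_plus_r_iff)
  then have h0: "0 <= h 0" using exp_s0(1)[OF H0(2,3), of 0] by (simp add: h_def)
  have h1: "h 1 <= 0"
  proof -
    obtain s y where sy: "s < s0 (zeta 1)" "s0 (zeta 1) < y" "ff1 (zeta 1) y = 0" "dilate s (zeta 1) \<in> Pset_plus_r p q \<mu> a" "ff (zeta 1) s < 0"
      "J p q \<mu> (dilate s (zeta 1)) = ff (zeta 1) s" "!!r. r <= y ==> ff (zeta 1) s <= ff (zeta 1) r" "!!r. y < r ==> ff1 (zeta 1) r < 0"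
      by (rule project_props[OF H1(1,5)]) blast
    have m: "m_r p q \<mu> a <= ereal (ff (zeta 1) s)" using m_r_le[OF sy(4)] sy(6) by simp
    \<comment> \<open>Up to the fibre maximum \<open>y\<close> the energy is at least its value at
      the fibre minimum, a negative number not below \<open>m_r\<close>. The end point has energy
      below \<open>2 * m_r\<close>, hence below twice that number, so it must lie beyond
      \<open>y\<close>.\<close>
    have "y < 0"
    proof (rule ccontr)
      assume "\<not> y < 0"
      then have "ff (zeta 1) s <= J p q \<mu> (zeta 1)" unfolding J_ff by (intro sy(7)) simp
      then have "ereal (ff (zeta 1) s) < 2 * m_r p q \<mu> a" by (intro le_less_trans[OF _ z1]) simp
      also have "\<dots> <= 2 * ereal (ff (zeta 1) s)" using m by (intro ereal_mult_left_mono) auto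
      finally show False using sy(5) by simp
    qed
    then show ?thesis using sy(8)[of 0] sy(2) exp_s0(2)[OF H1(2,3), of 0] by (simp add: h_def)
  qed
  have "continuous_on {0..1} h" unfolding h_def by (intro continuous_intros path_continuous zS zc)
  then obtain t where t: "0 <= t" "t <= 1" "h t = 0" using IVT2'[of h 1 0 0] h0 h1 by auto
  have tI: "t \<in> {0..1}" using t by simp
  note Ht = zH[OF tI]
  have g: "0 < ff1 (zeta t) (s0 (zeta t))" by (rule gap[OF Ht(2-4)])
  have le: "X^2 <= TA (zeta t)" "ff1 (zeta t) 0 <= 0" using t(3) by (auto simp: h_def max_def split: if_splits)
  have "s0 (zeta t) <= 0" using le(1) exp_s0(3)[OF Ht(2,3), of 0] by simp
  moreover have "s0 (zeta t) \<noteq> 0" using g le(2) by auto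
  ultimately have lt: "X^2 < TA (zeta t)" using exp_s0(2)[OF Ht(2,3), of 0] by simp
  then have "ff1 (zeta t) 0 = 0" using t(3) by (auto simp: h_def max_def split: if_splits)
  then have "zeta t \<in> Nm" using Ht lt by (simp add: Nm_def)
  then show ?thesis using that[OF tI] umin by simp
qed

text \<open>Crossing gives the lower bound. For the upper bound the fibre of \<open>u\<close> is
  followed from its local minimum through its maximum, which is \<open>u\<close> itself, until the
  energy is below twice a lower bound of \<open>m_r\<close>.\<close>

lemma mp_level_eq: "ereal (J p q \<mu> u) = mp_level p q \<mu> a"
proof (rule antisym)
  show "ereal (J p q \<mu> u) <= mp_level p q \<mu> a" unfolding mp_level_def
  proof (rule INF_greatest)
    fix zeta assume "zeta \<in> \<Gamma> p q \<mu> a"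
    then obtain t where "t \<in> {0..1}" "J p q \<mu> u <= J p q \<mu> (zeta t)" by (rule path_crosses)
    then show "ereal (J p q \<mu> u) <= (SUP t\<in>{0..1}. ereal (J p q \<mu> (zeta t)))" by (intro SUP_upper2) auto
  qed
  obtain z y where zy: "z < s0 u" "s0 u < y" "ff1 u y = 0" "dilate z u \<in> Pset_plus_r p q \<mu> a" "!!s. z <= s ==> ff u s <= ff u y"
    by (rule project_props[OF uD(1) mass_eq]) blast
  have max: "ff u s <= J p q \<mu> u" if "z <= s" for s
  proof -
    have "ff u y <= J p q \<mu> u" using Nm_max(1)[OF uN, of y] zy(2) exp_s0(3)[OF uD(2,3), of y] by simp
    then show ?thesis using zy(5)[OF that] by linarith
  qed
  obtain c where c: "ereal c <= m_r p q \<mu> a" by (rule m_r_ge)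
  have pos: "0 < TF u" by (rule tuple_pos(2)[OF uD(2,3)])
  \<comment> \<open>After dropping \<open>TG\<close>, which only lowers the energy, and factoring
    out \<open>exp (alpha * s)\<close>, the bracket tends to \<open>- TF u < 0\<close>; so the
    energy tends to minus infinity along the fibre.\<close>
  have "((%s. TA u / 2 * exp ((2 - alpha) * s) + CE u / 4 * exp ((1 - alpha) * s) - TF u) \<longlongrightarrow> TA u / 2 * 0 + CE u / 4 * 0 - TF u) at_top"
    by (intro tendsto_intros filterlim_compose[OF exp_at_bot] filterlim_tendsto_neg_mult_at_bot[OF tendsto_const _ filterlim_ident])
      (use ab in auto)
  from filterlim_tendsto_neg_mult_at_bot[OF this _ filterlim_compose[OF exp_at_top filterlim_tendsto_pos_mult_at_top[OF tendsto_const _ filterlim_ident]], of alpha]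
  have "LIM s at_top. (TA u / 2 * exp ((2 - alpha) * s) + CE u / 4 * exp ((1 - alpha) * s) - TF u) * exp (alpha * s) :> at_bot"
    using pos ab by simp
  then have "eventually (%s. (TA u / 2 * exp ((2 - alpha) * s) + CE u / 4 * exp ((1 - alpha) * s) - TF u) * exp (alpha * s) < 2 * c) at_top"
    unfolding filterlim_at_bot_dense by blast
  then obtain s1 where s1: "z < s1" "(TA u / 2 * exp ((2 - alpha) * s1) + CE u / 4 * exp ((1 - alpha) * s1) - TF u) * exp (alpha * s1) < 2 * c"
    using eventually_happens'[OF trivial_limit_at_top_linorder eventually_conj[OF eventually_gt_at_top[of z]]] by blast
  have "ff u s1 <= (TA u / 2 * exp ((2 - alpha) * s1) + CE u / 4 * exp ((1 - alpha) * s1) - TF u) * exp (alpha * s1)"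
  proof -
    have "(TA u / 2 * exp ((2 - alpha) * s1) + CE u / 4 * exp ((1 - alpha) * s1) - TF u) * exp (alpha * s1)
        = TA u * exp (2 * s1) / 2 + CE u * exp s1 / 4 - TF u * exp (alpha * s1)"
      by (simp add: algebra_simps flip: exp_add)
    then show ?thesis using tuple_nonneg(2)[of u] by (simp add: fib_def)
  qed
  then have low: "ff u s1 < 2 * c" using s1 by linarith
  define zeta where "zeta t = dilate (z + t * (s1 - z)) u" for t
  have J: "J p q \<mu> (zeta t) = ff u (z + t * (s1 - z))" for t by (simp add: zeta_def J_ff ff_dilate[OF uD(2)])
  have "zeta \<in> \<Gamma> p q \<mu> a" unfolding \<Gamma>_def
  proof (intro CollectI conjI ballI)
    show "zeta t \<in> Sr a" for t
      using H1r_dilate[OF uD(1)] by (simp add: zeta_def Sr_def S_def Lnorm_2 n2_dilate[OF uL] mass_eq H1_dilate[OF uD(2)])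
    show "zeta 0 \<in> Pset_plus_r p q \<mu> a" using zy(4) by (simp add: zeta_def)
    have "ereal (J p q \<mu> (zeta 1)) < 2 * ereal c" using low by (simp add: J)
    also have "\<dots> <= 2 * m_r p q \<mu> a" using c by (intro ereal_mult_left_mono) auto
    finally show "ereal (J p q \<mu> (zeta 1)) < 2 * m_r p q \<mu> a" .
    show "H1_continuous_path zeta" unfolding H1_continuous_path_def
    proof (intro ballI allI impI)
      fix t e :: real assume e: "0 < e"
      have "((%r. H1_norm (%x. zeta r x - zeta t x)) \<longlongrightarrow> 0) (at t)"
        unfolding tendsto_at_iff_sequentially o_def zeta_def
        by (auto intro!: dilate_H1_continuous[OF uD(2)] tendsto_intros)
      from order_tendstoD(2)[OF this e] obtain delta where delta: "0 < delta" "!!r. r \<noteq> t ==> \<bar>r - t\<bar> < delta ==> H1_norm (%x. zeta r x - zeta t x) < e"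
        unfolding eventually_at by (auto simp: dist_real_def)
      have "H1_norm (%x. 0 :: complex) = 0" using grad_norm_scaleR[OF uD(2), of 0] by (simp add: H1_norm_eq)
      then have "H1_norm (%x. zeta r x - zeta t x) < e" if "\<bar>r - t\<bar> < delta" for r using delta(2)[OF _ that] e by (cases "r = t") auto
      then show "\<exists>delta>0. \<forall>s\<in>{0..1}. \<bar>s - t\<bar> < delta \<longrightarrow> H1_norm (%x. zeta s x - zeta t x) < e" using delta(1) by blast
    qed
  qed
  moreover have "(SUP t\<in>{0..1}. ereal (J p q \<mu> (zeta t))) <= ereal (J p q \<mu> u)"
    by (rule SUP_least) (use s1(1) in \<open>auto simp: J intro!: max\<close>)
  ultimately show "mp_level p q \<mu> a <= ereal (J p q \<mu> u)" unfolding mp_level_def by (intro INF_lower2[of zeta])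
qed

text \<open>Dilating \<open>u\<close> outwards lowers both the gradient norm and the energy, so \<open>u\<close> does not
  minimise the energy on any gradient ball.\<close>

lemma not_first_solution:
  assumes w: "first_solution p q \<mu> a w" shows "\<not> (AE x in lborel. u x = w x)"
proof
  assume ae: "AE x in lborel. u x = w x"
  have wD: "w \<in> D p q \<mu> a" and wm: "!!v. v \<in> D p q \<mu> a ==> J p q \<mu> w <= J p q \<mu> v" using w by (auto simp: first_solution_def)
  have wH: "w \<in> H1" using wD by (auto simp: D_def S_def)
  note wL = H1_L2[OF wH]
  have "wgrad w (weak_grad u)"
    by (rule wg_cong[OF H1_wg[OF uD(2)] L2_measurable[OF uL] L2_measurable[OF wL]]) (use ae in auto)
  then have g: "grad_norm w = grad_norm u" using grad_norm_wg[OF wL] by (simp add: grad_norm_eq)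
  \<comment> \<open>Continuity along the constant sequence \<open>u\<close> serves as invariance of
    the integrals under changes on null sets.\<close>
  have d: "(%n. n2 (%x. u x - w x)) ----> 0"
    using n2_eq_0_iff[OF L2_diff[OF uL wL]] ae by simp
  have b: "n2 u <= max (n2 u) (grad_norm u)" "grad_norm u <= max (n2 u) (grad_norm u)" by auto
  have "CE w = CE u"
    using coulomb_tendsto[of "%n. u", OF uD(2) wH b d] by (simp add: LIMSEQ_const_iff)
  moreover have "pw t w = pw t u" if "2 < t" "t < 6" for t
    using pw_tendsto_L2[of "%n. u", OF uD(1) b d wH that] by (simp add: LIMSEQ_const_iff)
  ultimately have J: "J p q \<mu> w = J p q \<mu> u" using pq by (simp add: J_ff TA_def TF_def TG_def g)
  \<comment> \<open>Strictly between the gap point and 0, where the fibre map is strictly below its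
    maximum.\<close>
  define s where "s = s0 u / 2"
  have s: "s < 0" "s0 u <= s" using uD(6) by (auto simp: s_def)
  have "grad_norm (dilate s u) <= grad_norm u" using s by (simp add: grad_norm_dilate[OF uD(2)] mult_left_le_one_le)
  then have "dilate s u \<in> D p q \<mu> a"
    using wD g by (simp add: D_def S_def H1_dilate[OF uD(2)] Lnorm_2 n2_dilate[OF uL] mass_eq)
  from wm[OF this] have "J p q \<mu> u <= ff u s" unfolding J by (simp add: J_ff ff_dilate[OF uD(2)])
  moreover have "ff u s < J p q \<mu> u" using Nm_max(2)[OF uN] exp_s0(3)[OF uD(2,3), of s] s by simp
  ultimately show False by simp
qed

end

theorem theorem1p4:
  fixes \<mu> p q a :: real
  assumes "\<mu> > 0" and "2 < q" and "q \<le> 12/5" and "10/3 < p" and "p < 6"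
    and "0 < a" and "a < a0_bar p q \<mu>"
    and "a < (3 / (4 * GN p powr p)) powr (1 / (2 * p * gam p + p - 6))
             * (4 / (4 * gam p - 1)) powr ((p * gam p - 1) / (2 * p * gam p + p - 6))
             * ((1 - gam p) / GN (12/5) powr (12/5)) powr ((p * gam p - 2) / (2 * p * gam p + p - 6))"
  shows "\<exists>lam u. lam > 0 \<and> u \<in> H1r \<and> positive_fun u \<and>
           weak_solution p q \<mu> lam u \<and> (\<integral>x. (norm (u x))\<^sup>2 \<partial>lborel) = a\<^sup>2 \<and>
           ereal (J p q \<mu> u) = mp_level p q \<mu> a \<and>
           (\<forall>w. first_solution p q \<mu> a w \<longrightarrow> \<not> (AE x in lborel. u x = w x))"
proof -
  obtain X where X: "0 < X" "p * gam p * (GN p powr p * a powr (p - p * gam p) / p) * X powr (p * gam p)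
     + q * gam q * (\<mu> * GN q powr q * a powr (q - q * gam q) / q) * X powr (q * gam q) < X^2"
    by (rule gap_exists[OF assms(1-7)])
  interpret nls p q \<mu> a X by unfold_locales (use assms X in auto)
  obtain u where u: "u \<in> Nm" "!!x. u x = cor (norm (u x))" "!!v. v \<in> Nm ==> J p q \<mu> u <= J p q \<mu> v"
    by (rule minimizer) blast
  interpret nls_min p q \<mu> a X u by unfold_locales (rule u)+
  show ?thesis
  proof (intro exI conjI allI impI)
    show "(LBINT x. (norm (u x))^2) = a^2" using n2_sq[of u] mass_eq by simp
  qed (rule lam_pos uD(1) positive weak_solution mp_level_eq | erule not_first_solution)+
qed

end
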